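(* Let $(X,q)$ be a rack with a $2$-cocycle, let $H$ be a Hopf algebra with a realization $V=V(X,q)\in{}^H_H\mathcal{YD}$, with coaction $v_x\mapsto\sum_{y\in X}e_{xy}\otimes v_y$, and let $K$ be the Hopf subalgebra of $H$ generated by $\{e_{xy}\}_{x,y\in X}$. Then the quotient $\overline K=K/\langle\mathcal S^n(e_{xy}) : x\ne y,\ n\ge0\rangle$ is a non-zero group algebra which is a quotient of $\Bbbk G_X$ via $f_x\mapsto\overline e_{xx}$, $x\in X$, where $\overline e_{xx}$ is the class of $e_{xx}$. Setting $\overline G=\langle\overline e_{xx}:x\in X\rangle$, one has $\overline K=\Bbbk\overline G$ and $V\in{}^{\overline G}_{\overline G}\mathcal{YD}$ (as a realization of the braided vector space $V$). If $X$ is faithful, then $\{\overline e_{xx}\}_{x\in X}$ is a linearly independent set.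
   Context: $\Bbbk$ is an algebraically closed field of characteristic zero. A rack is a nonempty set $X$ with $\rhd:X\times X\to X$ such that $x\rhd(y\rhd z)=(x\rhd y)\rhd(x\rhd z)$ and every $\phi_x:y\mapsto x\rhd y$ is bijective; it is faithful if $\phi_x=\phi_y$ implies $x=y$. A $2$-cocycle is $q:X\times X\to\Bbbk^\times$ with $q_{x,y\rhd z}q_{y,z}=q_{x\rhd y,x\rhd z}q_{x,z}$. $V(X,q)$ has basis $\{v_x\}_{x\in X}$ and braiding $c(v_x\otimes v_y)=q_{x,y}v_{x\rhd y}\otimes v_x$. A realization over $H$ is a Yetter-Drinfeld structure on $V$ over $H$ whose categorical braiding $v\otimes w\mapsto v_{(-1)}\cdot w\otimes v_{(0)}$ equals $c$. $G_X$ is the enveloping group: generated by $f_x$, $x\in X$, with relations $f_xf_y=f_{x\rhd y}f_x$. $\mathcal S$ is the antipode. ${}^{\overline G}_{\overline G}\mathcal{YD}$ means Yetter-Drinfeld modules over $\Bbbk\overline G$. *)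

theory Defs
  imports
    "HOL-Computational_Algebra.Polynomial"
    "HOL-Library.Poly_Mapping"
    "HOL-Algebra.Module"
    "HOL-Algebra.QuotRing"
    "HOL-Algebra.Subrings"
    "HOL-Algebra.Generated_Groups"
begin

text \<open>
  The ground field is a type \<open>'k\<close>; vector spaces over it are modules, in the sense of
  HOL-Algebra, over the record \<open>scalars\<close>, which is \<open>'k\<close> both as a ring and as a vector space
  over itself.  The multiplicative part of the record is not used for plain vector spaces.
\<close>

definition scalars :: "('k::field, 'k) module" where
  "scalars =
     \<lparr>carrier = UNIV, monoid.mult = (*), one = 1, ring.zero = 0, ring.add = (+),
      module.smult = (*)\<rparr>"

abbreviation vector_space_rec :: "('k::field, 'a, 'm) module_scheme \<Rightarrow> bool" where
  "vector_space_rec V \<equiv> Module.module (scalars :: ('k, 'k) module) V"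

abbreviation subspace_rec :: "('k::field, 'a, 'm) module_scheme \<Rightarrow> 'a set \<Rightarrow> bool" where
  "subspace_rec V N \<equiv> submodule N (scalars :: ('k, 'k) module) V"

definition linear_map ::
    "('k, 'a, 'm) module_scheme \<Rightarrow> ('k, 'b, 'n) module_scheme \<Rightarrow> ('a \<Rightarrow> 'b) \<Rightarrow> bool" where
  "linear_map V W f \<longleftrightarrow>
     f \<in> carrier V \<rightarrow> carrier W \<and>
     (\<forall>x\<in>carrier V. \<forall>y\<in>carrier V. f (x \<oplus>\<^bsub>V\<^esub> y) = f x \<oplus>\<^bsub>W\<^esub> f y) \<and>
     (\<forall>c. \<forall>x\<in>carrier V. f (c \<odot>\<^bsub>V\<^esub> x) = c \<odot>\<^bsub>W\<^esub> f x)"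

definition free_space :: "'x set \<Rightarrow> ('k::field, 'x \<Rightarrow>\<^sub>0 'k) module" where
  "free_space X =
     \<lparr>carrier = {v. Poly_Mapping.keys v \<subseteq> X}, monoid.mult = undefined, one = undefined,
      ring.zero = 0, ring.add = (+), module.smult = (\<lambda>c. Poly_Mapping.map ((*) c))\<rparr>"

abbreviation basis_vec :: "'x \<Rightarrow> ('x \<Rightarrow>\<^sub>0 'k::field)" where
  "basis_vec x \<equiv> Poly_Mapping.single x 1"

definition lin_extend ::
    "('k::field, 'a, 'm) module_scheme \<Rightarrow> ('x \<Rightarrow> 'a) \<Rightarrow> ('x \<Rightarrow>\<^sub>0 'k) \<Rightarrow> 'a" where
  "lin_extend W f v = (\<Oplus>\<^bsub>W\<^esub>x\<in>Poly_Mapping.keys v. Poly_Mapping.lookup v x \<odot>\<^bsub>W\<^esub> f x)"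

text \<open>Linear independence as a family; in particular \<open>b\<close> is injective on \<open>X\<close>.\<close>

definition lin_indep_family ::
    "('k::field, 'a, 'm) module_scheme \<Rightarrow> 'x set \<Rightarrow> ('x \<Rightarrow> 'a) \<Rightarrow> bool" where
  "lin_indep_family W X b \<longleftrightarrow>
     (\<forall>c :: 'x \<Rightarrow>\<^sub>0 'k. Poly_Mapping.keys c \<subseteq> X \<and> lin_extend W b c = \<zero>\<^bsub>W\<^esub> \<longrightarrow> c = 0)"

text \<open>
  Quotient by a subspace.  The ring part is \<^const>\<open>FactRing\<close>, so for a two-sided ideal of an
  algebra this is the quotient algebra.  The union makes scalar multiplication independent of the
  representative.
\<close>

definition quotient_module ::
    "('k, 'a, 'm) module_scheme \<Rightarrow> 'a set \<Rightarrow> ('k, 'a set) module" where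
  "quotient_module M N =
     ring.extend (M Quot N) (module.fields (\<lambda>c A. \<Union>x\<in>A. N +>\<^bsub>M\<^esub> (c \<odot>\<^bsub>M\<^esub> x)))"


section \<open>Tensor products\<close>

type_synonym ('k, 'a, 'b) tensor = "(('a \<times> 'b) \<Rightarrow>\<^sub>0 'k) set"

definition bilinear_rels ::
    "('k::field, 'a, 'm) module_scheme \<Rightarrow> ('k, 'b, 'n) module_scheme \<Rightarrow> (('a \<times> 'b) \<Rightarrow>\<^sub>0 'k) set"
  where
  "bilinear_rels A B =
     {basis_vec (a \<oplus>\<^bsub>A\<^esub> a', b) - basis_vec (a, b) - basis_vec (a', b) | a a' b.
        a \<in> carrier A \<and> a' \<in> carrier A \<and> b \<in> carrier B} \<union>
     {basis_vec (a, b \<oplus>\<^bsub>B\<^esub> b') - basis_vec (a, b) - basis_vec (a, b') | a b b'.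
        a \<in> carrier A \<and> b \<in> carrier B \<and> b' \<in> carrier B} \<union>
     {basis_vec (c \<odot>\<^bsub>A\<^esub> a, b) - Poly_Mapping.single (a, b) c | c a b.
        a \<in> carrier A \<and> b \<in> carrier B} \<union>
     {basis_vec (a, c \<odot>\<^bsub>B\<^esub> b) - Poly_Mapping.single (a, b) c | c a b.
        a \<in> carrier A \<and> b \<in> carrier B}"

definition tensor_null ::
    "('k::field, 'a, 'm) module_scheme \<Rightarrow> ('k, 'b, 'n) module_scheme \<Rightarrow> (('a \<times> 'b) \<Rightarrow>\<^sub>0 'k) set"
  where
  "tensor_null A B = subspace_rec (free_space (carrier A \<times> carrier B)) hull (bilinear_rels A B)"

definition tensor_space ::
    "('k::field, 'a, 'm) module_scheme \<Rightarrow> ('k, 'b, 'n) module_scheme \<Rightarrow>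
     ('k, ('k, 'a, 'b) tensor) module" where
  "tensor_space A B = quotient_module (free_space (carrier A \<times> carrier B)) (tensor_null A B)"

definition pure_tensor ::
    "('k::field, 'a, 'm) module_scheme \<Rightarrow> ('k, 'b, 'n) module_scheme \<Rightarrow> 'a \<Rightarrow> 'b \<Rightarrow>
     ('k, 'a, 'b) tensor" where
  "pure_tensor A B a b =
     tensor_null A B +>\<^bsub>free_space (carrier A \<times> carrier B)\<^esub> basis_vec (a, b)"

text \<open>
  The linear map on a tensor product induced by a bilinear map \<open>\<beta>\<close> into \<open>W\<close>.  With
  \<open>T = \<Sum> a\<^sub>i \<otimes> b\<^sub>i\<close> the value is \<open>\<Sum> \<beta> a\<^sub>i b\<^sub>i\<close>, so nested uses render Sweedler notation.
\<close>

definition tensor_lift ::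
    "('k::field, 'c, 'm) module_scheme \<Rightarrow> ('a \<Rightarrow> 'b \<Rightarrow> 'c) \<Rightarrow> ('k, 'a, 'b) tensor \<Rightarrow> 'c" where
  "tensor_lift W \<beta> T = the_elem (lin_extend W (\<lambda>(a, b). \<beta> a b) ` T)"


section \<open>Hopf algebras\<close>

definition assoc_algebra :: "('k::field, 'a, 'm) module_scheme \<Rightarrow> bool" where
  "assoc_algebra A \<longleftrightarrow>
     vector_space_rec A \<and> ring A \<and>
     (\<forall>c. \<forall>x\<in>carrier A. \<forall>y\<in>carrier A.
        (c \<odot>\<^bsub>A\<^esub> x) \<otimes>\<^bsub>A\<^esub> y = c \<odot>\<^bsub>A\<^esub> (x \<otimes>\<^bsub>A\<^esub> y) \<and>
        x \<otimes>\<^bsub>A\<^esub> (c \<odot>\<^bsub>A\<^esub> y) = c \<odot>\<^bsub>A\<^esub> (x \<otimes>\<^bsub>A\<^esub> y))"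

definition alg_hom ::
    "('k, 'a, 'm) module_scheme \<Rightarrow> ('k, 'b, 'n) module_scheme \<Rightarrow> ('a \<Rightarrow> 'b) \<Rightarrow> bool" where
  "alg_hom A B f \<longleftrightarrow> f \<in> ring_hom A B \<and> linear_map A B f"

definition tensor_algebra ::
    "('k::field, 'a, 'm) module_scheme \<Rightarrow> ('k, 'b, 'n) module_scheme \<Rightarrow>
     ('k, ('k, 'a, 'b) tensor) module" where
  "tensor_algebra A B = (tensor_space A B)
     \<lparr>monoid.mult := (\<lambda>S T. tensor_lift (tensor_space A B) (\<lambda>a b.
                      tensor_lift (tensor_space A B) (\<lambda>a' b'.
                        pure_tensor A B (a \<otimes>\<^bsub>A\<^esub> a') (b \<otimes>\<^bsub>B\<^esub> b')) T) S),
      one := pure_tensor A B \<one>\<^bsub>A\<^esub> \<one>\<^bsub>B\<^esub>\<rparr>"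

record (overloaded) ('k::field, 'a) hopf = "('k, 'a) module" +
  comult :: "'a \<Rightarrow> ('k, 'a, 'a) tensor"
  counit :: "'a \<Rightarrow> 'k"
  antipode :: "'a \<Rightarrow> 'a"

definition hopf_algebra :: "('k::field, 'a) hopf \<Rightarrow> bool" where
  "hopf_algebra H \<longleftrightarrow>
     assoc_algebra H \<and>
     alg_hom H (tensor_algebra H H) (comult H) \<and>
     alg_hom H scalars (counit H) \<and>
     linear_map H H (antipode H) \<and>
     (let HHH = tensor_space H (tensor_space H H) in \<forall>h\<in>carrier H.
        tensor_lift HHH (\<lambda>a b. tensor_lift HHH (\<lambda>a' a''.
            pure_tensor H (tensor_space H H) a' (pure_tensor H H a'' b)) (comult H a)) (comult H h)
        = tensor_lift HHH (\<lambda>a b. pure_tensor H (tensor_space H H) a (comult H b)) (comult H h)) \<and>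
     (\<forall>h\<in>carrier H.
        tensor_lift H (\<lambda>a b. counit H a \<odot>\<^bsub>H\<^esub> b) (comult H h) = h \<and>
        tensor_lift H (\<lambda>a b. counit H b \<odot>\<^bsub>H\<^esub> a) (comult H h) = h) \<and>
     (\<forall>h\<in>carrier H.
        tensor_lift H (\<lambda>a b. antipode H a \<otimes>\<^bsub>H\<^esub> b) (comult H h) = counit H h \<odot>\<^bsub>H\<^esub> \<one>\<^bsub>H\<^esub> \<and>
        tensor_lift H (\<lambda>a b. a \<otimes>\<^bsub>H\<^esub> antipode H b) (comult H h) = counit H h \<odot>\<^bsub>H\<^esub> \<one>\<^bsub>H\<^esub>)"

definition hopf_hom :: "('k::field, 'a) hopf \<Rightarrow> ('k, 'b) hopf \<Rightarrow> ('a \<Rightarrow> 'b) \<Rightarrow> bool" where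
  "hopf_hom H L f \<longleftrightarrow>
     hopf_algebra H \<and> hopf_algebra L \<and> alg_hom H L f \<and>
     (\<forall>h\<in>carrier H.
        comult L (f h)
          = tensor_lift (tensor_space L L) (\<lambda>a b. pure_tensor L L (f a) (f b)) (comult H h) \<and>
        counit L (f h) = counit H h \<and>
        antipode L (f h) = f (antipode H h))"

text \<open>
  For a subspace \<open>A\<close> of \<open>H\<close>, the map below is \<open>A \<otimes> A \<rightarrow> H \<otimes> H\<close> induced by the inclusion.
  It is injective, as we are over a field, so the comultiplication of a Hopf subalgebra can be
  obtained through its inverse.
\<close>

definition incl_tensor :: "('k::field, 'a) hopf \<Rightarrow> ('k, 'a, 'a) tensor \<Rightarrow> ('k, 'a, 'a) tensor" where
  "incl_tensor H = tensor_lift (tensor_space H H) (pure_tensor H H)"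

abbreviation tensor_sub ::
    "('k::field, 'a) hopf \<Rightarrow> 'a set \<Rightarrow> ('k, ('k, 'a, 'a) tensor) module" where
  "tensor_sub H A \<equiv> tensor_space (H\<lparr>carrier := A\<rparr>) (H\<lparr>carrier := A\<rparr>)"

definition hopf_subalgebra :: "('k::field, 'a) hopf \<Rightarrow> 'a set \<Rightarrow> bool" where
  "hopf_subalgebra H A \<longleftrightarrow>
     subspace_rec H A \<and> subring A H \<and>
     comult H ` A \<subseteq> incl_tensor H ` carrier (tensor_sub H A) \<and>
     antipode H ` A \<subseteq> A"

definition sub_hopf :: "('k::field, 'a) hopf \<Rightarrow> 'a set \<Rightarrow> ('k, 'a) hopf" where
  "sub_hopf H A = H
     \<lparr>carrier := A,
      comult := (\<lambda>h. inv_into (carrier (tensor_sub H A)) (incl_tensor H) (comult H h))\<rparr>"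

text \<open>The quotient by a Hopf ideal: every operation is induced along \<open>h \<mapsto> I + h\<close>.\<close>

definition quotient_hopf :: "('k::field, 'a) hopf \<Rightarrow> 'a set \<Rightarrow> ('k, 'a set) hopf" where
  "quotient_hopf H I = (let Q = quotient_module H I; p = (\<lambda>h. I +>\<^bsub>H\<^esub> h) in
     module.extend Q (hopf.fields
       (\<lambda>A. the_elem ((\<lambda>h. tensor_lift (tensor_space Q Q)
               (\<lambda>a b. pure_tensor Q Q (p a) (p b)) (comult H h)) ` A))
       (\<lambda>A. the_elem (counit H ` A))
       (\<lambda>A. the_elem ((\<lambda>h. p (antipode H h)) ` A))))"

definition group_algebra :: "'g monoid \<Rightarrow> ('k::field, 'g \<Rightarrow>\<^sub>0 'k) hopf" where
  "group_algebra G = (let F = free_space (carrier G) in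
     module.extend
       (F\<lparr>monoid.mult := (\<lambda>a b. lin_extend F (\<lambda>g. lin_extend F (\<lambda>h. basis_vec (g \<otimes>\<^bsub>G\<^esub> h)) b) a),
          one := basis_vec \<one>\<^bsub>G\<^esub>\<rparr>)
       (hopf.fields
         (lin_extend (tensor_space F F) (\<lambda>g. pure_tensor F F (basis_vec g) (basis_vec g)))
         (lin_extend scalars (\<lambda>g. 1))
         (lin_extend F (\<lambda>g. basis_vec (inv\<^bsub>G\<^esub> g)))))"


section \<open>Yetter-Drinfeld modules\<close>

text \<open>
  Left-left Yetter-Drinfeld modules; the last condition is
  \<open>\<delta>(h \<cdot> v) = h\<^sub>(\<^sub>1\<^sub>) v\<^sub>(\<^sub>-\<^sub>1\<^sub>) S(h\<^sub>(\<^sub>3\<^sub>)) \<otimes> h\<^sub>(\<^sub>2\<^sub>) \<cdot> v\<^sub>(\<^sub>0\<^sub>)\<close>.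
\<close>

definition yetter_drinfeld ::
    "('k::field, 'h) hopf \<Rightarrow> ('k, 'v) module \<Rightarrow> ('h \<Rightarrow> 'v \<Rightarrow> 'v) \<Rightarrow>
     ('v \<Rightarrow> ('k, 'h, 'v) tensor) \<Rightarrow> bool" where
  "yetter_drinfeld H V act coact \<longleftrightarrow>
     hopf_algebra H \<and> vector_space_rec V \<and>
     (\<forall>h\<in>carrier H. linear_map V V (act h)) \<and>
     (\<forall>v\<in>carrier V. linear_map H V (\<lambda>h. act h v)) \<and>
     (\<forall>v\<in>carrier V. act \<one>\<^bsub>H\<^esub> v = v) \<and>
     (\<forall>h\<in>carrier H. \<forall>h'\<in>carrier H. \<forall>v\<in>carrier V. act (h \<otimes>\<^bsub>H\<^esub> h') v = act h (act h' v)) \<and>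
     linear_map V (tensor_space H V) coact \<and>
     (\<forall>v\<in>carrier V. tensor_lift V (\<lambda>h w. counit H h \<odot>\<^bsub>V\<^esub> w) (coact v) = v) \<and>
     (let HHV = tensor_space H (tensor_space H V) in \<forall>v\<in>carrier V.
        tensor_lift HHV (\<lambda>h w. tensor_lift HHV (\<lambda>a b.
            pure_tensor H (tensor_space H V) a (pure_tensor H V b w)) (comult H h)) (coact v)
        = tensor_lift HHV (\<lambda>h w. pure_tensor H (tensor_space H V) h (coact w)) (coact v)) \<and>
     (let HV = tensor_space H V in \<forall>h\<in>carrier H. \<forall>v\<in>carrier V.
        coact (act h v) =
          tensor_lift HV (\<lambda>h1 h'. tensor_lift HV (\<lambda>h2 h3. tensor_lift HV (\<lambda>a w.
            pure_tensor H V (h1 \<otimes>\<^bsub>H\<^esub> a \<otimes>\<^bsub>H\<^esub> antipode H h3) (act h2 w))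
          (coact v)) (comult H h')) (comult H h))"

definition yd_braiding ::
    "('k::field, 'v) module \<Rightarrow> ('h \<Rightarrow> 'v \<Rightarrow> 'v) \<Rightarrow> ('v \<Rightarrow> ('k, 'h, 'v) tensor) \<Rightarrow>
     ('k, 'v, 'v) tensor \<Rightarrow> ('k, 'v, 'v) tensor" where
  "yd_braiding V act coact =
     tensor_lift (tensor_space V V) (\<lambda>v w.
       tensor_lift (tensor_space V V) (\<lambda>h v0. pure_tensor V V (act h w) v0) (coact v))"


section \<open>Racks\<close>

definition rack :: "'x set \<Rightarrow> ('x \<Rightarrow> 'x \<Rightarrow> 'x) \<Rightarrow> bool" where
  "rack X op \<longleftrightarrow>
     X \<noteq> {} \<and>
     (\<forall>x\<in>X. bij_betw (op x) X X) \<and>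
     (\<forall>x\<in>X. \<forall>y\<in>X. \<forall>z\<in>X. op x (op y z) = op (op x y) (op x z))"

definition faithful_rack :: "'x set \<Rightarrow> ('x \<Rightarrow> 'x \<Rightarrow> 'x) \<Rightarrow> bool" where
  "faithful_rack X op \<longleftrightarrow>
     (\<forall>x\<in>X. \<forall>y\<in>X. (\<forall>z\<in>X. op x z = op y z) \<longrightarrow> x = y)"

definition rack_cocycle :: "'x set \<Rightarrow> ('x \<Rightarrow> 'x \<Rightarrow> 'x) \<Rightarrow> ('x \<Rightarrow> 'x \<Rightarrow> 'k::field) \<Rightarrow> bool" where
  "rack_cocycle X op q \<longleftrightarrow>
     (\<forall>x\<in>X. \<forall>y\<in>X. q x y \<noteq> 0) \<and>
     (\<forall>x\<in>X. \<forall>y\<in>X. \<forall>z\<in>X. q x (op y z) * q y z = q (op x y) (op x z) * q x z)"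

text \<open>
  The underlying space of \<open>V(X,q)\<close> is \<^term>\<open>free_space X\<close>, with \<open>v\<^sub>x\<close> given by
  \<^term>\<open>basis_vec x\<close>.
\<close>

definition rack_braiding ::
    "'x set \<Rightarrow> ('x \<Rightarrow> 'x \<Rightarrow> 'x) \<Rightarrow> ('x \<Rightarrow> 'x \<Rightarrow> 'k::field) \<Rightarrow>
     ('k, 'x \<Rightarrow>\<^sub>0 'k, 'x \<Rightarrow>\<^sub>0 'k) tensor \<Rightarrow> ('k, 'x \<Rightarrow>\<^sub>0 'k, 'x \<Rightarrow>\<^sub>0 'k) tensor" where
  "rack_braiding X op q = (let V = free_space X; VV = tensor_space V V in
     tensor_lift VV (\<lambda>u w. lin_extend VV (\<lambda>x. lin_extend VV (\<lambda>y.
       q x y \<odot>\<^bsub>VV\<^esub> pure_tensor V V (basis_vec (op x y)) (basis_vec x)) w) u))"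

definition realization ::
    "('k::field, 'h) hopf \<Rightarrow> 'x set \<Rightarrow> ('x \<Rightarrow> 'x \<Rightarrow> 'x) \<Rightarrow> ('x \<Rightarrow> 'x \<Rightarrow> 'k) \<Rightarrow>
     ('h \<Rightarrow> ('x \<Rightarrow>\<^sub>0 'k) \<Rightarrow> ('x \<Rightarrow>\<^sub>0 'k)) \<Rightarrow>
     (('x \<Rightarrow>\<^sub>0 'k) \<Rightarrow> ('k, 'h, 'x \<Rightarrow>\<^sub>0 'k) tensor) \<Rightarrow> bool" where
  "realization H X op q act coact \<longleftrightarrow>
     yetter_drinfeld H (free_space X) act coact \<and>
     (\<forall>T\<in>carrier (tensor_space (free_space X) (free_space X)).
        yd_braiding (free_space X) act coact T = rack_braiding X op q T)"

text \<open>
  The enveloping group, as words in the letters \<open>(x, True)\<close>, standing for \<open>f\<^sub>x\<close>, and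
  \<open>(x, False)\<close>, standing for the inverse of \<open>f\<^sub>x\<close>, modulo the congruence generated by
  cancellation and the defining relations.
\<close>

inductive env_eq ::
    "'x set \<Rightarrow> ('x \<Rightarrow> 'x \<Rightarrow> 'x) \<Rightarrow> ('x \<times> bool) list \<Rightarrow> ('x \<times> bool) list \<Rightarrow> bool"
  for X op where
  env_refl: "w \<in> lists (X \<times> UNIV) \<Longrightarrow> env_eq X op w w"
| env_sym: "env_eq X op u w \<Longrightarrow> env_eq X op w u"
| env_trans: "env_eq X op u v \<Longrightarrow> env_eq X op v w \<Longrightarrow> env_eq X op u w"
| env_append: "env_eq X op u u' \<Longrightarrow> env_eq X op w w' \<Longrightarrow> env_eq X op (u @ w) (u' @ w')"
| env_cancel: "x \<in> X \<Longrightarrow> env_eq X op [(x, b), (x, \<not> b)] []"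
| env_rel: "x \<in> X \<Longrightarrow> y \<in> X \<Longrightarrow>
    env_eq X op [(x, True), (y, True)] [(op x y, True), (x, True)]"

definition enveloping_group ::
    "'x set \<Rightarrow> ('x \<Rightarrow> 'x \<Rightarrow> 'x) \<Rightarrow> ('x \<times> bool) list set monoid" where
  "enveloping_group X op =
     \<lparr>carrier = lists (X \<times> UNIV) // {(u, w). env_eq X op u w},
      monoid.mult = (\<lambda>A B. \<Union>a\<in>A. \<Union>b\<in>B. {w. env_eq X op (a @ b) w}),
      one = {w. env_eq X op [] w}\<rparr>"

definition env_gen :: "'x set \<Rightarrow> ('x \<Rightarrow> 'x \<Rightarrow> 'x) \<Rightarrow> 'x \<Rightarrow> ('x \<times> bool) list set" where
  "env_gen X op x = {w. env_eq X op [(x, True)] w}"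

end

theory Submission
  imports Defs
begin

text \<open>
  The coaction matrix \<open>E = (e x y)\<close> is comultiplicative: coassociativity and counitality of the coaction
  say \<open>\<Delta> (e x y) = \<Sum>z. e x z \<otimes> e z y\<close> and \<open>\<epsilon> (e x y) = \<delta> x y\<close> (\<open>comult_e\<close>, \<open>counit_e\<close>).  The antipode is an
  antihomomorphism of algebras and of coalgebras (\<open>antipode_mult\<close>, \<open>antipode_comult\<close>), so every matrix
  \<open>S\<^sup>n E\<close> is comultiplicative as well, with the tensor factors exchanged for odd \<open>n\<close>, and consecutive
  matrices are inverse to each other (\<open>entry_comult\<close>, \<open>entry_inverse\<close>).  Hence \<open>K\<close> is the algebra generated
  by all entries of all \<open>S\<^sup>n E\<close>.  In \<open>\<Delta> (S\<^sup>n (e x y))\<close> with \<open>x \<noteq> y\<close> each summand has an off-diagonal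
  factor, so the off-diagonal entries generate a Hopf ideal \<open>I\<close>; modulo \<open>I\<close> the diagonal entries are
  grouplike, and those of \<open>S\<^sup>n\<^sup>+\<^sup>1 E\<close> invert those of \<open>S\<^sup>n E\<close>.  Therefore \<open>K / I\<close> is spanned by the group
  generated by the classes \<open>g x\<close> of \<open>e x x\<close>.  Distinct grouplike elements of a Hopf algebra are linearly
  independent (\<open>grouplikes_independent\<close>), which makes \<open>K / I\<close> the group algebra of that group.  It is
  not zero because \<open>\<epsilon>\<close> vanishes on \<open>I\<close>.
  
  The braiding of \<open>V(X,q)\<close>, compared with the one coming from the coaction, says that \<open>e x x\<close> acts by
  \<open>v\<^sub>w \<mapsto> q x w v\<^bsub>x \<rhd> w\<^esub>\<close> and that off-diagonal entries of \<open>E\<close> act by zero (\<open>act_e\<close>).  The diagonal entries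
  are thus invertible on \<open>V\<close>, and the relations between \<open>S\<^sup>n E\<close> and \<open>S\<^sup>n\<^sup>+\<^sup>1 E\<close> propagate the vanishing to all
  \<open>n\<close> (\<open>act_entry\<close>).  So \<open>I\<close> annihilates \<open>V\<close>, and \<open>V\<close> is a module over \<open>K / I\<close>, with coaction
  \<open>v\<^sub>x \<mapsto> g x \<otimes> v\<^sub>x\<close>.  The Yetter-Drinfeld condition over \<open>H\<close>, projected to \<open>K / I\<close>, gives
  \<open>g (x \<rhd> w) = g x g w (g x)\<^sup>-\<^sup>1\<close> (\<open>diag_conjugate\<close>).  These are the defining relations of the enveloping
  group, and they are also what the Yetter-Drinfeld condition over the group amounts to
  (\<open>gact_monomial\<close>).  If \<open>g x = g y\<close> then \<open>e x x\<close> and \<open>e y y\<close> act alike, so \<open>x\<close> and \<open>y\<close> induce the same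
  permutation of \<open>X\<close>; for a faithful rack the \<open>g x\<close> are therefore distinct, hence independent.
  
  Tensors are cosets of formal sums, and all maps on them are evaluated through their universal
  property.  Consequently two linear maps on a tensor product are compared on pure tensors only, and
  a Sweedler sum \<open>\<Sum> \<beta> h\<^sub>1 h\<^sub>2\<close> is the image of \<open>\<Delta> h\<close> under the linear map induced by \<open>\<beta>\<close>.
\<close>

section \<open>Vector spaces as records\<close>

lemma scalars_simps [simp]:
  "carrier (scalars :: ('k::field, 'k) module) = UNIV"
  "\<zero>\<^bsub>(scalars :: ('k::field, 'k) module)\<^esub> = 0"
  "\<one>\<^bsub>(scalars :: ('k::field, 'k) module)\<^esub> = 1"
  "a \<oplus>\<^bsub>(scalars :: ('k::field, 'k) module)\<^esub> b = a + b"
  "a \<otimes>\<^bsub>(scalars :: ('k::field, 'k) module)\<^esub> b = a * b"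
  "a \<odot>\<^bsub>(scalars :: ('k::field, 'k) module)\<^esub> b = a * b"
  by (simp_all add: scalars_def)

lemma cring_scalars: "cring (scalars :: ('k::field, 'k) module)"
proof (rule cringI)
  show "abelian_group (scalars :: ('k::field, 'k) module)"
  proof (rule abelian_groupI)
    show "\<exists>y\<in>carrier scalars. y \<oplus>\<^bsub>scalars\<^esub> x = \<zero>\<^bsub>(scalars :: ('k::field, 'k) module)\<^esub>"
      if "x \<in> carrier scalars" for x :: 'k
      by (simp add: exI[of _ "- x"])
  qed (simp_all add: algebra_simps)
  show "Group.comm_monoid (scalars :: ('k::field, 'k) module)"
    by (rule comm_monoidI) (simp_all add: algebra_simps)
qed (simp_all add: algebra_simps)

text \<open>
  Additive inverses are scalar multiples by \<open>- 1\<close>, so they have no clause of their own; the price is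
  the clause on multiplication by \<open>0\<close>.
\<close>

lemma vector_space_recI:
  fixes V :: "('k::field, 'a, 'm) module_scheme"
  assumes "\<And>x y. x \<in> carrier V \<Longrightarrow> y \<in> carrier V \<Longrightarrow> x \<oplus>\<^bsub>V\<^esub> y \<in> carrier V"
    and "\<zero>\<^bsub>V\<^esub> \<in> carrier V"
    and "\<And>c x. x \<in> carrier V \<Longrightarrow> c \<odot>\<^bsub>V\<^esub> x \<in> carrier V"
    and "\<And>x y z. x \<in> carrier V \<Longrightarrow> y \<in> carrier V \<Longrightarrow> z \<in> carrier V \<Longrightarrow>
           x \<oplus>\<^bsub>V\<^esub> y \<oplus>\<^bsub>V\<^esub> z = x \<oplus>\<^bsub>V\<^esub> (y \<oplus>\<^bsub>V\<^esub> z)"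
    and "\<And>x y. x \<in> carrier V \<Longrightarrow> y \<in> carrier V \<Longrightarrow> x \<oplus>\<^bsub>V\<^esub> y = y \<oplus>\<^bsub>V\<^esub> x"
    and "\<And>x. x \<in> carrier V \<Longrightarrow> \<zero>\<^bsub>V\<^esub> \<oplus>\<^bsub>V\<^esub> x = x"
    and "\<And>x. x \<in> carrier V \<Longrightarrow> 0 \<odot>\<^bsub>V\<^esub> x = \<zero>\<^bsub>V\<^esub>"
    and "\<And>x. x \<in> carrier V \<Longrightarrow> 1 \<odot>\<^bsub>V\<^esub> x = x"
    and "\<And>a b x. x \<in> carrier V \<Longrightarrow> (a + b) \<odot>\<^bsub>V\<^esub> x = a \<odot>\<^bsub>V\<^esub> x \<oplus>\<^bsub>V\<^esub> b \<odot>\<^bsub>V\<^esub> x"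
    and "\<And>a x y. x \<in> carrier V \<Longrightarrow> y \<in> carrier V \<Longrightarrow>
           a \<odot>\<^bsub>V\<^esub> (x \<oplus>\<^bsub>V\<^esub> y) = a \<odot>\<^bsub>V\<^esub> x \<oplus>\<^bsub>V\<^esub> a \<odot>\<^bsub>V\<^esub> y"
    and "\<And>a b x. x \<in> carrier V \<Longrightarrow> (a * b) \<odot>\<^bsub>V\<^esub> x = a \<odot>\<^bsub>V\<^esub> (b \<odot>\<^bsub>V\<^esub> x)"
  shows "vector_space_rec V"
proof (rule moduleI[OF cring_scalars])
  show "abelian_group V"
  proof (rule abelian_groupI)
    fix x assume x: "x \<in> carrier V"
    have "(- 1) \<odot>\<^bsub>V\<^esub> x \<oplus>\<^bsub>V\<^esub> x = (- 1) \<odot>\<^bsub>V\<^esub> x \<oplus>\<^bsub>V\<^esub> 1 \<odot>\<^bsub>V\<^esub> x"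
      using x assms(8) by simp
    also have "\<dots> = \<zero>\<^bsub>V\<^esub>" using x assms(9)[of x "-1" 1] assms(7) by simp
    finally show "\<exists>y\<in>carrier V. y \<oplus>\<^bsub>V\<^esub> x = \<zero>\<^bsub>V\<^esub>" using x assms(3) by blast
  qed (use assms in auto)
qed (use assms in auto)

context
  fixes V :: "('k::field, 'a, 'm) module_scheme"
  assumes V: "vector_space_rec V"
begin

lemma vs_abelian_group: "abelian_group V"
  using V by (simp add: module_def)

lemma vs_abelian_monoid: "abelian_monoid V"
  using vs_abelian_group by (rule abelian_group.axioms(1))

lemma vs_closed [simp]:
  "x \<in> carrier V \<Longrightarrow> y \<in> carrier V \<Longrightarrow> x \<oplus>\<^bsub>V\<^esub> y \<in> carrier V"
  "\<zero>\<^bsub>V\<^esub> \<in> carrier V"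
  "x \<in> carrier V \<Longrightarrow> c \<odot>\<^bsub>V\<^esub> x \<in> carrier V"
proof -
  interpret module "scalars :: ('k, 'k) module" V by (rule V)
  show "x \<in> carrier V \<Longrightarrow> y \<in> carrier V \<Longrightarrow> x \<oplus>\<^bsub>V\<^esub> y \<in> carrier V"
    "\<zero>\<^bsub>V\<^esub> \<in> carrier V" "x \<in> carrier V \<Longrightarrow> c \<odot>\<^bsub>V\<^esub> x \<in> carrier V"
    using smult_closed by auto
qed

lemma vs_add:
  "x \<in> carrier V \<Longrightarrow> y \<in> carrier V \<Longrightarrow> z \<in> carrier V \<Longrightarrow> x \<oplus>\<^bsub>V\<^esub> y \<oplus>\<^bsub>V\<^esub> z = x \<oplus>\<^bsub>V\<^esub> (y \<oplus>\<^bsub>V\<^esub> z)"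
  "x \<in> carrier V \<Longrightarrow> y \<in> carrier V \<Longrightarrow> x \<oplus>\<^bsub>V\<^esub> y = y \<oplus>\<^bsub>V\<^esub> x"
  "x \<in> carrier V \<Longrightarrow> y \<in> carrier V \<Longrightarrow> z \<in> carrier V \<Longrightarrow> x \<oplus>\<^bsub>V\<^esub> (y \<oplus>\<^bsub>V\<^esub> z) = y \<oplus>\<^bsub>V\<^esub> (x \<oplus>\<^bsub>V\<^esub> z)"
proof -
  interpret module "scalars :: ('k, 'k) module" V by (rule V)
  show "x \<in> carrier V \<Longrightarrow> y \<in> carrier V \<Longrightarrow> z \<in> carrier V \<Longrightarrow> x \<oplus>\<^bsub>V\<^esub> y \<oplus>\<^bsub>V\<^esub> z = x \<oplus>\<^bsub>V\<^esub> (y \<oplus>\<^bsub>V\<^esub> z)"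
    "x \<in> carrier V \<Longrightarrow> y \<in> carrier V \<Longrightarrow> x \<oplus>\<^bsub>V\<^esub> y = y \<oplus>\<^bsub>V\<^esub> x"
    "x \<in> carrier V \<Longrightarrow> y \<in> carrier V \<Longrightarrow> z \<in> carrier V \<Longrightarrow> x \<oplus>\<^bsub>V\<^esub> (y \<oplus>\<^bsub>V\<^esub> z) = y \<oplus>\<^bsub>V\<^esub> (x \<oplus>\<^bsub>V\<^esub> z)"
    by (auto simp: M.a_ac)
qed

lemma vs_zero [simp]:
  "x \<in> carrier V \<Longrightarrow> \<zero>\<^bsub>V\<^esub> \<oplus>\<^bsub>V\<^esub> x = x"
  "x \<in> carrier V \<Longrightarrow> x \<oplus>\<^bsub>V\<^esub> \<zero>\<^bsub>V\<^esub> = x"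
  "x \<in> carrier V \<Longrightarrow> 0 \<odot>\<^bsub>V\<^esub> x = \<zero>\<^bsub>V\<^esub>"
  "c \<odot>\<^bsub>V\<^esub> \<zero>\<^bsub>V\<^esub> = \<zero>\<^bsub>V\<^esub>"
  "x \<in> carrier V \<Longrightarrow> 1 \<odot>\<^bsub>V\<^esub> x = x"
proof -
  interpret module "scalars :: ('k, 'k) module" V by (rule V)
  show "x \<in> carrier V \<Longrightarrow> \<zero>\<^bsub>V\<^esub> \<oplus>\<^bsub>V\<^esub> x = x"
    "x \<in> carrier V \<Longrightarrow> x \<oplus>\<^bsub>V\<^esub> \<zero>\<^bsub>V\<^esub> = x"
    "x \<in> carrier V \<Longrightarrow> 0 \<odot>\<^bsub>V\<^esub> x = \<zero>\<^bsub>V\<^esub>"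
    "c \<odot>\<^bsub>V\<^esub> \<zero>\<^bsub>V\<^esub> = \<zero>\<^bsub>V\<^esub>"
    "x \<in> carrier V \<Longrightarrow> 1 \<odot>\<^bsub>V\<^esub> x = x"
    using smult_l_null smult_r_null smult_one by auto
qed

lemma vs_smult:
  "x \<in> carrier V \<Longrightarrow> (a + b) \<odot>\<^bsub>V\<^esub> x = a \<odot>\<^bsub>V\<^esub> x \<oplus>\<^bsub>V\<^esub> b \<odot>\<^bsub>V\<^esub> x"
  "x \<in> carrier V \<Longrightarrow> y \<in> carrier V \<Longrightarrow> a \<odot>\<^bsub>V\<^esub> (x \<oplus>\<^bsub>V\<^esub> y) = a \<odot>\<^bsub>V\<^esub> x \<oplus>\<^bsub>V\<^esub> a \<odot>\<^bsub>V\<^esub> y"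
  "x \<in> carrier V \<Longrightarrow> a \<odot>\<^bsub>V\<^esub> (b \<odot>\<^bsub>V\<^esub> x) = (a * b) \<odot>\<^bsub>V\<^esub> x"
proof -
  interpret module "scalars :: ('k, 'k) module" V by (rule V)
  show "x \<in> carrier V \<Longrightarrow> (a + b) \<odot>\<^bsub>V\<^esub> x = a \<odot>\<^bsub>V\<^esub> x \<oplus>\<^bsub>V\<^esub> b \<odot>\<^bsub>V\<^esub> x"
    "x \<in> carrier V \<Longrightarrow> y \<in> carrier V \<Longrightarrow> a \<odot>\<^bsub>V\<^esub> (x \<oplus>\<^bsub>V\<^esub> y) = a \<odot>\<^bsub>V\<^esub> x \<oplus>\<^bsub>V\<^esub> a \<odot>\<^bsub>V\<^esub> y"
    "x \<in> carrier V \<Longrightarrow> a \<odot>\<^bsub>V\<^esub> (b \<odot>\<^bsub>V\<^esub> x) = (a * b) \<odot>\<^bsub>V\<^esub> x"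
    using smult_l_distr[of a b x] smult_r_distr[of a x y] smult_assoc1[of a b x] by auto
qed

lemma vs_neg [simp]:
  "x \<in> carrier V \<Longrightarrow> x \<oplus>\<^bsub>V\<^esub> (- 1) \<odot>\<^bsub>V\<^esub> x = \<zero>\<^bsub>V\<^esub>"
  "x \<in> carrier V \<Longrightarrow> (- 1) \<odot>\<^bsub>V\<^esub> x \<oplus>\<^bsub>V\<^esub> x = \<zero>\<^bsub>V\<^esub>"
  "x \<in> carrier V \<Longrightarrow> c \<odot>\<^bsub>V\<^esub> x \<oplus>\<^bsub>V\<^esub> (- c) \<odot>\<^bsub>V\<^esub> x = \<zero>\<^bsub>V\<^esub>"
  using vs_smult(1)[of x 1 "- 1"] vs_smult(1)[of x "- 1" 1] vs_smult(1)[of x c "- c"] by auto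

lemma vs_diff_eq_zero:
  "x \<in> carrier V \<Longrightarrow> y \<in> carrier V \<Longrightarrow> x \<oplus>\<^bsub>V\<^esub> (- 1) \<odot>\<^bsub>V\<^esub> y = \<zero>\<^bsub>V\<^esub> \<Longrightarrow> x = y"
  by (metis vs_add(1) vs_closed(3) vs_neg(2) vs_zero(1,2))

lemma vs_a_inv: "x \<in> carrier V \<Longrightarrow> \<ominus>\<^bsub>V\<^esub> x = (- 1) \<odot>\<^bsub>V\<^esub> x"
proof -
  interpret abelian_group V by (rule vs_abelian_group)
  show "x \<in> carrier V \<Longrightarrow> \<ominus>\<^bsub>V\<^esub> x = (- 1) \<odot>\<^bsub>V\<^esub> x"
    by (metis minus_equality vs_neg(2) vs_closed(3))
qed

lemma subspace_recI:
  assumes "N \<subseteq> carrier V" "\<zero>\<^bsub>V\<^esub> \<in> N"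
    and "\<And>x y. x \<in> N \<Longrightarrow> y \<in> N \<Longrightarrow> x \<oplus>\<^bsub>V\<^esub> y \<in> N" "\<And>c x. x \<in> N \<Longrightarrow> c \<odot>\<^bsub>V\<^esub> x \<in> N"
  shows "subspace_rec V N"
  using assms
  by (intro module.submoduleI[OF V]) (auto simp: vs_a_inv subset_iff)

lemma subspace_recD:
  assumes "subspace_rec V N"
  shows "x \<in> N \<Longrightarrow> x \<in> carrier V" "\<zero>\<^bsub>V\<^esub> \<in> N"
    and "x \<in> N \<Longrightarrow> y \<in> N \<Longrightarrow> x \<oplus>\<^bsub>V\<^esub> y \<in> N" and "x \<in> N \<Longrightarrow> c \<odot>\<^bsub>V\<^esub> x \<in> N"
proof -
  note E = module.submoduleE[OF V assms]
  show "x \<in> N \<Longrightarrow> x \<in> carrier V" "x \<in> N \<Longrightarrow> y \<in> N \<Longrightarrow> x \<oplus>\<^bsub>V\<^esub> y \<in> N"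
    "x \<in> N \<Longrightarrow> c \<odot>\<^bsub>V\<^esub> x \<in> N" using E by auto
  show "\<zero>\<^bsub>V\<^esub> \<in> N" using E(1,2) E(4)[of 0] vs_zero(3) by (metis UNIV_I ex_in_conv scalars_simps(1) subsetD)
qed

lemma subspace_rec_Inter:
  assumes "\<And>N. N \<in> \<N> \<Longrightarrow> subspace_rec V N" and "\<N> \<noteq> {}"
  shows "subspace_rec V (\<Inter>\<N>)"
  using assms by (intro subspace_recI) (auto dest: subspace_recD)

text \<open>
  The family of subspaces above \<open>S\<close> must be inhabited, since the empty intersection is the whole type;
  this is where \<open>S \<subseteq> carrier V\<close> enters.
\<close>

lemma subspace_rec_hull:
  assumes "S \<subseteq> carrier V"
  shows "subspace_rec V (subspace_rec V hull S)"
  unfolding hull_def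
  using module.carrier_is_submodule[OF V] assms by (intro subspace_rec_Inter) auto

lemma vs_finsum_closed [simp]:
  "(\<And>i. i \<in> A \<Longrightarrow> f i \<in> carrier V) \<Longrightarrow> (\<Oplus>\<^bsub>V\<^esub>i\<in>A. f i) \<in> carrier V"
  by (rule abelian_monoid.finsum_closed[OF vs_abelian_monoid]) auto

lemma vs_finsum_cong:
  "(\<And>i. i \<in> A \<Longrightarrow> g i \<in> carrier V) \<Longrightarrow> (\<And>i. i \<in> A \<Longrightarrow> f i = g i) \<Longrightarrow>
   (\<Oplus>\<^bsub>V\<^esub>i\<in>A. f i) = (\<Oplus>\<^bsub>V\<^esub>i\<in>A. g i)"
  by (rule abelian_monoid.finsum_cong'[OF vs_abelian_monoid]) auto

lemma vs_finsum_insert: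
  "finite A \<Longrightarrow> a \<notin> A \<Longrightarrow> (\<And>i. i \<in> insert a A \<Longrightarrow> f i \<in> carrier V) \<Longrightarrow>
   (\<Oplus>\<^bsub>V\<^esub>i\<in>insert a A. f i) = f a \<oplus>\<^bsub>V\<^esub> (\<Oplus>\<^bsub>V\<^esub>i\<in>A. f i)"
  by (rule abelian_monoid.finsum_insert[OF vs_abelian_monoid]) auto

lemma vs_finsum_empty [simp]: "(\<Oplus>\<^bsub>V\<^esub>i\<in>{}. f i) = \<zero>\<^bsub>V\<^esub>"
  by (rule abelian_monoid.finsum_empty[OF vs_abelian_monoid])

lemma vs_finsum_singleton [simp]:
  "f a \<in> carrier V \<Longrightarrow> (\<Oplus>\<^bsub>V\<^esub>i\<in>{a}. f i) = f a"
  using vs_finsum_insert[of "{}" a f] by auto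

lemma vs_finsum_addf:
  "(\<And>i. i \<in> A \<Longrightarrow> f i \<in> carrier V) \<Longrightarrow> (\<And>i. i \<in> A \<Longrightarrow> g i \<in> carrier V) \<Longrightarrow>
   (\<Oplus>\<^bsub>V\<^esub>i\<in>A. f i \<oplus>\<^bsub>V\<^esub> g i) = (\<Oplus>\<^bsub>V\<^esub>i\<in>A. f i) \<oplus>\<^bsub>V\<^esub> (\<Oplus>\<^bsub>V\<^esub>i\<in>A. g i)"
  by (rule abelian_monoid.finsum_addf[OF vs_abelian_monoid]) auto

lemma vs_finsum_smult:
  "finite A \<Longrightarrow> (\<And>i. i \<in> A \<Longrightarrow> f i \<in> carrier V) \<Longrightarrow>
   c \<odot>\<^bsub>V\<^esub> (\<Oplus>\<^bsub>V\<^esub>i\<in>A. f i) = (\<Oplus>\<^bsub>V\<^esub>i\<in>A. c \<odot>\<^bsub>V\<^esub> f i)"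
  by (rule module.finsum_smult_ldistr[OF V]) auto

lemma vs_finsum_superset:
  assumes "finite B" "A \<subseteq> B" "\<And>i. i \<in> B \<Longrightarrow> f i \<in> carrier V" "\<And>i. i \<in> B - A \<Longrightarrow> f i = \<zero>\<^bsub>V\<^esub>"
  shows "(\<Oplus>\<^bsub>V\<^esub>i\<in>A. f i) = (\<Oplus>\<^bsub>V\<^esub>i\<in>B. f i)"
proof -
  interpret abelian_monoid V by (rule vs_abelian_monoid)
  show ?thesis using assms by (intro add.finprod_mono_neutral_cong_left) auto
qed

lemma vs_finsum_single:
  assumes "finite B" "a \<in> B" "\<And>i. i \<in> B \<Longrightarrow> f i \<in> carrier V"
    and "\<And>i. i \<in> B \<Longrightarrow> i \<noteq> a \<Longrightarrow> f i = \<zero>\<^bsub>V\<^esub>"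
  shows "(\<Oplus>\<^bsub>V\<^esub>i\<in>B. f i) = f a"
proof -
  have "(\<Oplus>\<^bsub>V\<^esub>i\<in>B. f i) = (\<Oplus>\<^bsub>V\<^esub>i\<in>{a}. f i)"
    using assms by (intro vs_finsum_superset[symmetric]) auto
  then show ?thesis using assms by simp
qed

lemma vs_finsum_zero:
  assumes "\<And>i. i \<in> B \<Longrightarrow> f i = \<zero>\<^bsub>V\<^esub>"
  shows "(\<Oplus>\<^bsub>V\<^esub>i\<in>B. f i) = \<zero>\<^bsub>V\<^esub>"
proof -
  interpret abelian_monoid V by (rule vs_abelian_monoid)
  show ?thesis using assms by (intro add.finprod_one_eqI) auto
qed

end

lemma vs_scalars [simp]: "vector_space_rec (scalars :: ('k::field, 'k) module)"
  by (rule vector_space_recI) (simp_all add: algebra_simps)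

subsection \<open>Linear and bilinear maps\<close>

text \<open>
  Phrased as linearity in each slot, so that bilinearity of a nested expression is proved by the same
  rules as its linearity.
\<close>

definition bilinear_map ::
    "('k, 'a, 'm) module_scheme \<Rightarrow> ('k, 'b, 'n) module_scheme \<Rightarrow> ('k, 'c, 'p) module_scheme \<Rightarrow>
     ('a \<Rightarrow> 'b \<Rightarrow> 'c) \<Rightarrow> bool" where
  "bilinear_map A B W \<beta> \<longleftrightarrow>
     (\<forall>a\<in>carrier A. linear_map B W (\<beta> a)) \<and> (\<forall>b\<in>carrier B. linear_map A W (\<lambda>a. \<beta> a b))"

lemma linear_mapI:
  assumes "\<And>x. x \<in> carrier V \<Longrightarrow> f x \<in> carrier W"
    and "\<And>x y. x \<in> carrier V \<Longrightarrow> y \<in> carrier V \<Longrightarrow> f (x \<oplus>\<^bsub>V\<^esub> y) = f x \<oplus>\<^bsub>W\<^esub> f y"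
    and "\<And>c x. x \<in> carrier V \<Longrightarrow> f (c \<odot>\<^bsub>V\<^esub> x) = c \<odot>\<^bsub>W\<^esub> f x"
  shows "linear_map V W f"
  using assms by (auto simp: linear_map_def)

lemma linear_mapD:
  assumes "linear_map V W f"
  shows "x \<in> carrier V \<Longrightarrow> f x \<in> carrier W"
    and "x \<in> carrier V \<Longrightarrow> y \<in> carrier V \<Longrightarrow> f (x \<oplus>\<^bsub>V\<^esub> y) = f x \<oplus>\<^bsub>W\<^esub> f y"
    and "x \<in> carrier V \<Longrightarrow> f (c \<odot>\<^bsub>V\<^esub> x) = c \<odot>\<^bsub>W\<^esub> f x"
  using assms by (auto simp: linear_map_def)

lemma linear_map_zero:
  assumes "vector_space_rec V" "vector_space_rec W" "linear_map V W f"
  shows "f \<zero>\<^bsub>V\<^esub> = \<zero>\<^bsub>W\<^esub>"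
  using linear_mapD(3)[OF assms(3), of "\<zero>\<^bsub>V\<^esub>" 0] linear_mapD(1)[OF assms(3), of "\<zero>\<^bsub>V\<^esub>"] assms(1,2)
  by simp

lemma linear_map_finsum:
  assumes "vector_space_rec V" "vector_space_rec W" "linear_map V W f" "finite A"
    and "\<And>i. i \<in> A \<Longrightarrow> g i \<in> carrier V"
  shows "f (\<Oplus>\<^bsub>V\<^esub>i\<in>A. g i) = (\<Oplus>\<^bsub>W\<^esub>i\<in>A. f (g i))"
  using assms(4,5)
proof (induction A rule: finite_induct)
  case empty
  then show ?case by (simp add: assms(1,2) linear_map_zero[OF assms(1-3)])
next
  case (insert a A)
  then have "f (\<Oplus>\<^bsub>V\<^esub>i\<in>insert a A. g i) = f (g a) \<oplus>\<^bsub>W\<^esub> f (\<Oplus>\<^bsub>V\<^esub>i\<in>A. g i)"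
    by (subst vs_finsum_insert[OF assms(1)]) (auto simp: assms(1) linear_mapD[OF assms(3)])
  also have "\<dots> = (\<Oplus>\<^bsub>W\<^esub>i\<in>insert a A. f (g i))"
    using insert by (subst vs_finsum_insert[OF assms(2)]) (auto simp: linear_mapD[OF assms(3)])
  finally show ?case .
qed

lemma linear_map_cong:
  assumes "vector_space_rec V" "linear_map V W f" "\<And>x. x \<in> carrier V \<Longrightarrow> f x = g x"
  shows "linear_map V W g"
  using assms by (auto simp: linear_map_def Pi_def)

lemma linear_map_kernel:
  assumes "vector_space_rec V" "vector_space_rec W" "linear_map V W f"
  shows "subspace_rec V {x \<in> carrier V. f x = \<zero>\<^bsub>W\<^esub>}"
  by (rule subspace_recI[OF assms(1)])
     (auto simp: assms(1,2) linear_mapD[OF assms(3)] linear_map_zero[OF assms])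

text \<open>
  Rules that establish the linearity of an expression by following its syntactic shape.
\<close>

named_theorems linear_intros

lemma linear_map_id [linear_intros]: "linear_map V V (\<lambda>x. x)"
  by (simp add: linear_map_def)

lemma linear_map_comp:
  "linear_map W U f \<Longrightarrow> linear_map V W g \<Longrightarrow> linear_map V U (\<lambda>x. f (g x))"
  by (simp add: linear_map_def Pi_def)

lemma bilinear_mapI:
  assumes "\<And>a. a \<in> carrier A \<Longrightarrow> linear_map B W (\<beta> a)"
    and "\<And>b. b \<in> carrier B \<Longrightarrow> linear_map A W (\<lambda>a. \<beta> a b)"
  shows "bilinear_map A B W \<beta>"
  using assms by (auto simp: bilinear_map_def)

lemma bilinear_mapD:
  assumes "bilinear_map A B W \<beta>"
  shows "a \<in> carrier A \<Longrightarrow> linear_map B W (\<beta> a)"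
    and "b \<in> carrier B \<Longrightarrow> linear_map A W (\<lambda>a. \<beta> a b)"
    and "a \<in> carrier A \<Longrightarrow> b \<in> carrier B \<Longrightarrow> \<beta> a b \<in> carrier W"
  using assms by (auto simp: bilinear_map_def dest: linear_mapD)

lemma linear_map_bilinear:
  assumes "bilinear_map A B W \<beta>"
  shows "a \<in> carrier A \<Longrightarrow> linear_map V B g \<Longrightarrow> linear_map V W (\<lambda>v. \<beta> a (g v))"
    and "b \<in> carrier B \<Longrightarrow> linear_map V A f \<Longrightarrow> linear_map V W (\<lambda>v. \<beta> (f v) b)"
  using linear_map_comp[OF bilinear_mapD(1)[OF assms]] linear_map_comp[OF bilinear_mapD(2)[OF assms]]
  by auto

lemma linear_map_smult [linear_intros]:
  assumes "vector_space_rec W" "linear_map V W f"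
  shows "linear_map V W (\<lambda>v. c \<odot>\<^bsub>W\<^esub> f v)"
  using assms(1) linear_mapD[OF assms(2)]
  by (intro linear_mapI) (simp_all add: vs_smult mult.commute)

lemma linear_map_smult_left [linear_intros]:
  assumes "vector_space_rec W" "linear_map V scalars f" "w \<in> carrier W"
  shows "linear_map V W (\<lambda>v. f v \<odot>\<^bsub>W\<^esub> w)"
  using assms(1,3) linear_mapD[OF assms(2)]
  by (intro linear_mapI) (simp_all add: vs_smult)

lemma linear_map_add:
  assumes "vector_space_rec W" "linear_map V W f" "linear_map V W g"
  shows "linear_map V W (\<lambda>v. f v \<oplus>\<^bsub>W\<^esub> g v)"
  using assms(1) linear_mapD[OF assms(2)] linear_mapD[OF assms(3)]
  by (intro linear_mapI) (simp_all add: vs_smult vs_add)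

lemma linear_map_finsum_fun [linear_intros]:
  assumes "vector_space_rec W" "finite S" "\<And>i. i \<in> S \<Longrightarrow> linear_map V W (\<lambda>v. f v i)"
  shows "linear_map V W (\<lambda>v. \<Oplus>\<^bsub>W\<^esub>i\<in>S. f v i)"
  by (intro linear_mapI)
     (auto simp: assms(1,2) linear_mapD[OF assms(3)] vs_finsum_smult vs_finsum_addf[symmetric]
       intro!: vs_finsum_cong)

subsection \<open>Free spaces\<close>

lemma free_space_simps [simp]:
  "v \<in> carrier (free_space X) \<longleftrightarrow> Poly_Mapping.keys v \<subseteq> X"
  "\<zero>\<^bsub>free_space X\<^esub> = 0"
  "v \<oplus>\<^bsub>free_space X\<^esub> w = v + w"
  "c \<odot>\<^bsub>free_space X\<^esub> v = Poly_Mapping.map ((*) c) v"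
  by (simp_all add: free_space_def)

lemma lookup_scale [simp]:
  "Poly_Mapping.lookup (Poly_Mapping.map ((*) c) v) x = c * Poly_Mapping.lookup v x"
  for c :: "'k::field"
  by (simp add: Poly_Mapping.map.rep_eq when_def)

lemma vs_free_space [simp]: "vector_space_rec (free_space X :: ('k::field, 'x \<Rightarrow>\<^sub>0 'k) module)"
proof (rule vector_space_recI)
  fix v w :: "'x \<Rightarrow>\<^sub>0 'k" and c :: 'k
  assume "v \<in> carrier (free_space X)"
  then show "c \<odot>\<^bsub>free_space X\<^esub> v \<in> carrier (free_space X)"
    by (auto simp: in_keys_iff)
  assume "w \<in> carrier (free_space X)"
  then show "v \<oplus>\<^bsub>free_space X\<^esub> w \<in> carrier (free_space X)"
    using \<open>v \<in> _\<close> Poly_Mapping.keys_add[of v w] by auto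
qed (auto simp: algebra_simps lookup_add intro!: poly_mapping_eqI)

lemma free_space_induct [consumes 1, case_names zero single add]:
  fixes v :: "'x \<Rightarrow>\<^sub>0 'k::field"
  assumes "v \<in> carrier (free_space X)" "P 0" "\<And>x c. x \<in> X \<Longrightarrow> P (Poly_Mapping.single x c)"
    and "\<And>v w. v \<in> carrier (free_space X) \<Longrightarrow> w \<in> carrier (free_space X) \<Longrightarrow> P v \<Longrightarrow> P w \<Longrightarrow> P (v + w)"
  shows "P v"
  using assms(1)
proof (induction v rule: Poly_Mapping.update_induct)
  case const show ?case by (rule assms(2))
next
  case (update f a b)
  have eq: "Poly_Mapping.update a b f = f + Poly_Mapping.single a b"
    using update.hyps(1)
    by (intro poly_mapping_eqI) (auto simp: lookup_update lookup_add lookup_single in_keys_iff)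
  have "Poly_Mapping.keys f \<subseteq> X" "a \<in> X"
    using update.prems update.hyps by (auto simp: keys_update)
  then show ?case unfolding eq
    using update.IH by (intro assms(4) assms(3)) auto
qed

lemma lin_extend_superset:
  fixes W :: "('k::field, 'a, 'm) module_scheme"
  assumes W: "vector_space_rec W" and f: "\<And>x. x \<in> X \<Longrightarrow> f x \<in> carrier W"
    and "finite S" "Poly_Mapping.keys v \<subseteq> S" "S \<subseteq> X"
  shows "lin_extend W f v = (\<Oplus>\<^bsub>W\<^esub>x\<in>S. Poly_Mapping.lookup v x \<odot>\<^bsub>W\<^esub> f x)"
  unfolding lin_extend_def using assms
  by (intro vs_finsum_superset) (auto simp: in_keys_iff)

lemma lin_extend_linear [linear_intros]:
  fixes W :: "('k::field, 'a, 'm) module_scheme"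
  assumes W: "vector_space_rec W" and f: "\<And>x. x \<in> X \<Longrightarrow> f x \<in> carrier W"
  shows "linear_map (free_space X) W (lin_extend W f)"
proof (rule linear_mapI)
  fix v w :: "'b \<Rightarrow>\<^sub>0 'k" and c :: 'k
  assume v: "v \<in> carrier (free_space X)"
  show "lin_extend W f v \<in> carrier W"
    unfolding lin_extend_def using v W f by (intro vs_finsum_closed) auto
  have "lin_extend W f (Poly_Mapping.map ((*) c) v) =
      (\<Oplus>\<^bsub>W\<^esub>x\<in>Poly_Mapping.keys v. (c * Poly_Mapping.lookup v x) \<odot>\<^bsub>W\<^esub> f x)"
    using v by (subst lin_extend_superset[OF W f, where S = "Poly_Mapping.keys v"])
      (auto simp: in_keys_iff)
  also have "\<dots> = c \<odot>\<^bsub>W\<^esub> lin_extend W f v"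
    unfolding lin_extend_def using v f
    by (subst vs_finsum_smult[OF W]) (auto simp: W vs_smult subset_iff intro!: vs_finsum_cong)
  finally show "lin_extend W f (c \<odot>\<^bsub>free_space X\<^esub> v) = c \<odot>\<^bsub>W\<^esub> lin_extend W f v" by simp
  assume w: "w \<in> carrier (free_space X)"
  let ?S = "Poly_Mapping.keys v \<union> Poly_Mapping.keys w"
  have S: "?S \<subseteq> X" using v w by auto
  have "lin_extend W f (v + w) =
      (\<Oplus>\<^bsub>W\<^esub>x\<in>?S. Poly_Mapping.lookup v x \<odot>\<^bsub>W\<^esub> f x \<oplus>\<^bsub>W\<^esub> Poly_Mapping.lookup w x \<odot>\<^bsub>W\<^esub> f x)"
    using S f
    by (subst lin_extend_superset[OF W f, where S = ?S])
      (auto simp: W keys_add lookup_add vs_smult subset_iff intro!: vs_finsum_cong dest: set_mp[OF keys_add])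
  also have "\<dots> = lin_extend W f v \<oplus>\<^bsub>W\<^esub> lin_extend W f w"
    using S f
    by (subst vs_finsum_addf[OF W]) (auto simp: W subset_iff lin_extend_superset[OF W f, where S = ?S and X = X])
  finally show "lin_extend W f (v \<oplus>\<^bsub>free_space X\<^esub> w) = lin_extend W f v \<oplus>\<^bsub>W\<^esub> lin_extend W f w"
    by simp
qed

lemma lin_extend_single:
  assumes "vector_space_rec W" "f x \<in> carrier W"
  shows "lin_extend W f (Poly_Mapping.single x c) = c \<odot>\<^bsub>W\<^esub> f x"
  using assms by (cases "c = 0") (simp_all add: lin_extend_def)

lemma lin_extend_basis [simp]:
  assumes "vector_space_rec W" "f x \<in> carrier W"
  shows "lin_extend W f (basis_vec x) = f x"
  using assms by (simp add: lin_extend_single)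

lemma linear_map_free_eq:
  fixes W :: "('k::field, 'a, 'm) module_scheme"
  assumes W: "vector_space_rec W"
    and f: "linear_map (free_space X) W f" and g: "linear_map (free_space X) W g"
    and eq: "\<And>x. x \<in> X \<Longrightarrow> f (basis_vec x) = g (basis_vec x)"
    and v: "v \<in> carrier (free_space X)"
  shows "f v = g v"
  using v
proof (induction v rule: free_space_induct)
  case zero
  show ?case using linear_map_zero[OF vs_free_space W f] linear_map_zero[OF vs_free_space W g] by simp
next
  case (single x c)
  then show ?case
    using linear_mapD(3)[OF f, of "basis_vec x" c] linear_mapD(3)[OF g, of "basis_vec x" c] eq
    by (simp add: map_single)
next
  case (add v w)
  then show ?case using linear_mapD(2)[OF f, of v w] linear_mapD(2)[OF g, of v w] by simp
qed

lemma linear_lin_extend: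
  assumes "vector_space_rec W" "vector_space_rec U" "linear_map W U g"
    and "\<And>x. x \<in> X \<Longrightarrow> f x \<in> carrier W" "v \<in> carrier (free_space X)"
  shows "g (lin_extend W f v) = lin_extend U (\<lambda>x. g (f x)) v"
  using assms(5)
  by (rule linear_map_free_eq[rotated -1])
     (auto simp: assms(1-4) linear_mapD[OF assms(3)] intro!: linear_map_comp[OF assms(3)] lin_extend_linear)

lemma lin_extend_basis_vec:
  "v \<in> carrier (free_space X) \<Longrightarrow> lin_extend (free_space X) basis_vec v = v"
  by (rule linear_map_free_eq[where X = X and W = "free_space X"]) (auto intro!: linear_intros)

lemma lin_extend_cong:
  assumes "vector_space_rec W" "v \<in> carrier (free_space X)" "\<And>x. x \<in> X \<Longrightarrow> f x = g x"
    "\<And>x. x \<in> X \<Longrightarrow> g x \<in> carrier W"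
  shows "lin_extend W f v = lin_extend W g v"
  unfolding lin_extend_def using assms by (intro vs_finsum_cong) auto

lemma linear_map_lin_extend [linear_intros]:
  assumes "vector_space_rec W" "\<And>x. x \<in> X \<Longrightarrow> linear_map V W (\<lambda>v. f v x)"
    and "u \<in> carrier (free_space X)"
  shows "linear_map V W (\<lambda>v. lin_extend W (f v) u)"
  unfolding lin_extend_def using assms by (intro linear_intros) auto

lemma linear_map_lookup: "linear_map (free_space X) scalars (\<lambda>v. Poly_Mapping.lookup v x)"
  by (auto intro!: linear_mapI simp: lookup_add)

subsection \<open>Quotient spaces\<close>

lemma quotient_module_simps:
  "carrier (quotient_module M N) = (\<lambda>x. N +>\<^bsub>M\<^esub> x) ` carrier M"
  "\<zero>\<^bsub>quotient_module M N\<^esub> = N"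
  "\<one>\<^bsub>quotient_module M N\<^esub> = N +>\<^bsub>M\<^esub> \<one>\<^bsub>M\<^esub>"
  "A \<oplus>\<^bsub>quotient_module M N\<^esub> B = A <+>\<^bsub>M\<^esub> B"
  "A \<otimes>\<^bsub>quotient_module M N\<^esub> B = rcoset_mult M N A B"
  "c \<odot>\<^bsub>quotient_module M N\<^esub> A = (\<Union>x\<in>A. N +>\<^bsub>M\<^esub> (c \<odot>\<^bsub>M\<^esub> x))"
  by (auto simp: quotient_module_def FactRing_def ring.defs module.defs A_RCOSETS_def RCOSETS_def
      a_r_coset_def)

context
  fixes M :: "('k::field, 'a, 'm) module_scheme" and N
  assumes M: "vector_space_rec M" and N: "subspace_rec M N"
begin

lemma coset_eq_image: "N +>\<^bsub>M\<^esub> x = (\<lambda>n. n \<oplus>\<^bsub>M\<^esub> x) ` N"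
  by (auto simp: a_r_coset_def')

lemma coset_self: "x \<in> carrier M \<Longrightarrow> x \<in> N +>\<^bsub>M\<^esub> x"
  unfolding coset_eq_image
  by (rule image_eqI[where x = "\<zero>\<^bsub>M\<^esub>"]) (simp_all add: M subspace_recD[OF M N])

lemma coset_absorb: "n \<in> N \<Longrightarrow> x \<in> carrier M \<Longrightarrow> N +>\<^bsub>M\<^esub> (n \<oplus>\<^bsub>M\<^esub> x) = N +>\<^bsub>M\<^esub> x"
proof -
  have sub: "N +>\<^bsub>M\<^esub> (n \<oplus>\<^bsub>M\<^esub> x) \<subseteq> N +>\<^bsub>M\<^esub> x" if "n \<in> N" "x \<in> carrier M" for n x
  proof
    fix y assume "y \<in> N +>\<^bsub>M\<^esub> (n \<oplus>\<^bsub>M\<^esub> x)"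
    then obtain m where m: "m \<in> N" "y = m \<oplus>\<^bsub>M\<^esub> (n \<oplus>\<^bsub>M\<^esub> x)" by (auto simp: coset_eq_image)
    then have "y = (m \<oplus>\<^bsub>M\<^esub> n) \<oplus>\<^bsub>M\<^esub> x"
      using that by (simp add: vs_add(1)[OF M] subspace_recD(1)[OF M N])
    then show "y \<in> N +>\<^bsub>M\<^esub> x" using m that by (auto simp: coset_eq_image subspace_recD[OF M N])
  qed
  assume n: "n \<in> N" and x: "x \<in> carrier M"
  have "(- 1) \<odot>\<^bsub>M\<^esub> n \<oplus>\<^bsub>M\<^esub> (n \<oplus>\<^bsub>M\<^esub> x) = x"
    using n x by (simp add: vs_add(1)[OF M, symmetric] M subspace_recD[OF M N])
  then show ?thesis
    using sub[OF n x] sub[of "(- 1) \<odot>\<^bsub>M\<^esub> n" "n \<oplus>\<^bsub>M\<^esub> x"] n x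
    by (simp add: M subspace_recD[OF M N] subset_antisym)
qed

lemma coset_eqI:
  assumes "x \<in> carrier M" "y \<in> carrier M" "x \<oplus>\<^bsub>M\<^esub> (- 1) \<odot>\<^bsub>M\<^esub> y \<in> N"
  shows "N +>\<^bsub>M\<^esub> x = N +>\<^bsub>M\<^esub> y"
  using coset_absorb[OF assms(3,2)] assms by (simp add: vs_add(1)[OF M] M)

lemma coset_eqD:
  assumes "x \<in> carrier M" "y \<in> carrier M" "N +>\<^bsub>M\<^esub> x = N +>\<^bsub>M\<^esub> y"
  shows "x \<oplus>\<^bsub>M\<^esub> (- 1) \<odot>\<^bsub>M\<^esub> y \<in> N"
proof -
  obtain n where "n \<in> N" "x = n \<oplus>\<^bsub>M\<^esub> y"
    using coset_self[OF assms(1)] assms(3) by (auto simp: coset_eq_image)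
  then show ?thesis using assms by (simp add: vs_add(1)[OF M] M subspace_recD[OF M N])
qed

lemma coset_zero: "N +>\<^bsub>M\<^esub> \<zero>\<^bsub>M\<^esub> = N"
  by (auto simp: coset_eq_image M subspace_recD[OF M N] image_iff)

lemma coset_in_null_iff: "x \<in> carrier M \<Longrightarrow> N +>\<^bsub>M\<^esub> x = N \<longleftrightarrow> x \<in> N"
  using coset_eqD[of x "\<zero>\<^bsub>M\<^esub>"] coset_eqI[of x "\<zero>\<^bsub>M\<^esub>"] by (auto simp: coset_zero M)

lemma coset_add:
  "x \<in> carrier M \<Longrightarrow> y \<in> carrier M \<Longrightarrow>
   (N +>\<^bsub>M\<^esub> x) \<oplus>\<^bsub>quotient_module M N\<^esub> (N +>\<^bsub>M\<^esub> y) = N +>\<^bsub>M\<^esub> (x \<oplus>\<^bsub>M\<^esub> y)"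
  unfolding quotient_module_simps set_add_def' coset_eq_image
proof (intro equalityI subsetI)
  assume x: "x \<in> carrier M" and y: "y \<in> carrier M"
  fix z assume "z \<in> (\<Union>h\<in>(\<lambda>n. n \<oplus>\<^bsub>M\<^esub> x) ` N. \<Union>k\<in>(\<lambda>n. n \<oplus>\<^bsub>M\<^esub> y) ` N. {h \<oplus>\<^bsub>M\<^esub> k})"
  then obtain n m where nm: "n \<in> N" "m \<in> N" "z = (n \<oplus>\<^bsub>M\<^esub> x) \<oplus>\<^bsub>M\<^esub> (m \<oplus>\<^bsub>M\<^esub> y)" by auto
  then have "z = (n \<oplus>\<^bsub>M\<^esub> m) \<oplus>\<^bsub>M\<^esub> (x \<oplus>\<^bsub>M\<^esub> y)"
    using x y by (simp add: vs_add[OF M] M subspace_recD(1)[OF M N])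
  then show "z \<in> (\<lambda>n. n \<oplus>\<^bsub>M\<^esub> (x \<oplus>\<^bsub>M\<^esub> y)) ` N" using nm by (auto simp: subspace_recD[OF M N])
next
  assume x: "x \<in> carrier M" and y: "y \<in> carrier M"
  fix z assume "z \<in> (\<lambda>n. n \<oplus>\<^bsub>M\<^esub> (x \<oplus>\<^bsub>M\<^esub> y)) ` N"
  then obtain n where n: "n \<in> N" "z = n \<oplus>\<^bsub>M\<^esub> (x \<oplus>\<^bsub>M\<^esub> y)" by auto
  then have "z = (n \<oplus>\<^bsub>M\<^esub> x) \<oplus>\<^bsub>M\<^esub> (\<zero>\<^bsub>M\<^esub> \<oplus>\<^bsub>M\<^esub> y)"
    using x y by (simp add: vs_add(1)[OF M] M subspace_recD(1)[OF M N])
  then show "z \<in> (\<Union>h\<in>(\<lambda>n. n \<oplus>\<^bsub>M\<^esub> x) ` N. \<Union>k\<in>(\<lambda>n. n \<oplus>\<^bsub>M\<^esub> y) ` N. {h \<oplus>\<^bsub>M\<^esub> k})"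
    using n subspace_recD(2)[OF M N] by blast
qed

lemma coset_smult:
  assumes x: "x \<in> carrier M"
  shows "c \<odot>\<^bsub>quotient_module M N\<^esub> (N +>\<^bsub>M\<^esub> x) = N +>\<^bsub>M\<^esub> (c \<odot>\<^bsub>M\<^esub> x)"
proof -
  have "N +>\<^bsub>M\<^esub> (c \<odot>\<^bsub>M\<^esub> y) = N +>\<^bsub>M\<^esub> (c \<odot>\<^bsub>M\<^esub> x)" if y: "y \<in> N +>\<^bsub>M\<^esub> x" for y
  proof -
    obtain n where n: "n \<in> N" "y = n \<oplus>\<^bsub>M\<^esub> x" using y by (auto simp: coset_eq_image)
    then have "c \<odot>\<^bsub>M\<^esub> y = c \<odot>\<^bsub>M\<^esub> n \<oplus>\<^bsub>M\<^esub> c \<odot>\<^bsub>M\<^esub> x" using x by (simp add: vs_smult[OF M] subspace_recD[OF M N])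
    then show ?thesis using n x by (simp add: coset_absorb subspace_recD[OF M N] M)
  qed
  then show ?thesis unfolding quotient_module_simps using coset_self[OF x] by blast
qed

lemma vs_quotient_module: "vector_space_rec (quotient_module M N)"
proof (rule vector_space_recI)
  show "\<zero>\<^bsub>quotient_module M N\<^esub> \<in> carrier (quotient_module M N)"
    using coset_zero by (metis image_eqI quotient_module_simps(1,2) vs_closed(2)[OF M])
  show "\<zero>\<^bsub>quotient_module M N\<^esub> \<oplus>\<^bsub>quotient_module M N\<^esub> A = A"
    if A: "A \<in> carrier (quotient_module M N)" for A
  proof -
    obtain x where x: "x \<in> carrier M" "A = N +>\<^bsub>M\<^esub> x"
      using A by (auto simp: quotient_module_simps)
    then show ?thesis using coset_add[of "\<zero>\<^bsub>M\<^esub>" x] by (simp add: coset_zero M quotient_module_simps(2))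
  qed
  show "0 \<odot>\<^bsub>quotient_module M N\<^esub> A = \<zero>\<^bsub>quotient_module M N\<^esub>"
    if "A \<in> carrier (quotient_module M N)" for A
    using that by (auto simp: quotient_module_simps(1,2) coset_smult coset_zero M)
  show "A \<oplus>\<^bsub>quotient_module M N\<^esub> B \<in> carrier (quotient_module M N)"
    "A \<oplus>\<^bsub>quotient_module M N\<^esub> B = B \<oplus>\<^bsub>quotient_module M N\<^esub> A"
    "A \<oplus>\<^bsub>quotient_module M N\<^esub> B \<oplus>\<^bsub>quotient_module M N\<^esub> C
      = A \<oplus>\<^bsub>quotient_module M N\<^esub> (B \<oplus>\<^bsub>quotient_module M N\<^esub> C)"
    "c \<odot>\<^bsub>quotient_module M N\<^esub> A \<in> carrier (quotient_module M N)"
    "1 \<odot>\<^bsub>quotient_module M N\<^esub> A = A"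
    "(c + d) \<odot>\<^bsub>quotient_module M N\<^esub> A
      = c \<odot>\<^bsub>quotient_module M N\<^esub> A \<oplus>\<^bsub>quotient_module M N\<^esub> d \<odot>\<^bsub>quotient_module M N\<^esub> A"
    "c \<odot>\<^bsub>quotient_module M N\<^esub> (A \<oplus>\<^bsub>quotient_module M N\<^esub> B)
      = c \<odot>\<^bsub>quotient_module M N\<^esub> A \<oplus>\<^bsub>quotient_module M N\<^esub> c \<odot>\<^bsub>quotient_module M N\<^esub> B"
    "(c * d) \<odot>\<^bsub>quotient_module M N\<^esub> A = c \<odot>\<^bsub>quotient_module M N\<^esub> (d \<odot>\<^bsub>quotient_module M N\<^esub> A)"
    if ABC: "A \<in> carrier (quotient_module M N)" "B \<in> carrier (quotient_module M N)"
      "C \<in> carrier (quotient_module M N)" for A B C c d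
  proof -
    obtain x y z where [simp]: "x \<in> carrier M" "y \<in> carrier M" "z \<in> carrier M"
      and eq: "A = N +>\<^bsub>M\<^esub> x" "B = N +>\<^bsub>M\<^esub> y" "C = N +>\<^bsub>M\<^esub> z"
      using ABC by (auto simp: quotient_module_simps(1))
    note [simp] = coset_add coset_smult quotient_module_simps(1) M
    show "A \<oplus>\<^bsub>quotient_module M N\<^esub> B \<in> carrier (quotient_module M N)"
      "c \<odot>\<^bsub>quotient_module M N\<^esub> A \<in> carrier (quotient_module M N)"
      unfolding eq by simp_all
    show "A \<oplus>\<^bsub>quotient_module M N\<^esub> B = B \<oplus>\<^bsub>quotient_module M N\<^esub> A"
      unfolding eq by (simp add: vs_add(2)[OF M, of x y])
    show "A \<oplus>\<^bsub>quotient_module M N\<^esub> B \<oplus>\<^bsub>quotient_module M N\<^esub> C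
      = A \<oplus>\<^bsub>quotient_module M N\<^esub> (B \<oplus>\<^bsub>quotient_module M N\<^esub> C)"
      unfolding eq by (simp add: vs_add(1)[OF M])
    show "1 \<odot>\<^bsub>quotient_module M N\<^esub> A = A"
      "(c + d) \<odot>\<^bsub>quotient_module M N\<^esub> A
      = c \<odot>\<^bsub>quotient_module M N\<^esub> A \<oplus>\<^bsub>quotient_module M N\<^esub> d \<odot>\<^bsub>quotient_module M N\<^esub> A"
      "c \<odot>\<^bsub>quotient_module M N\<^esub> (A \<oplus>\<^bsub>quotient_module M N\<^esub> B)
      = c \<odot>\<^bsub>quotient_module M N\<^esub> A \<oplus>\<^bsub>quotient_module M N\<^esub> c \<odot>\<^bsub>quotient_module M N\<^esub> B"
      "(c * d) \<odot>\<^bsub>quotient_module M N\<^esub> A = c \<odot>\<^bsub>quotient_module M N\<^esub> (d \<odot>\<^bsub>quotient_module M N\<^esub> A)"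
      unfolding eq by (simp_all add: vs_smult[OF M])
  qed
qed

lemma quotient_map_linear: "linear_map M (quotient_module M N) (\<lambda>x. N +>\<^bsub>M\<^esub> x)"
  by (rule linear_mapI) (auto simp: coset_add coset_smult quotient_module_simps(1))

lemma image_coset:
  assumes "vector_space_rec W" "linear_map M W f" "\<And>n. n \<in> N \<Longrightarrow> f n = \<zero>\<^bsub>W\<^esub>" "x \<in> carrier M"
  shows "f ` (N +>\<^bsub>M\<^esub> x) = {f x}"
proof -
  have "f y = f x" if y: "y \<in> N +>\<^bsub>M\<^esub> x" for y
  proof -
    obtain n where n: "n \<in> N" "y = n \<oplus>\<^bsub>M\<^esub> x" using y by (auto simp: coset_eq_image)
    then show ?thesis
      using assms by (simp add: linear_mapD[OF assms(2)] subspace_recD[OF M N])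
  qed
  then show ?thesis using coset_self[OF assms(4)] by blast
qed

text \<open>
  Induced maps on a quotient are written as the common value of \<open>f\<close> on a coset.
\<close>

lemma quotient_factor_linear:
  assumes "vector_space_rec W" "linear_map M W f" "\<And>n. n \<in> N \<Longrightarrow> f n = \<zero>\<^bsub>W\<^esub>"
  shows "linear_map (quotient_module M N) W (\<lambda>A. the_elem (f ` A))"
    (is ?lin)
    and "x \<in> carrier M \<Longrightarrow> the_elem (f ` (N +>\<^bsub>M\<^esub> x)) = f x"
proof -
  show eq: "x \<in> carrier M \<Longrightarrow> the_elem (f ` (N +>\<^bsub>M\<^esub> x)) = f x" for x
    by (simp only: image_coset[OF assms] the_elem_eq)
  show ?lin
    by (rule linear_mapI)
       (auto simp: quotient_module_simps(1) coset_add coset_smult eq M linear_mapD[OF assms(2)])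
qed

end

section \<open>Tensor products\<close>

abbreviation (input) tensor_free where
  "tensor_free A B \<equiv> free_space (carrier A \<times> carrier B)"

lemma bilinear_rels_subset:
  assumes "vector_space_rec A" "vector_space_rec B"
  shows "bilinear_rels A B \<subseteq> carrier (tensor_free A B)"
  using assms unfolding bilinear_rels_def by (auto dest!: set_mp[OF keys_diff] split: if_splits)

lemma tensor_null_subspace:
  assumes "vector_space_rec A" "vector_space_rec B"
  shows "subspace_rec (tensor_free A B) (tensor_null A B)"
  unfolding tensor_null_def
  by (rule subspace_rec_hull[OF vs_free_space bilinear_rels_subset[OF assms]])

lemma vs_tensor_space [simp]:
  assumes "vector_space_rec A" "vector_space_rec B"
  shows "vector_space_rec (tensor_space A B)"
  unfolding tensor_space_def
  by (rule vs_quotient_module[OF vs_free_space tensor_null_subspace[OF assms]])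

text \<open>
  The kernel of \<open>f\<close> is a subspace, so it contains the span of the relations once it contains them.
\<close>

lemma tensor_null_kernel:
  fixes A :: "('k::field, 'a, 'm) module_scheme" and B :: "('k, 'b, 'n) module_scheme"
  assumes A: "vector_space_rec A" and B: "vector_space_rec B" and W: "vector_space_rec W"
    and f: "linear_map (tensor_free A B) W f"
    and rels: "\<And>r. r \<in> bilinear_rels A B \<Longrightarrow> f r = \<zero>\<^bsub>W\<^esub>"
    and "r \<in> tensor_null A B"
  shows "f r = \<zero>\<^bsub>W\<^esub>"
proof -
  have "tensor_null A B \<subseteq> {r \<in> carrier (tensor_free A B). f r = \<zero>\<^bsub>W\<^esub>}"
    unfolding tensor_null_def
    using rels bilinear_rels_subset[OF A B]
    by (intro hull_minimal linear_map_kernel[OF vs_free_space W f]) blast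
  then show ?thesis using assms(6) by blast
qed

lemma lin_extend_bilinear_null:
  fixes A :: "('k::field, 'a, 'm) module_scheme" and B :: "('k, 'b, 'n) module_scheme"
  assumes A: "vector_space_rec A" and B: "vector_space_rec B" and W: "vector_space_rec W"
    and \<beta>: "bilinear_map A B W \<beta>" and "r \<in> tensor_null A B"
  shows "lin_extend W (\<lambda>(a, b). \<beta> a b) r = \<zero>\<^bsub>W\<^esub>"
proof (rule tensor_null_kernel[OF A B W _ _ assms(5)])
  let ?F = "tensor_free A B :: ('k, 'a \<times> 'b \<Rightarrow>\<^sub>0 'k) module"
  let ?f = "lin_extend W (\<lambda>(a, b). \<beta> a b)"
  show lin: "linear_map ?F W ?f"
    using bilinear_mapD(3)[OF \<beta>] W by (intro linear_intros) auto
  have diff: "?f (u - v) = ?f u \<oplus>\<^bsub>W\<^esub> (- 1) \<odot>\<^bsub>W\<^esub> ?f v" if "u \<in> carrier ?F" "v \<in> carrier ?F" for u v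
  proof -
    have "u - v = u \<oplus>\<^bsub>?F\<^esub> (- 1) \<odot>\<^bsub>?F\<^esub> v"
      by (auto intro!: poly_mapping_eqI simp: lookup_add lookup_minus)
    then show ?thesis
      using that linear_mapD[OF lin] by (metis vs_closed(3) vs_free_space)
  qed
  fix r assume "r \<in> bilinear_rels A B"
  then show "?f r = \<zero>\<^bsub>W\<^esub>"
    unfolding bilinear_rels_def
  proof (elim UnE CollectE exE conjE)
    fix a a' b
    assume *: "r = basis_vec (a \<oplus>\<^bsub>A\<^esub> a', b) - basis_vec (a, b) - basis_vec (a', b)"
      "a \<in> carrier A" "a' \<in> carrier A" "b \<in> carrier B"
    have u: "basis_vec (a \<oplus>\<^bsub>A\<^esub> a', b) \<in> carrier ?F" "basis_vec (a, b) \<in> carrier ?F"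
      "basis_vec (a', b) \<in> carrier ?F" using * A by auto
    have "basis_vec (a \<oplus>\<^bsub>A\<^esub> a', b) - basis_vec (a, b) \<in> carrier ?F"
      using u by (auto dest!: set_mp[OF keys_diff] split: if_splits)
    with u * show ?thesis
      using W A linear_mapD[OF bilinear_mapD(2)[OF \<beta>, of b]]
      by (simp add: diff vs_add[OF W] vs_smult[OF W])
  next
    fix a b b'
    assume *: "r = basis_vec (a, b \<oplus>\<^bsub>B\<^esub> b') - basis_vec (a, b) - basis_vec (a, b')"
      "a \<in> carrier A" "b \<in> carrier B" "b' \<in> carrier B"
    have u: "basis_vec (a, b \<oplus>\<^bsub>B\<^esub> b') \<in> carrier ?F" "basis_vec (a, b) \<in> carrier ?F"
      "basis_vec (a, b') \<in> carrier ?F" using * B by auto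
    have "basis_vec (a, b \<oplus>\<^bsub>B\<^esub> b') - basis_vec (a, b) \<in> carrier ?F"
      using u by (auto dest!: set_mp[OF keys_diff] split: if_splits)
    with u * show ?thesis
      using W B linear_mapD[OF bilinear_mapD(1)[OF \<beta>, of a]]
      by (simp add: diff vs_add[OF W] vs_smult[OF W])
  next
    fix c a b
    assume *: "r = basis_vec (c \<odot>\<^bsub>A\<^esub> a, b) - Poly_Mapping.single (a, b) c"
      "a \<in> carrier A" "b \<in> carrier B"
    then show ?thesis
      using W A linear_mapD[OF bilinear_mapD(2)[OF \<beta>, of b]]
      by (simp add: diff lin_extend_single vs_smult)
  next
    fix c a b
    assume *: "r = basis_vec (a, c \<odot>\<^bsub>B\<^esub> b) - Poly_Mapping.single (a, b) c"
      "a \<in> carrier A" "b \<in> carrier B"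
    then show ?thesis
      using W B linear_mapD[OF bilinear_mapD(1)[OF \<beta>, of a]]
      by (simp add: diff lin_extend_single vs_smult)
  qed
qed

context
  fixes A :: "('k::field, 'a, 'm) module_scheme" and B :: "('k, 'b, 'n) module_scheme"
  assumes A: "vector_space_rec A" and B: "vector_space_rec B"
begin

lemma tensor_coset_eqI:
  assumes "u \<in> carrier (tensor_free A B)" "v \<in> carrier (tensor_free A B)" "u - v \<in> bilinear_rels A B"
  shows "tensor_null A B +>\<^bsub>tensor_free A B\<^esub> u = tensor_null A B +>\<^bsub>tensor_free A B\<^esub> v"
proof (rule coset_eqI[OF vs_free_space tensor_null_subspace[OF A B] assms(1,2)])
  have "u \<oplus>\<^bsub>tensor_free A B\<^esub> (- 1) \<odot>\<^bsub>tensor_free A B\<^esub> v = u - v"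
    by (auto intro!: poly_mapping_eqI simp: lookup_add lookup_minus)
  then show "u \<oplus>\<^bsub>tensor_free A B\<^esub> (- 1) \<odot>\<^bsub>tensor_free A B\<^esub> v \<in> tensor_null A B"
    using assms(3) hull_subset unfolding tensor_null_def by fastforce
qed

lemma pure_tensor_bilinear: "bilinear_map A B (tensor_space A B) (pure_tensor A B)"
proof -
  let ?F = "tensor_free A B :: ('k, 'a \<times> 'b \<Rightarrow>\<^sub>0 'k) module"
  let ?p = "\<lambda>v. tensor_null A B +>\<^bsub>?F\<^esub> v"
  note lin = quotient_map_linear[OF vs_free_space tensor_null_subspace[OF A B], folded tensor_space_def]
  have s: "\<And>c a b. (a, b) \<in> carrier A \<times> carrier B \<Longrightarrow>
      ?p (Poly_Mapping.single (a, b) c) = c \<odot>\<^bsub>tensor_space A B\<^esub> ?p (basis_vec (a, b))"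
    using linear_mapD(3)[OF lin, symmetric] by (simp add: map_single)
  have p: "\<And>a b a' b'. (a, b) \<in> carrier A \<times> carrier B \<Longrightarrow> (a', b') \<in> carrier A \<times> carrier B \<Longrightarrow>
      ?p (basis_vec (a, b) + basis_vec (a', b')) = ?p (basis_vec (a, b)) \<oplus>\<^bsub>tensor_space A B\<^esub> ?p (basis_vec (a', b'))"
    using linear_mapD(2)[OF lin] by simp
  have keys: "Poly_Mapping.keys (basis_vec z + basis_vec z') \<subseteq> S" if "z \<in> S" "z' \<in> S"
    for z z' :: "'a \<times> 'b" and S
    using that keys_add[of "basis_vec z" "basis_vec z'"] by auto
  show ?thesis
  proof (intro bilinear_mapI linear_mapI; unfold pure_tensor_def)
    fix a a' b assume *: "b \<in> carrier B" "a \<in> carrier A" "a' \<in> carrier A"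
    have "basis_vec (a \<oplus>\<^bsub>A\<^esub> a', b) - (basis_vec (a, b) + basis_vec (a', b)) \<in> bilinear_rels A B"
      unfolding bilinear_rels_def diff_diff_add[symmetric] using * by blast
    then show "?p (basis_vec (a \<oplus>\<^bsub>A\<^esub> a', b)) = ?p (basis_vec (a, b)) \<oplus>\<^bsub>tensor_space A B\<^esub> ?p (basis_vec (a', b))"
      using * by (subst p[symmetric]) (simp_all add: tensor_coset_eqI A keys)
  next
    fix a b b' assume *: "a \<in> carrier A" "b \<in> carrier B" "b' \<in> carrier B"
    have "basis_vec (a, b \<oplus>\<^bsub>B\<^esub> b') - (basis_vec (a, b) + basis_vec (a, b')) \<in> bilinear_rels A B"
      unfolding bilinear_rels_def diff_diff_add[symmetric] using * by blast
    then show "?p (basis_vec (a, b \<oplus>\<^bsub>B\<^esub> b')) = ?p (basis_vec (a, b)) \<oplus>\<^bsub>tensor_space A B\<^esub> ?p (basis_vec (a, b'))"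
      using * by (subst p[symmetric]) (simp_all add: tensor_coset_eqI B keys)
  next
    fix a b and c :: 'k assume *: "a \<in> carrier A" "b \<in> carrier B"
    have "basis_vec (c \<odot>\<^bsub>A\<^esub> a, b) - Poly_Mapping.single (a, b) c \<in> bilinear_rels A B"
      "basis_vec (a, c \<odot>\<^bsub>B\<^esub> b) - Poly_Mapping.single (a, b) c \<in> bilinear_rels A B"
      unfolding bilinear_rels_def using * by blast+
    then show "?p (basis_vec (c \<odot>\<^bsub>A\<^esub> a, b)) = c \<odot>\<^bsub>tensor_space A B\<^esub> ?p (basis_vec (a, b))"
      "?p (basis_vec (a, c \<odot>\<^bsub>B\<^esub> b)) = c \<odot>\<^bsub>tensor_space A B\<^esub> ?p (basis_vec (a, b))"
      using * by (simp_all add: s[symmetric] A B tensor_coset_eqI)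
  qed (use linear_mapD(1)[OF lin] in auto)
qed

lemma pure_tensor_closed [simp]:
  "a \<in> carrier A \<Longrightarrow> b \<in> carrier B \<Longrightarrow> pure_tensor A B a b \<in> carrier (tensor_space A B)"
  by (rule bilinear_mapD(3)[OF pure_tensor_bilinear])

lemma pure_tensor_simps:
  "a \<in> carrier A \<Longrightarrow> a' \<in> carrier A \<Longrightarrow> b \<in> carrier B \<Longrightarrow>
    pure_tensor A B (a \<oplus>\<^bsub>A\<^esub> a') b = pure_tensor A B a b \<oplus>\<^bsub>tensor_space A B\<^esub> pure_tensor A B a' b"
  "a \<in> carrier A \<Longrightarrow> b \<in> carrier B \<Longrightarrow> b' \<in> carrier B \<Longrightarrow>
    pure_tensor A B a (b \<oplus>\<^bsub>B\<^esub> b') = pure_tensor A B a b \<oplus>\<^bsub>tensor_space A B\<^esub> pure_tensor A B a b'"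
  "a \<in> carrier A \<Longrightarrow> b \<in> carrier B \<Longrightarrow>
    pure_tensor A B (c \<odot>\<^bsub>A\<^esub> a) b = c \<odot>\<^bsub>tensor_space A B\<^esub> pure_tensor A B a b"
  "a \<in> carrier A \<Longrightarrow> b \<in> carrier B \<Longrightarrow>
    pure_tensor A B a (c \<odot>\<^bsub>B\<^esub> b) = c \<odot>\<^bsub>tensor_space A B\<^esub> pure_tensor A B a b"
  "b \<in> carrier B \<Longrightarrow> pure_tensor A B \<zero>\<^bsub>A\<^esub> b = \<zero>\<^bsub>tensor_space A B\<^esub>"
  "a \<in> carrier A \<Longrightarrow> pure_tensor A B a \<zero>\<^bsub>B\<^esub> = \<zero>\<^bsub>tensor_space A B\<^esub>"
  using linear_mapD(2,3)[OF bilinear_mapD(1)[OF pure_tensor_bilinear]]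
    linear_mapD(2,3)[OF bilinear_mapD(2)[OF pure_tensor_bilinear]]
    linear_map_zero[OF _ _ bilinear_mapD(1)[OF pure_tensor_bilinear]]
    linear_map_zero[OF _ _ bilinear_mapD(2)[OF pure_tensor_bilinear]]
  by (auto simp: A B)

lemma linear_map_pure_tensor [linear_intros]:
  "a \<in> carrier A \<Longrightarrow> linear_map V B g \<Longrightarrow> linear_map V (tensor_space A B) (\<lambda>v. pure_tensor A B a (g v))"
  "b \<in> carrier B \<Longrightarrow> linear_map V A f \<Longrightarrow> linear_map V (tensor_space A B) (\<lambda>v. pure_tensor A B (f v) b)"
  by (rule linear_map_bilinear[OF pure_tensor_bilinear]; assumption)+

text \<open>
  Scalar multiples of pure tensors are pure, so every tensor is a plain sum of pure ones and the
  induction needs neither a zero nor a scaling case.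
\<close>

lemma tensor_induct [consumes 1, case_names pure add]:
  assumes T: "T \<in> carrier (tensor_space A B)"
    and pure: "\<And>a b. a \<in> carrier A \<Longrightarrow> b \<in> carrier B \<Longrightarrow> P (pure_tensor A B a b)"
    and add: "\<And>S T. S \<in> carrier (tensor_space A B) \<Longrightarrow> T \<in> carrier (tensor_space A B) \<Longrightarrow>
           P S \<Longrightarrow> P T \<Longrightarrow> P (S \<oplus>\<^bsub>tensor_space A B\<^esub> T)"
  shows "P T"
proof -
  let ?F = "tensor_free A B :: ('k, 'a \<times> 'b \<Rightarrow>\<^sub>0 'k) module"
  let ?p = "\<lambda>v. tensor_null A B +>\<^bsub>?F\<^esub> v"
  note lin = quotient_map_linear[OF vs_free_space tensor_null_subspace[OF A B], folded tensor_space_def]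
  obtain v where v: "v \<in> carrier ?F" "T = ?p v"
    using T by (auto simp: tensor_space_def quotient_module_simps(1))
  from v(1) have "P (?p v)"
  proof (induction v rule: free_space_induct)
    case zero
    have "?p 0 = \<zero>\<^bsub>tensor_space A B\<^esub>" using linear_map_zero[OF vs_free_space _ lin] A B by simp
    then show ?case using pure[of "\<zero>\<^bsub>A\<^esub>" "\<zero>\<^bsub>B\<^esub>"] A B by (simp add: pure_tensor_simps)
  next
    case (single z c)
    obtain a b where z: "z = (a, b)" by (cases z)
    have "?p (Poly_Mapping.single z c) = c \<odot>\<^bsub>tensor_space A B\<^esub> ?p (basis_vec z)"
      using linear_mapD(3)[OF lin, of "basis_vec z" c] single by (simp add: map_single)
    also have "\<dots> = pure_tensor A B (c \<odot>\<^bsub>A\<^esub> a) b"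
      using single z by (simp add: pure_tensor_simps) (simp add: pure_tensor_def)
    finally show ?case using pure[of "c \<odot>\<^bsub>A\<^esub> a" b] single z A by auto
  next
    case (add v w)
    then show ?case using linear_mapD(1,2)[OF lin] assms(3)[of "?p v" "?p w"] by simp
  qed
  then show ?thesis using v by simp
qed

lemma linear_map_tensor_eq:
  assumes "linear_map (tensor_space A B) W f" "linear_map (tensor_space A B) W g"
    and "\<And>a b. a \<in> carrier A \<Longrightarrow> b \<in> carrier B \<Longrightarrow> f (pure_tensor A B a b) = g (pure_tensor A B a b)"
    and "T \<in> carrier (tensor_space A B)"
  shows "f T = g T"
  using assms(4)
  by (induction T rule: tensor_induct) (auto simp: assms(3) linear_mapD[OF assms(1)] linear_mapD[OF assms(2)])

lemma tensor_lift_coset: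
  assumes W: "vector_space_rec W" and \<beta>: "bilinear_map A B W \<beta>" and v: "v \<in> carrier (tensor_free A B)"
  shows "tensor_lift W \<beta> (tensor_null A B +>\<^bsub>tensor_free A B\<^esub> v) = lin_extend W (\<lambda>(a, b). \<beta> a b) v"
  unfolding tensor_lift_def
  using bilinear_mapD(3)[OF \<beta>] lin_extend_bilinear_null[OF A B W \<beta>]
  by (intro quotient_factor_linear(2)[OF vs_free_space tensor_null_subspace[OF A B] W _ _ v])
     (auto intro!: linear_intros W)

lemma tensor_lift_linear:
  assumes W: "vector_space_rec W" and \<beta>: "bilinear_map A B W \<beta>"
  shows "linear_map (tensor_space A B) W (tensor_lift W \<beta>)"
  unfolding tensor_lift_def tensor_space_def
  using bilinear_mapD(3)[OF \<beta>] lin_extend_bilinear_null[OF A B W \<beta>]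
  by (intro quotient_factor_linear(1)[OF vs_free_space tensor_null_subspace[OF A B] W])
     (auto intro!: linear_intros W)

lemma tensor_lift_closed:
  assumes W: "vector_space_rec W" and \<beta>: "bilinear_map A B W \<beta>" and "T \<in> carrier (tensor_space A B)"
  shows "tensor_lift W \<beta> T \<in> carrier W"
  using linear_mapD(1)[OF tensor_lift_linear[OF W \<beta>]] assms(3) .

lemma tensor_lift_pure:
  assumes W: "vector_space_rec W" and \<beta>: "bilinear_map A B W \<beta>" and "a \<in> carrier A" "b \<in> carrier B"
  shows "tensor_lift W \<beta> (pure_tensor A B a b) = \<beta> a b"
  unfolding pure_tensor_def using assms bilinear_mapD(3)[OF \<beta>]
  by (subst tensor_lift_coset[OF W \<beta>]) auto

lemma tensor_lift_cong:
  assumes W: "vector_space_rec W" and \<beta>: "bilinear_map A B W \<beta>" and T: "T \<in> carrier (tensor_space A B)"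
    and eq: "\<And>a b. a \<in> carrier A \<Longrightarrow> b \<in> carrier B \<Longrightarrow> \<beta> a b = \<gamma> a b"
  shows "tensor_lift W \<beta> T = tensor_lift W \<gamma> T"
proof -
  have \<gamma>: "bilinear_map A B W \<gamma>"
    using \<beta> eq
    by (auto simp: bilinear_map_def intro: linear_map_cong[OF A, where f = "\<lambda>a. \<beta> a b" for b]
        linear_map_cong[OF B, where f = "\<beta> a" for a])
  show ?thesis
    by (rule linear_map_tensor_eq[OF tensor_lift_linear[OF W \<beta>] tensor_lift_linear[OF W \<gamma>] _ T])
       (simp add: tensor_lift_pure W \<beta> \<gamma> eq)
qed

lemma linear_tensor_lift:
  assumes W: "vector_space_rec W" and U: "vector_space_rec U" and \<beta>: "bilinear_map A B W \<beta>"
    and g: "linear_map W U g" and T: "T \<in> carrier (tensor_space A B)"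
  shows "g (tensor_lift W \<beta> T) = tensor_lift U (\<lambda>a b. g (\<beta> a b)) T"
proof -
  have \<gamma>: "bilinear_map A B U (\<lambda>a b. g (\<beta> a b))"
    using \<beta> by (auto simp: bilinear_map_def intro: linear_map_comp[OF g])
  show ?thesis
    by (rule linear_map_tensor_eq[OF linear_map_comp[OF g tensor_lift_linear[OF W \<beta>]] tensor_lift_linear[OF U \<gamma>] _ T])
       (simp add: tensor_lift_pure W U \<beta> \<gamma>)
qed

lemma tensor_lift_id:
  assumes T: "T \<in> carrier (tensor_space A B)"
  shows "tensor_lift (tensor_space A B) (pure_tensor A B) T = T"
  by (rule linear_map_tensor_eq[OF tensor_lift_linear[OF _ pure_tensor_bilinear] linear_map_id _ T])
     (simp_all add: A B tensor_lift_pure[OF _ pure_tensor_bilinear])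

text \<open>
  Linear dependence through the bilinear map, for a fixed tensor; together with linear dependence
  through the tensor this covers all nested Sweedler sums.
\<close>

lemma linear_map_tensor_lift_fun:
  assumes T: "T \<in> carrier (tensor_space A B)" and W: "vector_space_rec W" and V: "vector_space_rec V"
    and \<beta>: "\<And>v. v \<in> carrier V \<Longrightarrow> bilinear_map A B W (\<beta> v)"
    and lin: "\<And>a b. a \<in> carrier A \<Longrightarrow> b \<in> carrier B \<Longrightarrow> linear_map V W (\<lambda>v. \<beta> v a b)"
  shows "linear_map V W (\<lambda>v. tensor_lift W (\<beta> v) T)"
proof (rule linear_mapI)
  note tl = tensor_lift_linear[OF W \<beta>]
  fix x y c assume x: "x \<in> carrier V"
  show "tensor_lift W (\<beta> x) T \<in> carrier W" by (rule tensor_lift_closed[OF W \<beta>[OF x] T])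
  have cx: "c \<odot>\<^bsub>V\<^esub> x \<in> carrier V" using x V by simp
  show "tensor_lift W (\<beta> (c \<odot>\<^bsub>V\<^esub> x)) T = c \<odot>\<^bsub>W\<^esub> tensor_lift W (\<beta> x) T"
    by (rule linear_map_tensor_eq[OF tl[OF cx] linear_map_smult[OF W tl[OF x]] _ T])
       (simp add: tensor_lift_pure[OF W \<beta>] x cx linear_mapD(3)[OF lin])
  assume y: "y \<in> carrier V"
  have xy: "x \<oplus>\<^bsub>V\<^esub> y \<in> carrier V" using x y V by simp
  show "tensor_lift W (\<beta> (x \<oplus>\<^bsub>V\<^esub> y)) T = tensor_lift W (\<beta> x) T \<oplus>\<^bsub>W\<^esub> tensor_lift W (\<beta> y) T"
    by (rule linear_map_tensor_eq[OF tl[OF xy] linear_map_add[OF W tl[OF x] tl[OF y]] _ T])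
       (simp add: tensor_lift_pure[OF W \<beta>] x y xy linear_mapD(2)[OF lin])
qed

end

lemma linear_map_tensor_lift [linear_intros]:
  assumes "linear_map V (tensor_space A B) f" "vector_space_rec A" "vector_space_rec B"
    "vector_space_rec W" "bilinear_map A B W \<beta>"
  shows "linear_map V W (\<lambda>v. tensor_lift W \<beta> (f v))"
  using linear_map_comp[OF tensor_lift_linear[OF assms(2-5)] assms(1)] .

section \<open>Algebras and their tensor products\<close>

lemma assoc_algebraI:
  fixes A :: "('k::field, 'a, 'm) module_scheme"
  assumes vs: "vector_space_rec A" and bil: "bilinear_map A A A (\<otimes>\<^bsub>A\<^esub>)"
    and one: "\<one>\<^bsub>A\<^esub> \<in> carrier A" "\<And>x. x \<in> carrier A \<Longrightarrow> \<one>\<^bsub>A\<^esub> \<otimes>\<^bsub>A\<^esub> x = x"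
      "\<And>x. x \<in> carrier A \<Longrightarrow> x \<otimes>\<^bsub>A\<^esub> \<one>\<^bsub>A\<^esub> = x"
    and assoc: "\<And>x y z. x \<in> carrier A \<Longrightarrow> y \<in> carrier A \<Longrightarrow> z \<in> carrier A \<Longrightarrow>
      x \<otimes>\<^bsub>A\<^esub> y \<otimes>\<^bsub>A\<^esub> z = x \<otimes>\<^bsub>A\<^esub> (y \<otimes>\<^bsub>A\<^esub> z)"
  shows "assoc_algebra A"
proof -
  note L = linear_mapD[OF bilinear_mapD(1)[OF bil]] and R = linear_mapD[OF bilinear_mapD(2)[OF bil]]
  have "ring A"
    by (intro ringI monoidI vs_abelian_group[OF vs]) (simp_all add: one assoc L R)
  then show ?thesis using vs L(3) R(3) by (simp add: assoc_algebra_def)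
qed

context
  fixes A :: "('k::field, 'a, 'm) module_scheme"
  assumes A: "assoc_algebra A"
begin

lemma algebra_vs [simp]: "vector_space_rec A" and algebra_ring: "ring A"
  using A by (simp_all add: assoc_algebra_def)

lemma algebra_mult_closed [simp]: "x \<in> carrier A \<Longrightarrow> y \<in> carrier A \<Longrightarrow> x \<otimes>\<^bsub>A\<^esub> y \<in> carrier A"
  and algebra_one_closed [simp]: "\<one>\<^bsub>A\<^esub> \<in> carrier A"
  and algebra_one [simp]: "x \<in> carrier A \<Longrightarrow> \<one>\<^bsub>A\<^esub> \<otimes>\<^bsub>A\<^esub> x = x" "x \<in> carrier A \<Longrightarrow> x \<otimes>\<^bsub>A\<^esub> \<one>\<^bsub>A\<^esub> = x"
  and algebra_assoc: "x \<in> carrier A \<Longrightarrow> y \<in> carrier A \<Longrightarrow> z \<in> carrier A \<Longrightarrow>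
    x \<otimes>\<^bsub>A\<^esub> y \<otimes>\<^bsub>A\<^esub> z = x \<otimes>\<^bsub>A\<^esub> (y \<otimes>\<^bsub>A\<^esub> z)"
  and algebra_null [simp]: "x \<in> carrier A \<Longrightarrow> \<zero>\<^bsub>A\<^esub> \<otimes>\<^bsub>A\<^esub> x = \<zero>\<^bsub>A\<^esub>" "x \<in> carrier A \<Longrightarrow> x \<otimes>\<^bsub>A\<^esub> \<zero>\<^bsub>A\<^esub> = \<zero>\<^bsub>A\<^esub>"
proof -
  interpret ring A by (rule algebra_ring)
  show "x \<in> carrier A \<Longrightarrow> y \<in> carrier A \<Longrightarrow> x \<otimes>\<^bsub>A\<^esub> y \<in> carrier A" "\<one>\<^bsub>A\<^esub> \<in> carrier A"
    "x \<in> carrier A \<Longrightarrow> \<one>\<^bsub>A\<^esub> \<otimes>\<^bsub>A\<^esub> x = x" "x \<in> carrier A \<Longrightarrow> x \<otimes>\<^bsub>A\<^esub> \<one>\<^bsub>A\<^esub> = x"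
    "x \<in> carrier A \<Longrightarrow> y \<in> carrier A \<Longrightarrow> z \<in> carrier A \<Longrightarrow> x \<otimes>\<^bsub>A\<^esub> y \<otimes>\<^bsub>A\<^esub> z = x \<otimes>\<^bsub>A\<^esub> (y \<otimes>\<^bsub>A\<^esub> z)"
    "x \<in> carrier A \<Longrightarrow> \<zero>\<^bsub>A\<^esub> \<otimes>\<^bsub>A\<^esub> x = \<zero>\<^bsub>A\<^esub>" "x \<in> carrier A \<Longrightarrow> x \<otimes>\<^bsub>A\<^esub> \<zero>\<^bsub>A\<^esub> = \<zero>\<^bsub>A\<^esub>"
    by (auto simp: m_assoc)
qed

lemma algebra_smult:
  "x \<in> carrier A \<Longrightarrow> y \<in> carrier A \<Longrightarrow> (c \<odot>\<^bsub>A\<^esub> x) \<otimes>\<^bsub>A\<^esub> y = c \<odot>\<^bsub>A\<^esub> (x \<otimes>\<^bsub>A\<^esub> y)"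
  "x \<in> carrier A \<Longrightarrow> y \<in> carrier A \<Longrightarrow> x \<otimes>\<^bsub>A\<^esub> (c \<odot>\<^bsub>A\<^esub> y) = c \<odot>\<^bsub>A\<^esub> (x \<otimes>\<^bsub>A\<^esub> y)"
  using A by (simp_all add: assoc_algebra_def)

lemma algebra_mult_bilinear: "bilinear_map A A A (\<otimes>\<^bsub>A\<^esub>)"
proof -
  interpret ring A by (rule algebra_ring)
  show ?thesis by (intro bilinear_mapI linear_mapI) (auto simp: l_distr r_distr algebra_smult)
qed

lemma linear_map_mult [linear_intros]:
  "a \<in> carrier A \<Longrightarrow> linear_map V A g \<Longrightarrow> linear_map V A (\<lambda>v. a \<otimes>\<^bsub>A\<^esub> g v)"
  "b \<in> carrier A \<Longrightarrow> linear_map V A f \<Longrightarrow> linear_map V A (\<lambda>v. f v \<otimes>\<^bsub>A\<^esub> b)"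
  by (rule linear_map_bilinear[OF algebra_mult_bilinear]; assumption)+

end

lemma tensor_algebra_simps [simp]:
  "carrier (tensor_algebra A B) = carrier (tensor_space A B)"
  "\<zero>\<^bsub>tensor_algebra A B\<^esub> = \<zero>\<^bsub>tensor_space A B\<^esub>"
  "S \<oplus>\<^bsub>tensor_algebra A B\<^esub> T = S \<oplus>\<^bsub>tensor_space A B\<^esub> T"
  "c \<odot>\<^bsub>tensor_algebra A B\<^esub> T = c \<odot>\<^bsub>tensor_space A B\<^esub> T"
  "\<one>\<^bsub>tensor_algebra A B\<^esub> = pure_tensor A B \<one>\<^bsub>A\<^esub> \<one>\<^bsub>B\<^esub>"
  by (simp_all add: tensor_algebra_def)

lemma linear_map_tensor_algebra [simp]:
  "linear_map V (tensor_algebra A B) f \<longleftrightarrow> linear_map V (tensor_space A B) f"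
  "linear_map (tensor_algebra A B) W g \<longleftrightarrow> linear_map (tensor_space A B) W g"
  by (simp_all add: linear_map_def)

lemma vs_tensor_algebra [simp]:
  assumes "vector_space_rec A" "vector_space_rec B"
  shows "vector_space_rec (tensor_algebra A B)"
  using vs_tensor_space[OF assms] assms
  by (intro vector_space_recI) (simp_all add: vs_add vs_smult)

lemma tensor_lift_tensor_algebra [simp]:
  "tensor_lift (tensor_algebra A B) = tensor_lift (tensor_space A B)"
  by (simp add: tensor_lift_def[abs_def] lin_extend_def[abs_def] finsum_def tensor_algebra_def
      del: tensor_algebra_simps)

lemma tensor_algebra_mult_eq:
  "S \<otimes>\<^bsub>tensor_algebra A B\<^esub> T = tensor_lift (tensor_space A B) (\<lambda>a b.
     tensor_lift (tensor_space A B) (\<lambda>a' b'. pure_tensor A B (a \<otimes>\<^bsub>A\<^esub> a') (b \<otimes>\<^bsub>B\<^esub> b')) T) S"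
  by (simp add: tensor_algebra_def)

context
  fixes A :: "('k::field, 'a, 'm) module_scheme" and B :: "('k, 'b, 'n) module_scheme"
  assumes A: "assoc_algebra A" and B: "assoc_algebra B"
begin

lemma tensor_mult_inner_bilinear:
  assumes "a \<in> carrier A" "b \<in> carrier B"
  shows "bilinear_map A B (tensor_space A B) (\<lambda>a' b'. pure_tensor A B (a \<otimes>\<^bsub>A\<^esub> a') (b \<otimes>\<^bsub>B\<^esub> b'))"
  using assms by (intro bilinear_mapI linear_intros) (simp_all add: A B)

lemma tensor_mult_outer_bilinear:
  assumes "T \<in> carrier (tensor_space A B)"
  shows "bilinear_map A B (tensor_space A B) (\<lambda>a b.
     tensor_lift (tensor_space A B) (\<lambda>a' b'. pure_tensor A B (a \<otimes>\<^bsub>A\<^esub> a') (b \<otimes>\<^bsub>B\<^esub> b')) T)"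
  using assms
  by (intro bilinear_mapI linear_map_tensor_lift_fun[of A B] tensor_mult_inner_bilinear linear_intros)
     (simp_all add: A B)

lemma tensor_mult_bilinear:
  "bilinear_map (tensor_space A B) (tensor_space A B) (tensor_space A B) (\<otimes>\<^bsub>tensor_algebra A B\<^esub>)"
proof (rule bilinear_mapI)
  fix S assume S: "S \<in> carrier (tensor_space A B)"
  show "linear_map (tensor_space A B) (tensor_space A B) ((\<otimes>\<^bsub>tensor_algebra A B\<^esub>) S)"
    unfolding tensor_algebra_mult_eq
    by (rule linear_map_tensor_lift_fun[OF _ _ S])
       (auto simp: A B intro!: tensor_mult_outer_bilinear tensor_lift_linear tensor_mult_inner_bilinear)
next
  fix T assume T: "T \<in> carrier (tensor_space A B)"
  show "linear_map (tensor_space A B) (tensor_space A B) (\<lambda>S. S \<otimes>\<^bsub>tensor_algebra A B\<^esub> T)"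
    unfolding tensor_algebra_mult_eq
    by (rule tensor_lift_linear[OF _ _ _ tensor_mult_outer_bilinear[OF T]]) (simp_all add: A B)
qed

lemma tensor_mult_pure [simp]:
  assumes "a \<in> carrier A" "b \<in> carrier B" "a' \<in> carrier A" "b' \<in> carrier B"
  shows "pure_tensor A B a b \<otimes>\<^bsub>tensor_algebra A B\<^esub> pure_tensor A B a' b'
    = pure_tensor A B (a \<otimes>\<^bsub>A\<^esub> a') (b \<otimes>\<^bsub>B\<^esub> b')"
  unfolding tensor_algebra_mult_eq using assms
  by (simp add: A B tensor_lift_pure[OF _ _ _ tensor_mult_outer_bilinear]
      tensor_lift_pure[OF _ _ _ tensor_mult_inner_bilinear])

text \<open>
  Each side of the associative law is linear in each of its three arguments, so pure tensors suffice.
\<close>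

lemma tensor_algebra_assoc: "assoc_algebra (tensor_algebra A B)"
proof (rule assoc_algebraI)
  note TL = linear_mapD[OF bilinear_mapD(1)[OF tensor_mult_bilinear]]
    and TR = linear_mapD[OF bilinear_mapD(2)[OF tensor_mult_bilinear]]
  have vs[simp]: "vector_space_rec A" "vector_space_rec B" using A B by simp_all
  show "bilinear_map (tensor_algebra A B) (tensor_algebra A B) (tensor_algebra A B) (\<otimes>\<^bsub>tensor_algebra A B\<^esub>)"
    using tensor_mult_bilinear by (simp add: bilinear_map_def)
  show "\<one>\<^bsub>tensor_algebra A B\<^esub> \<otimes>\<^bsub>tensor_algebra A B\<^esub> S = S" "S \<otimes>\<^bsub>tensor_algebra A B\<^esub> \<one>\<^bsub>tensor_algebra A B\<^esub> = S"
    if "S \<in> carrier (tensor_algebra A B)" for S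
    using that unfolding tensor_algebra_simps
    by (induction S rule: tensor_induct[OF vs, consumes 1, case_names pure add]) (simp_all add: A B TL(2) TR(2))
  show "R \<otimes>\<^bsub>tensor_algebra A B\<^esub> S \<otimes>\<^bsub>tensor_algebra A B\<^esub> T = R \<otimes>\<^bsub>tensor_algebra A B\<^esub> (S \<otimes>\<^bsub>tensor_algebra A B\<^esub> T)"
    if RST: "R \<in> carrier (tensor_algebra A B)" "S \<in> carrier (tensor_algebra A B)"
      "T \<in> carrier (tensor_algebra A B)" for R S T
  proof -
    note T = RST(3)[unfolded tensor_algebra_simps]
    note S = RST(2)[unfolded tensor_algebra_simps]
    note R = RST(1)[unfolded tensor_algebra_simps]
    have 1: "pure_tensor A B a b \<otimes>\<^bsub>tensor_algebra A B\<^esub> pure_tensor A B a' b' \<otimes>\<^bsub>tensor_algebra A B\<^esub> T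
      = pure_tensor A B a b \<otimes>\<^bsub>tensor_algebra A B\<^esub> (pure_tensor A B a' b' \<otimes>\<^bsub>tensor_algebra A B\<^esub> T)"
      if "a \<in> carrier A" "b \<in> carrier B" "a' \<in> carrier A" "b' \<in> carrier B" for a b a' b'
      using T that
      by (induction T rule: tensor_induct[OF vs, consumes 1, case_names pure add]) (simp_all add: A B TL(1,2) algebra_assoc)
    have 2: "pure_tensor A B a b \<otimes>\<^bsub>tensor_algebra A B\<^esub> S \<otimes>\<^bsub>tensor_algebra A B\<^esub> T
      = pure_tensor A B a b \<otimes>\<^bsub>tensor_algebra A B\<^esub> (S \<otimes>\<^bsub>tensor_algebra A B\<^esub> T)"
      if ab: "a \<in> carrier A" "b \<in> carrier B" for a b
      using S
    proof (induction S rule: tensor_induct[OF vs, consumes 1, case_names pure add])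
      case (pure a' b') then show ?case using 1 ab by simp
    next
      case (add S S') then show ?case using T ab by (simp add: TL(1,2) TR(2))
    qed
    show ?thesis
      using R
    proof (induction R rule: tensor_induct[OF vs, consumes 1, case_names pure add])
      case (pure a' b') then show ?case using 2 by simp
    next
      case (add R R') then show ?case using T S by (simp add: TL(1,2) TR(2))
    qed
  qed
qed (simp_all add: A B)

lemma tensor_lift_mult:
  assumes W: "vector_space_rec W" and \<beta>: "bilinear_map A B W \<beta>"
    and S: "S \<in> carrier (tensor_space A B)" and T: "T \<in> carrier (tensor_space A B)"
  shows "tensor_lift W \<beta> (S \<otimes>\<^bsub>tensor_algebra A B\<^esub> T) =
    tensor_lift W (\<lambda>a b. tensor_lift W (\<lambda>a' b'. \<beta> (a \<otimes>\<^bsub>A\<^esub> a') (b \<otimes>\<^bsub>B\<^esub> b')) T) S"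
proof -
  have vs[simp]: "vector_space_rec A" "vector_space_rec B" using A B by simp_all
  have "tensor_lift W \<beta> (S \<otimes>\<^bsub>tensor_algebra A B\<^esub> T) =
    tensor_lift W (\<lambda>a b. tensor_lift W \<beta> (tensor_lift (tensor_space A B)
      (\<lambda>a' b'. pure_tensor A B (a \<otimes>\<^bsub>A\<^esub> a') (b \<otimes>\<^bsub>B\<^esub> b')) T)) S"
    unfolding tensor_algebra_mult_eq
    by (rule linear_tensor_lift[OF vs _ W tensor_mult_outer_bilinear[OF T] tensor_lift_linear[OF vs W \<beta>] S]) simp
  also have "\<dots> = tensor_lift W (\<lambda>a b. tensor_lift W (\<lambda>a' b'. \<beta> (a \<otimes>\<^bsub>A\<^esub> a') (b \<otimes>\<^bsub>B\<^esub> b')) T) S"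
  proof (rule tensor_lift_cong[OF vs W _ S])
    show "bilinear_map A B W (\<lambda>a b. tensor_lift W \<beta> (tensor_lift (tensor_space A B)
      (\<lambda>a' b'. pure_tensor A B (a \<otimes>\<^bsub>A\<^esub> a') (b \<otimes>\<^bsub>B\<^esub> b')) T))"
      using tensor_mult_outer_bilinear[OF T]
      by (auto simp: bilinear_map_def intro: linear_map_comp[OF tensor_lift_linear[OF vs W \<beta>]])
    fix a b assume ab: "a \<in> carrier A" "b \<in> carrier B"
    have "tensor_lift W \<beta> (tensor_lift (tensor_space A B)
      (\<lambda>a' b'. pure_tensor A B (a \<otimes>\<^bsub>A\<^esub> a') (b \<otimes>\<^bsub>B\<^esub> b')) T) =
      tensor_lift W (\<lambda>a' b'. tensor_lift W \<beta> (pure_tensor A B (a \<otimes>\<^bsub>A\<^esub> a') (b \<otimes>\<^bsub>B\<^esub> b'))) T"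
      by (rule linear_tensor_lift[OF vs _ W tensor_mult_inner_bilinear[OF ab] tensor_lift_linear[OF vs W \<beta>] T]) simp
    also have "\<dots> = tensor_lift W (\<lambda>a' b'. \<beta> (a \<otimes>\<^bsub>A\<^esub> a') (b \<otimes>\<^bsub>B\<^esub> b')) T"
    proof (rule tensor_lift_cong[OF vs W _ T])
      show "bilinear_map A B W (\<lambda>a' b'. tensor_lift W \<beta> (pure_tensor A B (a \<otimes>\<^bsub>A\<^esub> a') (b \<otimes>\<^bsub>B\<^esub> b')))"
        using tensor_mult_inner_bilinear[OF ab]
        by (auto simp: bilinear_map_def intro: linear_map_comp[OF tensor_lift_linear[OF vs W \<beta>]])
    qed (use ab in \<open>simp add: tensor_lift_pure[OF vs W \<beta>] A B\<close>)
    finally show "tensor_lift W \<beta> (tensor_lift (tensor_space A B)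
      (\<lambda>a' b'. pure_tensor A B (a \<otimes>\<^bsub>A\<^esub> a') (b \<otimes>\<^bsub>B\<^esub> b')) T) =
      tensor_lift W (\<lambda>a' b'. \<beta> (a \<otimes>\<^bsub>A\<^esub> a') (b \<otimes>\<^bsub>B\<^esub> b')) T" .
  qed
  finally show ?thesis .
qed

end

text \<open>
  Both sides are linear in \<open>T\<close> and agree on pure tensors.
\<close>

lemma tensor_lift_swap:
  assumes A: "vector_space_rec A" and B: "vector_space_rec B" and C: "vector_space_rec C"
    and D: "vector_space_rec D" and W: "vector_space_rec W"
    and S: "S \<in> carrier (tensor_space A B)" and T: "T \<in> carrier (tensor_space C D)"
    and ab: "\<And>c d. c \<in> carrier C \<Longrightarrow> d \<in> carrier D \<Longrightarrow> bilinear_map A B W (\<lambda>a b. \<tau> a b c d)"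
    and cd: "\<And>a b. a \<in> carrier A \<Longrightarrow> b \<in> carrier B \<Longrightarrow> bilinear_map C D W (\<tau> a b)"
  shows "tensor_lift W (\<lambda>a b. tensor_lift W (\<tau> a b) T) S =
    tensor_lift W (\<lambda>c d. tensor_lift W (\<lambda>a b. \<tau> a b c d) S) T"
proof -
  have o1: "bilinear_map A B W (\<lambda>a b. tensor_lift W (\<tau> a b) T)" if "T \<in> carrier (tensor_space C D)" for T
    using that by (intro bilinear_mapI linear_map_tensor_lift_fun[OF C D])
      (auto simp: A B W cd intro: bilinear_mapD(1,2)[OF ab] bilinear_mapD(1,2)[OF cd])
  have o2: "bilinear_map C D W (\<lambda>c d. tensor_lift W (\<lambda>a b. \<tau> a b c d) S)"
    using S by (intro bilinear_mapI linear_map_tensor_lift_fun[OF A B])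
      (auto simp: C D W ab intro: bilinear_mapD(1,2)[OF ab] bilinear_mapD(1,2)[OF cd])
  have "linear_map (tensor_space C D) W (\<lambda>T. tensor_lift W (\<lambda>a b. tensor_lift W (\<tau> a b) T) S)"
    by (rule linear_map_tensor_lift_fun[OF A B S W]) (simp_all add: C D o1 tensor_lift_linear W cd)
  then show ?thesis
  proof (rule linear_map_tensor_eq[OF C D _ tensor_lift_linear[OF C D W o2] _ T])
    fix c d assume c: "c \<in> carrier C" "d \<in> carrier D"
    have "tensor_lift W (\<lambda>a b. tensor_lift W (\<tau> a b) (pure_tensor C D c d)) S
      = tensor_lift W (\<lambda>a b. \<tau> a b c d) S"
      using c by (intro tensor_lift_cong[OF A B W o1 S]) (simp_all add: C D tensor_lift_pure W cd)
    then show "tensor_lift W (\<lambda>a b. tensor_lift W (\<tau> a b) (pure_tensor C D c d)) S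
      = tensor_lift W (\<lambda>c d. tensor_lift W (\<lambda>a b. \<tau> a b c d) S) (pure_tensor C D c d)"
      using c by (simp add: tensor_lift_pure[OF C D W o2])
  qed
qed

section \<open>Sweedler calculus and the antipode\<close>

text \<open>
  \<open>tensor_lift W \<beta> (comult H h)\<close> is the Sweedler sum \<open>\<Sum> \<beta> h\<^sub>1 h\<^sub>2\<close> with values in \<open>W\<close>.  The axioms of a
  Hopf algebra become rewriting rules for such sums, for arbitrary multilinear arguments.
\<close>

context
  fixes H :: "('k::field, 'a) hopf"
  assumes H: "hopf_algebra H"
begin

lemma hopf_assoc_algebra [simp]: "assoc_algebra H" "assoc_algebra (tensor_algebra H H)"
  using H tensor_algebra_assoc[of H H] by (simp_all add: hopf_algebra_def)

lemma hopf_vs [simp]: "vector_space_rec H"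
  by simp

lemma comult_linear: "linear_map H (tensor_space H H) (comult H)"
  and comult_mult: "x \<in> carrier H \<Longrightarrow> y \<in> carrier H \<Longrightarrow>
    comult H (x \<otimes>\<^bsub>H\<^esub> y) = comult H x \<otimes>\<^bsub>tensor_algebra H H\<^esub> comult H y"
  and comult_one: "comult H \<one>\<^bsub>H\<^esub> = pure_tensor H H \<one>\<^bsub>H\<^esub> \<one>\<^bsub>H\<^esub>"
  and counit_linear: "linear_map H scalars (counit H)"
  and counit_mult: "x \<in> carrier H \<Longrightarrow> y \<in> carrier H \<Longrightarrow> counit H (x \<otimes>\<^bsub>H\<^esub> y) = counit H x * counit H y"
  and counit_one: "counit H \<one>\<^bsub>H\<^esub> = 1"
  and antipode_linear: "linear_map H H (antipode H)"
  using H by (auto simp: hopf_algebra_def alg_hom_def dest: ring_hom_mult ring_hom_one)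

lemma hopf_closed [simp]:
  "x \<in> carrier H \<Longrightarrow> comult H x \<in> carrier (tensor_space H H)"
  "x \<in> carrier H \<Longrightarrow> antipode H x \<in> carrier H"
  using linear_mapD(1)[OF comult_linear] linear_mapD(1)[OF antipode_linear] by auto

lemma linear_map_hopf [linear_intros]:
  "linear_map V H f \<Longrightarrow> linear_map V (tensor_space H H) (\<lambda>v. comult H (f v))"
  "linear_map V H f \<Longrightarrow> linear_map V scalars (\<lambda>v. counit H (f v))"
  "linear_map V H f \<Longrightarrow> linear_map V H (\<lambda>v. antipode H (f v))"
  using linear_map_comp[OF comult_linear] linear_map_comp[OF counit_linear]
    linear_map_comp[OF antipode_linear] by auto

lemma linear_map_sweedler_arg [linear_intros]:
  assumes "linear_map V H f" "vector_space_rec W" "bilinear_map H H W \<beta>"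
  shows "linear_map V W (\<lambda>v. tensor_lift W \<beta> (comult H (f v)))"
  using assms by (intro linear_map_tensor_lift[where A = H and B = H] linear_map_hopf) simp_all

lemma linear_map_sweedler_fun [linear_intros]:
  assumes "x \<in> carrier H" "vector_space_rec W" "vector_space_rec V"
    "\<And>v. v \<in> carrier V \<Longrightarrow> bilinear_map H H W (\<beta> v)"
    "\<And>a b. a \<in> carrier H \<Longrightarrow> b \<in> carrier H \<Longrightarrow> linear_map V W (\<lambda>v. \<beta> v a b)"
  shows "linear_map V W (\<lambda>v. tensor_lift W (\<beta> v) (comult H x))"
  using assms by (intro linear_map_tensor_lift_fun[where A = H and B = H]) simp_all

lemma sweedler_cong:
  assumes "vector_space_rec W" "bilinear_map H H W \<beta>" "h \<in> carrier H"
    "\<And>a b. a \<in> carrier H \<Longrightarrow> b \<in> carrier H \<Longrightarrow> \<beta> a b = \<gamma> a b"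
  shows "tensor_lift W \<beta> (comult H h) = tensor_lift W \<gamma> (comult H h)"
  using assms by (intro tensor_lift_cong[where A = H and B = H]) simp_all

lemma sweedler_linear:
  assumes "vector_space_rec W" "vector_space_rec U" "bilinear_map H H W \<beta>" "linear_map W U g"
    "h \<in> carrier H"
  shows "g (tensor_lift W \<beta> (comult H h)) = tensor_lift U (\<lambda>a b. g (\<beta> a b)) (comult H h)"
  using assms by (intro linear_tensor_lift[where A = H and B = H]) simp_all

lemma sweedler_mult:
  assumes "vector_space_rec W" "bilinear_map H H W \<beta>" "x \<in> carrier H" "y \<in> carrier H"
  shows "tensor_lift W \<beta> (comult H (x \<otimes>\<^bsub>H\<^esub> y)) = tensor_lift W (\<lambda>a b.
    tensor_lift W (\<lambda>a' b'. \<beta> (a \<otimes>\<^bsub>H\<^esub> a') (b \<otimes>\<^bsub>H\<^esub> b')) (comult H y)) (comult H x)"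
  using assms by (simp add: comult_mult tensor_lift_mult)

text \<open>
  Coassociativity is an equation in \<open>H \<otimes> (H \<otimes> H)\<close>; the trilinear map \<open>\<tau>\<close> factors through this space,
  and the induced linear map is applied to both sides.
\<close>

lemma sweedler_coassoc:
  assumes W: "vector_space_rec W" and h: "h \<in> carrier H"
    and \<tau>1: "\<And>a. a \<in> carrier H \<Longrightarrow> bilinear_map H H W (\<tau> a)"
    and \<tau>2: "\<And>c. c \<in> carrier H \<Longrightarrow> bilinear_map H H W (\<lambda>a b. \<tau> a b c)"
  shows "tensor_lift W (\<lambda>x c. tensor_lift W (\<lambda>a b. \<tau> a b c) (comult H x)) (comult H h) =
    tensor_lift W (\<lambda>a y. tensor_lift W (\<lambda>b c. \<tau> a b c) (comult H y)) (comult H h)"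
proof -
  let ?HH = "tensor_space H H"
  let ?HHH = "tensor_space H ?HH"
  let ?t = "tensor_lift W (\<lambda>a. tensor_lift W (\<tau> a))"
  have bt: "bilinear_map H ?HH W (\<lambda>a. tensor_lift W (\<tau> a))"
    using W \<tau>1 \<tau>2 by (intro bilinear_mapI tensor_lift_linear linear_map_tensor_lift_fun[of H H])
      (auto intro: bilinear_mapD(1,2)[OF \<tau>1] bilinear_mapD(1,2)[OF \<tau>2])
  have lt: "linear_map ?HHH W ?t" using W bt by (intro tensor_lift_linear) simp_all
  have pure: "?t (pure_tensor H ?HH a (pure_tensor H H b c)) = \<tau> a b c"
    if "a \<in> carrier H" "b \<in> carrier H" "c \<in> carrier H" for a b c
    using that by (simp add: tensor_lift_pure[OF _ _ W bt] tensor_lift_pure[OF _ _ W \<tau>1])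
  have b1: "bilinear_map H H ?HHH (\<lambda>a b. pure_tensor H ?HH a (comult H b))"
    by (intro bilinear_mapI linear_intros) simp_all
  have b2: "bilinear_map H H ?HHH (\<lambda>a' a''. pure_tensor H ?HH a' (pure_tensor H H a'' b))"
    if "b \<in> carrier H" for b
    using that by (intro bilinear_mapI linear_intros) simp_all
  have b3: "bilinear_map H H ?HHH (\<lambda>a b. tensor_lift ?HHH
      (\<lambda>a' a''. pure_tensor H ?HH a' (pure_tensor H H a'' b)) (comult H a))"
    by (intro bilinear_mapI linear_intros b2) simp_all
  have ax: "tensor_lift ?HHH (\<lambda>a b. tensor_lift ?HHH (\<lambda>a' a''.
            pure_tensor H ?HH a' (pure_tensor H H a'' b)) (comult H a)) (comult H h)
        = tensor_lift ?HHH (\<lambda>a b. pure_tensor H ?HH a (comult H b)) (comult H h)"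
    using H h by (simp add: hopf_algebra_def Let_def)
  have "tensor_lift W (\<lambda>x c. tensor_lift W (\<lambda>a b. \<tau> a b c) (comult H x)) (comult H h) =
    tensor_lift W (\<lambda>x c. ?t (tensor_lift ?HHH
      (\<lambda>a b. pure_tensor H ?HH a (pure_tensor H H b c)) (comult H x))) (comult H h)"
  proof (rule sweedler_cong[OF W _ h])
    show "bilinear_map H H W (\<lambda>x c. tensor_lift W (\<lambda>a b. \<tau> a b c) (comult H x))"
      by (intro bilinear_mapI linear_intros \<tau>2 W bilinear_mapD(1)[OF \<tau>1]) simp_all
    fix x c assume xc: "x \<in> carrier H" "c \<in> carrier H"
    show "tensor_lift W (\<lambda>a b. \<tau> a b c) (comult H x) =
      ?t (tensor_lift ?HHH (\<lambda>a b. pure_tensor H ?HH a (pure_tensor H H b c)) (comult H x))"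
      using xc by (subst sweedler_linear[OF _ W b2 lt]) (auto intro!: sweedler_cong[OF W \<tau>2] simp: pure)
  qed
  also have "\<dots> = ?t (tensor_lift ?HHH (\<lambda>x c. tensor_lift ?HHH
      (\<lambda>a b. pure_tensor H ?HH a (pure_tensor H H b c)) (comult H x)) (comult H h))"
    by (rule sweedler_linear[OF _ W b3 lt h, symmetric]) simp
  also have "\<dots> = tensor_lift W (\<lambda>a y. ?t (pure_tensor H ?HH a (comult H y))) (comult H h)"
    unfolding ax by (rule sweedler_linear[OF _ W b1 lt h]) simp
  also have "\<dots> = tensor_lift W (\<lambda>a y. tensor_lift W (\<lambda>b c. \<tau> a b c) (comult H y)) (comult H h)"
  proof (rule sweedler_cong[OF W _ h])
    show "bilinear_map H H W (\<lambda>a y. ?t (pure_tensor H ?HH a (comult H y)))"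
      using b1 by (auto simp: bilinear_map_def intro: linear_map_comp[OF lt])
  qed (simp add: tensor_lift_pure[OF _ _ W bt])
  finally show ?thesis .
qed

lemma sweedler_counit:
  assumes W: "vector_space_rec W" and f: "linear_map H W f" and h: "h \<in> carrier H"
  shows "tensor_lift W (\<lambda>a b. counit H a \<odot>\<^bsub>W\<^esub> f b) (comult H h) = f h"
    "tensor_lift W (\<lambda>a b. counit H b \<odot>\<^bsub>W\<^esub> f a) (comult H h) = f h"
proof -
  have bl: "bilinear_map H H H (\<lambda>a b. counit H a \<odot>\<^bsub>H\<^esub> b)" "bilinear_map H H H (\<lambda>a b. counit H b \<odot>\<^bsub>H\<^esub> a)"
    by (intro bilinear_mapI linear_intros; simp)+
  have ax: "tensor_lift H (\<lambda>a b. counit H a \<odot>\<^bsub>H\<^esub> b) (comult H h) = h"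
    "tensor_lift H (\<lambda>a b. counit H b \<odot>\<^bsub>H\<^esub> a) (comult H h) = h"
    using H h by (simp_all add: hopf_algebra_def)
  have bw: "bilinear_map H H W (\<lambda>a b. counit H a \<odot>\<^bsub>W\<^esub> f b)" "bilinear_map H H W (\<lambda>a b. counit H b \<odot>\<^bsub>W\<^esub> f a)"
    by (intro bilinear_mapI linear_intros f W; simp add: linear_mapD(1)[OF f])+
  show "tensor_lift W (\<lambda>a b. counit H a \<odot>\<^bsub>W\<^esub> f b) (comult H h) = f h"
    unfolding sweedler_linear[OF _ W bl(1) f h, unfolded ax, OF hopf_vs]
    by (rule sweedler_cong[OF W bw(1) h]) (simp add: linear_mapD[OF f])
  show "tensor_lift W (\<lambda>a b. counit H b \<odot>\<^bsub>W\<^esub> f a) (comult H h) = f h"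
    unfolding sweedler_linear[OF _ W bl(2) f h, unfolded ax, OF hopf_vs]
    by (rule sweedler_cong[OF W bw(2) h]) (simp add: linear_mapD[OF f])
qed

lemma sweedler_one:
  assumes "vector_space_rec W" "bilinear_map H H W \<beta>"
  shows "tensor_lift W \<beta> (comult H \<one>\<^bsub>H\<^esub>) = \<beta> \<one>\<^bsub>H\<^esub> \<one>\<^bsub>H\<^esub>"
  using assms by (simp add: comult_one tensor_lift_pure)

lemma sweedler_antipode:
  assumes "h \<in> carrier H"
  shows "tensor_lift H (\<lambda>a b. antipode H a \<otimes>\<^bsub>H\<^esub> b) (comult H h) = counit H h \<odot>\<^bsub>H\<^esub> \<one>\<^bsub>H\<^esub>"
    "tensor_lift H (\<lambda>a b. a \<otimes>\<^bsub>H\<^esub> antipode H b) (comult H h) = counit H h \<odot>\<^bsub>H\<^esub> \<one>\<^bsub>H\<^esub>"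
  using H assms by (simp_all add: hopf_algebra_def)

lemma bilinear_map_mult:
  assumes "assoc_algebra A" "linear_map H A f" "linear_map H A g"
  shows "bilinear_map H H A (\<lambda>a b. f a \<otimes>\<^bsub>A\<^esub> g b)"
  using assms by (intro bilinear_mapI linear_intros) (auto dest: linear_mapD(1))

text \<open>
  In the convolution algebra \<open>Hom(H, A)\<close> this says: from \<open>\<phi> * j = \<theta>\<close> and \<open>j * k = \<epsilon>\<close> follows
  \<open>\<phi> = \<phi> * (j * k) = (\<phi> * j) * k = \<theta> * k\<close>.  The behaviour of the antipode on products and coproducts
  is derived from it.
\<close>

lemma convolution_cancel:
  assumes A: "assoc_algebra A"
    and \<phi>: "linear_map H A \<phi>" and j: "linear_map H A j" and k: "linear_map H A k"
    and \<theta>: "\<And>x. x \<in> carrier H \<Longrightarrow> tensor_lift A (\<lambda>a b. \<phi> a \<otimes>\<^bsub>A\<^esub> j b) (comult H x) = \<theta> x"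
    and jk: "\<And>x. x \<in> carrier H \<Longrightarrow>
      tensor_lift A (\<lambda>a b. j a \<otimes>\<^bsub>A\<^esub> k b) (comult H x) = counit H x \<odot>\<^bsub>A\<^esub> \<one>\<^bsub>A\<^esub>"
    and h: "h \<in> carrier H"
  shows "\<phi> h = tensor_lift A (\<lambda>a b. \<theta> a \<otimes>\<^bsub>A\<^esub> k b) (comult H h)"
proof -
  have [simp]: "vector_space_rec A" using A by simp
  note cl [simp] = linear_mapD(1)[OF \<phi>] linear_mapD(1)[OF j] linear_mapD(1)[OF k]
  have jkb: "bilinear_map H H A (\<lambda>a b. j a \<otimes>\<^bsub>A\<^esub> k b)" by (rule bilinear_map_mult[OF A j k])
  have \<phi>jb: "bilinear_map H H A (\<lambda>a b. \<phi> a \<otimes>\<^bsub>A\<^esub> j b)" by (rule bilinear_map_mult[OF A \<phi> j])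
  have \<tau>1: "bilinear_map H H A (\<lambda>b c. \<phi> a \<otimes>\<^bsub>A\<^esub> (j b \<otimes>\<^bsub>A\<^esub> k c))" if "a \<in> carrier H" for a
    using that by (intro bilinear_mapI linear_intros A j k) (simp_all add: A)
  have \<tau>2: "bilinear_map H H A (\<lambda>a b. \<phi> a \<otimes>\<^bsub>A\<^esub> (j b \<otimes>\<^bsub>A\<^esub> k c))" if "c \<in> carrier H" for c
    using that by (intro bilinear_mapI linear_intros A j \<phi>) (simp_all add: A)
  have "\<phi> h = tensor_lift A (\<lambda>a y. counit H y \<odot>\<^bsub>A\<^esub> \<phi> a) (comult H h)"
    by (rule sweedler_counit(2)[symmetric]) (simp_all add: \<phi> h)
  also have "\<dots> = tensor_lift A (\<lambda>a y. tensor_lift A (\<lambda>b c. \<phi> a \<otimes>\<^bsub>A\<^esub> (j b \<otimes>\<^bsub>A\<^esub> k c)) (comult H y)) (comult H h)"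
  proof (rule sweedler_cong[OF _ _ h])
    show "bilinear_map H H A (\<lambda>a y. counit H y \<odot>\<^bsub>A\<^esub> \<phi> a)"
      by (intro bilinear_mapI linear_intros \<phi>) (simp_all add: A)
    fix a y assume ay: "a \<in> carrier H" "y \<in> carrier H"
    have "linear_map A A (\<lambda>v. \<phi> a \<otimes>\<^bsub>A\<^esub> v)"
      using ay by (intro linear_intros A) simp
    then have "tensor_lift A (\<lambda>b c. \<phi> a \<otimes>\<^bsub>A\<^esub> (j b \<otimes>\<^bsub>A\<^esub> k c)) (comult H y)
      = \<phi> a \<otimes>\<^bsub>A\<^esub> tensor_lift A (\<lambda>b c. j b \<otimes>\<^bsub>A\<^esub> k c) (comult H y)"
      using ay by (intro sweedler_linear[OF _ _ jkb, symmetric]) simp_all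
    then show "counit H y \<odot>\<^bsub>A\<^esub> \<phi> a
      = tensor_lift A (\<lambda>b c. \<phi> a \<otimes>\<^bsub>A\<^esub> (j b \<otimes>\<^bsub>A\<^esub> k c)) (comult H y)"
      using ay by (simp add: jk algebra_smult[OF A] algebra_one_closed[OF A] algebra_one[OF A])
  qed simp
  also have "\<dots> = tensor_lift A (\<lambda>x c. tensor_lift A (\<lambda>a b. \<phi> a \<otimes>\<^bsub>A\<^esub> (j b \<otimes>\<^bsub>A\<^esub> k c)) (comult H x)) (comult H h)"
    by (rule sweedler_coassoc[OF _ h \<tau>1 \<tau>2, symmetric]) simp_all
  also have "\<dots> = tensor_lift A (\<lambda>a b. \<theta> a \<otimes>\<^bsub>A\<^esub> k b) (comult H h)"
  proof (rule sweedler_cong[OF _ _ h])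
    show "bilinear_map H H A (\<lambda>x c. tensor_lift A (\<lambda>a b. \<phi> a \<otimes>\<^bsub>A\<^esub> (j b \<otimes>\<^bsub>A\<^esub> k c)) (comult H x))"
      by (intro bilinear_mapI linear_intros \<tau>2 A j k \<phi>) (simp_all add: A)
    fix x c assume xc: "x \<in> carrier H" "c \<in> carrier H"
    have lin: "linear_map A A (\<lambda>v. v \<otimes>\<^bsub>A\<^esub> k c)"
      using xc by (intro linear_intros A) simp
    have "\<theta> x \<otimes>\<^bsub>A\<^esub> k c = tensor_lift A (\<lambda>a b. \<phi> a \<otimes>\<^bsub>A\<^esub> j b \<otimes>\<^bsub>A\<^esub> k c) (comult H x)"
      unfolding \<theta>[OF xc(1), symmetric] by (rule sweedler_linear[OF _ _ \<phi>jb lin xc(1)]) simp_all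
    also have "\<dots> = tensor_lift A (\<lambda>a b. \<phi> a \<otimes>\<^bsub>A\<^esub> (j b \<otimes>\<^bsub>A\<^esub> k c)) (comult H x)"
      using xc by (intro sweedler_cong[OF _ _ xc(1), symmetric] \<tau>2) (simp_all add: algebra_assoc[OF A])
    finally show "tensor_lift A (\<lambda>a b. \<phi> a \<otimes>\<^bsub>A\<^esub> (j b \<otimes>\<^bsub>A\<^esub> k c)) (comult H x) = \<theta> x \<otimes>\<^bsub>A\<^esub> k c"
      by simp
  qed simp
  finally show ?thesis .
qed

text \<open>
  The case \<open>\<theta> = \<epsilon>(-) u\<close>, in which the convolution \<open>\<theta> * k\<close> collapses to \<open>u k\<close>.
\<close>

lemma convolution_right_inverse:
  assumes A: "assoc_algebra A"
    and \<phi>: "linear_map H A \<phi>" and j: "linear_map H A j" and k: "linear_map H A k"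
    and u: "u \<in> carrier A"
    and \<phi>j: "\<And>x. x \<in> carrier H \<Longrightarrow>
      tensor_lift A (\<lambda>a b. \<phi> a \<otimes>\<^bsub>A\<^esub> j b) (comult H x) = counit H x \<odot>\<^bsub>A\<^esub> u"
    and jk: "\<And>x. x \<in> carrier H \<Longrightarrow>
      tensor_lift A (\<lambda>a b. j a \<otimes>\<^bsub>A\<^esub> k b) (comult H x) = counit H x \<odot>\<^bsub>A\<^esub> \<one>\<^bsub>A\<^esub>"
    and h: "h \<in> carrier H"
  shows "\<phi> h = u \<otimes>\<^bsub>A\<^esub> k h"
proof -
  have [simp]: "vector_space_rec A" using A by simp
  note cl [simp] = linear_mapD(1)[OF \<phi>] linear_mapD(1)[OF j] linear_mapD(1)[OF k]
  have ku: "linear_map H A (\<lambda>b. u \<otimes>\<^bsub>A\<^esub> k b)" by (intro linear_intros A k u)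
  have "\<phi> h = tensor_lift A (\<lambda>a b. (counit H a \<odot>\<^bsub>A\<^esub> u) \<otimes>\<^bsub>A\<^esub> k b) (comult H h)"
    by (rule convolution_cancel[OF A \<phi> j k \<phi>j jk h])
  also have "\<dots> = tensor_lift A (\<lambda>a b. counit H a \<odot>\<^bsub>A\<^esub> (u \<otimes>\<^bsub>A\<^esub> k b)) (comult H h)"
    by (rule sweedler_cong[OF _ _ h, symmetric])
       (auto intro!: bilinear_mapI linear_intros k simp: A u algebra_smult[OF A])
  also have "\<dots> = u \<otimes>\<^bsub>A\<^esub> k h"
    by (rule sweedler_counit(1)[OF _ ku h]) simp
  finally show ?thesis .
qed

text \<open>
  As a function of \<open>g\<close>, the convolution of \<open>S (g h)\<close> with the identity is \<open>\<epsilon>(g) S h\<close>, so \<open>S (g h)\<close> is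
  \<open>S h\<close> times the convolution inverse \<open>S g\<close> of the identity.  The premise is the same argument in the
  other variable: as a function of \<open>x\<close>, the convolution of \<open>\<Sum> S (g\<^sub>1 x) g\<^sub>2\<close> with the identity is
  \<open>\<epsilon>(g x) 1\<close>, by the antipode axiom for the product \<open>g x\<close>.
\<close>

lemma antipode_mult:
  assumes g: "g \<in> carrier H" and h: "h \<in> carrier H"
  shows "antipode H (g \<otimes>\<^bsub>H\<^esub> h) = antipode H h \<otimes>\<^bsub>H\<^esub> antipode H g"
proof -
  let ?S = "antipode H"
  have S: "linear_map H H ?S" by (rule antipode_linear)
  have id: "linear_map H H (\<lambda>x. x)" by (rule linear_map_id)
  have bil: "bilinear_map H H H (\<lambda>g1 g2. ?S (g1 \<otimes>\<^bsub>H\<^esub> x) \<otimes>\<^bsub>H\<^esub> (g2 \<otimes>\<^bsub>H\<^esub> y))"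
    "bilinear_map H H H (\<lambda>x y. ?S (g1 \<otimes>\<^bsub>H\<^esub> x) \<otimes>\<^bsub>H\<^esub> (g2 \<otimes>\<^bsub>H\<^esub> y))"
    "bilinear_map H H H (\<lambda>g1 g2. ?S (g1 \<otimes>\<^bsub>H\<^esub> x) \<otimes>\<^bsub>H\<^esub> g2)"
    if "x \<in> carrier H" "y \<in> carrier H" "g1 \<in> carrier H" "g2 \<in> carrier H" for x y g1 g2
    using that by (intro bilinear_mapI linear_intros; simp)+
  let ?\<phi> = "\<lambda>g x. tensor_lift H (\<lambda>g1 g2. ?S (g1 \<otimes>\<^bsub>H\<^esub> x) \<otimes>\<^bsub>H\<^esub> g2) (comult H g)"
  have \<phi>: "linear_map H H (?\<phi> g)" if "g \<in> carrier H" for g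
    using that by (intro linear_intros bilinear_mapI) simp_all
  have step: "?\<phi> g x = (counit H g \<odot>\<^bsub>H\<^esub> \<one>\<^bsub>H\<^esub>) \<otimes>\<^bsub>H\<^esub> ?S x"
    if g: "g \<in> carrier H" and x: "x \<in> carrier H" for g x
  proof (rule convolution_right_inverse[OF _ \<phi>[OF g] id S _ _ _ x])
    fix x assume x: "x \<in> carrier H"
    have "tensor_lift H (\<lambda>a b. ?\<phi> g a \<otimes>\<^bsub>H\<^esub> b) (comult H x) =
      tensor_lift H (\<lambda>a b. tensor_lift H (\<lambda>g1 g2. ?S (g1 \<otimes>\<^bsub>H\<^esub> a) \<otimes>\<^bsub>H\<^esub> (g2 \<otimes>\<^bsub>H\<^esub> b)) (comult H g)) (comult H x)"
    proof (rule sweedler_cong[OF _ _ x])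
      show "bilinear_map H H H (\<lambda>a b. ?\<phi> g a \<otimes>\<^bsub>H\<^esub> b)"
        using linear_mapD(1)[OF \<phi>[OF g]] by (intro bilinear_mapI linear_intros \<phi> g) simp_all
      fix a b assume ab: "a \<in> carrier H" "b \<in> carrier H"
      have lin: "linear_map H H (\<lambda>v. v \<otimes>\<^bsub>H\<^esub> b)" using ab by (intro linear_intros) simp_all
      show "?\<phi> g a \<otimes>\<^bsub>H\<^esub> b = tensor_lift H (\<lambda>g1 g2. ?S (g1 \<otimes>\<^bsub>H\<^esub> a) \<otimes>\<^bsub>H\<^esub> (g2 \<otimes>\<^bsub>H\<^esub> b)) (comult H g)"
        unfolding sweedler_linear[OF hopf_vs hopf_vs bil(3)[OF ab(1) ab(1) ab(1) ab(1)] lin g]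
        using ab by (intro sweedler_cong[OF _ _ g, symmetric] bil) (auto simp: algebra_assoc)
    qed simp
    also have "\<dots> = tensor_lift H (\<lambda>g1 g2. tensor_lift H (\<lambda>a b. ?S (g1 \<otimes>\<^bsub>H\<^esub> a) \<otimes>\<^bsub>H\<^esub> (g2 \<otimes>\<^bsub>H\<^esub> b)) (comult H x)) (comult H g)"
      using g x by (intro tensor_lift_swap[where A = H and B = H and C = H and D = H] bil) simp_all
    also have "\<dots> = tensor_lift H (\<lambda>a b. ?S a \<otimes>\<^bsub>H\<^esub> b) (comult H (g \<otimes>\<^bsub>H\<^esub> x))"
      by (rule sweedler_mult[OF _ _ g x, symmetric]) (auto intro!: bilinear_mapI linear_intros)
    also have "\<dots> = counit H x \<odot>\<^bsub>H\<^esub> (counit H g \<odot>\<^bsub>H\<^esub> \<one>\<^bsub>H\<^esub>)"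
      using g x by (simp add: sweedler_antipode counit_mult vs_smult mult.commute)
    finally show "tensor_lift H (\<lambda>a b. ?\<phi> g a \<otimes>\<^bsub>H\<^esub> b) (comult H x) = counit H x \<odot>\<^bsub>H\<^esub> (counit H g \<odot>\<^bsub>H\<^esub> \<one>\<^bsub>H\<^esub>)" .
  qed (simp_all add: sweedler_antipode)
  show ?thesis
  proof (rule convolution_right_inverse[where \<phi> = "\<lambda>g. ?S (g \<otimes>\<^bsub>H\<^esub> h)" and j = "\<lambda>x. x"])
    show "linear_map H H (\<lambda>g. ?S (g \<otimes>\<^bsub>H\<^esub> h))" using h by (intro linear_intros) simp_all
    fix x assume "x \<in> carrier H"
    then show "tensor_lift H (\<lambda>a b. ?S (a \<otimes>\<^bsub>H\<^esub> h) \<otimes>\<^bsub>H\<^esub> b) (comult H x) = counit H x \<odot>\<^bsub>H\<^esub> ?S h"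
      using h by (simp add: step algebra_smult)
  qed (simp_all add: S id h g sweedler_antipode)
qed

lemma antipode_one: "antipode H \<one>\<^bsub>H\<^esub> = \<one>\<^bsub>H\<^esub>"
  using sweedler_antipode(1)[of "\<one>\<^bsub>H\<^esub>"]
    sweedler_one[OF hopf_vs bilinear_map_mult[OF hopf_assoc_algebra(1) antipode_linear linear_map_id]]
  by (simp add: counit_one)

text \<open>
  Apply the counit to \<open>\<Sum> S h\<^sub>1 h\<^sub>2 = \<epsilon>(h) 1\<close>.
\<close>

lemma antipode_counit:
  assumes h: "h \<in> carrier H"
  shows "counit H (antipode H h) = counit H h"
proof -
  have bl: "bilinear_map H H H (\<lambda>a b. antipode H a \<otimes>\<^bsub>H\<^esub> b)"
    by (intro bilinear_mapI linear_intros) simp_all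
  have "counit H h = counit H (tensor_lift H (\<lambda>a b. antipode H a \<otimes>\<^bsub>H\<^esub> b) (comult H h))"
    using h linear_mapD(3)[OF counit_linear] by (simp add: sweedler_antipode counit_one)
  also have "\<dots> = tensor_lift scalars (\<lambda>a b. counit H (antipode H a \<otimes>\<^bsub>H\<^esub> b)) (comult H h)"
    by (rule sweedler_linear[OF _ _ bl counit_linear h]) simp_all
  also have "\<dots> = tensor_lift scalars (\<lambda>a b. counit H b \<odot>\<^bsub>scalars\<^esub> counit H (antipode H a)) (comult H h)"
    by (rule sweedler_cong[OF _ _ h]) (auto intro!: bilinear_mapI linear_intros simp: counit_mult)
  also have "\<dots> = counit H (antipode H h)"
    by (rule sweedler_counit(2)[OF _ _ h]) (auto intro!: linear_intros)
  finally show ?thesis ..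
qed

text \<open>
  Both \<open>\<Delta> \<circ> S\<close> and \<open>h \<mapsto> S h\<^sub>2 \<otimes> S h\<^sub>1\<close> are convolution inverses of
  \<open>\<Delta> h = (h\<^sub>1 \<otimes> 1) (1 \<otimes> h\<^sub>2)\<close>.  The two factors are cancelled from the right one after the other.
\<close>

lemma antipode_comult:
  assumes h: "h \<in> carrier H"
  shows "comult H (antipode H h)
    = tensor_lift (tensor_space H H) (\<lambda>a b. pure_tensor H H (antipode H b) (antipode H a)) (comult H h)"
proof -
  let ?S = "antipode H" and ?T = "tensor_algebra H H" and ?I = "\<one>\<^bsub>H\<^esub>"
  let ?P = "\<lambda>x. pure_tensor H H x ?I" and ?Q = "\<lambda>x. pure_tensor H H ?I x"
  let ?\<phi> = "\<lambda>x. comult H (?S x)"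
  have T: "assoc_algebra ?T" by simp
  have P: "linear_map H ?T ?P" and Q: "linear_map H ?T ?Q" and \<phi>: "linear_map H ?T ?\<phi>"
    and PS: "linear_map H ?T (\<lambda>x. ?P (?S x))" and QS: "linear_map H ?T (\<lambda>x. ?Q (?S x))"
    unfolding linear_map_tensor_algebra by (intro linear_intros; simp)+
  have PQ: "tensor_lift ?T (\<lambda>a b. ?P a \<otimes>\<^bsub>?T\<^esub> ?Q b) (comult H x) = comult H x" if x: "x \<in> carrier H" for x
  proof -
    have "tensor_lift ?T (\<lambda>a b. ?P a \<otimes>\<^bsub>?T\<^esub> ?Q b) (comult H x) = tensor_lift ?T (pure_tensor H H) (comult H x)"
      by (rule sweedler_cong[OF _ bilinear_map_mult[OF T P Q] x]) simp_all
    then show ?thesis using x by (simp add: tensor_lift_id)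
  qed
  let ?\<psi> = "\<lambda>x. tensor_lift ?T (\<lambda>a b. ?\<phi> a \<otimes>\<^bsub>?T\<^esub> ?P b) (comult H x)"
  have \<psi>: "linear_map H ?T ?\<psi>"
    by (intro linear_intros bilinear_map_mult \<phi> P) simp_all
  have jk: "tensor_lift ?T (\<lambda>a b. ?P a \<otimes>\<^bsub>?T\<^esub> ?P (?S b)) (comult H x) = counit H x \<odot>\<^bsub>?T\<^esub> \<one>\<^bsub>?T\<^esub>"
    "tensor_lift ?T (\<lambda>a b. ?Q a \<otimes>\<^bsub>?T\<^esub> ?Q (?S b)) (comult H x) = counit H x \<odot>\<^bsub>?T\<^esub> \<one>\<^bsub>?T\<^esub>"
    if x: "x \<in> carrier H" for x
  proof -
    have bl: "bilinear_map H H H (\<lambda>a b. a \<otimes>\<^bsub>H\<^esub> ?S b)" by (intro bilinear_mapI linear_intros) simp_all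
    have "?P (tensor_lift H (\<lambda>a b. a \<otimes>\<^bsub>H\<^esub> ?S b) (comult H x)) = tensor_lift ?T (\<lambda>a b. ?P (a \<otimes>\<^bsub>H\<^esub> ?S b)) (comult H x)"
      by (rule sweedler_linear[OF _ _ bl P x]) simp_all
    also have "\<dots> = tensor_lift ?T (\<lambda>a b. ?P a \<otimes>\<^bsub>?T\<^esub> ?P (?S b)) (comult H x)"
      by (rule sweedler_cong[OF _ _ x, symmetric]) (simp_all add: bilinear_map_mult[OF T P PS])
    finally show "tensor_lift ?T (\<lambda>a b. ?P a \<otimes>\<^bsub>?T\<^esub> ?P (?S b)) (comult H x) = counit H x \<odot>\<^bsub>?T\<^esub> \<one>\<^bsub>?T\<^esub>"
      using x by (simp add: sweedler_antipode pure_tensor_simps)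
    have "?Q (tensor_lift H (\<lambda>a b. a \<otimes>\<^bsub>H\<^esub> ?S b) (comult H x)) = tensor_lift ?T (\<lambda>a b. ?Q (a \<otimes>\<^bsub>H\<^esub> ?S b)) (comult H x)"
      by (rule sweedler_linear[OF _ _ bl Q x]) simp_all
    also have "\<dots> = tensor_lift ?T (\<lambda>a b. ?Q a \<otimes>\<^bsub>?T\<^esub> ?Q (?S b)) (comult H x)"
      by (rule sweedler_cong[OF _ _ x, symmetric]) (simp_all add: bilinear_map_mult[OF T Q QS])
    finally show "tensor_lift ?T (\<lambda>a b. ?Q a \<otimes>\<^bsub>?T\<^esub> ?Q (?S b)) (comult H x) = counit H x \<odot>\<^bsub>?T\<^esub> \<one>\<^bsub>?T\<^esub>"
      using x by (simp add: sweedler_antipode pure_tensor_simps)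
  qed
  have \<phi>\<Delta>: "tensor_lift ?T (\<lambda>a b. ?\<phi> a \<otimes>\<^bsub>?T\<^esub> comult H b) (comult H x) = counit H x \<odot>\<^bsub>?T\<^esub> \<one>\<^bsub>?T\<^esub>"
    if x: "x \<in> carrier H" for x
  proof -
    have bl: "bilinear_map H H H (\<lambda>a b. ?S a \<otimes>\<^bsub>H\<^esub> b)" by (intro bilinear_mapI linear_intros) simp_all
    have \<Delta>: "linear_map H ?T (comult H)" using comult_linear by simp
    have "comult H (tensor_lift H (\<lambda>a b. ?S a \<otimes>\<^bsub>H\<^esub> b) (comult H x))
      = tensor_lift ?T (\<lambda>a b. comult H (?S a \<otimes>\<^bsub>H\<^esub> b)) (comult H x)"
      by (rule sweedler_linear[OF _ _ bl \<Delta> x]) simp_all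
    also have "\<dots> = tensor_lift ?T (\<lambda>a b. ?\<phi> a \<otimes>\<^bsub>?T\<^esub> comult H b) (comult H x)"
      by (rule sweedler_cong[OF _ _ x, symmetric])
        (simp_all add: bilinear_map_mult[OF T \<phi> \<Delta>] comult_mult)
    finally show ?thesis
      using x linear_mapD(3)[OF comult_linear] by (simp add: sweedler_antipode comult_one)
  qed
  have \<psi>_eq: "?\<psi> x = ?Q (?S x)" if x: "x \<in> carrier H" for x
  proof -
    have "?\<psi> x = \<one>\<^bsub>?T\<^esub> \<otimes>\<^bsub>?T\<^esub> ?Q (?S x)"
    proof (rule convolution_right_inverse[OF T \<psi> Q QS _ _ jk(2) x])
      fix x assume x: "x \<in> carrier H"
      have \<tau>1: "bilinear_map H H ?T (\<lambda>b c. ?\<phi> a \<otimes>\<^bsub>?T\<^esub> (?P b \<otimes>\<^bsub>?T\<^esub> ?Q c))" if "a \<in> carrier H" for a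
        using that by (intro bilinear_mapI linear_map_mult[OF T] P Q) simp_all
      have \<tau>2: "bilinear_map H H ?T (\<lambda>a b. ?\<phi> a \<otimes>\<^bsub>?T\<^esub> (?P b \<otimes>\<^bsub>?T\<^esub> ?Q c))" if "c \<in> carrier H" for c
        using that by (intro bilinear_mapI linear_map_mult[OF T] P \<phi>) simp_all
      have "tensor_lift ?T (\<lambda>y c. ?\<psi> y \<otimes>\<^bsub>?T\<^esub> ?Q c) (comult H x)
        = tensor_lift ?T (\<lambda>y c. tensor_lift ?T (\<lambda>a b. ?\<phi> a \<otimes>\<^bsub>?T\<^esub> (?P b \<otimes>\<^bsub>?T\<^esub> ?Q c)) (comult H y)) (comult H x)"
      proof (rule sweedler_cong[OF _ bilinear_map_mult[OF T \<psi> Q] x])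
        fix y c assume yc: "y \<in> carrier H" "c \<in> carrier H"
        have lin: "linear_map ?T ?T (\<lambda>v. v \<otimes>\<^bsub>?T\<^esub> ?Q c)"
          using yc by (intro linear_map_mult[OF T] linear_map_id) simp
        have "?\<psi> y \<otimes>\<^bsub>?T\<^esub> ?Q c = tensor_lift ?T (\<lambda>a b. ?\<phi> a \<otimes>\<^bsub>?T\<^esub> ?P b \<otimes>\<^bsub>?T\<^esub> ?Q c) (comult H y)"
          by (rule sweedler_linear[OF _ _ bilinear_map_mult[OF T \<phi> P] lin yc(1)]) simp_all
        also have "\<dots> = tensor_lift ?T (\<lambda>a b. ?\<phi> a \<otimes>\<^bsub>?T\<^esub> (?P b \<otimes>\<^bsub>?T\<^esub> ?Q c)) (comult H y)"
          using yc by (intro sweedler_cong[OF _ \<tau>2 yc(1), symmetric]) (simp_all add: algebra_assoc[OF T])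
        finally show "?\<psi> y \<otimes>\<^bsub>?T\<^esub> ?Q c = tensor_lift ?T (\<lambda>a b. ?\<phi> a \<otimes>\<^bsub>?T\<^esub> (?P b \<otimes>\<^bsub>?T\<^esub> ?Q c)) (comult H y)" .
      qed simp
      also have "\<dots> = tensor_lift ?T (\<lambda>a y. tensor_lift ?T (\<lambda>b c. ?\<phi> a \<otimes>\<^bsub>?T\<^esub> (?P b \<otimes>\<^bsub>?T\<^esub> ?Q c)) (comult H y)) (comult H x)"
        by (rule sweedler_coassoc[OF _ x \<tau>1 \<tau>2]) simp_all
      also have "\<dots> = tensor_lift ?T (\<lambda>a b. ?\<phi> a \<otimes>\<^bsub>?T\<^esub> comult H b) (comult H x)"
      proof (rule sweedler_cong[OF _ _ x, symmetric])
        show "bilinear_map H H ?T (\<lambda>a b. ?\<phi> a \<otimes>\<^bsub>?T\<^esub> comult H b)"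
          by (rule bilinear_map_mult[OF T \<phi>]) (simp add: comult_linear)
        fix a y assume ay: "a \<in> carrier H" "y \<in> carrier H"
        have lin: "linear_map ?T ?T (\<lambda>v. ?\<phi> a \<otimes>\<^bsub>?T\<^esub> v)"
          using ay by (intro linear_map_mult[OF T] linear_map_id) simp
        show "?\<phi> a \<otimes>\<^bsub>?T\<^esub> comult H y = tensor_lift ?T (\<lambda>b c. ?\<phi> a \<otimes>\<^bsub>?T\<^esub> (?P b \<otimes>\<^bsub>?T\<^esub> ?Q c)) (comult H y)"
          using sweedler_linear[OF _ _ bilinear_map_mult[OF T P Q] lin ay(2)] PQ[OF ay(2)] by simp
      qed simp
      also have "\<dots> = counit H x \<odot>\<^bsub>?T\<^esub> \<one>\<^bsub>?T\<^esub>" by (rule \<phi>\<Delta>[OF x])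
      finally show "tensor_lift ?T (\<lambda>y c. ?\<psi> y \<otimes>\<^bsub>?T\<^esub> ?Q c) (comult H x) = counit H x \<odot>\<^bsub>?T\<^esub> \<one>\<^bsub>?T\<^esub>" .
    qed simp_all
    then show ?thesis using x by simp
  qed
  have "?\<phi> h = tensor_lift ?T (\<lambda>a b. ?Q (?S a) \<otimes>\<^bsub>?T\<^esub> ?P (?S b)) (comult H h)"
    by (rule convolution_cancel[OF T \<phi> P PS \<psi>_eq jk(1) h])
  also have "\<dots> = tensor_lift ?T (\<lambda>a b. pure_tensor H H (?S b) (?S a)) (comult H h)"
    by (rule sweedler_cong[OF _ bilinear_map_mult[OF T QS PS] h]) simp_all
  finally show ?thesis by simp
qed

end

section \<open>Complements and linear functionals\<close>

lemma vs_subspace: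
  assumes "vector_space_rec M" "subspace_rec M N"
  shows "vector_space_rec (M\<lparr>carrier := N\<rparr>)"
  using submodule.submodule_is_module[OF assms(2,1)] .

lemma vector_space_poly_mapping:
  "vector_space (\<lambda>(c::'k::field) (v :: 'x \<Rightarrow>\<^sub>0 'k). Poly_Mapping.map ((*) c) v)"
  by unfold_locales (auto intro!: poly_mapping_eqI simp: lookup_add algebra_simps)

text \<open>
  The space \<open>M\<close> is a quotient of the free space on its underlying type, where complements exist.
  The preimage of \<open>N\<close> contains the kernel of the quotient map, so a projection onto this preimage
  fixes the kernel and descends to \<open>M\<close>.
\<close>

lemma subspace_retraction:
  fixes M :: "('k::field, 'a, 'm) module_scheme"
  assumes M: "vector_space_rec M" and N: "subspace_rec M N"
  shows "\<exists>r. linear_map M (M\<lparr>carrier := N\<rparr>) r \<and> (\<forall>n\<in>N. r n = n)"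
proof -
  let ?F = "free_space UNIV :: ('k, 'a \<Rightarrow>\<^sub>0 'k) module"
  let ?s = "\<lambda>(c::'k) (v :: 'a \<Rightarrow>\<^sub>0 'k). Poly_Mapping.map ((*) c) v"
  let ?\<pi> = "lin_extend M (\<lambda>x. if x \<in> carrier M then x else \<zero>\<^bsub>M\<^esub>)"
  have \<pi>: "linear_map ?F M ?\<pi>" using M by (intro linear_intros) auto
  note \<pi>D = linear_mapD[OF \<pi>, simplified]
  have \<pi>0: "?\<pi> 0 = \<zero>\<^bsub>M\<^esub>" using linear_map_zero[OF vs_free_space M \<pi>] by simp
  have \<pi>b: "?\<pi> (basis_vec x) = x" if "x \<in> carrier M" for x using that M by simp
  interpret F: vector_space ?s by (rule vector_space_poly_mapping)
  interpret FF: vector_space_pair ?s ?s ..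
  let ?P = "{v. ?\<pi> v \<in> N}"
  have P: "F.subspace ?P"
    unfolding F.subspace_def by (auto simp: \<pi>D \<pi>0 subspace_recD[OF M N])
  have "Vector_Spaces.linear ?s ?s (\<lambda>v. v)" by unfold_locales auto
  then obtain p where p: "\<And>v. ?\<pi> (p v) \<in> N" "Vector_Spaces.linear ?s ?s p" "\<And>v. ?\<pi> v \<in> N \<Longrightarrow> p v = v"
    using FF.linear_exists_left_inverse_on[OF _ P, of "\<lambda>v. v"] by fastforce
  interpret p: Vector_Spaces.linear ?s ?s p by (rule p(2))
  have ker: "?\<pi> (p u) = ?\<pi> (p v)" if uv: "?\<pi> u = ?\<pi> v" for u v
  proof -
    have d: "?\<pi> (u - v) = \<zero>\<^bsub>M\<^esub>"
    proof -
      have eq: "u - v = u + ?s (- 1) v" by (auto intro!: poly_mapping_eqI simp: lookup_add lookup_minus)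
      have "?\<pi> (u - v) = ?\<pi> u \<oplus>\<^bsub>M\<^esub> (- 1) \<odot>\<^bsub>M\<^esub> ?\<pi> v" by (simp only: eq \<pi>D)
      then show ?thesis using uv \<pi>D(1) M by simp
    qed
    then have "p (u - v) = u - v" using p(3)[of "u - v"] subspace_recD(2)[OF M N] by simp
    then have "p u = p v + (u - v)" using p.diff[of u v] by (simp add: algebra_simps)
    then show ?thesis using \<pi>D d M by simp
  qed
  show ?thesis
  proof (intro exI conjI ballI linear_mapI)
    let ?r = "\<lambda>m. ?\<pi> (p (basis_vec m))"
    fix m m' c assume m: "m \<in> carrier M"
    show "?r m \<in> carrier (M\<lparr>carrier := N\<rparr>)" using p(1) by simp
    have "?r (c \<odot>\<^bsub>M\<^esub> m) = ?\<pi> (p (?s c (basis_vec m)))"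
      using m M by (intro ker) (simp add: \<pi>D \<pi>b map_single lin_extend_single)
    then show "?r (c \<odot>\<^bsub>M\<^esub> m) = c \<odot>\<^bsub>M\<lparr>carrier := N\<rparr>\<^esub> ?r m"
      by (simp only: p.scale \<pi>D module.simps) simp
    assume m': "m' \<in> carrier M"
    have "?r (m \<oplus>\<^bsub>M\<^esub> m') = ?\<pi> (p (basis_vec m + basis_vec m'))"
      using m m' M by (intro ker) (simp add: \<pi>D \<pi>b)
    then show "?r (m \<oplus>\<^bsub>M\<^esub> m') = ?r m \<oplus>\<^bsub>M\<lparr>carrier := N\<rparr>\<^esub> ?r m'"
      by (simp add: p.add \<pi>D)
  next
    fix n assume n: "n \<in> N"
    then show "?\<pi> (p (basis_vec n)) = n"
      using p(3)[of "basis_vec n"] \<pi>b[of n] subspace_recD(1)[OF M N n] by simp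
  qed
qed

lemma smult_cancel:
  assumes M: "vector_space_rec M" and u: "u \<in> carrier M" "u \<noteq> \<zero>\<^bsub>M\<^esub>" and eq: "c \<odot>\<^bsub>M\<^esub> u = d \<odot>\<^bsub>M\<^esub> u"
  shows "c = d"
proof (rule ccontr)
  assume "c \<noteq> d"
  have "(c + (- 1) * d) \<odot>\<^bsub>M\<^esub> u = d \<odot>\<^bsub>M\<^esub> u \<oplus>\<^bsub>M\<^esub> (- d) \<odot>\<^bsub>M\<^esub> u"
    using u eq vs_smult(1)[OF M u(1), of c "- d"] by simp
  then have "(1 / (c - d)) \<odot>\<^bsub>M\<^esub> ((c - d) \<odot>\<^bsub>M\<^esub> u) = \<zero>\<^bsub>M\<^esub>" using u M by simp
  then show False using \<open>c \<noteq> d\<close> u by (simp add: vs_smult[OF M] M)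
qed

text \<open>
  The map \<open>m - r m\<close>, with \<open>r\<close> a retraction onto \<open>N\<close>, kills \<open>N\<close> but not \<open>w\<close>.  A retraction onto the line
  through the image of \<open>w\<close> then makes it scalar valued.
\<close>

lemma separating_functional:
  fixes M :: "('k::field, 'a, 'm) module_scheme"
  assumes M: "vector_space_rec M" and N: "subspace_rec M N" and w: "w \<in> carrier M" "w \<notin> N"
  shows "\<exists>f. linear_map M (scalars :: ('k, 'k) module) f \<and> (\<forall>n\<in>N. f n = 0) \<and> f w = 1"
proof -
  obtain r where r: "linear_map M (M\<lparr>carrier := N\<rparr>) r" "\<And>n. n \<in> N \<Longrightarrow> r n = n"
    using subspace_retraction[OF M N] by blast
  have rM: "linear_map M M r" using r(1) subspace_recD(1)[OF M N] by (auto simp: linear_map_def)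
  let ?q = "\<lambda>m. m \<oplus>\<^bsub>M\<^esub> (- 1) \<odot>\<^bsub>M\<^esub> r m"
  have q: "linear_map M M ?q" by (intro linear_map_add linear_intros M rM)
  let ?u = "?q w"
  have u: "?u \<in> carrier M" using linear_mapD(1)[OF q w(1)] .
  have u0: "?u \<noteq> \<zero>\<^bsub>M\<^esub>"
    using vs_diff_eq_zero[OF M w(1) linear_mapD(1)[OF rM w(1)]] linear_mapD(1)[OF r(1) w(1)] w(2) by auto
  let ?L = "{c \<odot>\<^bsub>M\<^esub> ?u | c. True}"
  have L: "subspace_rec M ?L"
  proof (rule subspace_recI[OF M])
    show "\<zero>\<^bsub>M\<^esub> \<in> ?L" using u M by (auto intro!: exI[of _ 0])
    show "x \<oplus>\<^bsub>M\<^esub> y \<in> ?L" if "x \<in> ?L" "y \<in> ?L" for x y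
      using that u by (auto simp: vs_smult(1)[OF M, symmetric])
    show "c \<odot>\<^bsub>M\<^esub> x \<in> ?L" if "x \<in> ?L" for c x
      using that u by (auto simp: vs_smult(3)[OF M])
  qed (use u M in auto)
  obtain t where t: "linear_map M (M\<lparr>carrier := ?L\<rparr>) t" "\<And>n. n \<in> ?L \<Longrightarrow> t n = n"
    using subspace_retraction[OF M L] by blast
  define f where "f m = (THE c. t (?q m) = c \<odot>\<^bsub>M\<^esub> ?u)" for m
  have fI: "f m = c" if "t (?q m) = c \<odot>\<^bsub>M\<^esub> ?u" for m c
    unfolding f_def using that smult_cancel[OF M u u0] by (intro the_equality) auto
  have f: "t (?q m) = f m \<odot>\<^bsub>M\<^esub> ?u" if m: "m \<in> carrier M" for m
    using linear_mapD(1)[OF t(1) linear_mapD(1)[OF q m]] fI by auto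
  show ?thesis
  proof (intro exI[of _ f] conjI ballI linear_mapI)
    fix n assume n: "n \<in> N"
    have "?q n = \<zero>\<^bsub>M\<^esub>" using r(2) n subspace_recD(1)[OF M N n] M by simp
    then show "f n = 0"
      using t(2)[OF subspace_recD(2)[OF M L]] u M by (intro fI) simp
  next
    have "?u \<in> ?L" using u M by (auto intro!: exI[of _ 1])
    then show "f w = 1" using t(2) u M by (intro fI) simp
  next
    fix x y c assume x: "x \<in> carrier M"
    have "t (?q (c \<odot>\<^bsub>M\<^esub> x)) = c \<odot>\<^bsub>M\<^esub> (f x \<odot>\<^bsub>M\<^esub> ?u)"
      by (simp only: linear_mapD(3)[OF q x] linear_mapD(3)[OF t(1) linear_mapD(1)[OF q x]] f[OF x]) simp
    then have "t (?q (c \<odot>\<^bsub>M\<^esub> x)) = (c * f x) \<odot>\<^bsub>M\<^esub> ?u" by (simp only: vs_smult(3)[OF M u])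
    from fI[OF this] show "f (c \<odot>\<^bsub>M\<^esub> x) = c \<odot>\<^bsub>scalars\<^esub> f x" by simp
    assume y: "y \<in> carrier M"
    have "t (?q (x \<oplus>\<^bsub>M\<^esub> y)) = f x \<odot>\<^bsub>M\<^esub> ?u \<oplus>\<^bsub>M\<^esub> f y \<odot>\<^bsub>M\<^esub> ?u"
      by (simp only: linear_mapD(2)[OF q x y]
          linear_mapD(2)[OF t(1) linear_mapD(1)[OF q x] linear_mapD(1)[OF q y]] f[OF x] f[OF y]) simp
    then have "t (?q (x \<oplus>\<^bsub>M\<^esub> y)) = (f x + f y) \<odot>\<^bsub>M\<^esub> ?u" by (simp only: vs_smult(1)[OF M u])
    from fI[OF this] show "f (x \<oplus>\<^bsub>M\<^esub> y) = f x \<oplus>\<^bsub>scalars\<^esub> f y" by simp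
  qed simp
qed

section \<open>Maps between tensor products\<close>

text \<open>
  Hopf algebras, their subalgebras and quotients, and group algebras are records with different
  further fields over the same vector space; their tensor products coincide.
\<close>

lemma tensor_space_cong:
  assumes "carrier A = carrier A'" "ring.add A = ring.add A'" "module.smult A = module.smult A'"
    and "carrier B = carrier B'" "ring.add B = ring.add B'" "module.smult B = module.smult B'"
  shows "tensor_space A B = tensor_space A' B'" "pure_tensor A B = pure_tensor A' B'"
proof -
  have "bilinear_rels A B = bilinear_rels A' B'" unfolding bilinear_rels_def assms ..
  then have null: "tensor_null A B = tensor_null A' B'" unfolding tensor_null_def assms by simp
  show "tensor_space A B = tensor_space A' B'" "pure_tensor A B = pure_tensor A' B'"
    by (simp_all add: tensor_space_def pure_tensor_def[abs_def] null assms)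
qed

lemma lin_extend_cong_space:
  assumes "carrier W = carrier W'" "ring.add W = ring.add W'" "ring.zero W = ring.zero W'"
    "module.smult W = module.smult W'"
  shows "lin_extend W = lin_extend W'"
  by (intro ext) (simp add: lin_extend_def finsum_def finprod_def assms)

definition tensor_map ::
    "('k::field, 'c, 'm) module_scheme \<Rightarrow> ('k, 'd, 'n) module_scheme \<Rightarrow> ('a \<Rightarrow> 'c) \<Rightarrow> ('b \<Rightarrow> 'd) \<Rightarrow>
     ('k, 'a, 'b) tensor \<Rightarrow> ('k, 'c, 'd) tensor" where
  "tensor_map C D f g = tensor_lift (tensor_space C D) (\<lambda>a b. pure_tensor C D (f a) (g b))"

context
  fixes A :: "('k::field, 'a, 'm) module_scheme" and B :: "('k, 'b, 'n) module_scheme"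
    and C :: "('k, 'c, 'p) module_scheme" and D :: "('k, 'd, 'q) module_scheme" and f g
  assumes A: "vector_space_rec A" and B: "vector_space_rec B" and C: "vector_space_rec C"
    and D: "vector_space_rec D" and f: "linear_map A C f" and g: "linear_map B D g"
begin

lemma tensor_map_bilinear: "bilinear_map A B (tensor_space C D) (\<lambda>a b. pure_tensor C D (f a) (g b))"
  by (intro bilinear_mapI linear_intros f g C D) (simp_all add: linear_mapD[OF f] linear_mapD[OF g])

lemma tensor_map_linear: "linear_map (tensor_space A B) (tensor_space C D) (tensor_map C D f g)"
  unfolding tensor_map_def by (intro tensor_lift_linear A B tensor_map_bilinear) (simp add: C D)

lemma tensor_map_pure:
  "a \<in> carrier A \<Longrightarrow> b \<in> carrier B \<Longrightarrow>
   tensor_map C D f g (pure_tensor A B a b) = pure_tensor C D (f a) (g b)"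
  unfolding tensor_map_def by (intro tensor_lift_pure[OF A B _ tensor_map_bilinear]) (simp_all add: C D)

lemma tensor_lift_tensor_map:
  assumes W: "vector_space_rec W" and \<beta>: "bilinear_map C D W \<beta>" and T: "T \<in> carrier (tensor_space A B)"
  shows "tensor_lift W \<beta> (tensor_map C D f g T) = tensor_lift W (\<lambda>a b. \<beta> (f a) (g b)) T"
proof -
  have b: "bilinear_map A B W (\<lambda>a b. \<beta> (f a) (g b))"
    by (intro bilinear_mapI linear_map_bilinear[OF \<beta>] f g) (simp_all add: linear_mapD[OF f] linear_mapD[OF g])
  show ?thesis
    by (rule linear_map_tensor_eq[OF A B linear_map_comp[OF tensor_lift_linear[OF C D W \<beta>] tensor_map_linear]
          tensor_lift_linear[OF A B W b] _ T])
       (simp add: tensor_map_pure tensor_lift_pure[OF C D W \<beta>] tensor_lift_pure[OF A B W b]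
          linear_mapD[OF f] linear_mapD[OF g])
qed

end

lemma tensor_map_mult:
  assumes A: "assoc_algebra A" and B: "assoc_algebra B" and C: "assoc_algebra C" and D: "assoc_algebra D"
    and f: "linear_map A C f" "\<And>x y. x \<in> carrier A \<Longrightarrow> y \<in> carrier A \<Longrightarrow> f (x \<otimes>\<^bsub>A\<^esub> y) = f x \<otimes>\<^bsub>C\<^esub> f y"
    and g: "linear_map B D g" "\<And>x y. x \<in> carrier B \<Longrightarrow> y \<in> carrier B \<Longrightarrow> g (x \<otimes>\<^bsub>B\<^esub> y) = g x \<otimes>\<^bsub>D\<^esub> g y"
    and S: "S \<in> carrier (tensor_space A B)" and T: "T \<in> carrier (tensor_space A B)"
  shows "tensor_map C D f g (S \<otimes>\<^bsub>tensor_algebra A B\<^esub> T)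
    = tensor_map C D f g S \<otimes>\<^bsub>tensor_algebra C D\<^esub> tensor_map C D f g T"
proof -
  have vs[simp]: "vector_space_rec A" "vector_space_rec B" "vector_space_rec C" "vector_space_rec D"
    using A B C D by simp_all
  note lin = tensor_map_linear[OF vs f(1) g(1)] and pure = tensor_map_pure[OF vs f(1) g(1)]
  note tm = tensor_mult_bilinear[OF A B] and tm' = tensor_mult_bilinear[OF C D]
  note cl [simp] = linear_mapD(1)[OF f(1)] linear_mapD(1)[OF g(1)] linear_mapD(1)[OF lin]
    algebra_mult_closed[OF A] algebra_mult_closed[OF B]
  have 1: "tensor_map C D f g (pure_tensor A B a b \<otimes>\<^bsub>tensor_algebra A B\<^esub> T)
    = tensor_map C D f g (pure_tensor A B a b) \<otimes>\<^bsub>tensor_algebra C D\<^esub> tensor_map C D f g T"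
    if ab: "a \<in> carrier A" "b \<in> carrier B" for a b
  proof (rule linear_map_tensor_eq[OF vs(1,2) _ _ _ T])
    show "linear_map (tensor_space A B) (tensor_space C D)
      (\<lambda>T. tensor_map C D f g (pure_tensor A B a b \<otimes>\<^bsub>tensor_algebra A B\<^esub> T))"
      using ab by (intro linear_map_comp[OF lin] linear_map_bilinear[OF tm] linear_map_id) simp
    show "linear_map (tensor_space A B) (tensor_space C D)
      (\<lambda>T. tensor_map C D f g (pure_tensor A B a b) \<otimes>\<^bsub>tensor_algebra C D\<^esub> tensor_map C D f g T)"
      using ab by (intro linear_map_bilinear[OF tm'] lin) simp
  qed (use ab in \<open>simp add: pure tensor_mult_pure[OF A B] tensor_mult_pure[OF C D] f(2) g(2)\<close>)
  show ?thesis
    by (rule linear_map_tensor_eq[OF vs(1,2) _ _ _ S])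
       (auto simp: 1 intro!: linear_map_comp[OF lin] linear_map_bilinear(2)[OF tm] linear_map_id
          linear_map_bilinear(2)[OF tm'] lin simp: T)
qed

section \<open>Hopf subalgebras\<close>

context
  fixes H :: "('k::field, 'a) hopf" and A and K
  assumes H: "hopf_algebra H" and sub: "hopf_subalgebra H A"
  defines "K \<equiv> sub_hopf H A"
begin

lemma sub_hopf_simps [simp]:
  "carrier (sub_hopf H A) = A" "x \<oplus>\<^bsub>sub_hopf H A\<^esub> y = x \<oplus>\<^bsub>H\<^esub> y" "c \<odot>\<^bsub>sub_hopf H A\<^esub> x = c \<odot>\<^bsub>H\<^esub> x"
  "\<zero>\<^bsub>sub_hopf H A\<^esub> = \<zero>\<^bsub>H\<^esub>" "\<one>\<^bsub>sub_hopf H A\<^esub> = \<one>\<^bsub>H\<^esub>" "x \<otimes>\<^bsub>sub_hopf H A\<^esub> y = x \<otimes>\<^bsub>H\<^esub> y"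
  "counit (sub_hopf H A) = counit H" "antipode (sub_hopf H A) = antipode H"
  by (simp_all add: sub_hopf_def)

lemma sub_hopf_tensor:
  "tensor_sub H A = tensor_space (sub_hopf H A) (sub_hopf H A)"
  by (rule tensor_space_cong) (simp_all add: sub_hopf_def)

lemma hopf_subalgebra_closed:
  "x \<in> A \<Longrightarrow> x \<in> carrier H" "\<zero>\<^bsub>H\<^esub> \<in> A" "\<one>\<^bsub>H\<^esub> \<in> A"
  "x \<in> A \<Longrightarrow> y \<in> A \<Longrightarrow> x \<oplus>\<^bsub>H\<^esub> y \<in> A" "x \<in> A \<Longrightarrow> y \<in> A \<Longrightarrow> x \<otimes>\<^bsub>H\<^esub> y \<in> A"
  "x \<in> A \<Longrightarrow> c \<odot>\<^bsub>H\<^esub> x \<in> A" "x \<in> A \<Longrightarrow> antipode H x \<in> A"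
proof -
  have s: "subspace_rec H A" and r: "subring A H" using sub by (auto simp: hopf_subalgebra_def)
  note S = subspace_recD[OF hopf_vs[OF H] s]
  show "x \<in> A \<Longrightarrow> x \<in> carrier H" "\<zero>\<^bsub>H\<^esub> \<in> A" "x \<in> A \<Longrightarrow> y \<in> A \<Longrightarrow> x \<oplus>\<^bsub>H\<^esub> y \<in> A"
    "x \<in> A \<Longrightarrow> c \<odot>\<^bsub>H\<^esub> x \<in> A" using S by auto
  show "\<one>\<^bsub>H\<^esub> \<in> A" "x \<in> A \<Longrightarrow> y \<in> A \<Longrightarrow> x \<otimes>\<^bsub>H\<^esub> y \<in> A"
    using r by (auto simp: subring_def intro: submonoid.one_closed submonoid.m_closed)
  show "x \<in> A \<Longrightarrow> antipode H x \<in> A" using sub by (auto simp: hopf_subalgebra_def)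
qed

lemma sub_hopf_vs: "vector_space_rec K"
  using H by (intro vector_space_recI)
    (auto simp: K_def hopf_subalgebra_closed vs_add[OF hopf_vs[OF H]] vs_smult[OF hopf_vs[OF H]])

lemma sub_hopf_incl: "linear_map K H (\<lambda>x. x)"
  by (rule linear_mapI) (simp_all add: K_def hopf_subalgebra_closed)

lemma linear_map_into_sub: "linear_map V K f \<longleftrightarrow> linear_map V H f \<and> f \<in> carrier V \<rightarrow> A"
  using hopf_subalgebra_closed(1) by (auto simp: linear_map_def K_def)

lemma sub_hopf_algebra: "assoc_algebra K"
proof (rule assoc_algebraI[OF sub_hopf_vs])
  note a = hopf_assoc_algebra(1)[OF H]
  note L = linear_mapD[OF bilinear_mapD(1)[OF algebra_mult_bilinear[OF a]]]
    and R = linear_mapD[OF bilinear_mapD(2)[OF algebra_mult_bilinear[OF a]]]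
  show "bilinear_map K K K (\<otimes>\<^bsub>K\<^esub>)"
    by (intro bilinear_mapI linear_mapI) (simp_all add: K_def hopf_subalgebra_closed L R)
qed (auto simp: K_def hopf_subalgebra_closed algebra_one[OF hopf_assoc_algebra(1)[OF H]]
    algebra_assoc[OF hopf_assoc_algebra(1)[OF H]])

lemma sub_hopf_retraction: "\<exists>r. linear_map H K r \<and> (\<forall>n\<in>A. r n = n)"
proof -
  obtain r where "linear_map H (H\<lparr>carrier := A\<rparr>) r" "\<forall>n\<in>A. r n = n"
    using subspace_retraction[of H A] H sub by (auto simp: hopf_subalgebra_def)
  then show ?thesis by (auto simp: linear_map_def K_def)
qed

lemma incl_tensor_eq: "incl_tensor H = tensor_map H H (\<lambda>x. x) (\<lambda>x. x)"
  by (simp add: incl_tensor_def tensor_map_def)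

text \<open>
  A retraction \<open>r\<close> of \<open>H\<close> onto \<open>A\<close> yields the left inverse \<open>r \<otimes> r\<close>.
\<close>

lemma incl_tensor_inj: "inj_on (incl_tensor H) (carrier (tensor_space K K))"
proof -
  have vs: "vector_space_rec K" "vector_space_rec H" using H sub_hopf_vs by simp_all
  obtain r where r: "linear_map H K r" "\<forall>n\<in>A. r n = n" using sub_hopf_retraction by blast
  have "tensor_map K K r r (incl_tensor H T) = T" if T: "T \<in> carrier (tensor_space K K)" for T
  proof (rule linear_map_tensor_eq[OF vs(1,1) _ linear_map_id _ T])
    show "linear_map (tensor_space K K) (tensor_space K K) (\<lambda>T. tensor_map K K r r (incl_tensor H T))"
      unfolding incl_tensor_eq
      by (rule linear_map_comp[OF tensor_map_linear[OF vs(2,2,1,1) r(1) r(1)]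
            tensor_map_linear[OF vs(1,1,2,2) sub_hopf_incl sub_hopf_incl]])
    fix a b assume ab: "a \<in> carrier K" "b \<in> carrier K"
    then have "a \<in> A" "b \<in> A" "a \<in> carrier H" "b \<in> carrier H"
      by (simp_all add: K_def hopf_subalgebra_closed)
    with ab show "tensor_map K K r r (incl_tensor H (pure_tensor K K a b)) = pure_tensor K K a b"
      unfolding incl_tensor_eq using r(2)
      by (simp add: tensor_map_pure[OF vs(1,1,2,2) sub_hopf_incl sub_hopf_incl]
          tensor_map_pure[OF vs(2,2,1,1) r(1) r(1)])
  qed
  then show ?thesis by (rule inj_on_inverseI)
qed

lemma sub_comult:
  assumes h: "h \<in> A"
  shows "comult K h \<in> carrier (tensor_space K K)" "incl_tensor H (comult K h) = comult H h"
proof -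
  have "comult H h \<in> incl_tensor H ` carrier (tensor_space K K)"
    using sub h by (auto simp: hopf_subalgebra_def sub_hopf_tensor K_def)
  moreover have "comult K h = inv_into (carrier (tensor_space K K)) (incl_tensor H) (comult H h)"
    by (simp add: K_def sub_hopf_tensor[symmetric]) (simp add: sub_hopf_def)
  ultimately show "comult K h \<in> carrier (tensor_space K K)" "incl_tensor H (comult K h) = comult H h"
    by (simp_all add: inv_into_into f_inv_into_f)
qed

lemma sub_comult_eqI:
  assumes "h \<in> A" "T \<in> carrier (tensor_space K K)" "incl_tensor H T = comult H h"
  shows "comult K h = T"
  using inj_onD[OF incl_tensor_inj] sub_comult[OF assms(1)] assms by metis

text \<open>
  Sweedler sums of elements of \<open>A\<close> agree in the two Hopf algebras.  A bilinear map that is only given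
  on \<open>A\<close> is first extended along a retraction.
\<close>

lemma sub_sweedler:
  assumes h: "h \<in> A" and W: "vector_space_rec W" and \<beta>: "bilinear_map H H W \<beta>"
  shows "tensor_lift W \<beta> (comult K h) = tensor_lift W \<beta> (comult H h)"
  using tensor_lift_tensor_map[OF sub_hopf_vs sub_hopf_vs hopf_vs[OF H] hopf_vs[OF H] sub_hopf_incl sub_hopf_incl W \<beta>
      sub_comult(1)[OF h]] sub_comult(2)[OF h]
  by (simp add: incl_tensor_eq)

lemma sub_sweedler_retract:
  assumes h: "h \<in> A" and W: "vector_space_rec W" and \<beta>: "bilinear_map K K W \<beta>"
    and r: "linear_map H K r" "\<forall>n\<in>A. r n = n"
  shows "tensor_lift W \<beta> (comult K h) = tensor_lift W (\<lambda>a b. \<beta> (r a) (r b)) (comult H h)"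
proof -
  have b: "bilinear_map H H W (\<lambda>a b. \<beta> (r a) (r b))"
    by (intro bilinear_mapI linear_map_bilinear[OF \<beta>] r) (simp_all add: linear_mapD[OF r(1)])
  have "tensor_lift W \<beta> (comult K h) = tensor_lift W (\<lambda>a b. \<beta> (r a) (r b)) (comult K h)"
    by (rule tensor_lift_cong[OF sub_hopf_vs sub_hopf_vs W \<beta> sub_comult(1)[OF h]])
       (use r(2) in \<open>simp add: K_def\<close>)
  also have "\<dots> = tensor_lift W (\<lambda>a b. \<beta> (r a) (r b)) (comult H h)"
    by (rule sub_sweedler[OF h W b])
  finally show ?thesis .
qed

lemma sub_sweedler_sub:
  assumes h: "h \<in> A" and \<beta>: "bilinear_map H H H \<beta>" and cl: "\<And>a b. a \<in> A \<Longrightarrow> b \<in> A \<Longrightarrow> \<beta> a b \<in> A"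
  shows "tensor_lift K \<beta> (comult K h) = tensor_lift H \<beta> (comult H h)"
proof -
  have "bilinear_map K K K \<beta>"
    using cl hopf_subalgebra_closed(1) sub_hopf_incl
    by (intro bilinear_mapI; subst linear_map_into_sub) (auto simp: K_def intro!: linear_map_bilinear[OF \<beta>])
  from linear_tensor_lift[OF sub_hopf_vs sub_hopf_vs sub_hopf_vs hopf_vs[OF H] this sub_hopf_incl sub_comult(1)[OF h]]
  show ?thesis using sub_sweedler[OF h hopf_vs[OF H] \<beta>] by simp
qed

lemma sub_comult_linear: "linear_map K (tensor_space K K) (comult K)"
proof (rule linear_mapI)
  have vs: "vector_space_rec K" "vector_space_rec H" using H sub_hopf_vs by simp_all
  note lin = linear_mapD[OF tensor_map_linear[OF vs(1,1,2,2) sub_hopf_incl sub_hopf_incl], folded incl_tensor_eq]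
  fix x y c assume "x \<in> carrier K"
  then have x: "x \<in> A" by (simp add: K_def)
  show "comult K x \<in> carrier (tensor_space K K)" by (rule sub_comult(1)[OF x])
  show "comult K (c \<odot>\<^bsub>K\<^esub> x) = c \<odot>\<^bsub>tensor_space K K\<^esub> comult K x"
    using x vs
    by (intro sub_comult_eqI)
       (simp_all add: lin sub_comult linear_mapD[OF comult_linear[OF H]] hopf_subalgebra_closed,
        simp_all add: K_def hopf_subalgebra_closed linear_mapD[OF comult_linear[OF H]])
  assume "y \<in> carrier K"
  then have y: "y \<in> A" by (simp add: K_def)
  show "comult K (x \<oplus>\<^bsub>K\<^esub> y) = comult K x \<oplus>\<^bsub>tensor_space K K\<^esub> comult K y"
    using x y vs
    by (intro sub_comult_eqI)
       (simp_all add: lin sub_comult linear_mapD[OF comult_linear[OF H]] hopf_subalgebra_closed,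
        simp_all add: K_def hopf_subalgebra_closed linear_mapD[OF comult_linear[OF H]])
qed

text \<open>
  Axioms with values in \<open>A\<close> are those of \<open>H\<close>.  Coassociativity takes its values in \<open>A \<otimes> (A \<otimes> A)\<close>; the
  universal trilinear map of this space is extended to \<open>H\<close> along a retraction, and for the extension
  coassociativity of \<open>H\<close> applies.
\<close>

lemma sub_hopf_hopf_algebra: "hopf_algebra K"
proof -
  have vs[simp]: "vector_space_rec K" "vector_space_rec H" using H sub_hopf_vs by simp_all
  have K[simp]: "assoc_algebra K" by (rule sub_hopf_algebra)
  obtain r where r: "linear_map H K r" "\<forall>n\<in>A. r n = n" using sub_hopf_retraction by blast
  have cK: "carrier K = A" by (simp add: K_def)
  have rA[simp]: "r x \<in> A" if "x \<in> carrier H" for x using linear_mapD(1)[OF r(1) that] cK by simp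
  show ?thesis
    unfolding hopf_algebra_def Let_def alg_hom_def linear_map_tensor_algebra
  proof (intro conjI ballI)
    show "comult K \<in> ring_hom K (tensor_algebra K K)"
    proof (rule ring_hom_memI)
      fix x y assume "x \<in> carrier K" "y \<in> carrier K"
      then have xy: "x \<in> A" "y \<in> A" by (simp_all add: K_def)
      show "comult K x \<in> carrier (tensor_algebra K K)" using sub_comult xy by simp
      show "comult K (x \<otimes>\<^bsub>K\<^esub> y) = comult K x \<otimes>\<^bsub>tensor_algebra K K\<^esub> comult K y"
      proof (rule sub_comult_eqI)
        show "x \<otimes>\<^bsub>K\<^esub> y \<in> A" using xy by (simp add: K_def hopf_subalgebra_closed)
        show "comult K x \<otimes>\<^bsub>tensor_algebra K K\<^esub> comult K y \<in> carrier (tensor_space K K)"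
          using sub_comult xy by (intro bilinear_mapD(3)[OF tensor_mult_bilinear]) simp_all
        show "incl_tensor H (comult K x \<otimes>\<^bsub>tensor_algebra K K\<^esub> comult K y) = comult H (x \<otimes>\<^bsub>K\<^esub> y)"
          using sub_comult xy hopf_assoc_algebra[OF H] unfolding incl_tensor_eq
          by (subst tensor_map_mult)
             (simp_all add: sub_hopf_incl, simp_all add: K_def comult_mult[OF H] hopf_subalgebra_closed incl_tensor_eq[symmetric])
      qed
      show "comult K (x \<oplus>\<^bsub>K\<^esub> y) = comult K x \<oplus>\<^bsub>tensor_algebra K K\<^esub> comult K y"
        using linear_mapD(2)[OF sub_comult_linear] \<open>x \<in> carrier K\<close> \<open>y \<in> carrier K\<close> by simp
    next
      show "comult K \<one>\<^bsub>K\<^esub> = \<one>\<^bsub>tensor_algebra K K\<^esub>"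
        unfolding tensor_algebra_simps
        by (rule sub_comult_eqI)
           (simp_all add: algebra_one_closed[OF K] incl_tensor_eq tensor_map_pure sub_hopf_incl cK[symmetric],
            simp add: K_def comult_one[OF H])
    qed
    show "linear_map K (tensor_space K K) (comult K)" by (rule sub_comult_linear)
    show "counit K \<in> ring_hom K scalars"
      by (rule ring_hom_memI)
         (auto simp: K_def counit_mult[OF H] counit_one[OF H] linear_mapD[OF counit_linear[OF H]] hopf_subalgebra_closed)
    show "linear_map K scalars (counit K)"
      by (rule linear_mapI) (auto simp: K_def linear_mapD[OF counit_linear[OF H]] hopf_subalgebra_closed)
    show "linear_map K K (antipode K)"
      by (rule linear_mapI) (auto simp: K_def linear_mapD[OF antipode_linear[OF H]] hopf_subalgebra_closed)
  next
    fix h assume h': "h \<in> carrier K"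
    then have h: "h \<in> A" "h \<in> carrier H" by (simp_all add: K_def hopf_subalgebra_closed)
    have b: "bilinear_map H H H (\<lambda>a b. counit H a \<odot>\<^bsub>H\<^esub> b)" "bilinear_map H H H (\<lambda>a b. counit H b \<odot>\<^bsub>H\<^esub> a)"
      "bilinear_map H H H (\<lambda>a b. antipode H a \<otimes>\<^bsub>H\<^esub> b)" "bilinear_map H H H (\<lambda>a b. a \<otimes>\<^bsub>H\<^esub> antipode H b)"
      by (intro bilinear_mapI linear_intros H; simp add: H hopf_assoc_algebra[OF H] hopf_closed[OF H])+
    show "tensor_lift K (\<lambda>a b. counit K a \<odot>\<^bsub>K\<^esub> b) (comult K h) = h"
      using sub_sweedler_sub[OF h(1) b(1)] sweedler_counit(1)[OF H vs(2) linear_map_id h(2)]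
      by (simp add: K_def hopf_subalgebra_closed)
    show "tensor_lift K (\<lambda>a b. counit K b \<odot>\<^bsub>K\<^esub> a) (comult K h) = h"
      using sub_sweedler_sub[OF h(1) b(2)] sweedler_counit(2)[OF H vs(2) linear_map_id h(2)]
      by (simp add: K_def hopf_subalgebra_closed)
    show "tensor_lift K (\<lambda>a b. antipode K a \<otimes>\<^bsub>K\<^esub> b) (comult K h) = counit K h \<odot>\<^bsub>K\<^esub> \<one>\<^bsub>K\<^esub>"
      using sub_sweedler_sub[OF h(1) b(3)] sweedler_antipode(1)[OF H h(2)]
      by (simp add: K_def hopf_subalgebra_closed)
    show "tensor_lift K (\<lambda>a b. a \<otimes>\<^bsub>K\<^esub> antipode K b) (comult K h) = counit K h \<odot>\<^bsub>K\<^esub> \<one>\<^bsub>K\<^esub>"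
      using sub_sweedler_sub[OF h(1) b(4)] sweedler_antipode(2)[OF H h(2)]
      by (simp add: K_def hopf_subalgebra_closed)
    let ?W = "tensor_space K (tensor_space K K)"
    let ?\<tau> = "\<lambda>a b c. pure_tensor K (tensor_space K K) (r a) (pure_tensor K K (r b) (r c))"
    have W: "vector_space_rec ?W" by simp
    have \<tau>1: "bilinear_map H H ?W (?\<tau> a)" if "a \<in> carrier H" for a
      using that r(1) by (intro bilinear_mapI linear_intros) (simp_all add: cK)
    have \<tau>2: "bilinear_map H H ?W (\<lambda>a b. ?\<tau> a b c)" if "c \<in> carrier H" for c
      using that r(1) by (intro bilinear_mapI linear_intros) (simp_all add: cK)
    have in1: "bilinear_map H H ?W (\<lambda>a b. tensor_lift ?W (\<lambda>a' a''. ?\<tau> a' a'' b) (comult H a))"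
      by (intro bilinear_mapI linear_map_sweedler_arg[OF H] linear_map_sweedler_fun[OF H] linear_map_id \<tau>2 W vs
          bilinear_mapD(1)[OF \<tau>1])
    have in2: "bilinear_map H H ?W (\<lambda>a b. tensor_lift ?W (\<lambda>b' b''. ?\<tau> a b' b'') (comult H b))"
      by (intro bilinear_mapI linear_map_sweedler_arg[OF H] linear_map_sweedler_fun[OF H] linear_map_id \<tau>1 W vs
          bilinear_mapD(2)[OF \<tau>2])
    have "tensor_lift ?W (\<lambda>a b. tensor_lift ?W (\<lambda>a' a''. pure_tensor K (tensor_space K K) a' (pure_tensor K K a'' b)) (comult K a)) (comult K h)
      = tensor_lift ?W (\<lambda>a b. tensor_lift ?W (\<lambda>a' a''. ?\<tau> a' a'' b) (comult H a)) (comult K h)"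
    proof (rule tensor_lift_cong[OF vs(1,1) W _ sub_comult(1)[OF h(1)], symmetric])
      show "bilinear_map K K ?W (\<lambda>a b. tensor_lift ?W (\<lambda>a' a''. ?\<tau> a' a'' b) (comult H a))"
        using sub_hopf_incl
        by (intro bilinear_mapI linear_map_bilinear[OF in1]) (auto simp: cK hopf_subalgebra_closed)
      fix a b assume ab: "a \<in> carrier K" "b \<in> carrier K"
      then have a: "a \<in> A" and b: "b \<in> A" "b \<in> carrier H" by (simp_all add: cK hopf_subalgebra_closed)
      have "bilinear_map K K ?W (\<lambda>a' a''. ?\<tau> a' a'' b)"
        using sub_hopf_incl b
        by (intro bilinear_mapI linear_map_bilinear[OF \<tau>2]) (auto simp: cK hopf_subalgebra_closed)
      then show "tensor_lift ?W (\<lambda>a' a''. ?\<tau> a' a'' b) (comult H a)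
        = tensor_lift ?W (\<lambda>a' a''. pure_tensor K (tensor_space K K) a' (pure_tensor K K a'' b)) (comult K a)"
        unfolding sub_sweedler[OF a W \<tau>2[OF b(2)], symmetric]
        by (rule tensor_lift_cong[OF vs(1,1) W _ sub_comult(1)[OF a]]) (use r(2) b in \<open>simp add: cK\<close>)
    qed
    also have "\<dots> = tensor_lift ?W (\<lambda>a b. tensor_lift ?W (\<lambda>a' a''. ?\<tau> a' a'' b) (comult H a)) (comult H h)"
      by (rule sub_sweedler[OF h(1) W in1])
    also have "\<dots> = tensor_lift ?W (\<lambda>a b. tensor_lift ?W (\<lambda>b' b''. ?\<tau> a b' b'') (comult H b)) (comult H h)"
      by (rule sweedler_coassoc[OF H W h(2) \<tau>1 \<tau>2])
    also have "\<dots> = tensor_lift ?W (\<lambda>a b. tensor_lift ?W (\<lambda>b' b''. ?\<tau> a b' b'') (comult H b)) (comult K h)"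
      by (rule sub_sweedler[OF h(1) W in2, symmetric])
    also have "\<dots> = tensor_lift ?W (\<lambda>a b. pure_tensor K (tensor_space K K) a (comult K b)) (comult K h)"
    proof (rule tensor_lift_cong[OF vs(1,1) W _ sub_comult(1)[OF h(1)]])
      show "bilinear_map K K ?W (\<lambda>a b. tensor_lift ?W (\<lambda>b' b''. ?\<tau> a b' b'') (comult H b))"
        using sub_hopf_incl
        by (intro bilinear_mapI linear_map_bilinear[OF in2]) (auto simp: cK hopf_subalgebra_closed)
      fix a b assume "a \<in> carrier K" "b \<in> carrier K"
      then have a: "a \<in> A" "a \<in> carrier H" and b: "b \<in> A" by (simp_all add: cK hopf_subalgebra_closed)
      have bl: "bilinear_map K K ?W (\<lambda>b' b''. ?\<tau> a b' b'')"
        using sub_hopf_incl a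
        by (intro bilinear_mapI linear_map_bilinear[OF \<tau>1]) (auto simp: cK hopf_subalgebra_closed)
      have lin: "linear_map (tensor_space K K) ?W (\<lambda>T. pure_tensor K (tensor_space K K) a T)"
        using a by (intro linear_intros) (simp_all add: cK)
      have "pure_tensor K (tensor_space K K) a (comult K b)
        = pure_tensor K (tensor_space K K) a (tensor_lift (tensor_space K K) (pure_tensor K K) (comult K b))"
        by (simp add: tensor_lift_id sub_comult(1)[OF b])
      also have "\<dots> = tensor_lift ?W (\<lambda>b' b''. pure_tensor K (tensor_space K K) a (pure_tensor K K b' b'')) (comult K b)"
        by (rule linear_tensor_lift[OF vs(1,1) _ W pure_tensor_bilinear[OF vs(1,1)] lin sub_comult(1)[OF b]]) simp
      also have "\<dots> = tensor_lift ?W (\<lambda>b' b''. ?\<tau> a b' b'') (comult K b)"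
        by (rule tensor_lift_cong[OF vs(1,1) W bl sub_comult(1)[OF b], symmetric]) (use r(2) a in \<open>simp add: cK\<close>)
      also have "\<dots> = tensor_lift ?W (\<lambda>b' b''. ?\<tau> a b' b'') (comult H b)"
        by (rule sub_sweedler[OF b W \<tau>1[OF a(2)]])
      finally show "tensor_lift ?W (\<lambda>b' b''. ?\<tau> a b' b'') (comult H b) = pure_tensor K (tensor_space K K) a (comult K b)" ..
    qed
    finally show "tensor_lift ?W (\<lambda>a b. tensor_lift ?W (\<lambda>a' a''. pure_tensor K (tensor_space K K) a' (pure_tensor K K a'' b)) (comult K a)) (comult K h)
      = tensor_lift ?W (\<lambda>a b. pure_tensor K (tensor_space K K) a (comult K b)) (comult K h)" .
  qed simp_all
qed

end

section \<open>Hopf algebras spanned by grouplike elements\<close>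

text \<open>
  The spanning family is indexed rather than a set, because the elements of a group span its group
  algebra through the map to basis vectors.
\<close>

definition spanned_by :: "('k::field, 'a, 'm) module_scheme \<Rightarrow> 'j set \<Rightarrow> ('j \<Rightarrow> 'a) \<Rightarrow> bool" where
  "spanned_by W J b \<longleftrightarrow> b \<in> J \<rightarrow> carrier W \<and> lin_extend W b ` carrier (free_space J) = carrier W"

lemma linear_map_span_eq:
  fixes U :: "('k::field, 'b, 'n) module_scheme"
  assumes W: "vector_space_rec W" and U: "vector_space_rec U" and sp: "spanned_by W J b"
    and f: "linear_map W U f" and g: "linear_map W U g"
    and eq: "\<And>j. j \<in> J \<Longrightarrow> f (b j) = g (b j)" and x: "x \<in> carrier W"
  shows "f x = g x"
proof -
  have "x \<in> lin_extend W b ` carrier (free_space J)" using sp x by (simp only: spanned_by_def)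
  then obtain v where v: "v \<in> carrier (free_space J)" "x = lin_extend W b v" by blast
  have b: "\<And>j. j \<in> J \<Longrightarrow> b j \<in> carrier W" using sp by (auto simp: spanned_by_def)
  have "f (lin_extend W b v) = lin_extend U (\<lambda>j. f (b j)) v"
    by (rule linear_lin_extend[OF W U f b v(1)])
  also have "\<dots> = lin_extend U (\<lambda>j. g (b j)) v"
    by (rule lin_extend_cong[OF U v(1)]) (simp_all add: eq b linear_mapD(1)[OF g])
  also have "\<dots> = g (lin_extend W b v)"
    by (rule linear_lin_extend[OF W U g b v(1), symmetric])
  finally show ?thesis using v by simp
qed

definition grouplike :: "('k::field, 'a) hopf \<Rightarrow> 'a \<Rightarrow> bool" where
  "grouplike L g \<longleftrightarrow> g \<in> carrier L \<and> comult L g = pure_tensor L L g g \<and> counit L g = 1"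

text \<open>Every axiom is linear in each element involved, so it suffices to check it on the \<open>b j\<close>.\<close>

lemma hopf_algebra_of_grouplikes:
  fixes L :: "('k::field, 'a) hopf"
  assumes L: "assoc_algebra L" and sp: "spanned_by L J b"
    and \<Delta>: "linear_map L (tensor_space L L) (comult L)" and \<epsilon>: "linear_map L scalars (counit L)"
    and S: "linear_map L L (antipode L)"
    and gl: "\<And>j. j \<in> J \<Longrightarrow> grouplike L (b j)"
    and one: "grouplike L \<one>\<^bsub>L\<^esub>"
    and mult: "\<And>i j. i \<in> J \<Longrightarrow> j \<in> J \<Longrightarrow> grouplike L (b i \<otimes>\<^bsub>L\<^esub> b j)"
    and inv: "\<And>j. j \<in> J \<Longrightarrow> antipode L (b j) \<otimes>\<^bsub>L\<^esub> b j = \<one>\<^bsub>L\<^esub>"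
      "\<And>j. j \<in> J \<Longrightarrow> b j \<otimes>\<^bsub>L\<^esub> antipode L (b j) = \<one>\<^bsub>L\<^esub>"
  shows "hopf_algebra L"
proof -
  have vs[simp]: "vector_space_rec L" using L by simp
  have T: "assoc_algebra (tensor_algebra L L)" by (rule tensor_algebra_assoc[OF L L])
  have b[simp]: "b j \<in> carrier L" if "j \<in> J" for j using sp that by (auto simp: spanned_by_def)
  have \<Delta>b[simp]: "comult L (b j) = pure_tensor L L (b j) (b j)" and \<epsilon>b[simp]: "counit L (b j) = 1"
    if "j \<in> J" for j using gl[OF that] by (simp_all add: grouplike_def)
  note cl[simp] = linear_mapD(1)[OF \<Delta>] linear_mapD(1)[OF S]
  note span_eq = linear_map_span_eq[OF vs _ sp]
  have \<Delta>m: "comult L (x \<otimes>\<^bsub>L\<^esub> y) = comult L x \<otimes>\<^bsub>tensor_algebra L L\<^esub> comult L y"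
    if x: "x \<in> carrier L" and y: "y \<in> carrier L" for x y
  proof (rule span_eq[where f = "\<lambda>x. comult L (x \<otimes>\<^bsub>L\<^esub> y)", OF _ _ _ _ x])
    show "linear_map L (tensor_space L L) (\<lambda>x. comult L (x \<otimes>\<^bsub>L\<^esub> y))"
      by (intro linear_map_comp[OF \<Delta>] linear_intros L y)
    show "linear_map L (tensor_space L L) (\<lambda>x. comult L x \<otimes>\<^bsub>tensor_algebra L L\<^esub> comult L y)"
      using linear_map_mult(2)[OF T, of "comult L y" L "comult L"] \<Delta> y by simp
    fix i assume i: "i \<in> J"
    show "comult L (b i \<otimes>\<^bsub>L\<^esub> y) = comult L (b i) \<otimes>\<^bsub>tensor_algebra L L\<^esub> comult L y"
    proof (rule span_eq[where f = "\<lambda>y. comult L (b i \<otimes>\<^bsub>L\<^esub> y)", OF _ _ _ _ y])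
      show "linear_map L (tensor_space L L) (\<lambda>y. comult L (b i \<otimes>\<^bsub>L\<^esub> y))"
        using i by (intro linear_map_comp[OF \<Delta>] linear_intros L) simp
      show "linear_map L (tensor_space L L) (\<lambda>y. comult L (b i) \<otimes>\<^bsub>tensor_algebra L L\<^esub> comult L y)"
        using linear_map_mult(1)[OF T, of "comult L (b i)" L "comult L"] \<Delta> i by simp
      fix j assume "j \<in> J"
      then show "comult L (b i \<otimes>\<^bsub>L\<^esub> b j) = comult L (b i) \<otimes>\<^bsub>tensor_algebra L L\<^esub> comult L (b j)"
        using i mult[OF i] by (simp add: grouplike_def tensor_mult_pure[OF L L])
    qed simp
  qed simp
  have \<epsilon>m: "counit L (x \<otimes>\<^bsub>L\<^esub> y) = counit L x * counit L y"
    if x: "x \<in> carrier L" and y: "y \<in> carrier L" for x y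
  proof (rule span_eq[where f = "\<lambda>x. counit L (x \<otimes>\<^bsub>L\<^esub> y)" and U = scalars, OF _ _ _ _ x])
    show "linear_map L scalars (\<lambda>x. counit L (x \<otimes>\<^bsub>L\<^esub> y))"
      by (intro linear_map_comp[OF \<epsilon>] linear_intros L y)
    show "linear_map L scalars (\<lambda>x. counit L x * counit L y)"
      using linear_map_smult_left[OF vs_scalars \<epsilon>] by simp
    fix i assume i: "i \<in> J"
    show "counit L (b i \<otimes>\<^bsub>L\<^esub> y) = counit L (b i) * counit L y"
    proof (rule span_eq[where f = "\<lambda>y. counit L (b i \<otimes>\<^bsub>L\<^esub> y)" and U = scalars, OF _ _ _ _ y])
      show "linear_map L scalars (\<lambda>y. counit L (b i \<otimes>\<^bsub>L\<^esub> y))"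
        using i by (intro linear_map_comp[OF \<epsilon>] linear_intros L) simp
      show "linear_map L scalars (\<lambda>y. counit L (b i) * counit L y)"
        using linear_map_smult[OF vs_scalars \<epsilon>] by simp
      fix j assume "j \<in> J"
      then show "counit L (b i \<otimes>\<^bsub>L\<^esub> b j) = counit L (b i) * counit L (b j)"
        using i mult[OF i] by (simp add: grouplike_def)
    qed simp
  qed simp
  have bl: "bilinear_map L L L (\<lambda>a b. counit L a \<odot>\<^bsub>L\<^esub> b)" "bilinear_map L L L (\<lambda>a b. counit L b \<odot>\<^bsub>L\<^esub> a)"
    "bilinear_map L L L (\<lambda>a b. antipode L a \<otimes>\<^bsub>L\<^esub> b)" "bilinear_map L L L (\<lambda>a b. a \<otimes>\<^bsub>L\<^esub> antipode L b)"
    by (intro bilinear_mapI linear_intros \<epsilon> S L vs; simp)+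
  have \<epsilon>1: "linear_map L L (\<lambda>h. counit L h \<odot>\<^bsub>L\<^esub> \<one>\<^bsub>L\<^esub>)"
    by (intro linear_intros \<epsilon> vs) (simp add: algebra_one_closed[OF L])
  show ?thesis
    unfolding hopf_algebra_def Let_def alg_hom_def linear_map_tensor_algebra
  proof (intro conjI ballI)
    show "comult L \<in> ring_hom L (tensor_algebra L L)"
      using one by (intro ring_hom_memI) (simp_all add: \<Delta>m linear_mapD[OF \<Delta>] grouplike_def)
    show "counit L \<in> ring_hom L scalars"
      using one by (intro ring_hom_memI) (simp_all add: \<epsilon>m linear_mapD[OF \<epsilon>] grouplike_def)
  next
    fix h assume h: "h \<in> carrier L"
    note lin = tensor_lift_linear[OF vs vs vs, THEN linear_map_comp, OF _ \<Delta>]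
    show "tensor_lift L (\<lambda>a b. counit L a \<odot>\<^bsub>L\<^esub> b) (comult L h) = h"
      by (rule span_eq[OF vs lin[OF bl(1)] linear_map_id _ h]) (simp add: tensor_lift_pure[OF vs vs vs bl(1)])
    show "tensor_lift L (\<lambda>a b. counit L b \<odot>\<^bsub>L\<^esub> a) (comult L h) = h"
      by (rule span_eq[OF vs lin[OF bl(2)] linear_map_id _ h]) (simp add: tensor_lift_pure[OF vs vs vs bl(2)])
    show "tensor_lift L (\<lambda>a b. antipode L a \<otimes>\<^bsub>L\<^esub> b) (comult L h) = counit L h \<odot>\<^bsub>L\<^esub> \<one>\<^bsub>L\<^esub>"
      by (rule span_eq[OF vs lin[OF bl(3)] \<epsilon>1 _ h])
         (simp add: tensor_lift_pure[OF vs vs vs bl(3)] inv algebra_one_closed[OF L])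
    show "tensor_lift L (\<lambda>a b. a \<otimes>\<^bsub>L\<^esub> antipode L b) (comult L h) = counit L h \<odot>\<^bsub>L\<^esub> \<one>\<^bsub>L\<^esub>"
      by (rule span_eq[OF vs lin[OF bl(4)] \<epsilon>1 _ h])
         (simp add: tensor_lift_pure[OF vs vs vs bl(4)] inv algebra_one_closed[OF L])
    let ?W = "tensor_space L (tensor_space L L)"
    have W: "vector_space_rec ?W" by simp
    have b2: "bilinear_map L L ?W (\<lambda>a' a''. pure_tensor L (tensor_space L L) a' (pure_tensor L L a'' b))"
      if "b \<in> carrier L" for b using that by (intro bilinear_mapI linear_intros) simp_all
    have b3: "bilinear_map L L ?W (\<lambda>a b. tensor_lift ?W
        (\<lambda>a' a''. pure_tensor L (tensor_space L L) a' (pure_tensor L L a'' b)) (comult L a))"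
      by (intro bilinear_mapI linear_map_tensor_lift_fun[of L L] b2 linear_map_comp[OF tensor_lift_linear[OF vs vs W b2] \<Delta>]
         linear_intros) simp_all
    have b1: "bilinear_map L L ?W (\<lambda>a b. pure_tensor L (tensor_space L L) a (comult L b))"
      using \<Delta> by (intro bilinear_mapI linear_map_pure_tensor linear_map_id) simp_all
    show "tensor_lift ?W (\<lambda>a b. tensor_lift ?W (\<lambda>a' a''. pure_tensor L (tensor_space L L) a' (pure_tensor L L a'' b)) (comult L a)) (comult L h)
      = tensor_lift ?W (\<lambda>a b. pure_tensor L (tensor_space L L) a (comult L b)) (comult L h)"
      by (rule span_eq[OF W linear_map_comp[OF tensor_lift_linear[OF vs vs W b3] \<Delta>]
            linear_map_comp[OF tensor_lift_linear[OF vs vs W b1] \<Delta>] _ h])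
         (simp add: tensor_lift_pure[OF vs vs W b3] tensor_lift_pure[OF vs vs W b2] tensor_lift_pure[OF vs vs W b1])
  qed (use L \<Delta> \<epsilon> S in simp_all)
qed

text \<open>
  A functional that vanishes on one grouplike element of a relation but not on another turns it,
  through \<open>(f \<otimes> id) \<circ> \<Delta>\<close>, into a shorter relation.
\<close>

lemma grouplikes_independent:
  fixes H :: "('k::field, 'a) hopf" and J :: "'j set"
  assumes H: "hopf_algebra H" and gl: "\<And>j. j \<in> J \<Longrightarrow> grouplike H (b j)" and inj: "inj_on b J"
  shows "lin_indep_family H J b"
proof -
  have vs[simp]: "vector_space_rec H" using H by (rule hopf_vs)
  have b[simp]: "b j \<in> carrier H" "counit H (b j) = 1" "comult H (b j) = pure_tensor H H (b j) (b j)"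
    if "j \<in> J" for j using gl[OF that] by (simp_all add: grouplike_def)
  have "c = 0" if "Poly_Mapping.keys c \<subseteq> J" "lin_extend H b c = \<zero>\<^bsub>H\<^esub>" for c :: "'j \<Rightarrow>\<^sub>0 'k"
    using that
  proof (induction "card (Poly_Mapping.keys c)" arbitrary: c rule: less_induct)
    case less
    show ?case
    proof (rule ccontr)
      assume c0: "c \<noteq> 0"
      then obtain j0 where j0: "j0 \<in> Poly_Mapping.keys c" using keys_eq_empty by blast
      have j0J: "j0 \<in> J" using j0 less.prems by blast
      show False
      proof (cases "Poly_Mapping.keys c = {j0}")
        case True
        then have "lin_extend H b c = Poly_Mapping.lookup c j0 \<odot>\<^bsub>H\<^esub> b j0"
          using j0J by (simp add: lin_extend_def)
        then have "counit H (Poly_Mapping.lookup c j0 \<odot>\<^bsub>H\<^esub> b j0) = counit H \<zero>\<^bsub>H\<^esub>" using less.prems by simp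
        then have "Poly_Mapping.lookup c j0 = 0"
          using linear_mapD(3)[OF counit_linear[OF H]] linear_map_zero[OF vs vs_scalars counit_linear[OF H]] j0J by simp
        then show False using j0 by (simp add: in_keys_iff)
      next
        case False
        then obtain j1 where j1: "j1 \<in> Poly_Mapping.keys c" "j1 \<noteq> j0" using j0 by blast
        have j1J: "j1 \<in> J" using j1 less.prems by blast
        let ?N = "{a \<odot>\<^bsub>H\<^esub> b j0 | a. True}"
        have N: "subspace_rec H ?N"
        proof (rule subspace_recI[OF vs])
          show "\<zero>\<^bsub>H\<^esub> \<in> ?N" using j0J by (auto intro!: exI[of _ 0])
          show "x \<oplus>\<^bsub>H\<^esub> y \<in> ?N" if "x \<in> ?N" "y \<in> ?N" for x y
            using that j0J by (auto simp: vs_smult(1)[OF vs, symmetric])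
          show "d \<odot>\<^bsub>H\<^esub> x \<in> ?N" if "x \<in> ?N" for d x
            using that j0J by (auto simp: vs_smult(3)[OF vs])
        qed (use j0J in auto)
        have "b j1 \<notin> ?N"
        proof
          assume "b j1 \<in> ?N"
          then obtain a where a: "b j1 = a \<odot>\<^bsub>H\<^esub> b j0" by auto
          \<comment> \<open>Proportional grouplike elements are equal, by the counit.\<close>
          have "counit H (a \<odot>\<^bsub>H\<^esub> b j0) = a" using linear_mapD(3)[OF counit_linear[OF H]] j0J by simp
          then have "a = 1" using b(2)[OF j1J] by (simp only: a)
          then have "b j1 = b j0" using a j0J by simp
          then show False using inj_onD[OF inj] j0J j1J j1 by blast
        qed
        then obtain f where f: "linear_map H scalars f" "\<And>n. n \<in> ?N \<Longrightarrow> f n = 0" "f (b j1) = 1"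
          using separating_functional[OF vs N b(1)[OF j1J]] by blast
        have "b j0 = 1 \<odot>\<^bsub>H\<^esub> b j0" using j0J by simp
        then have fj0: "f (b j0) = 0" by (intro f(2)) blast
        let ?D = "\<lambda>h. tensor_lift H (\<lambda>x y. f x \<odot>\<^bsub>H\<^esub> y) (comult H h)"
        have bil: "bilinear_map H H H (\<lambda>x y. f x \<odot>\<^bsub>H\<^esub> y)"
          by (intro bilinear_mapI linear_intros f vs) simp
        have D: "linear_map H H ?D" by (intro linear_intros H bil vs)
        have Db: "?D (b j) = f (b j) \<odot>\<^bsub>H\<^esub> b j" if "j \<in> J" for j
          using that by (simp add: tensor_lift_pure[OF vs vs vs bil])
        \<comment> \<open>The coefficients after applying \<open>f \<otimes> id\<close>: the one at \<open>j0\<close> has gone, the one at \<open>j1\<close> is kept.\<close>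
        define c' where "c' = Abs_poly_mapping (\<lambda>j. Poly_Mapping.lookup c j * f (b j))"
        have lc': "Poly_Mapping.lookup c' j = Poly_Mapping.lookup c j * f (b j)" for j
          unfolding c'_def
          by (subst lookup_Abs_poly_mapping)
             (auto intro: finite_subset[OF _ finite_keys[of c]] simp: in_keys_iff)
        have keys: "Poly_Mapping.keys c' \<subseteq> Poly_Mapping.keys c - {j0}"
          using fj0 by (auto simp: in_keys_iff lc')
        have "\<zero>\<^bsub>H\<^esub> = ?D (lin_extend H b c)"
          using less.prems linear_map_zero[OF vs vs D] by simp
        also have "\<dots> = lin_extend H (\<lambda>j. ?D (b j)) c"
          using less.prems by (intro linear_lin_extend[OF vs vs D, where X = J]) simp_all
        also have "\<dots> = (\<Oplus>\<^bsub>H\<^esub>j\<in>Poly_Mapping.keys c. Poly_Mapping.lookup c' j \<odot>\<^bsub>H\<^esub> b j)"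
          unfolding lin_extend_def using less.prems
          by (intro vs_finsum_cong[OF vs]) (auto simp: Db lc' vs_smult[OF vs] simp del: b(3))
        also have "\<dots> = lin_extend H b c'"
          using keys less.prems by (intro lin_extend_superset[OF vs, symmetric, where X = J]) auto
        finally have "lin_extend H b c' = \<zero>\<^bsub>H\<^esub>" ..
        moreover have "card (Poly_Mapping.keys c') < card (Poly_Mapping.keys c)"
          using keys j0 by (intro psubset_card_mono) auto
        ultimately have "c' = 0" using less.hyps[of c'] keys less.prems by blast
        then show False using lc'[of j1] f(3) j1 by (simp add: in_keys_iff)
      qed
    qed
  qed
  then show ?thesis by (simp add: lin_indep_family_def)
qed

lemma lin_indep_family_inj:
  fixes W :: "('k::field, 'a, 'm) module_scheme"
  assumes W: "vector_space_rec W" and b: "\<And>j. j \<in> J \<Longrightarrow> b j \<in> carrier W" and ind: "lin_indep_family W J b"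
  shows "inj_on (lin_extend W b) (carrier (free_space J))"
proof (rule inj_onI)
  fix u v :: "'b \<Rightarrow>\<^sub>0 'k"
  assume uv: "u \<in> carrier (free_space J)" "v \<in> carrier (free_space J)" "lin_extend W b u = lin_extend W b v"
  have lin: "linear_map (free_space J) W (lin_extend W b)" by (intro linear_intros W b)
  note L = linear_mapD[OF lin]
  let ?d = "u \<oplus>\<^bsub>free_space J\<^esub> (- 1) \<odot>\<^bsub>free_space J\<^esub> v"
  have d: "?d \<in> carrier (free_space J)" using uv by (intro vs_closed[OF vs_free_space]) auto
  have "lin_extend W b ?d = lin_extend W b u \<oplus>\<^bsub>W\<^esub> (- 1) \<odot>\<^bsub>W\<^esub> lin_extend W b v"
    using uv L vs_closed(3)[OF vs_free_space] by metis
  then have "lin_extend W b ?d = \<zero>\<^bsub>W\<^esub>" using uv L(1) W by simp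
  then have "?d = 0" using ind d unfolding lin_indep_family_def by (simp only: free_space_simps(1))
  then show "u = v" using vs_diff_eq_zero[OF vs_free_space uv(1,2)] by simp
qed

section \<open>Group algebras\<close>

lemma group_algebra_simps [simp]:
  "carrier (group_algebra G) = carrier (free_space (carrier G))"
  "\<zero>\<^bsub>group_algebra G\<^esub> = 0"
  "v \<oplus>\<^bsub>group_algebra G\<^esub> w = v + w"
  "c \<odot>\<^bsub>group_algebra G\<^esub> v = Poly_Mapping.map ((*) c) v"
  "\<one>\<^bsub>group_algebra G\<^esub> = basis_vec \<one>\<^bsub>G\<^esub>"
  "v \<otimes>\<^bsub>group_algebra G\<^esub> w = lin_extend (free_space (carrier G))
     (\<lambda>g. lin_extend (free_space (carrier G)) (\<lambda>h. basis_vec (g \<otimes>\<^bsub>G\<^esub> h)) w) v"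
  "counit (group_algebra G) = lin_extend scalars (\<lambda>g. 1)"
  "antipode (group_algebra G) = lin_extend (free_space (carrier G)) (\<lambda>g. basis_vec (inv\<^bsub>G\<^esub> g))"
  by (simp_all add: group_algebra_def Let_def module.defs hopf.defs free_space_def)

lemma group_algebra_space:
  "ring.add (group_algebra G) = ring.add (free_space (carrier G))"
  "module.smult (group_algebra G) = module.smult (free_space (carrier G))"
  by (simp_all add: fun_eq_iff)

lemma group_algebra_tensor:
  "tensor_space (group_algebra G) (group_algebra G) = tensor_space (free_space (carrier G)) (free_space (carrier G))"
  "pure_tensor (group_algebra G) (group_algebra G) = pure_tensor (free_space (carrier G)) (free_space (carrier G))"
  by (rule tensor_space_cong; simp only: group_algebra_space group_algebra_simps(1))+

lemma group_algebra_comult: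
  "comult (group_algebra G) = lin_extend (tensor_space (group_algebra G) (group_algebra G))
     (\<lambda>g. pure_tensor (group_algebra G) (group_algebra G) (basis_vec g) (basis_vec g))"
  unfolding group_algebra_tensor by (simp add: group_algebra_def Let_def module.defs hopf.defs)

lemma linear_map_group_algebra [simp]:
  "linear_map (group_algebra G) W f \<longleftrightarrow> linear_map (free_space (carrier G)) W f"
  "linear_map V (group_algebra G) g \<longleftrightarrow> linear_map V (free_space (carrier G)) g"
  by (simp_all add: linear_map_def)

lemma lin_extend_group_algebra [simp]:
  "lin_extend (group_algebra G) = lin_extend (free_space (carrier G))"
  by (rule lin_extend_cong_space) (simp_all only: group_algebra_space group_algebra_simps free_space_simps)

context
  fixes G :: "'g monoid"
  assumes G: "Group.group G"
begin

interpretation G: Group.group G by (rule G)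

lemma group_algebra_mult_basis [simp]:
  assumes "g \<in> carrier G" "h \<in> carrier G"
  shows "basis_vec g \<otimes>\<^bsub>group_algebra G\<^esub> basis_vec h = (basis_vec (g \<otimes>\<^bsub>G\<^esub> h) :: 'g \<Rightarrow>\<^sub>0 'k::field)"
  using assms by simp

lemma vs_group_algebra [simp]: "vector_space_rec (group_algebra G :: ('k::field, 'g \<Rightarrow>\<^sub>0 'k) hopf)"
proof -
  have F: "vector_space_rec (free_space (carrier G) :: ('k, 'g \<Rightarrow>\<^sub>0 'k) module)" by simp
  show ?thesis
    using vs_closed[OF F] vs_add[OF F] vs_zero[OF F] vs_smult[OF F]
    by (intro vector_space_recI) (simp_all only: group_algebra_space group_algebra_simps(1,2) free_space_simps(2))
qed

lemma group_algebra_spanned: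
  "spanned_by (group_algebra G :: ('k::field, 'g \<Rightarrow>\<^sub>0 'k) hopf) (carrier G) basis_vec"
  by (auto simp: spanned_by_def image_iff lin_extend_basis_vec[of _ "carrier G", simplified])

lemma group_algebra_bilinear:
  "bilinear_map (group_algebra G) (group_algebra G) (group_algebra G)
     (\<otimes>\<^bsub>(group_algebra G :: ('k::field, 'g \<Rightarrow>\<^sub>0 'k) hopf)\<^esub>)"
proof (intro bilinear_mapI; unfold linear_map_group_algebra group_algebra_simps(6))
  let ?F = "free_space (carrier G) :: ('k, 'g \<Rightarrow>\<^sub>0 'k) module"
  have in_lin: "linear_map ?F ?F (lin_extend ?F (\<lambda>h. basis_vec (g \<otimes>\<^bsub>G\<^esub> h)))" if "g \<in> carrier G" for g
    using that by (intro linear_intros) auto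
  show "linear_map ?F ?F (\<lambda>w. lin_extend ?F (\<lambda>g. lin_extend ?F (\<lambda>h. basis_vec (g \<otimes>\<^bsub>G\<^esub> h)) w) v)"
    if "v \<in> carrier (group_algebra G)" for v :: "'g \<Rightarrow>\<^sub>0 'k"
    using that in_lin by (intro linear_map_lin_extend[where X = "carrier G"]) simp_all
  show "linear_map ?F ?F (\<lambda>v. lin_extend ?F (\<lambda>g. lin_extend ?F (\<lambda>h. basis_vec (g \<otimes>\<^bsub>G\<^esub> h)) w) v)"
    if "w \<in> carrier (group_algebra G)" for w :: "'g \<Rightarrow>\<^sub>0 'k"
    using that linear_mapD(1)[OF in_lin] by (intro linear_intros) simp_all
qed

lemma group_algebra_assoc: "assoc_algebra (group_algebra G :: ('k::field, 'g \<Rightarrow>\<^sub>0 'k) hopf)"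
proof (rule assoc_algebraI[OF vs_group_algebra group_algebra_bilinear])
  let ?A = "group_algebra G :: ('k, 'g \<Rightarrow>\<^sub>0 'k) hopf"
  note L = bilinear_mapD(1)[OF group_algebra_bilinear] and R = bilinear_mapD(2)[OF group_algebra_bilinear]
  note sp = linear_map_span_eq[OF vs_group_algebra vs_group_algebra group_algebra_spanned]
  have bv: "basis_vec g \<in> carrier ?A" if "g \<in> carrier G" for g using that by simp
  show 1: "\<one>\<^bsub>?A\<^esub> \<in> carrier ?A" by simp
  show "\<one>\<^bsub>?A\<^esub> \<otimes>\<^bsub>?A\<^esub> x = x" if x: "x \<in> carrier ?A" for x
    by (rule sp[OF L[OF 1] linear_map_id _ x]) simp
  show "x \<otimes>\<^bsub>?A\<^esub> \<one>\<^bsub>?A\<^esub> = x" if x: "x \<in> carrier ?A" for x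
    by (rule sp[OF R[OF 1] linear_map_id _ x]) simp
  note mc = bilinear_mapD(3)[OF group_algebra_bilinear]
  show "x \<otimes>\<^bsub>?A\<^esub> y \<otimes>\<^bsub>?A\<^esub> z = x \<otimes>\<^bsub>?A\<^esub> (y \<otimes>\<^bsub>?A\<^esub> z)"
    if x: "x \<in> carrier ?A" and y: "y \<in> carrier ?A" and z: "z \<in> carrier ?A" for x y z
  proof (rule sp[OF linear_map_comp[OF R[OF z] R[OF y]] R[OF mc[OF y z]] _ x])
    fix g assume g: "g \<in> carrier G"
    show "basis_vec g \<otimes>\<^bsub>?A\<^esub> y \<otimes>\<^bsub>?A\<^esub> z = basis_vec g \<otimes>\<^bsub>?A\<^esub> (y \<otimes>\<^bsub>?A\<^esub> z)"
    proof (rule sp[OF linear_map_comp[OF R[OF z] L[OF bv[OF g]]] linear_map_comp[OF L[OF bv[OF g]] R[OF z]] _ y])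
      fix h assume h: "h \<in> carrier G"
      show "basis_vec g \<otimes>\<^bsub>?A\<^esub> basis_vec h \<otimes>\<^bsub>?A\<^esub> z = basis_vec g \<otimes>\<^bsub>?A\<^esub> (basis_vec h \<otimes>\<^bsub>?A\<^esub> z)"
      proof (rule sp[OF L[OF mc[OF bv[OF g] bv[OF h]]] linear_map_comp[OF L[OF bv[OF g]] L[OF bv[OF h]]] _ z])
        fix k assume k: "k \<in> carrier G"
        show "basis_vec g \<otimes>\<^bsub>?A\<^esub> basis_vec h \<otimes>\<^bsub>?A\<^esub> basis_vec k
          = basis_vec g \<otimes>\<^bsub>?A\<^esub> (basis_vec h \<otimes>\<^bsub>?A\<^esub> basis_vec k)"
          using g h k by (simp only: group_algebra_mult_basis G.m_closed G.m_assoc)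
      qed
    qed
  qed
qed

lemma group_algebra_linear:
  "linear_map (group_algebra G) (tensor_space (group_algebra G) (group_algebra G))
     (comult (group_algebra G :: ('k::field, 'g \<Rightarrow>\<^sub>0 'k) hopf))"
  "linear_map (group_algebra G) scalars (counit (group_algebra G :: ('k::field, 'g \<Rightarrow>\<^sub>0 'k) hopf))"
  "linear_map (group_algebra G) (group_algebra G) (antipode (group_algebra G :: ('k::field, 'g \<Rightarrow>\<^sub>0 'k) hopf))"
  unfolding linear_map_group_algebra group_algebra_comult group_algebra_simps(7,8)
  by (intro linear_intros; simp)+

lemma group_algebra_grouplike:
  "g \<in> carrier G \<Longrightarrow> grouplike (group_algebra G :: ('k::field, 'g \<Rightarrow>\<^sub>0 'k) hopf) (basis_vec g)"
  unfolding grouplike_def group_algebra_comult by simp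

lemma group_algebra_hopf: "hopf_algebra (group_algebra G :: ('k::field, 'g \<Rightarrow>\<^sub>0 'k) hopf)"
proof (rule hopf_algebra_of_grouplikes[OF group_algebra_assoc group_algebra_spanned group_algebra_linear])
  let ?A = "group_algebra G :: ('k, 'g \<Rightarrow>\<^sub>0 'k) hopf"
  show "grouplike ?A (basis_vec g)" if "g \<in> carrier G" for g by (rule group_algebra_grouplike[OF that])
  show "grouplike ?A \<one>\<^bsub>?A\<^esub>" using group_algebra_grouplike[OF G.one_closed] by simp
  show "grouplike ?A (basis_vec g \<otimes>\<^bsub>?A\<^esub> basis_vec h)" if "g \<in> carrier G" "h \<in> carrier G" for g h
    unfolding group_algebra_mult_basis[OF that] using that by (intro group_algebra_grouplike) simp
  have S: "antipode ?A (basis_vec g) = basis_vec (inv\<^bsub>G\<^esub> g)" if "g \<in> carrier G" for g using that by simp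
  show "antipode ?A (basis_vec g) \<otimes>\<^bsub>?A\<^esub> basis_vec g = \<one>\<^bsub>?A\<^esub>" "basis_vec g \<otimes>\<^bsub>?A\<^esub> antipode ?A (basis_vec g) = \<one>\<^bsub>?A\<^esub>"
    if "g \<in> carrier G" for g
    unfolding S[OF that] using that by (simp_all only: group_algebra_mult_basis G.inv_closed G.l_inv G.r_inv group_algebra_simps(5))
qed

text \<open>
  The universal property of the group algebra.  Compatibility with the antipodes is automatic:
  \<open>S (\<phi> g)\<close> and \<open>\<phi> (inv g)\<close> are both inverse to \<open>\<phi> g\<close>.
\<close>

lemma group_algebra_hom:
  fixes L :: "('k::field, 'a) hopf"
  assumes L: "hopf_algebra L" and gl: "\<And>g. g \<in> carrier G \<Longrightarrow> grouplike L (\<phi> g)"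
    and mult: "\<And>g h. g \<in> carrier G \<Longrightarrow> h \<in> carrier G \<Longrightarrow> \<phi> (g \<otimes>\<^bsub>G\<^esub> h) = \<phi> g \<otimes>\<^bsub>L\<^esub> \<phi> h"
    and one: "\<phi> \<one>\<^bsub>G\<^esub> = \<one>\<^bsub>L\<^esub>"
  shows "hopf_hom (group_algebra G) L (lin_extend L \<phi>)"
proof -
  let ?A = "group_algebra G :: ('k, 'g \<Rightarrow>\<^sub>0 'k) hopf" and ?f = "lin_extend L \<phi>"
  have vs[simp]: "vector_space_rec L" using L by (rule hopf_vs)
  have La: "assoc_algebra L" using hopf_assoc_algebra(1)[OF L] .
  have \<phi>[simp]: "\<phi> g \<in> carrier L" "comult L (\<phi> g) = pure_tensor L L (\<phi> g) (\<phi> g)" "counit L (\<phi> g) = 1"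
    if "g \<in> carrier G" for g using gl[OF that] by (simp_all add: grouplike_def)
  have f: "linear_map ?A L ?f" unfolding linear_map_group_algebra by (intro linear_intros) simp_all
  have fb: "?f (basis_vec g) = \<phi> g" if "g \<in> carrier G" for g using that by simp
  have A: "assoc_algebra ?A" by (rule group_algebra_assoc)
  note hA = group_algebra_hopf[where 'k = 'k]
  note sp = linear_map_span_eq[OF vs_group_algebra _ group_algebra_spanned]
  note L' = bilinear_mapD(1)[OF group_algebra_bilinear] and R' = bilinear_mapD(2)[OF group_algebra_bilinear]
  have bv: "basis_vec g \<in> carrier ?A" if "g \<in> carrier G" for g using that by simp
  have fc: "?f x \<in> carrier L" if "x \<in> carrier ?A" for x by (rule linear_mapD(1)[OF f that])
  have m: "?f (x \<otimes>\<^bsub>?A\<^esub> y) = ?f x \<otimes>\<^bsub>L\<^esub> ?f y" if x: "x \<in> carrier ?A" and y: "y \<in> carrier ?A" for x y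
  proof (rule sp[OF vs linear_map_comp[OF f R'[OF y]] linear_map_mult(2)[OF La fc[OF y] f] _ x])
    fix g assume g: "g \<in> carrier G"
    show "?f (basis_vec g \<otimes>\<^bsub>?A\<^esub> y) = ?f (basis_vec g) \<otimes>\<^bsub>L\<^esub> ?f y"
    proof (rule sp[OF vs linear_map_comp[OF f L'[OF bv[OF g]]] linear_map_mult(1)[OF La fc[OF bv[OF g]] f] _ y])
      fix h assume h: "h \<in> carrier G"
      show "?f (basis_vec g \<otimes>\<^bsub>?A\<^esub> basis_vec h) = ?f (basis_vec g) \<otimes>\<^bsub>L\<^esub> ?f (basis_vec h)"
        using g h by (simp only: group_algebra_mult_basis fb G.m_closed mult)
    qed
  qed
  have "?f \<in> ring_hom ?A L"
    using fc by (intro ring_hom_memI) (simp_all only: m linear_mapD(2)[OF f] group_algebra_simps(5) fb[OF G.one_closed] one)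
  moreover have "comult L (?f h) = tensor_lift (tensor_space L L) (\<lambda>a b. pure_tensor L L (?f a) (?f b)) (comult ?A h)"
    if h: "h \<in> carrier ?A" for h
    unfolding tensor_map_def[symmetric]
  proof (rule sp[OF _ linear_map_comp[OF comult_linear[OF L] f]
        linear_map_comp[OF tensor_map_linear comult_linear[OF hA]] _ h])
    fix g assume g: "g \<in> carrier G"
    have "comult ?A (basis_vec g) = pure_tensor ?A ?A (basis_vec g) (basis_vec g)"
      using group_algebra_grouplike[OF g] unfolding grouplike_def by blast
    then show "comult L (?f (basis_vec g)) = tensor_map L L ?f ?f (comult ?A (basis_vec g))"
      using g f by (simp only: fb \<phi> tensor_map_pure[OF vs_group_algebra vs_group_algebra vs vs f f bv bv])
  qed (use f in \<open>simp_all del: linear_map_group_algebra\<close>)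
  moreover have "counit L (?f h) = counit ?A h" if h: "h \<in> carrier ?A" for h
    by (rule sp[OF vs_scalars linear_map_comp[OF counit_linear[OF L] f] counit_linear[OF hA] _ h]) simp
  moreover have "antipode L (?f h) = ?f (antipode ?A h)" if h: "h \<in> carrier ?A" for h
  proof (rule sp[OF vs linear_map_comp[OF antipode_linear[OF L] f] linear_map_comp[OF f antipode_linear[OF hA]] _ h])
    fix g assume g: "g \<in> carrier G"
    have bl: "bilinear_map L L L (\<lambda>a b. antipode L a \<otimes>\<^bsub>L\<^esub> b)"
      by (intro bilinear_mapI linear_map_mult[OF La] linear_map_id antipode_linear[OF L] hopf_closed[OF L])
    have "antipode L (\<phi> g) \<otimes>\<^bsub>L\<^esub> \<phi> g = \<one>\<^bsub>L\<^esub>"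
      using sweedler_antipode(1)[OF L, of "\<phi> g"] g
      by (simp add: tensor_lift_pure[OF vs vs vs bl] algebra_one_closed[OF La])
    then have "antipode L (\<phi> g) \<otimes>\<^bsub>L\<^esub> \<phi> g \<otimes>\<^bsub>L\<^esub> \<phi> (inv\<^bsub>G\<^esub> g) = \<phi> (inv\<^bsub>G\<^esub> g)"
      using g by (simp add: algebra_one[OF La])
    moreover have "\<phi> g \<otimes>\<^bsub>L\<^esub> \<phi> (inv\<^bsub>G\<^esub> g) = \<one>\<^bsub>L\<^esub>" using g by (simp add: mult[symmetric] one)
    ultimately have "antipode L (\<phi> g) = \<phi> (inv\<^bsub>G\<^esub> g)"
      using g by (simp add: algebra_assoc[OF La] algebra_one[OF La] hopf_closed[OF L])
    then show "antipode L (?f (basis_vec g)) = ?f (antipode ?A (basis_vec g))" using g by simp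
  qed
  ultimately show ?thesis using L hA f by (simp add: hopf_hom_def alg_hom_def)
qed

end

section \<open>Grouplike elements\<close>

context
  fixes L :: "('k::field, 'a) hopf"
  assumes L: "hopf_algebra L"
begin

lemma grouplikeD:
  assumes "grouplike L g"
  shows "g \<in> carrier L" "comult L g = pure_tensor L L g g" "counit L g = 1"
  using assms by (simp_all add: grouplike_def)

lemma grouplike_one: "grouplike L \<one>\<^bsub>L\<^esub>"
  using L by (simp add: grouplike_def comult_one counit_one algebra_one_closed[OF hopf_assoc_algebra(1)])

lemma grouplike_mult: "grouplike L g \<Longrightarrow> grouplike L h \<Longrightarrow> grouplike L (g \<otimes>\<^bsub>L\<^esub> h)"
  using L hopf_assoc_algebra(1)[OF L]
  by (simp add: grouplike_def comult_mult counit_mult)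

text \<open>
  On a grouplike element the antipode axiom reads \<open>S g g = 1 = g S g\<close>.
\<close>

lemma grouplike_antipode:
  assumes g: "grouplike L g"
  shows "grouplike L (antipode L g)" "antipode L g \<otimes>\<^bsub>L\<^esub> g = \<one>\<^bsub>L\<^esub>" "g \<otimes>\<^bsub>L\<^esub> antipode L g = \<one>\<^bsub>L\<^esub>"
proof -
  note gD = grouplikeD[OF g]
  have a: "assoc_algebra L" using hopf_assoc_algebra(1)[OF L] .
  have vs: "vector_space_rec L" using L by (rule hopf_vs)
  have b: "bilinear_map L L L (\<lambda>a b. antipode L a \<otimes>\<^bsub>L\<^esub> b)" "bilinear_map L L L (\<lambda>a b. a \<otimes>\<^bsub>L\<^esub> antipode L b)"
    "bilinear_map L L (tensor_space L L) (\<lambda>a b. pure_tensor L L (antipode L b) (antipode L a))"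
    by (intro bilinear_mapI linear_intros L a vs hopf_closed[OF L]; assumption)+
  show "antipode L g \<otimes>\<^bsub>L\<^esub> g = \<one>\<^bsub>L\<^esub>" "g \<otimes>\<^bsub>L\<^esub> antipode L g = \<one>\<^bsub>L\<^esub>"
    using sweedler_antipode[OF L gD(1)] gD
    by (simp_all add: tensor_lift_pure[OF vs vs vs b(1)] tensor_lift_pure[OF vs vs vs b(2)] vs algebra_one_closed[OF a])
  show "grouplike L (antipode L g)"
    using gD antipode_comult[OF L gD(1)] antipode_counit[OF L gD(1)] hopf_closed(2)[OF L gD(1)]
    by (simp add: grouplike_def tensor_lift_pure[OF vs vs _ b(3)] vs)
qed

lemma group_units_hopf: "Group.group (units_of L)"
  using algebra_ring[OF hopf_assoc_algebra(1)[OF L]] by (intro monoid.units_group ring.is_monoid)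

lemma grouplike_unit: "grouplike L g \<Longrightarrow> g \<in> Units L"
  using grouplike_antipode[of g] grouplikeD(1) hopf_closed(2)[OF L] by (auto simp: Units_def)

lemma grouplike_inv:
  assumes "grouplike L g" shows "inv\<^bsub>units_of L\<^esub> g = antipode L g"
  using grouplike_antipode[OF assms] grouplike_unit assms
  by (intro group.inv_equality[OF group_units_hopf]) (simp_all add: units_of_def)

lemma grouplikes_subgroup: "subgroup {g. grouplike L g} (units_of L)"
proof (rule group.subgroupI[OF group_units_hopf])
  show "{g. grouplike L g} \<subseteq> carrier (units_of L)" using grouplike_unit by (auto simp: units_of_def)
  show "{g. grouplike L g} \<noteq> {}" using grouplike_one by blast
  show "inv\<^bsub>units_of L\<^esub> a \<in> {g. grouplike L g}" if "a \<in> {g. grouplike L g}" for a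
    using that grouplike_antipode(1) by (simp add: grouplike_inv)
  show "a \<otimes>\<^bsub>units_of L\<^esub> b \<in> {g. grouplike L g}" if "a \<in> {g. grouplike L g}" "b \<in> {g. grouplike L g}" for a b
    using that grouplike_mult by (simp add: units_of_def)
qed

end

section \<open>Quotients by Hopf ideals\<close>

lemma ideal_of_subspace:
  assumes K: "assoc_algebra K" and J: "subspace_rec K J"
    and l: "\<And>a x. a \<in> J \<Longrightarrow> x \<in> carrier K \<Longrightarrow> x \<otimes>\<^bsub>K\<^esub> a \<in> J"
    and r: "\<And>a x. a \<in> J \<Longrightarrow> x \<in> carrier K \<Longrightarrow> a \<otimes>\<^bsub>K\<^esub> x \<in> J"
  shows "ideal J K"
  using J l r by (intro idealI algebra_ring[OF K]) (auto simp: submodule_def)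

text \<open>
  Closed under scalars because \<open>c x = (c 1) x\<close>.
\<close>

lemma ideal_subspace:
  assumes K: "assoc_algebra K" and J: "ideal J K"
  shows "subspace_rec K J"
proof (rule subspace_recI)
  interpret ideal J K by (rule J)
  have vs: "vector_space_rec K" using K by simp
  show "vector_space_rec K" by fact
  show "J \<subseteq> carrier K" using a_subset .
  show "\<zero>\<^bsub>K\<^esub> \<in> J" by simp
  show "x \<oplus>\<^bsub>K\<^esub> y \<in> J" if "x \<in> J" "y \<in> J" for x y using that by simp
  show "c \<odot>\<^bsub>K\<^esub> x \<in> J" if x: "x \<in> J" for c x
  proof -
    have xc: "x \<in> carrier K" using x a_Hcarr by simp
    have "(c \<odot>\<^bsub>K\<^esub> \<one>\<^bsub>K\<^esub>) \<otimes>\<^bsub>K\<^esub> x \<in> J" using x vs by (intro I_l_closed) (simp_all add: vs_closed(3))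
    then show ?thesis using xc K by (simp add: algebra_smult)
  qed
qed

lemma kernel_ideal:
  assumes K: "assoc_algebra K" and L: "assoc_algebra L" and f: "linear_map K L f"
    and mult: "\<And>x y. x \<in> carrier K \<Longrightarrow> y \<in> carrier K \<Longrightarrow> f (x \<otimes>\<^bsub>K\<^esub> y) = f x \<otimes>\<^bsub>L\<^esub> f y"
  shows "ideal {h \<in> carrier K. f h = \<zero>\<^bsub>L\<^esub>} K"
  using K L linear_mapD(1)[OF f]
  by (intro ideal_of_subspace K linear_map_kernel f) (simp_all add: mult)

lemma quotient_assoc_algebra:
  assumes K: "assoc_algebra K" and I: "ideal I K"
  shows "assoc_algebra (quotient_module K I)"
    and "x \<in> carrier K \<Longrightarrow> y \<in> carrier K \<Longrightarrow>
      (I +>\<^bsub>K\<^esub> x) \<otimes>\<^bsub>quotient_module K I\<^esub> (I +>\<^bsub>K\<^esub> y) = I +>\<^bsub>K\<^esub> (x \<otimes>\<^bsub>K\<^esub> y)"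
proof -
  interpret ideal I K by (rule I)
  let ?Q = "quotient_module K I"
  have vs: "vector_space_rec K" using K by simp
  have sub: "subspace_rec K I" by (rule ideal_subspace[OF K I])
  show m: "(I +>\<^bsub>K\<^esub> x) \<otimes>\<^bsub>?Q\<^esub> (I +>\<^bsub>K\<^esub> y) = I +>\<^bsub>K\<^esub> (x \<otimes>\<^bsub>K\<^esub> y)"
    if "x \<in> carrier K" "y \<in> carrier K" for x y
    using rcoset_mult_add[OF that] by (simp add: quotient_module_simps(5))
  note L = linear_mapD[OF bilinear_mapD(1)[OF algebra_mult_bilinear[OF K]]]
    and R = linear_mapD[OF bilinear_mapD(2)[OF algebra_mult_bilinear[OF K]]]
  note p = coset_add[OF vs sub] coset_smult[OF vs sub] m quotient_module_simps(1,3)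
  show "assoc_algebra ?Q"
  proof (rule assoc_algebraI[OF vs_quotient_module[OF vs sub]])
    show "bilinear_map ?Q ?Q ?Q (\<otimes>\<^bsub>?Q\<^esub>)"
      using vs by (intro bilinear_mapI linear_mapI) (auto simp: p L R)
    show "\<one>\<^bsub>?Q\<^esub> \<in> carrier ?Q" by (simp add: p)
    show "\<one>\<^bsub>?Q\<^esub> \<otimes>\<^bsub>?Q\<^esub> a = a" "a \<otimes>\<^bsub>?Q\<^esub> \<one>\<^bsub>?Q\<^esub> = a" if "a \<in> carrier ?Q" for a using that by (auto simp: p)
    show "a \<otimes>\<^bsub>?Q\<^esub> b \<otimes>\<^bsub>?Q\<^esub> c = a \<otimes>\<^bsub>?Q\<^esub> (b \<otimes>\<^bsub>?Q\<^esub> c)"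
      if abc: "a \<in> carrier ?Q" "b \<in> carrier ?Q" "c \<in> carrier ?Q" for a b c
    proof -
      obtain x y z where "x \<in> carrier K" "y \<in> carrier K" "z \<in> carrier K"
        "a = I +>\<^bsub>K\<^esub> x" "b = I +>\<^bsub>K\<^esub> y" "c = I +>\<^bsub>K\<^esub> z"
        using abc by (auto simp: p)
      then show ?thesis by (simp add: m m_assoc)
    qed
  qed
qed

text \<open>
  The first condition is \<open>\<Delta> I \<subseteq> I \<otimes> K + K \<otimes> I\<close>, stated as the vanishing of \<open>\<Delta> I\<close> in the tensor square of
  the quotient, which is the form in which it makes the induced comultiplication well defined.
\<close>

definition hopf_ideal :: "('k::field, 'a) hopf \<Rightarrow> 'a set \<Rightarrow> bool" where
  "hopf_ideal K I \<longleftrightarrow> ideal I K \<and>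
     (\<forall>h\<in>I. tensor_map (quotient_module K I) (quotient_module K I) (\<lambda>x. I +>\<^bsub>K\<^esub> x) (\<lambda>x. I +>\<^bsub>K\<^esub> x) (comult K h)
        = \<zero>\<^bsub>tensor_space (quotient_module K I) (quotient_module K I)\<^esub> \<and>
       counit K h = 0 \<and> antipode K h \<in> I)"

context
  fixes K :: "('k::field, 'a) hopf" and I Q p
  assumes K: "hopf_algebra K" and I: "hopf_ideal K I"
  defines "Q \<equiv> quotient_hopf K I" and "p \<equiv> \<lambda>x. I +>\<^bsub>K\<^esub> x"
begin

lemma quotient_hopf_space:
  "carrier (quotient_hopf K I) = carrier (quotient_module K I)"
  "ring.add (quotient_hopf K I) = ring.add (quotient_module K I)"
  "ring.zero (quotient_hopf K I) = ring.zero (quotient_module K I)"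
  "module.smult (quotient_hopf K I) = module.smult (quotient_module K I)"
  "monoid.mult (quotient_hopf K I) = monoid.mult (quotient_module K I)"
  "monoid.one (quotient_hopf K I) = monoid.one (quotient_module K I)"
  by (simp_all add: quotient_hopf_def Let_def module.defs hopf.defs)

lemma quotient_hopf_tensor:
  "tensor_space (quotient_module K I) (quotient_module K I) = tensor_space Q Q"
  "pure_tensor (quotient_module K I) (quotient_module K I) = pure_tensor Q Q"
  unfolding Q_def by (rule tensor_space_cong; simp only: quotient_hopf_space)+

lemma quotient_hopf_carrier: "carrier Q = p ` carrier K"
  unfolding Q_def p_def quotient_hopf_space quotient_module_simps ..

lemma quotient_hopf_algebra: "assoc_algebra Q"
proof -
  have a: "assoc_algebra (quotient_module K I)"
    using I K by (intro quotient_assoc_algebra(1)) (simp_all add: hopf_ideal_def)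
  then have vs: "vector_space_rec (quotient_module K I)" by simp
  note B = algebra_mult_bilinear[OF a]
  have "vector_space_rec Q"
    using vs_closed[OF vs] vs_add[OF vs] vs_zero[OF vs] vs_smult[OF vs]
    by (intro vector_space_recI) (simp_all only: Q_def quotient_hopf_space)
  moreover have "bilinear_map Q Q Q (\<otimes>\<^bsub>Q\<^esub>)"
    using B unfolding bilinear_map_def linear_map_def Q_def quotient_hopf_space by simp
  ultimately show ?thesis
    using algebra_one_closed[OF a] algebra_one[OF a] algebra_assoc[OF a]
    by (intro assoc_algebraI) (simp_all only: Q_def quotient_hopf_space)
qed

lemma quotient_hopf_vs: "vector_space_rec Q"
  using quotient_hopf_algebra by simp

lemma hopf_ideal_subspace: "subspace_rec K I"
  using I K by (intro ideal_subspace) (simp_all add: hopf_ideal_def)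

lemma linear_map_quotient_hopf:
  "linear_map (quotient_module K I) W f \<longleftrightarrow> linear_map Q W f"
  "linear_map U (quotient_module K I) g \<longleftrightarrow> linear_map U Q g"
  by (simp_all only: linear_map_def Q_def quotient_hopf_space)

lemma quotient_hopf_proj: "linear_map K Q p"
  unfolding linear_map_quotient_hopf[symmetric] p_def
  by (rule quotient_map_linear[OF hopf_vs[OF K] hopf_ideal_subspace])

lemma quotient_hopf_mult:
  "x \<in> carrier K \<Longrightarrow> y \<in> carrier K \<Longrightarrow> p (x \<otimes>\<^bsub>K\<^esub> y) = p x \<otimes>\<^bsub>Q\<^esub> p y"
  unfolding Q_def p_def quotient_hopf_space
  using I K by (intro quotient_assoc_algebra(2)[symmetric]) (simp_all add: hopf_ideal_def)

lemma quotient_hopf_one: "p \<one>\<^bsub>K\<^esub> = \<one>\<^bsub>Q\<^esub>"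
  unfolding Q_def p_def quotient_hopf_space quotient_module_simps ..

lemma quotient_hopf_ops:
  "linear_map Q (tensor_space Q Q) (comult Q)"
  "x \<in> carrier K \<Longrightarrow> comult Q (p x) = tensor_map Q Q p p (comult K x)"
  "linear_map Q scalars (counit Q)"
  "x \<in> carrier K \<Longrightarrow> counit Q (p x) = counit K x"
  "linear_map Q Q (antipode Q)"
  "x \<in> carrier K \<Longrightarrow> antipode Q (p x) = p (antipode K x)"
proof -
  let ?M = "quotient_module K I"
  note vs = hopf_vs[OF K] note sub = hopf_ideal_subspace
  note QQ = vs_tensor_space[OF quotient_hopf_vs quotient_hopf_vs]
  note fac = quotient_factor_linear[OF vs sub, folded p_def]
  have c: "comult Q = (\<lambda>A. the_elem ((\<lambda>h. tensor_map Q Q p p (comult K h)) ` A))"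
    unfolding tensor_map_def quotient_hopf_tensor[symmetric] p_def
    by (simp add: Q_def quotient_hopf_def Let_def module.defs hopf.defs)
  have cl: "linear_map K (tensor_space Q Q) (\<lambda>h. tensor_map Q Q p p (comult K h))"
    by (rule linear_map_comp[OF tensor_map_linear[OF vs vs quotient_hopf_vs quotient_hopf_vs
          quotient_hopf_proj quotient_hopf_proj] comult_linear[OF K]])
  have c0: "tensor_map Q Q p p (comult K h) = \<zero>\<^bsub>tensor_space Q Q\<^esub>" if "h \<in> I" for h
    using I that unfolding hopf_ideal_def tensor_map_def quotient_hopf_tensor p_def by blast
  show "linear_map Q (tensor_space Q Q) (comult Q)"
    unfolding c linear_map_quotient_hopf[symmetric] by (rule fac(1)[OF QQ cl]) (rule c0)
  show "x \<in> carrier K \<Longrightarrow> comult Q (p x) = tensor_map Q Q p p (comult K x)"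
    unfolding c by (rule fac(2)[OF QQ cl]) (rule c0)
  have e: "counit Q = (\<lambda>A. the_elem (counit K ` A))"
    by (simp add: Q_def quotient_hopf_def Let_def module.defs hopf.defs)
  have e0: "counit K h = \<zero>\<^bsub>scalars\<^esub>" if "h \<in> I" for h using I that by (simp add: hopf_ideal_def)
  show "linear_map Q scalars (counit Q)"
    unfolding e linear_map_quotient_hopf[symmetric] by (rule fac(1)[OF vs_scalars counit_linear[OF K]]) (rule e0)
  show "x \<in> carrier K \<Longrightarrow> counit Q (p x) = counit K x"
    unfolding e by (rule fac(2)[OF vs_scalars counit_linear[OF K]]) (rule e0)
  have a: "antipode Q = (\<lambda>A. the_elem ((\<lambda>h. p (antipode K h)) ` A))"
    by (simp add: Q_def p_def quotient_hopf_def Let_def module.defs hopf.defs)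
  have al: "linear_map K Q (\<lambda>h. p (antipode K h))"
    by (rule linear_map_comp[OF quotient_hopf_proj antipode_linear[OF K]])
  have a0: "p (antipode K h) = \<zero>\<^bsub>Q\<^esub>" if "h \<in> I" for h
  proof -
    have S: "antipode K h \<in> I" using I that by (simp add: hopf_ideal_def)
    then have "I +>\<^bsub>K\<^esub> antipode K h = I"
      using coset_in_null_iff[OF vs sub] subspace_recD(1)[OF vs sub] by blast
    then show ?thesis by (simp add: p_def Q_def quotient_hopf_space quotient_module_simps(2))
  qed
  show "linear_map Q Q (antipode Q)"
    unfolding a linear_map_quotient_hopf(1)[symmetric] by (rule fac(1)[OF quotient_hopf_vs al]) (rule a0)
  show "x \<in> carrier K \<Longrightarrow> antipode Q (p x) = p (antipode K x)"
    unfolding a by (rule fac(2)[OF quotient_hopf_vs al]) (rule a0)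
qed

lemma quotient_sweedler:
  assumes "vector_space_rec W" "bilinear_map Q Q W \<beta>" "x \<in> carrier K"
  shows "tensor_lift W \<beta> (comult Q (p x)) = tensor_lift W (\<lambda>a b. \<beta> (p a) (p b)) (comult K x)"
  using assms hopf_vs[OF K] quotient_hopf_vs hopf_closed[OF K]
  by (simp add: quotient_hopf_ops tensor_lift_tensor_map[OF _ _ _ _ quotient_hopf_proj quotient_hopf_proj])

text \<open>
  Every element of the quotient is some \<open>p h\<close>, and by \<open>quotient_sweedler\<close> its Sweedler sums are computed
  from those of \<open>h\<close>; each axiom is thus the image under \<open>p\<close> of the axiom for \<open>h\<close>.
\<close>

lemma quotient_hopf_hopf_algebra: "hopf_algebra Q"
proof -
  have Qa[simp]: "assoc_algebra Q" by (rule quotient_hopf_algebra)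
  have vs[simp]: "vector_space_rec Q" "vector_space_rec K" using quotient_hopf_vs hopf_vs[OF K] .
  have Ka[simp]: "assoc_algebra K" by (rule hopf_assoc_algebra(1)[OF K])
  note pl = quotient_hopf_proj
  have pc[simp]: "p x \<in> carrier Q" if "x \<in> carrier K" for x by (rule linear_mapD(1)[OF pl that])
  have ex: "\<exists>h\<in>carrier K. y = p h" if "y \<in> carrier Q" for y using that quotient_hopf_carrier by auto
  note ops = quotient_hopf_ops
  note cl = linear_mapD(1)[OF ops(1)] linear_mapD(1)[OF ops(5)]
  show ?thesis
    unfolding hopf_algebra_def Let_def alg_hom_def linear_map_tensor_algebra
  proof (intro conjI ballI)
    show "comult Q \<in> ring_hom Q (tensor_algebra Q Q)"
    proof (rule ring_hom_memI)
      fix x y assume xy: "x \<in> carrier Q" "y \<in> carrier Q"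
      show "comult Q x \<in> carrier (tensor_algebra Q Q)" using xy by (simp add: cl)
      show "comult Q (x \<oplus>\<^bsub>Q\<^esub> y) = comult Q x \<oplus>\<^bsub>tensor_algebra Q Q\<^esub> comult Q y"
        using xy by (simp add: linear_mapD[OF ops(1)])
      obtain a b where ab: "a \<in> carrier K" "b \<in> carrier K" "x = p a" "y = p b" using ex xy by blast
      then have "comult Q (x \<otimes>\<^bsub>Q\<^esub> y) = tensor_map Q Q p p (comult K (a \<otimes>\<^bsub>K\<^esub> b))"
        by (simp add: quotient_hopf_mult[symmetric] ops)
      also have "\<dots> = tensor_map Q Q p p (comult K a) \<otimes>\<^bsub>tensor_algebra Q Q\<^esub> tensor_map Q Q p p (comult K b)"
        unfolding comult_mult[OF K ab(1,2)]
        using ab by (intro tensor_map_mult pl quotient_hopf_mult) (simp_all add: hopf_closed[OF K])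
      finally show "comult Q (x \<otimes>\<^bsub>Q\<^esub> y) = comult Q x \<otimes>\<^bsub>tensor_algebra Q Q\<^esub> comult Q y"
        using ab by (simp add: ops)
    next
      show "comult Q \<one>\<^bsub>Q\<^esub> = \<one>\<^bsub>tensor_algebra Q Q\<^esub>"
        using ops(2)[of "\<one>\<^bsub>K\<^esub>"]
        by (simp add: comult_one[OF K] tensor_map_pure[OF _ _ _ _ pl pl] quotient_hopf_one algebra_one_closed[OF Ka])
    qed
    show "counit Q \<in> ring_hom Q scalars"
    proof (rule ring_hom_memI)
      fix x y assume xy: "x \<in> carrier Q" "y \<in> carrier Q"
      show "counit Q (x \<oplus>\<^bsub>Q\<^esub> y) = counit Q x \<oplus>\<^bsub>scalars\<^esub> counit Q y"
        using xy by (simp add: linear_mapD[OF ops(3)])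
      obtain a b where "a \<in> carrier K" "b \<in> carrier K" "x = p a" "y = p b" using ex xy by blast
      then show "counit Q (x \<otimes>\<^bsub>Q\<^esub> y) = counit Q x \<otimes>\<^bsub>scalars\<^esub> counit Q y"
        by (simp add: quotient_hopf_mult[symmetric] ops counit_mult[OF K])
    next
      show "counit Q \<one>\<^bsub>Q\<^esub> = \<one>\<^bsub>scalars\<^esub>"
        using ops(4)[of "\<one>\<^bsub>K\<^esub>"]
        by (simp add: counit_one[OF K] quotient_hopf_one algebra_one_closed[OF Ka])
    qed simp
    show "linear_map Q (tensor_space Q Q) (comult Q)" "linear_map Q scalars (counit Q)" "linear_map Q Q (antipode Q)"
      by (rule ops)+
  next
    fix y assume "y \<in> carrier Q"
    then obtain h where h: "h \<in> carrier K" and y: "y = p h" using ex by blast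
    have bQ: "bilinear_map Q Q Q (\<lambda>a b. counit Q a \<odot>\<^bsub>Q\<^esub> b)" "bilinear_map Q Q Q (\<lambda>a b. counit Q b \<odot>\<^bsub>Q\<^esub> a)"
      "bilinear_map Q Q Q (\<lambda>a b. antipode Q a \<otimes>\<^bsub>Q\<^esub> b)" "bilinear_map Q Q Q (\<lambda>a b. a \<otimes>\<^bsub>Q\<^esub> antipode Q b)"
      by (intro bilinear_mapI linear_map_smult linear_map_smult_left linear_map_mult linear_map_id ops(3,5) Qa vs;
          simp add: cl)+
    have bK: "bilinear_map K K K (\<lambda>a b. antipode K a \<otimes>\<^bsub>K\<^esub> b)" "bilinear_map K K K (\<lambda>a b. a \<otimes>\<^bsub>K\<^esub> antipode K b)"
      by (intro bilinear_mapI linear_intros K; simp add: hopf_closed[OF K])+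
    have bp: "bilinear_map K K Q (\<lambda>a b. \<beta> (p a) (p b))" if "bilinear_map Q Q Q \<beta>" for \<beta>
      by (intro bilinear_mapI linear_map_bilinear[OF that] pl pc)
    note sw = quotient_sweedler[OF vs(1) _ h]
    show "tensor_lift Q (\<lambda>a b. counit Q a \<odot>\<^bsub>Q\<^esub> b) (comult Q y) = y"
      unfolding y sw[OF bQ(1)] using sweedler_counit(1)[OF K vs(1) pl h]
      by (simp add: sweedler_cong[OF K vs(1) bp[OF bQ(1)] h, where \<gamma> = "\<lambda>a b. counit K a \<odot>\<^bsub>Q\<^esub> p b"] ops)
    show "tensor_lift Q (\<lambda>a b. counit Q b \<odot>\<^bsub>Q\<^esub> a) (comult Q y) = y"
      unfolding y sw[OF bQ(2)] using sweedler_counit(2)[OF K vs(1) pl h]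
      by (simp add: sweedler_cong[OF K vs(1) bp[OF bQ(2)] h, where \<gamma> = "\<lambda>a b. counit K b \<odot>\<^bsub>Q\<^esub> p a"] ops)
    have p1: "p (counit K h \<odot>\<^bsub>K\<^esub> \<one>\<^bsub>K\<^esub>) = counit Q y \<odot>\<^bsub>Q\<^esub> \<one>\<^bsub>Q\<^esub>"
      unfolding y using h by (simp add: linear_mapD(3)[OF pl] quotient_hopf_one ops)
    show "tensor_lift Q (\<lambda>a b. antipode Q a \<otimes>\<^bsub>Q\<^esub> b) (comult Q y) = counit Q y \<odot>\<^bsub>Q\<^esub> \<one>\<^bsub>Q\<^esub>"
      unfolding p1[symmetric] sweedler_antipode(1)[OF K h, symmetric] sweedler_linear[OF K vs(2,1) bK(1) pl h]
      unfolding y sw[OF bQ(3)]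
      by (rule sweedler_cong[OF K vs(1) bp[OF bQ(3)] h]) (simp add: ops quotient_hopf_mult hopf_closed[OF K])
    show "tensor_lift Q (\<lambda>a b. a \<otimes>\<^bsub>Q\<^esub> antipode Q b) (comult Q y) = counit Q y \<odot>\<^bsub>Q\<^esub> \<one>\<^bsub>Q\<^esub>"
      unfolding p1[symmetric] sweedler_antipode(2)[OF K h, symmetric] sweedler_linear[OF K vs(2,1) bK(2) pl h]
      unfolding y sw[OF bQ(4)]
      by (rule sweedler_cong[OF K vs(1) bp[OF bQ(4)] h]) (simp add: ops quotient_hopf_mult hopf_closed[OF K])
    let ?W = "tensor_space Q (tensor_space Q Q)"
    let ?\<tau> = "\<lambda>a b c. pure_tensor Q (tensor_space Q Q) a (pure_tensor Q Q b c)"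
    have W: "vector_space_rec ?W" by simp
    have \<tau>1: "bilinear_map Q Q ?W (?\<tau> a)" if "a \<in> carrier Q" for a
      using that by (intro bilinear_mapI linear_map_pure_tensor linear_map_id) simp_all
    have \<tau>2: "bilinear_map Q Q ?W (\<lambda>a b. ?\<tau> a b c)" if "c \<in> carrier Q" for c
      using that by (intro bilinear_mapI linear_map_pure_tensor linear_map_id) simp_all
    have \<tau>1K: "bilinear_map K K ?W (\<lambda>b c. ?\<tau> (p a) (p b) (p c))" if "a \<in> carrier K" for a
      by (intro bilinear_mapI linear_map_bilinear[OF \<tau>1] pl pc that)
    have \<tau>2K: "bilinear_map K K ?W (\<lambda>a b. ?\<tau> (p a) (p b) (p c))" if "c \<in> carrier K" for c
      by (intro bilinear_mapI linear_map_bilinear[OF \<tau>2] pl pc that)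
    have o1: "bilinear_map Q Q ?W (\<lambda>a b. tensor_lift ?W (\<lambda>a' a''. ?\<tau> a' a'' b) (comult Q a))"
      by (intro bilinear_mapI linear_map_tensor_lift_fun[of Q Q] linear_map_tensor_lift[where A = Q and B = Q]
          \<tau>2 ops(1) linear_map_pure_tensor linear_map_id) (simp_all add: cl)
    have o2: "bilinear_map Q Q ?W (\<lambda>a b. pure_tensor Q (tensor_space Q Q) a (comult Q b))"
      by (intro bilinear_mapI linear_map_pure_tensor linear_map_id ops(1)) (simp_all add: cl)
    have "tensor_lift ?W (\<lambda>a b. tensor_lift ?W (\<lambda>a' a''. ?\<tau> a' a'' b) (comult Q a)) (comult Q y)
      = tensor_lift ?W (\<lambda>a b. tensor_lift ?W (\<lambda>a' a''. ?\<tau> a' a'' (p b)) (comult Q (p a))) (comult K h)"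
      unfolding y by (rule quotient_sweedler[OF W o1 h])
    also have "\<dots> = tensor_lift ?W (\<lambda>a b. tensor_lift ?W (\<lambda>a' a''. ?\<tau> (p a') (p a'') (p b)) (comult K a)) (comult K h)"
      by (rule sweedler_cong[OF K W _ h])
         (auto intro!: bilinear_mapI linear_map_bilinear[OF o1] pl quotient_sweedler[OF W \<tau>2])
    also have "\<dots> = tensor_lift ?W (\<lambda>a b. tensor_lift ?W (\<lambda>b' b''. ?\<tau> (p a) (p b') (p b'')) (comult K b)) (comult K h)"
      by (rule sweedler_coassoc[OF K W h \<tau>1K \<tau>2K])
    also have "\<dots> = tensor_lift ?W (\<lambda>a b. pure_tensor Q (tensor_space Q Q) (p a) (comult Q (p b))) (comult K h)"
    proof (rule sweedler_cong[OF K W _ h, symmetric])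
      show "bilinear_map K K ?W (\<lambda>a b. pure_tensor Q (tensor_space Q Q) (p a) (comult Q (p b)))"
        by (intro bilinear_mapI linear_map_bilinear[OF o2] pl pc)
      fix a b assume ab: "a \<in> carrier K" "b \<in> carrier K"
      have lin: "linear_map (tensor_space Q Q) ?W (\<lambda>T. pure_tensor Q (tensor_space Q Q) (p a) T)"
        using ab by (intro linear_map_pure_tensor linear_map_id) simp_all
      have "pure_tensor Q (tensor_space Q Q) (p a) (comult Q (p b))
        = tensor_lift ?W (\<lambda>b' b''. ?\<tau> (p a) b' b'') (comult Q (p b))"
        using linear_tensor_lift[OF vs(1,1) _ W pure_tensor_bilinear[OF vs(1,1)] lin, of "comult Q (p b)"]
          tensor_lift_id[OF vs(1,1), of "comult Q (p b)"] ab by (simp add: cl)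
      also have "\<dots> = tensor_lift ?W (\<lambda>b' b''. ?\<tau> (p a) (p b') (p b'')) (comult K b)"
        by (rule quotient_sweedler[OF W \<tau>1[OF pc[OF ab(1)]] ab(2)])
      finally show "pure_tensor Q (tensor_space Q Q) (p a) (comult Q (p b))
        = tensor_lift ?W (\<lambda>b' b''. ?\<tau> (p a) (p b') (p b'')) (comult K b)" .
    qed
    also have "\<dots> = tensor_lift ?W (\<lambda>a b. pure_tensor Q (tensor_space Q Q) a (comult Q b)) (comult Q y)"
      unfolding y by (rule quotient_sweedler[OF W o2 h, symmetric])
    finally show "tensor_lift ?W (\<lambda>a b. tensor_lift ?W (\<lambda>a' a''. ?\<tau> a' a'' b) (comult Q a)) (comult Q y)
      = tensor_lift ?W (\<lambda>a b. pure_tensor Q (tensor_space Q Q) a (comult Q b)) (comult Q y)" .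
  qed simp
qed

lemma quotient_hopf_hom: "hopf_hom K Q p"
  unfolding hopf_hom_def alg_hom_def
  using K quotient_hopf_hopf_algebra quotient_hopf_proj linear_mapD[OF quotient_hopf_proj]
  by (auto simp: quotient_hopf_ops tensor_map_def quotient_hopf_mult quotient_hopf_one intro!: ring_hom_memI)

end

section \<open>The enveloping group\<close>

context
  fixes X :: "'x set" and op :: "'x \<Rightarrow> 'x \<Rightarrow> 'x"
  assumes X: "rack X op"
begin

abbreviation (input) env_cls :: "('x \<times> bool) list \<Rightarrow> ('x \<times> bool) list set" where
  "env_cls w \<equiv> {w'. env_eq X op w w'}"

lemma rack_closed [simp]: "x \<in> X \<Longrightarrow> y \<in> X \<Longrightarrow> op x y \<in> X"
  using X by (auto simp: rack_def bij_betw_def)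

lemma env_eq_words:
  "env_eq X op u w \<Longrightarrow> u \<in> lists (X \<times> UNIV) \<and> w \<in> lists (X \<times> UNIV)"
  by (induction rule: env_eq.induct) (auto simp: lists_eq_set)

lemma env_cls_eq: "env_eq X op u w \<Longrightarrow> env_cls u = env_cls w"
  by (blast intro: env_sym env_trans)

lemma env_cls_self: "w \<in> lists (X \<times> UNIV) \<Longrightarrow> w \<in> env_cls w"
  by (simp add: env_refl)

lemma env_carrier: "carrier (enveloping_group X op) = env_cls ` lists (X \<times> UNIV)"
  by (auto simp: enveloping_group_def quotient_def)

lemma env_one: "\<one>\<^bsub>enveloping_group X op\<^esub> = env_cls []"
  by (simp add: enveloping_group_def)

lemma env_mult:
  assumes "u \<in> lists (X \<times> UNIV)" "w \<in> lists (X \<times> UNIV)"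
  shows "env_cls u \<otimes>\<^bsub>enveloping_group X op\<^esub> env_cls w = env_cls (u @ w)"
proof -
  have "env_cls (a @ b) = env_cls (u @ w)" if "a \<in> env_cls u" "b \<in> env_cls w" for a b
    using that by (intro env_cls_eq) (auto intro: env_append env_sym)
  then have "(\<Union>a\<in>env_cls u. \<Union>b\<in>env_cls w. env_cls (a @ b)) = (\<Union>a\<in>env_cls u. \<Union>b\<in>env_cls w. env_cls (u @ w))"
    by (intro SUP_cong refl)
  also have "\<dots> = env_cls (u @ w)"
    using env_cls_self[OF assms(1)] env_cls_self[OF assms(2)] by blast
  finally show ?thesis by (simp add: enveloping_group_def)
qed

lemma env_inverse:
  "w \<in> lists (X \<times> UNIV) \<Longrightarrow> env_eq X op (rev (map (\<lambda>(x, b). (x, \<not> b)) w) @ w) []"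
proof (induction w)
  case Nil
  then show ?case by (simp add: env_refl)
next
  case (Cons a w)
  obtain x b where a: "a = (x, b)" "x \<in> X" using Cons.prems by (cases a) auto
  let ?r = "rev (map (\<lambda>(x, b). (x, \<not> b)) w)"
  have w: "w \<in> lists (X \<times> UNIV)" and r: "?r \<in> lists (X \<times> UNIV)"
    using Cons.prems by (auto simp: lists_eq_set)
  have "env_eq X op [(x, \<not> b), (x, b)] []" using env_cancel[OF a(2), of op "\<not> b"] by simp
  then have "env_eq X op (?r @ ([(x, \<not> b), (x, b)] @ w)) (?r @ ([] @ w))"
    using w r by (intro env_append env_refl)
  then have "env_eq X op (?r @ [(x, \<not> b), (x, b)] @ w) []"
    using Cons.IH[OF w] env_trans by fastforce
  then show ?case using a by simp
qed

lemma group_env: "Group.group (enveloping_group X op)"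
proof (rule groupI)
  fix A assume "A \<in> carrier (enveloping_group X op)"
  then obtain w where w: "w \<in> lists (X \<times> UNIV)" "A = env_cls w" by (auto simp: env_carrier)
  let ?r = "rev (map (\<lambda>(x, b). (x, \<not> b)) w)"
  have r: "?r \<in> lists (X \<times> UNIV)" using w by (auto simp: lists_eq_set)
  have "env_cls ?r \<otimes>\<^bsub>enveloping_group X op\<^esub> A = \<one>\<^bsub>enveloping_group X op\<^esub>"
    unfolding w(2) env_mult[OF r w(1)] env_one by (rule env_cls_eq[OF env_inverse[OF w(1)]])
  then show "\<exists>B\<in>carrier (enveloping_group X op). B \<otimes>\<^bsub>enveloping_group X op\<^esub> A = \<one>\<^bsub>enveloping_group X op\<^esub>"
    using r by (auto simp: env_carrier)
next
  fix A B assume "A \<in> carrier (enveloping_group X op)" "B \<in> carrier (enveloping_group X op)"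
  then obtain u w where uw: "u \<in> lists (X \<times> UNIV)" "A = env_cls u" "w \<in> lists (X \<times> UNIV)" "B = env_cls w"
    unfolding env_carrier by blast
  then have "u @ w \<in> lists (X \<times> UNIV)" by simp
  then show "A \<otimes>\<^bsub>enveloping_group X op\<^esub> B \<in> carrier (enveloping_group X op)"
    unfolding uw(2,4) env_mult[OF uw(1,3)] env_carrier by blast
  fix C assume "C \<in> carrier (enveloping_group X op)"
  then obtain v where v: "v \<in> lists (X \<times> UNIV)" "C = env_cls v" unfolding env_carrier by blast
  show "A \<otimes>\<^bsub>enveloping_group X op\<^esub> B \<otimes>\<^bsub>enveloping_group X op\<^esub> C
    = A \<otimes>\<^bsub>enveloping_group X op\<^esub> (B \<otimes>\<^bsub>enveloping_group X op\<^esub> C)"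
    using uw(1,3) v(1) unfolding uw(2,4) v(2) by (simp only: env_mult append_in_lists_conv append_assoc simp_thms)
next
  show "\<one>\<^bsub>enveloping_group X op\<^esub> \<in> carrier (enveloping_group X op)"
    unfolding env_carrier env_one by (rule imageI) simp
  fix A assume "A \<in> carrier (enveloping_group X op)"
  then obtain w where w: "w \<in> lists (X \<times> UNIV)" "A = env_cls w" unfolding env_carrier by blast
  then show "\<one>\<^bsub>enveloping_group X op\<^esub> \<otimes>\<^bsub>enveloping_group X op\<^esub> A = A"
    unfolding env_one w(2) using env_mult[of "[]" w] by simp
qed

lemma env_gen_closed: "x \<in> X \<Longrightarrow> env_gen X op x \<in> carrier (enveloping_group X op)"
  by (auto simp: env_gen_def env_carrier intro!: image_eqI[where x = "[(x, True)]"])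

text \<open>
  The universal property of the enveloping group: evaluating words in \<open>G\<close> respects the generating
  congruences, hence the whole congruence.
\<close>

lemma env_group_hom:
  assumes G: "Group.group G" and f: "\<And>x. x \<in> X \<Longrightarrow> f x \<in> carrier G"
    and rel: "\<And>x y. x \<in> X \<Longrightarrow> y \<in> X \<Longrightarrow> f x \<otimes>\<^bsub>G\<^esub> f y = f (op x y) \<otimes>\<^bsub>G\<^esub> f x"
  shows "\<exists>\<phi>. \<phi> \<in> hom (enveloping_group X op) G \<and> (\<forall>x\<in>X. \<phi> (env_gen X op x) = f x)"
proof -
  interpret G: Group.group G by (rule G)
  define ev where "ev w = foldr (\<lambda>(x, b) a. (if b then f x else inv\<^bsub>G\<^esub> f x) \<otimes>\<^bsub>G\<^esub> a) w \<one>\<^bsub>G\<^esub>" for w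
  have ev_cl: "ev w \<in> carrier G" if "w \<in> lists (X \<times> UNIV)" for w
    using that by (induction w) (auto simp: ev_def f)
  have ev_app: "ev (u @ w) = ev u \<otimes>\<^bsub>G\<^esub> ev w" if "u \<in> lists (X \<times> UNIV)" "w \<in> lists (X \<times> UNIV)" for u w
    using that(1)
  proof (induction u)
    case Nil then show ?case using ev_cl[OF that(2)] by (simp add: ev_def)
  next
    case (Cons a u)
    then show ?case using ev_cl[OF that(2)] ev_cl[of u] by (cases a) (auto simp: ev_def f G.m_assoc)
  qed
  have ev_eq: "ev u = ev w" if "env_eq X op u w" for u w
    using that
  proof (induction rule: env_eq.induct)
    case (env_append u u' w w')
    then show ?case using env_eq_words by (simp add: ev_app)
  next
    case (env_cancel x b)
    then show ?case by (cases b) (simp_all add: ev_def f)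
  next
    case (env_rel x y)
    then show ?case using rel[of x y] by (simp add: ev_def f)
  qed simp_all
  define \<phi> where "\<phi> A = the_elem (ev ` A)" for A
  have \<phi>: "\<phi> (env_cls w) = ev w" if "w \<in> lists (X \<times> UNIV)" for w
  proof -
    have "ev w' = ev w" if "w' \<in> env_cls w" for w'
      using ev_eq[of w w'] that by simp
    then have "ev ` env_cls w = {ev w}" using env_cls_self[OF that] by blast
    then show ?thesis by (simp add: \<phi>_def)
  qed
  have "\<phi> \<in> hom (enveloping_group X op) G"
  proof (rule homI)
    fix A B assume "A \<in> carrier (enveloping_group X op)" "B \<in> carrier (enveloping_group X op)"
    then obtain u w where uw: "u \<in> lists (X \<times> UNIV)" "A = env_cls u" "w \<in> lists (X \<times> UNIV)" "B = env_cls w"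
      unfolding env_carrier by blast
    then have "u @ w \<in> lists (X \<times> UNIV)" by simp
    then show "\<phi> A \<in> carrier G" "\<phi> (A \<otimes>\<^bsub>enveloping_group X op\<^esub> B) = \<phi> A \<otimes>\<^bsub>G\<^esub> \<phi> B"
      unfolding uw(2,4) env_mult[OF uw(1,3)] using uw(1,3) by (simp_all only: \<phi> ev_cl ev_app)
  qed
  moreover have "\<phi> (env_gen X op x) = f x" if "x \<in> X" for x
    using that \<phi>[of "[(x, True)]"] by (simp add: env_gen_def ev_def f)
  ultimately show ?thesis by blast
qed

end

section \<open>Subalgebras generated by a set\<close>

text \<open>
  Zero and negatives arise as scalar multiples.
\<close>

inductive_set gen_subalgebra :: "('k::field, 'a, 'm) module_scheme \<Rightarrow> 'a set \<Rightarrow> 'a set"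
  for H S where
  gen_one: "\<one>\<^bsub>H\<^esub> \<in> gen_subalgebra H S"
| gen_incl: "s \<in> S \<Longrightarrow> s \<in> gen_subalgebra H S"
| gen_add: "x \<in> gen_subalgebra H S \<Longrightarrow> y \<in> gen_subalgebra H S \<Longrightarrow> x \<oplus>\<^bsub>H\<^esub> y \<in> gen_subalgebra H S"
| gen_smult: "x \<in> gen_subalgebra H S \<Longrightarrow> c \<odot>\<^bsub>H\<^esub> x \<in> gen_subalgebra H S"
| gen_mult: "x \<in> gen_subalgebra H S \<Longrightarrow> y \<in> gen_subalgebra H S \<Longrightarrow> x \<otimes>\<^bsub>H\<^esub> y \<in> gen_subalgebra H S"

lemma subspace_finsum:
  assumes "vector_space_rec V" "subspace_rec V N" "finite A" "\<And>i. i \<in> A \<Longrightarrow> f i \<in> N"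
  shows "(\<Oplus>\<^bsub>V\<^esub>i\<in>A. f i) \<in> N"
  using assms(3,4)
proof (induction A rule: finite_induct)
  case empty then show ?case using assms(1,2) by (simp add: subspace_recD)
next
  case (insert a A)
  then show ?case
    using subspace_recD[OF assms(1,2)] by (subst vs_finsum_insert[OF assms(1)]) auto
qed

context
  fixes H :: "('k::field, 'a) hopf" and S
  assumes H: "hopf_algebra H" and S: "S \<subseteq> carrier H"
begin

lemma gen_subalgebra_closed: "x \<in> gen_subalgebra H S \<Longrightarrow> x \<in> carrier H"
proof (induction rule: gen_subalgebra.induct)
qed (use S H hopf_assoc_algebra(1)[OF H] in \<open>auto simp: algebra_one_closed vs_closed algebra_mult_closed\<close>)

lemma gen_subalgebra_subspace: "subspace_rec H (gen_subalgebra H S)"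
proof (rule subspace_recI[OF hopf_vs[OF H]])
  show "\<zero>\<^bsub>H\<^esub> \<in> gen_subalgebra H S"
    using gen_smult[where c = 0 and H = H and S = S, OF gen_one] H by (simp add: algebra_one_closed[OF hopf_assoc_algebra(1)])
qed (auto intro: gen_subalgebra.intros gen_subalgebra_closed)

lemma gen_subalgebra_subring: "subring (gen_subalgebra H S) H"
proof (rule ring.subringI[OF algebra_ring[OF hopf_assoc_algebra(1)[OF H]]])
  show "\<ominus>\<^bsub>H\<^esub> h \<in> gen_subalgebra H S" if "h \<in> gen_subalgebra H S" for h
    using that gen_subalgebra_closed by (simp add: vs_a_inv[OF hopf_vs[OF H]] gen_smult)
qed (auto intro: gen_subalgebra.intros gen_subalgebra_closed)

lemma gen_sub_algebra: "assoc_algebra (H\<lparr>carrier := gen_subalgebra H S\<rparr>)"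
proof (rule assoc_algebraI[OF vs_subspace[OF hopf_vs[OF H] gen_subalgebra_subspace]])
  note a = hopf_assoc_algebra(1)[OF H]
  note L = linear_mapD[OF bilinear_mapD(1)[OF algebra_mult_bilinear[OF a]]]
    and R = linear_mapD[OF bilinear_mapD(2)[OF algebra_mult_bilinear[OF a]]]
  let ?K = "H\<lparr>carrier := gen_subalgebra H S\<rparr>"
  show "bilinear_map ?K ?K ?K (\<otimes>\<^bsub>?K\<^esub>)"
    by (intro bilinear_mapI linear_mapI) (simp_all add: gen_subalgebra_closed L R gen_mult)
qed (simp_all add: gen_one gen_subalgebra_closed algebra_one[OF hopf_assoc_algebra(1)[OF H]]
    algebra_assoc[OF hopf_assoc_algebra(1)[OF H]])

lemma gen_sub_incl: "linear_map (H\<lparr>carrier := gen_subalgebra H S\<rparr>) H (\<lambda>x. x)"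
  by (rule linear_mapI) (simp_all add: gen_subalgebra_closed)

lemma gen_tensor_image:
  defines "B \<equiv> incl_tensor H ` carrier (tensor_sub H (gen_subalgebra H S))"
  shows "subspace_rec (tensor_space H H) B"
    and "a \<in> gen_subalgebra H S \<Longrightarrow> b \<in> gen_subalgebra H S \<Longrightarrow> pure_tensor H H a b \<in> B"
    and "s \<in> B \<Longrightarrow> t \<in> B \<Longrightarrow> s \<otimes>\<^bsub>tensor_algebra H H\<^esub> t \<in> B"
proof -
  let ?K = "H\<lparr>carrier := gen_subalgebra H S\<rparr>"
  have K: "assoc_algebra ?K" by (rule gen_sub_algebra)
  note Ha = hopf_assoc_algebra(1)[OF H]
  have vs[simp]: "vector_space_rec ?K" "vector_space_rec H" using K hopf_vs[OF H] by simp_all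
  have i: "incl_tensor H = tensor_map H H (\<lambda>x. x) (\<lambda>x. x)" by (simp add: incl_tensor_def tensor_map_def)
  note lin = tensor_map_linear[OF vs(1,1,2,2) gen_sub_incl gen_sub_incl, folded i]
  note L = linear_mapD[OF lin]
  show "subspace_rec (tensor_space H H) B"
  proof (rule subspace_recI)
    show "B \<subseteq> carrier (tensor_space H H)" using L(1) by (auto simp: B_def)
    show "\<zero>\<^bsub>tensor_space H H\<^esub> \<in> B"
      unfolding B_def using linear_map_zero[OF _ _ lin] vs by (auto intro!: image_eqI[where x = "\<zero>\<^bsub>tensor_space ?K ?K\<^esub>"])
    show "x \<oplus>\<^bsub>tensor_space H H\<^esub> y \<in> B" if xy: "x \<in> B" "y \<in> B" for x y
    proof -
      obtain s t where st: "s \<in> carrier (tensor_space ?K ?K)" "t \<in> carrier (tensor_space ?K ?K)"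
        "x = incl_tensor H s" "y = incl_tensor H t" using xy by (auto simp: B_def)
      then have "x \<oplus>\<^bsub>tensor_space H H\<^esub> y = incl_tensor H (s \<oplus>\<^bsub>tensor_space ?K ?K\<^esub> t)" by (simp add: L)
      then show ?thesis unfolding B_def using st vs_closed(1)[OF vs_tensor_space[OF vs(1,1)]] by blast
    qed
    show "c \<odot>\<^bsub>tensor_space H H\<^esub> x \<in> B" if x: "x \<in> B" for c x
    proof -
      obtain s where s: "s \<in> carrier (tensor_space ?K ?K)" "x = incl_tensor H s" using x by (auto simp: B_def)
      then have "c \<odot>\<^bsub>tensor_space H H\<^esub> x = incl_tensor H (c \<odot>\<^bsub>tensor_space ?K ?K\<^esub> s)" by (simp add: L)
      then show ?thesis unfolding B_def using s vs_closed(3)[OF vs_tensor_space[OF vs(1,1)]] by blast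
    qed
  qed simp
  show "pure_tensor H H a b \<in> B" if ab: "a \<in> gen_subalgebra H S" "b \<in> gen_subalgebra H S"
  proof -
    have "pure_tensor H H a b = incl_tensor H (pure_tensor ?K ?K a b)"
      unfolding i using ab by (simp add: tensor_map_pure[OF vs(1,1,2,2) gen_sub_incl gen_sub_incl])
    then show ?thesis unfolding B_def using ab pure_tensor_closed[OF vs(1,1)] by simp
  qed
  show "x \<otimes>\<^bsub>tensor_algebra H H\<^esub> y \<in> B" if xy: "x \<in> B" "y \<in> B" for x y
  proof -
    obtain s t where st: "s \<in> carrier (tensor_space ?K ?K)" "t \<in> carrier (tensor_space ?K ?K)"
      "x = incl_tensor H s" "y = incl_tensor H t" using xy by (auto simp: B_def)
    then have "x \<otimes>\<^bsub>tensor_algebra H H\<^esub> y = incl_tensor H (s \<otimes>\<^bsub>tensor_algebra ?K ?K\<^esub> t)"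
      unfolding i by (subst tensor_map_mult[OF K K Ha Ha gen_sub_incl _ gen_sub_incl]) simp_all
    then show ?thesis unfolding B_def using st bilinear_mapD(3)[OF tensor_mult_bilinear[OF K K]] by blast
  qed
qed

text \<open>
  The comultiplication is multiplicative and the antipode antimultiplicative, so it is enough to
  control the two on generators.
\<close>

lemma gen_hopf_subalgebra:
  assumes anti: "\<And>s. s \<in> S \<Longrightarrow> antipode H s \<in> S"
    and com: "\<And>s. s \<in> S \<Longrightarrow> comult H s \<in> incl_tensor H ` carrier (tensor_sub H (gen_subalgebra H S))"
  shows "hopf_subalgebra H (gen_subalgebra H S)"
proof -
  let ?A = "gen_subalgebra H S"
  note T = subspace_recD[OF vs_tensor_space[OF hopf_vs[OF H] hopf_vs[OF H]] gen_tensor_image(1)]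
  note Ha = hopf_assoc_algebra(1)[OF H]
  have "comult H x \<in> incl_tensor H ` carrier (tensor_sub H ?A)" if "x \<in> ?A" for x
    using that
  proof (induction rule: gen_subalgebra.induct)
    case gen_one
    show ?case unfolding comult_one[OF H] by (intro gen_tensor_image(2) gen_subalgebra.gen_one)
  next
    case (gen_mult x y)
    then show ?case
      unfolding comult_mult[OF H gen_mult(1,2)[THEN gen_subalgebra_closed]] by (intro gen_tensor_image(3))
  next
    case (gen_add x y)
    then show ?case
      using T(3) gen_subalgebra_closed by (simp only: linear_mapD(2)[OF comult_linear[OF H]])
  next
    case (gen_smult x c)
    then show ?case
      using T(4) gen_subalgebra_closed by (simp only: linear_mapD(3)[OF comult_linear[OF H]])
  qed (rule com)
  moreover have "antipode H x \<in> ?A" if "x \<in> ?A" for x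
    using that
  proof (induction rule: gen_subalgebra.induct)
    case (gen_mult x y)
    then show ?case by (simp add: antipode_mult[OF H] gen_subalgebra_closed gen_subalgebra.gen_mult)
  qed (simp_all add: antipode_one[OF H] linear_mapD[OF antipode_linear[OF H]] gen_subalgebra_closed
      gen_subalgebra.intros anti)
  ultimately show ?thesis
    using gen_subalgebra_subspace gen_subalgebra_subring by (auto simp: hopf_subalgebra_def)
qed

lemma gen_subalgebra_least:
  assumes A: "hopf_subalgebra H A" and "S \<subseteq> A"
  shows "gen_subalgebra H S \<subseteq> A"
proof
  fix x assume "x \<in> gen_subalgebra H S"
  then show "x \<in> A"
    using assms(2) by (induction rule: gen_subalgebra.induct) (auto intro: hopf_subalgebra_closed[OF H A])
qed

end

section \<open>Linearity of the two sides of the Yetter-Drinfeld axioms\<close>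

text \<open>
  Both sides of the coassociativity and compatibility axioms are multilinear as soon as the action is
  bilinear and the coaction linear.  This serves to evaluate the axioms on the coaction matrix, and
  conversely to verify them on bases.
\<close>

context
  fixes H :: "('k::field, 'h) hopf" and V :: "('k, 'v) module" and act coact HV
  assumes H: "hopf_algebra H" and V: "vector_space_rec V" and act: "bilinear_map H V V act"
    and coact: "linear_map V (tensor_space H V) coact"
  defines "HV \<equiv> tensor_space H V"
begin

lemma HV_vs: "vector_space_rec HV"
  unfolding HV_def using hopf_vs[OF H] V by simp

lemma pure_HV: "bilinear_map H V HV (pure_tensor H V)"
  unfolding HV_def using hopf_vs[OF H] V by (rule pure_tensor_bilinear)

lemma compat_bilinear3:
  assumes "h1 \<in> carrier H" "h2 \<in> carrier H" "h3 \<in> carrier H"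
  shows "bilinear_map H V HV (\<lambda>a w. pure_tensor H V (h1 \<otimes>\<^bsub>H\<^esub> a \<otimes>\<^bsub>H\<^esub> antipode H h3) (act h2 w))"
  using assms hopf_assoc_algebra(1)[OF H] bilinear_mapD(3)[OF act]
  by (intro bilinear_mapI linear_map_bilinear[OF pure_HV] linear_map_bilinear(1)[OF act] linear_map_mult linear_map_id)
     (simp_all add: hopf_closed[OF H] algebra_mult_closed)

lemma compat_linear_args:
  assumes a: "a \<in> carrier H" and w: "w \<in> carrier V"
  shows "h2 \<in> carrier H \<Longrightarrow> h3 \<in> carrier H \<Longrightarrow>
      linear_map H HV (\<lambda>h1. pure_tensor H V (h1 \<otimes>\<^bsub>H\<^esub> a \<otimes>\<^bsub>H\<^esub> antipode H h3) (act h2 w))"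
    and "h1 \<in> carrier H \<Longrightarrow> h3 \<in> carrier H \<Longrightarrow>
      linear_map H HV (\<lambda>h2. pure_tensor H V (h1 \<otimes>\<^bsub>H\<^esub> a \<otimes>\<^bsub>H\<^esub> antipode H h3) (act h2 w))"
    and "h1 \<in> carrier H \<Longrightarrow> h2 \<in> carrier H \<Longrightarrow>
      linear_map H HV (\<lambda>h3. pure_tensor H V (h1 \<otimes>\<^bsub>H\<^esub> a \<otimes>\<^bsub>H\<^esub> antipode H h3) (act h2 w))"
  using assms hopf_assoc_algebra(1)[OF H] bilinear_mapD(3)[OF act]
  by (intro linear_map_bilinear[OF pure_HV] linear_map_bilinear(2)[OF act] linear_map_mult linear_map_id antipode_linear[OF H];
      simp add: hopf_closed[OF H] algebra_mult_closed)+

lemma compat_bilinear2: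
  assumes h1: "h1 \<in> carrier H" and v: "v \<in> carrier V"
  shows "bilinear_map H H HV (\<lambda>h2 h3. tensor_lift HV (\<lambda>a w.
    pure_tensor H V (h1 \<otimes>\<^bsub>H\<^esub> a \<otimes>\<^bsub>H\<^esub> antipode H h3) (act h2 w)) (coact v))"
  by (intro bilinear_mapI linear_map_tensor_lift_fun[of H V, OF hopf_vs[OF H] V linear_mapD(1)[OF coact v]]
      compat_bilinear3 compat_linear_args HV_vs hopf_vs[OF H] h1)

lemma compat_bilinear1:
  assumes v: "v \<in> carrier V"
  shows "bilinear_map H H HV (\<lambda>h1 h'. tensor_lift HV (\<lambda>h2 h3. tensor_lift HV (\<lambda>a w.
    pure_tensor H V (h1 \<otimes>\<^bsub>H\<^esub> a \<otimes>\<^bsub>H\<^esub> antipode H h3) (act h2 w)) (coact v)) (comult H h'))"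
  by (intro bilinear_mapI linear_map_sweedler_arg[OF H] linear_map_sweedler_fun[OF H] linear_map_id compat_bilinear2 HV_vs hopf_vs[OF H] v
      linear_map_tensor_lift_fun[of H V, OF hopf_vs[OF H] V linear_mapD(1)[OF coact v]] compat_bilinear3 compat_linear_args)

lemma compat_linear:
  "v \<in> carrier V \<Longrightarrow> linear_map H HV (\<lambda>h. tensor_lift HV (\<lambda>h1 h'. tensor_lift HV (\<lambda>h2 h3. tensor_lift HV (\<lambda>a w.
    pure_tensor H V (h1 \<otimes>\<^bsub>H\<^esub> a \<otimes>\<^bsub>H\<^esub> antipode H h3) (act h2 w)) (coact v)) (comult H h')) (comult H h))"
  "h \<in> carrier H \<Longrightarrow> linear_map V HV (\<lambda>v. tensor_lift HV (\<lambda>h1 h'. tensor_lift HV (\<lambda>h2 h3. tensor_lift HV (\<lambda>a w.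
    pure_tensor H V (h1 \<otimes>\<^bsub>H\<^esub> a \<otimes>\<^bsub>H\<^esub> antipode H h3) (act h2 w)) (coact v)) (comult H h')) (comult H h))"
proof -
  show "v \<in> carrier V \<Longrightarrow> linear_map H HV (\<lambda>h. tensor_lift HV (\<lambda>h1 h'. tensor_lift HV (\<lambda>h2 h3. tensor_lift HV (\<lambda>a w.
    pure_tensor H V (h1 \<otimes>\<^bsub>H\<^esub> a \<otimes>\<^bsub>H\<^esub> antipode H h3) (act h2 w)) (coact v)) (comult H h')) (comult H h))"
    by (intro linear_map_sweedler_arg[OF H] linear_map_id compat_bilinear1 HV_vs)
  have l: "linear_map V HV (\<lambda>v. tensor_lift HV (\<lambda>a w.
    pure_tensor H V (h1 \<otimes>\<^bsub>H\<^esub> a \<otimes>\<^bsub>H\<^esub> antipode H h3) (act h2 w)) (coact v))"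
    if "h1 \<in> carrier H" "h2 \<in> carrier H" "h3 \<in> carrier H" for h1 h2 h3
    by (rule linear_map_comp[OF tensor_lift_linear[OF hopf_vs[OF H] V HV_vs compat_bilinear3[OF that]] coact])
  show "h \<in> carrier H \<Longrightarrow> linear_map V HV (\<lambda>v. tensor_lift HV (\<lambda>h1 h'. tensor_lift HV (\<lambda>h2 h3. tensor_lift HV (\<lambda>a w.
    pure_tensor H V (h1 \<otimes>\<^bsub>H\<^esub> a \<otimes>\<^bsub>H\<^esub> antipode H h3) (act h2 w)) (coact v)) (comult H h')) (comult H h))"
    by (intro linear_map_sweedler_fun[OF H] compat_bilinear1 compat_bilinear2 HV_vs V l)
qed

lemma coassoc_linear:
  defines "W \<equiv> tensor_space H HV"
  shows "bilinear_map H V W (\<lambda>h w. tensor_lift W (\<lambda>a b. pure_tensor H HV a (pure_tensor H V b w)) (comult H h))"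
    and "w \<in> carrier V \<Longrightarrow> bilinear_map H H W (\<lambda>a b. pure_tensor H HV a (pure_tensor H V b w))"
    and "bilinear_map H V W (\<lambda>h w. pure_tensor H HV h (coact w))"
proof -
  have W: "vector_space_rec W" unfolding W_def using hopf_vs[OF H] HV_vs by simp
  have p: "bilinear_map H HV W (pure_tensor H HV)"
    unfolding W_def by (rule pure_tensor_bilinear[OF hopf_vs[OF H] HV_vs])
  note pc = bilinear_mapD(3)[OF pure_HV]
  show b: "bilinear_map H H W (\<lambda>a b. pure_tensor H HV a (pure_tensor H V b w))" if "w \<in> carrier V" for w
    by (intro bilinear_mapI linear_map_bilinear[OF p] linear_map_bilinear[OF pure_HV] linear_map_id pc that)
  show "bilinear_map H V W (\<lambda>h w. tensor_lift W (\<lambda>a b. pure_tensor H HV a (pure_tensor H V b w)) (comult H h))"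
    by (intro bilinear_mapI linear_map_sweedler_arg[OF H] linear_map_sweedler_fun[OF H] b linear_map_id W V
        linear_map_bilinear(1)[OF p] linear_map_bilinear(1)[OF pure_HV])
  show "bilinear_map H V W (\<lambda>h w. pure_tensor H HV h (coact w))"
    using coact linear_mapD(1)[OF coact] unfolding HV_def[symmetric]
    by (intro bilinear_mapI linear_map_bilinear[OF p] linear_map_id)
qed

end

section \<open>Yetter-Drinfeld modules and their braiding\<close>

context
  fixes H :: "('k::field, 'h) hopf" and V :: "('k, 'v) module" and act coact
  assumes yd: "yetter_drinfeld H V act coact"
begin

lemma yd_hopf: "hopf_algebra H"
  and yd_vs: "vector_space_rec V"
  and yd_act: "h \<in> carrier H \<Longrightarrow> linear_map V V (act h)" "v \<in> carrier V \<Longrightarrow> linear_map H V (\<lambda>h. act h v)"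
  and yd_act_one: "v \<in> carrier V \<Longrightarrow> act \<one>\<^bsub>H\<^esub> v = v"
  and yd_act_mult: "g \<in> carrier H \<Longrightarrow> h \<in> carrier H \<Longrightarrow> v \<in> carrier V \<Longrightarrow> act (g \<otimes>\<^bsub>H\<^esub> h) v = act g (act h v)"
  and yd_coact: "linear_map V (tensor_space H V) coact"
  and yd_counit: "v \<in> carrier V \<Longrightarrow> tensor_lift V (\<lambda>h w. counit H h \<odot>\<^bsub>V\<^esub> w) (coact v) = v"
  using yd by (auto simp: yetter_drinfeld_def)

lemma yd_coassoc:
  "v \<in> carrier V \<Longrightarrow>
    tensor_lift (tensor_space H (tensor_space H V)) (\<lambda>h w. tensor_lift (tensor_space H (tensor_space H V)) (\<lambda>a b.
        pure_tensor H (tensor_space H V) a (pure_tensor H V b w)) (comult H h)) (coact v)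
    = tensor_lift (tensor_space H (tensor_space H V)) (\<lambda>h w. pure_tensor H (tensor_space H V) h (coact w)) (coact v)"
  using yd by (simp add: yetter_drinfeld_def Let_def)

lemma yd_compat:
  "h \<in> carrier H \<Longrightarrow> v \<in> carrier V \<Longrightarrow> coact (act h v) =
    tensor_lift (tensor_space H V) (\<lambda>h1 h'. tensor_lift (tensor_space H V) (\<lambda>h2 h3. tensor_lift (tensor_space H V) (\<lambda>a w.
      pure_tensor H V (h1 \<otimes>\<^bsub>H\<^esub> a \<otimes>\<^bsub>H\<^esub> antipode H h3) (act h2 w)) (coact v)) (comult H h')) (comult H h)"
  using yd by (simp add: yetter_drinfeld_def Let_def)

lemma yd_act_closed [simp]: "h \<in> carrier H \<Longrightarrow> v \<in> carrier V \<Longrightarrow> act h v \<in> carrier V"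
  using linear_mapD(1)[OF yd_act(1)] .

lemma yd_coact_closed [simp]: "v \<in> carrier V \<Longrightarrow> coact v \<in> carrier (tensor_space H V)"
  using linear_mapD(1)[OF yd_coact] .

lemma yd_braiding_inner:
  "w \<in> carrier V \<Longrightarrow> bilinear_map H V (tensor_space V V) (\<lambda>h v0. pure_tensor V V (act h w) v0)"
  by (intro bilinear_mapI linear_map_pure_tensor yd_act(2) yd_vs linear_map_id) simp_all

lemma yd_braiding_outer:
  "bilinear_map V V (tensor_space V V) (\<lambda>v w.
     tensor_lift (tensor_space V V) (\<lambda>h v0. pure_tensor V V (act h w) v0) (coact v))"
  using yd_vs yd_hopf
  by (intro bilinear_mapI linear_map_comp[OF tensor_lift_linear[OF _ _ _ yd_braiding_inner] yd_coact]
      linear_map_tensor_lift_fun[of H V] yd_braiding_inner linear_map_pure_tensor yd_act(1))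
     (simp_all add: hopf_vs)

lemma yd_braiding_linear: "linear_map (tensor_space V V) (tensor_space V V) (yd_braiding V act coact)"
  unfolding yd_braiding_def using yd_vs by (intro tensor_lift_linear yd_braiding_outer) simp_all

lemma yd_braiding_pure:
  "v \<in> carrier V \<Longrightarrow> w \<in> carrier V \<Longrightarrow> yd_braiding V act coact (pure_tensor V V v w) =
     tensor_lift (tensor_space V V) (\<lambda>h v0. pure_tensor V V (act h w) v0) (coact v)"
  unfolding yd_braiding_def using yd_vs by (intro tensor_lift_pure yd_braiding_outer) simp_all

end

context
  fixes X :: "'x set" and op and q :: "'x \<Rightarrow> 'x \<Rightarrow> 'k::field"
  assumes X: "rack X op"
begin

lemma rack_braiding_inner:
  "x \<in> X \<Longrightarrow> linear_map (free_space X) (tensor_space (free_space X) (free_space X))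
    (lin_extend (tensor_space (free_space X) (free_space X)) (\<lambda>y. q x y
       \<odot>\<^bsub>tensor_space (free_space X) (free_space X)\<^esub> pure_tensor (free_space X) (free_space X) (basis_vec (op x y)) (basis_vec x)))"
  by (intro linear_intros) (simp_all add: rack_closed[OF X])

lemma rack_braiding_outer:
  "bilinear_map (free_space X) (free_space X) (tensor_space (free_space X) (free_space X))
     (\<lambda>u w. lin_extend (tensor_space (free_space X) (free_space X)) (\<lambda>x. lin_extend (tensor_space (free_space X) (free_space X)) (\<lambda>y.
       q x y \<odot>\<^bsub>tensor_space (free_space X) (free_space X)\<^esub> pure_tensor (free_space X) (free_space X) (basis_vec (op x y)) (basis_vec x)) w) u)"
  by (intro bilinear_mapI linear_map_lin_extend[where X = X] lin_extend_linear rack_braiding_inner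
      linear_mapD(1)[OF rack_braiding_inner]) simp_all

lemma rack_braiding_linear:
  "linear_map (tensor_space (free_space X) (free_space X)) (tensor_space (free_space X) (free_space X)) (rack_braiding X op q)"
  unfolding rack_braiding_def Let_def by (intro tensor_lift_linear rack_braiding_outer) simp_all

lemma rack_braiding_basis:
  assumes "x \<in> X" "y \<in> X"
  shows "rack_braiding X op q (pure_tensor (free_space X) (free_space X) (basis_vec x) (basis_vec y)) =
    q x y \<odot>\<^bsub>tensor_space (free_space X) (free_space X)\<^esub> pure_tensor (free_space X) (free_space X) (basis_vec (op x y)) (basis_vec x)"
proof -
  let ?VV = "tensor_space (free_space X) (free_space X) :: ('k, ('k, 'x \<Rightarrow>\<^sub>0 'k, 'x \<Rightarrow>\<^sub>0 'k) tensor) module"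
  have cl: "q x y \<odot>\<^bsub>?VV\<^esub> pure_tensor (free_space X) (free_space X) (basis_vec (op x y)) (basis_vec x) \<in> carrier ?VV"
    using assms by (simp add: rack_closed[OF X])
  have "rack_braiding X op q (pure_tensor (free_space X) (free_space X) (basis_vec x) (basis_vec y)) =
    lin_extend ?VV (\<lambda>x. lin_extend ?VV (\<lambda>y.
       q x y \<odot>\<^bsub>?VV\<^esub> pure_tensor (free_space X) (free_space X) (basis_vec (op x y)) (basis_vec x)) (basis_vec y)) (basis_vec x)"
    unfolding rack_braiding_def Let_def using assms by (intro tensor_lift_pure rack_braiding_outer) simp_all
  also have "\<dots> = lin_extend ?VV (\<lambda>y.
       q x y \<odot>\<^bsub>?VV\<^esub> pure_tensor (free_space X) (free_space X) (basis_vec (op x y)) (basis_vec x)) (basis_vec y)"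
    using assms linear_mapD(1)[OF rack_braiding_inner] by (intro lin_extend_basis) simp_all
  also have "\<dots> = q x y \<odot>\<^bsub>?VV\<^esub> pure_tensor (free_space X) (free_space X) (basis_vec (op x y)) (basis_vec x)"
    using cl by (intro lin_extend_basis) simp_all
  finally show ?thesis .
qed

end

lemma linear_map_tensor_free_eq:
  fixes W :: "('k::field, 'w, 'm) module_scheme" and X :: "'x set" and Y :: "'y set"
  assumes "vector_space_rec W" "linear_map (tensor_space (free_space X) (free_space Y)) W f"
    "linear_map (tensor_space (free_space X) (free_space Y)) W g"
    and eq: "\<And>x y. x \<in> X \<Longrightarrow> y \<in> Y \<Longrightarrow> f (pure_tensor (free_space X) (free_space Y) (basis_vec x) (basis_vec y)) =
      g (pure_tensor (free_space X) (free_space Y) (basis_vec x) (basis_vec y))"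
    and T: "T \<in> carrier (tensor_space (free_space X) (free_space Y))"
  shows "f T = g T"
proof (rule linear_map_tensor_eq[OF vs_free_space vs_free_space assms(2,3) _ T])
  let ?p = "pure_tensor (free_space X) (free_space Y)"
  fix u :: "'x \<Rightarrow>\<^sub>0 'k" and v :: "'y \<Rightarrow>\<^sub>0 'k"
  assume u: "u \<in> carrier (free_space X)" and v: "v \<in> carrier (free_space Y)"
  show "f (?p u v) = g (?p u v)"
  proof (rule linear_map_free_eq[where f = "\<lambda>u. f (?p u v)", OF assms(1) _ _ _ u])
    show "linear_map (free_space X) W (\<lambda>u. f (?p u v))" "linear_map (free_space X) W (\<lambda>u. g (?p u v))"
      using v by (intro linear_map_comp[OF assms(2)] linear_map_comp[OF assms(3)] linear_map_pure_tensor linear_map_id; simp)+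
    fix x assume x: "x \<in> X"
    show "f (?p (basis_vec x) v) = g (?p (basis_vec x) v)"
    proof (rule linear_map_free_eq[where f = "\<lambda>v. f (?p (basis_vec x) v)", OF assms(1) _ _ _ v])
      show "linear_map (free_space Y) W (\<lambda>v. f (?p (basis_vec x) v))" "linear_map (free_space Y) W (\<lambda>v. g (?p (basis_vec x) v))"
        using x by (intro linear_map_comp[OF assms(2)] linear_map_comp[OF assms(3)] linear_map_pure_tensor linear_map_id; simp)+
    qed (rule eq[OF x])
  qed
qed

section \<open>Realizations of a rack with a cocycle\<close>

text \<open>
  A realization together with the matrix \<open>e\<close> of its coaction.
\<close>

locale rack_realization =
  fixes X :: "'x set" and op :: "'x \<Rightarrow> 'x \<Rightarrow> 'x" and q :: "'x \<Rightarrow> 'x \<Rightarrow> 'k::field"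
    and H :: "('k, 'h) hopf" and act :: "'h \<Rightarrow> ('x \<Rightarrow>\<^sub>0 'k) \<Rightarrow> ('x \<Rightarrow>\<^sub>0 'k)"
    and coact :: "('x \<Rightarrow>\<^sub>0 'k) \<Rightarrow> ('k, 'h, 'x \<Rightarrow>\<^sub>0 'k) tensor" and e :: "'x \<Rightarrow> 'x \<Rightarrow> 'h"
  assumes rack: "rack X op" and cocycle: "rack_cocycle X op q"
    and real: "realization H X op q act coact"
    and e_closed: "\<And>x y. x \<in> X \<Longrightarrow> y \<in> X \<Longrightarrow> e x y \<in> carrier H"
    and e_finite: "\<And>x. x \<in> X \<Longrightarrow> finite {y\<in>X. e x y \<noteq> \<zero>\<^bsub>H\<^esub>}"
    and coact_basis: "\<And>x. x \<in> X \<Longrightarrow> coact (basis_vec x) =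
      (\<Oplus>\<^bsub>tensor_space H (free_space X)\<^esub>y\<in>{y\<in>X. e x y \<noteq> \<zero>\<^bsub>H\<^esub>}. pure_tensor H (free_space X) (e x y) (basis_vec y))"
begin

abbreviation V :: "('k, 'x \<Rightarrow>\<^sub>0 'k) module" where "V \<equiv> free_space X"

text \<open>
  The rack may be infinite; rows of the coaction matrix are finite, and they index all sums over
  intermediate indices, also for the powers of the antipode, whose zero pattern can only be larger.
\<close>

definition row :: "'x \<Rightarrow> 'x set" where "row x = {y\<in>X. e x y \<noteq> \<zero>\<^bsub>H\<^esub>}"

definition entry :: "nat \<Rightarrow> 'x \<Rightarrow> 'x \<Rightarrow> 'h" where "entry n x y = (antipode H ^^ n) (e x y)"

lemma yd: "yetter_drinfeld H V act coact"
  and braiding: "T \<in> carrier (tensor_space V V) \<Longrightarrow> yd_braiding V act coact T = rack_braiding X op q T"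
  using real by (simp_all add: realization_def)

lemma H: "hopf_algebra H" by (rule yd_hopf[OF yd])

lemma H_vs [simp]: "vector_space_rec H" and H_alg [simp]: "assoc_algebra H"
  using H hopf_assoc_algebra(1)[OF H] by simp_all

lemma op_closed [simp]: "x \<in> X \<Longrightarrow> y \<in> X \<Longrightarrow> op x y \<in> X"
  by (rule rack_closed[OF rack])

lemma q_nonzero: "x \<in> X \<Longrightarrow> y \<in> X \<Longrightarrow> q x y \<noteq> 0"
  using cocycle by (simp add: rack_cocycle_def)

lemma row_finite [simp]: "x \<in> X \<Longrightarrow> finite (row x)"
  and row_subset: "y \<in> row x \<Longrightarrow> y \<in> X"
  using e_finite by (simp_all add: row_def)

lemma entry_0: "entry 0 x y = e x y" and entry_Suc: "entry (Suc n) x y = antipode H (entry n x y)"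
  by (simp_all add: entry_def)

lemma entry_closed [simp]: "x \<in> X \<Longrightarrow> y \<in> X \<Longrightarrow> entry n x y \<in> carrier H"
  by (induction n) (simp_all add: entry_0 entry_Suc e_closed hopf_closed[OF H])

lemma entry_zero: "y \<in> X \<Longrightarrow> y \<notin> row x \<Longrightarrow> entry n x y = \<zero>\<^bsub>H\<^esub>"
  using linear_map_zero[OF _ _ antipode_linear[OF H]]
  by (induction n) (simp_all add: entry_0 entry_Suc row_def)

lemma coact_lift:
  assumes "vector_space_rec W" "bilinear_map H V W \<beta>" "x \<in> X"
  shows "tensor_lift W \<beta> (coact (basis_vec x)) = (\<Oplus>\<^bsub>W\<^esub>y\<in>row x. \<beta> (e x y) (basis_vec y))"
proof -
  have "tensor_lift W \<beta> (coact (basis_vec x))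
    = (\<Oplus>\<^bsub>W\<^esub>y\<in>row x. tensor_lift W \<beta> (pure_tensor H V (e x y) (basis_vec y)))"
    unfolding coact_basis[OF assms(3)] row_def using assms
    by (intro linear_map_finsum tensor_lift_linear) (auto simp: e_closed e_finite)
  also have "\<dots> = (\<Oplus>\<^bsub>W\<^esub>y\<in>row x. \<beta> (e x y) (basis_vec y))"
    using assms bilinear_mapD(3)[OF assms(2)]
    by (intro vs_finsum_cong) (auto simp: e_closed row_subset tensor_lift_pure)
  finally show ?thesis .
qed

text \<open>
  Indices \<open>y\<close> outside the row are included, so coefficients can be read off without a case distinction.
\<close>

lemma row_sum_coeff:
  assumes W: "vector_space_rec W" and xy: "x \<in> X" "y \<in> X" and g: "\<And>z. z \<in> X \<Longrightarrow> g z \<in> carrier W"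
    and g0: "y \<notin> row x \<Longrightarrow> g y = \<zero>\<^bsub>W\<^esub>"
  shows "(\<Oplus>\<^bsub>W\<^esub>z\<in>row x. Poly_Mapping.lookup (basis_vec z) y \<odot>\<^bsub>W\<^esub> g z) = g y"
proof (cases "y \<in> row x")
  case True
  then have "(\<Oplus>\<^bsub>W\<^esub>z\<in>row x. Poly_Mapping.lookup (basis_vec z) y \<odot>\<^bsub>W\<^esub> g z)
    = Poly_Mapping.lookup (basis_vec y) y \<odot>\<^bsub>W\<^esub> g y"
    using xy by (intro vs_finsum_single[OF W]) (auto simp: W g row_subset lookup_single)
  then show ?thesis using xy by (simp add: W g)
next
  case False
  then have "(\<Oplus>\<^bsub>W\<^esub>z\<in>row x. Poly_Mapping.lookup (basis_vec z) y \<odot>\<^bsub>W\<^esub> g z) = \<zero>\<^bsub>W\<^esub>"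
    using xy by (intro vs_finsum_zero[OF W]) (auto simp: W g row_subset lookup_single when_def)
  then show ?thesis using g0 False by simp
qed

text \<open>
  Coassociativity of the coaction on the basis vector of \<open>x\<close>, in the coefficient at \<open>y\<close> of the last
  tensor factor.
\<close>

lemma comult_e:
  assumes xy: "x \<in> X" "y \<in> X"
  shows "comult H (e x y) = (\<Oplus>\<^bsub>tensor_space H H\<^esub>z\<in>row x. pure_tensor H H (e x z) (e z y))"
proof -
  let ?HV = "tensor_space H V" and ?HH = "tensor_space H H"
  let ?W = "tensor_space H ?HV"
  let ?s = "tensor_lift H (\<lambda>b w. Poly_Mapping.lookup w y \<odot>\<^bsub>H\<^esub> b)"
  have W: "vector_space_rec ?W" and HH: "vector_space_rec ?HH" by simp_all
  have sb: "bilinear_map H V H (\<lambda>b w. Poly_Mapping.lookup w y \<odot>\<^bsub>H\<^esub> b)"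
    by (intro bilinear_mapI linear_map_smult linear_map_smult_left linear_map_lookup linear_map_id) simp_all
  have s: "linear_map ?HV H ?s" by (intro tensor_lift_linear sb) simp_all
  have tb: "bilinear_map H ?HV ?HH (\<lambda>a S. pure_tensor H H a (?s S))"
    using linear_mapD(1)[OF s]
    by (intro bilinear_mapI linear_map_pure_tensor linear_map_id s) simp_all
  \<comment> \<open>The coefficient functional at \<open>y\<close>, applied to the last factor of \<open>H \<otimes> (H \<otimes> V)\<close>.\<close>
  let ?t = "tensor_lift ?HH (\<lambda>a S. pure_tensor H H a (?s S))"
  have t: "linear_map ?W ?HH ?t" by (intro tensor_lift_linear tb) simp_all
  have tp: "?t (pure_tensor H ?HV a S) = pure_tensor H H a (?s S)"
    if "a \<in> carrier H" "S \<in> carrier ?HV" for a S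
    by (intro tensor_lift_pure tb that) simp_all
  have act: "bilinear_map H V V act" using yd_act[OF yd] by (auto simp: bilinear_map_def)
  note out1 = coassoc_linear(1)[OF H vs_free_space act yd_coact[OF yd]]
    and in1 = coassoc_linear(2)[OF H vs_free_space act yd_coact[OF yd]]
    and out2 = coassoc_linear(3)[OF H vs_free_space act yd_coact[OF yd]]
  have ax: "(\<Oplus>\<^bsub>?W\<^esub>z\<in>row x. tensor_lift ?W (\<lambda>a b. pure_tensor H ?HV a (pure_tensor H V b (basis_vec z))) (comult H (e x z)))
    = (\<Oplus>\<^bsub>?W\<^esub>z\<in>row x. pure_tensor H ?HV (e x z) (coact (basis_vec z)))"
    using yd_coassoc[OF yd, of "basis_vec x"] xy
    by (simp add: coact_lift[OF W out1] coact_lift[OF W out2])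
  have l: "?t (tensor_lift ?W (\<lambda>a b. pure_tensor H ?HV a (pure_tensor H V b (basis_vec z))) (comult H (e x z)))
    = Poly_Mapping.lookup (basis_vec z) y \<odot>\<^bsub>?HH\<^esub> comult H (e x z)" if z: "z \<in> X" for z
  proof -
    have bz: "basis_vec z \<in> carrier V" using z by simp
    have exz: "e x z \<in> carrier H" using xy z by (simp add: e_closed)
    let ?c = "Poly_Mapping.lookup (basis_vec z) y"
    have lin: "linear_map ?HH ?HH (\<lambda>S. ?c \<odot>\<^bsub>?HH\<^esub> S)" by (intro linear_map_smult linear_map_id HH)
    have "?t (tensor_lift ?W (\<lambda>a b. pure_tensor H ?HV a (pure_tensor H V b (basis_vec z))) (comult H (e x z)))
      = tensor_lift ?HH (\<lambda>a b. ?t (pure_tensor H ?HV a (pure_tensor H V b (basis_vec z)))) (comult H (e x z))"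
      by (rule sweedler_linear[OF H W HH in1[OF bz] t exz])
    also have "\<dots> = tensor_lift ?HH (\<lambda>a b. ?c \<odot>\<^bsub>?HH\<^esub> pure_tensor H H a b) (comult H (e x z))"
    proof (rule sweedler_cong[OF H HH _ exz])
      show "bilinear_map H H ?HH (\<lambda>a b. ?t (pure_tensor H ?HV a (pure_tensor H V b (basis_vec z))))"
        using in1[OF bz] by (auto simp: bilinear_map_def intro: linear_map_comp[OF t])
      show "?t (pure_tensor H ?HV a (pure_tensor H V b (basis_vec z))) = ?c \<odot>\<^bsub>?HH\<^esub> pure_tensor H H a b"
        if "a \<in> carrier H" "b \<in> carrier H" for a b
        using that bz by (simp add: tp tensor_lift_pure[OF _ _ _ sb] pure_tensor_simps)
    qed
    also have "\<dots> = ?c \<odot>\<^bsub>?HH\<^esub> tensor_lift ?HH (pure_tensor H H) (comult H (e x z))"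
      by (rule sweedler_linear[OF H HH HH pure_tensor_bilinear lin exz, symmetric]) simp_all
    finally show ?thesis using exz by (simp add: tensor_lift_id hopf_closed[OF H])
  qed
  have scoact: "?s (coact (basis_vec z)) = e z y" if z: "z \<in> X" for z
    unfolding coact_lift[OF H_vs sb z]
    using z xy by (intro row_sum_coeff) (auto simp: e_closed row_def)
  have "comult H (e x y) = (\<Oplus>\<^bsub>?HH\<^esub>z\<in>row x. Poly_Mapping.lookup (basis_vec z) y \<odot>\<^bsub>?HH\<^esub> comult H (e x z))"
    using xy linear_map_zero[OF _ _ comult_linear[OF H]]
    by (intro row_sum_coeff[symmetric]) (auto simp: e_closed row_def hopf_closed[OF H])
  also have "\<dots> = (\<Oplus>\<^bsub>?HH\<^esub>z\<in>row x. ?t (tensor_lift ?W (\<lambda>a b. pure_tensor H ?HV a (pure_tensor H V b (basis_vec z))) (comult H (e x z))))"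
    using xy by (intro vs_finsum_cong[OF HH, symmetric]) (simp_all add: l row_subset e_closed hopf_closed[OF H])
  also have "\<dots> = ?t (\<Oplus>\<^bsub>?W\<^esub>z\<in>row x. tensor_lift ?W (\<lambda>a b. pure_tensor H ?HV a (pure_tensor H V b (basis_vec z))) (comult H (e x z)))"
    using xy by (intro linear_map_finsum[OF W HH t, symmetric] bilinear_mapD(3)[OF out1]) (simp_all add: row_subset e_closed)
  also have "\<dots> = (\<Oplus>\<^bsub>?HH\<^esub>z\<in>row x. ?t (pure_tensor H ?HV (e x z) (coact (basis_vec z))))"
    unfolding ax using xy
    by (intro linear_map_finsum[OF W HH t] bilinear_mapD(3)[OF out2]) (simp_all add: row_subset e_closed)
  also have "\<dots> = (\<Oplus>\<^bsub>?HH\<^esub>z\<in>row x. pure_tensor H H (e x z) (e z y))"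
    using xy by (intro vs_finsum_cong[OF HH]) (simp_all add: tp scoact row_subset e_closed yd_coact_closed[OF yd])
  finally show ?thesis .
qed

text \<open>
  Counitality of the coaction, in the coefficient at \<open>y\<close>.
\<close>

lemma counit_e:
  assumes xy: "x \<in> X" "y \<in> X"
  shows "counit H (e x y) = (if x = y then 1 else 0)"
proof -
  have b: "bilinear_map H V V (\<lambda>h w. counit H h \<odot>\<^bsub>V\<^esub> w)"
    by (intro bilinear_mapI linear_map_smult linear_map_smult_left counit_linear[OF H] linear_map_id) simp_all
  have lin: "linear_map V scalars (\<lambda>v. Poly_Mapping.lookup v y)" by (rule linear_map_lookup)
  have "(\<Oplus>\<^bsub>V\<^esub>z\<in>row x. counit H (e x z) \<odot>\<^bsub>V\<^esub> basis_vec z) = basis_vec x"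
    using yd_counit[OF yd, of "basis_vec x"] xy coact_lift[OF vs_free_space b xy(1)] by simp
  then have "Poly_Mapping.lookup (basis_vec x) y = Poly_Mapping.lookup (\<Oplus>\<^bsub>V\<^esub>z\<in>row x. counit H (e x z) \<odot>\<^bsub>V\<^esub> basis_vec z) y"
    by simp
  also have "\<dots> = (\<Oplus>\<^bsub>scalars\<^esub>z\<in>row x. Poly_Mapping.lookup (counit H (e x z) \<odot>\<^bsub>V\<^esub> basis_vec z) y)"
    using xy row_subset by (intro linear_map_finsum[OF vs_free_space vs_scalars lin] vs_closed(3)[OF vs_free_space]) simp_all
  also have "\<dots> = (\<Oplus>\<^bsub>scalars\<^esub>z\<in>row x. Poly_Mapping.lookup (basis_vec z) y \<odot>\<^bsub>scalars\<^esub> counit H (e x z))"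
    by (intro vs_finsum_cong[OF vs_scalars]) (simp_all add: lookup_single when_def)
  also have "\<dots> = counit H (e x y)"
    using xy linear_map_zero[OF H_vs vs_scalars counit_linear[OF H]]
    by (intro row_sum_coeff[OF vs_scalars]) (simp_all add: row_def)
  finally show ?thesis by (auto simp: lookup_single when_def)
qed

lemma row_self: "x \<in> X \<Longrightarrow> x \<in> row x"
  using counit_e[of x x] linear_map_zero[OF H_vs vs_scalars counit_linear[OF H]] by (auto simp: row_def)

lemma counit_entry: "x \<in> X \<Longrightarrow> y \<in> X \<Longrightarrow> counit H (entry n x y) = (if x = y then 1 else 0)"
  by (induction n) (simp_all add: entry_0 entry_Suc counit_e antipode_counit[OF H])

text \<open>
  Since the coaction matrix is comultiplicative, so is its image under any power of the antipode,
  with the tensor factors swapped for odd powers.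
\<close>

lemma entry_comult:
  assumes W: "vector_space_rec W" and \<beta>: "bilinear_map H H W \<beta>" and xy: "x \<in> X" "y \<in> X"
  shows "tensor_lift W \<beta> (comult H (entry n x y)) = (\<Oplus>\<^bsub>W\<^esub>z\<in>row x.
    if even n then \<beta> (entry n x z) (entry n z y) else \<beta> (entry n z y) (entry n x z))"
  using \<beta>
proof (induction n arbitrary: \<beta>)
  case 0
  have HH: "vector_space_rec (tensor_space H H)" by simp
  have "tensor_lift W \<beta> (comult H (entry 0 x y)) = (\<Oplus>\<^bsub>W\<^esub>z\<in>row x. tensor_lift W \<beta> (pure_tensor H H (e x z) (e z y)))"
    unfolding entry_0 comult_e[OF xy] using xy
    by (intro linear_map_finsum[OF HH W] tensor_lift_linear W 0) (simp_all add: row_subset e_closed)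
  also have "\<dots> = (\<Oplus>\<^bsub>W\<^esub>z\<in>row x. \<beta> (e x z) (e z y))"
    using xy bilinear_mapD(3)[OF 0] by (intro vs_finsum_cong[OF W]) (simp_all add: tensor_lift_pure W 0 row_subset e_closed)
  finally show ?case by (simp add: entry_0)
next
  case (Suc n)
  have h: "entry n x y \<in> carrier H" using xy by simp
  have HH: "vector_space_rec (tensor_space H H)" by simp
  have b1: "bilinear_map H H (tensor_space H H) (\<lambda>a b. pure_tensor H H (antipode H b) (antipode H a))"
    by (intro bilinear_mapI linear_map_pure_tensor antipode_linear[OF H]) (simp_all add: hopf_closed[OF H])
  have b2: "bilinear_map H H W (\<lambda>a b. \<beta> (antipode H b) (antipode H a))"
    by (intro bilinear_mapI linear_map_bilinear[OF Suc.prems] antipode_linear[OF H] hopf_closed[OF H])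
  have "tensor_lift W \<beta> (comult H (entry (Suc n) x y))
    = tensor_lift W (\<lambda>a b. tensor_lift W \<beta> (pure_tensor H H (antipode H b) (antipode H a))) (comult H (entry n x y))"
    unfolding entry_Suc antipode_comult[OF H h]
    by (rule sweedler_linear[OF H HH W b1 tensor_lift_linear[OF _ _ W Suc.prems] h]) simp_all
  also have "\<dots> = tensor_lift W (\<lambda>a b. \<beta> (antipode H b) (antipode H a)) (comult H (entry n x y))"
    by (rule sweedler_cong[OF H W b2 h, symmetric]) (simp add: tensor_lift_pure W Suc.prems hopf_closed[OF H])
  also have "\<dots> = (\<Oplus>\<^bsub>W\<^esub>z\<in>row x. if even n then \<beta> (antipode H (entry n z y)) (antipode H (entry n x z))
      else \<beta> (antipode H (entry n x z)) (antipode H (entry n z y)))"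
    by (rule Suc.IH[OF b2])
  also have "\<dots> = (\<Oplus>\<^bsub>W\<^esub>z\<in>row x. if even (Suc n) then \<beta> (entry (Suc n) x z) (entry (Suc n) z y)
      else \<beta> (entry (Suc n) z y) (entry (Suc n) x z))"
    using xy bilinear_mapD(3)[OF Suc.prems]
    by (intro vs_finsum_cong[OF W]) (auto simp: entry_Suc[symmetric] row_subset)
  finally show ?case .
qed

text \<open>
  The two antipode axioms, evaluated by \<open>entry_comult\<close>: consecutive matrices are mutually inverse.
\<close>

lemma entry_inverse:
  assumes xy: "x \<in> X" "y \<in> X"
  shows "(\<Oplus>\<^bsub>H\<^esub>z\<in>row x. if even n then entry (Suc n) x z \<otimes>\<^bsub>H\<^esub> entry n z y else entry (Suc n) z y \<otimes>\<^bsub>H\<^esub> entry n x z)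
      = (if x = y then \<one>\<^bsub>H\<^esub> else \<zero>\<^bsub>H\<^esub>)"
    and "(\<Oplus>\<^bsub>H\<^esub>z\<in>row x. if even n then entry n x z \<otimes>\<^bsub>H\<^esub> entry (Suc n) z y else entry n z y \<otimes>\<^bsub>H\<^esub> entry (Suc n) x z)
      = (if x = y then \<one>\<^bsub>H\<^esub> else \<zero>\<^bsub>H\<^esub>)"
proof -
  note b1 = bilinear_map_mult[OF H H_alg antipode_linear[OF H] linear_map_id]
    and b2 = bilinear_map_mult[OF H H_alg linear_map_id antipode_linear[OF H]]
  have *: "counit H (entry n x y) \<odot>\<^bsub>H\<^esub> \<one>\<^bsub>H\<^esub> = (if x = y then \<one>\<^bsub>H\<^esub> else \<zero>\<^bsub>H\<^esub>)"
    using xy by (simp add: counit_entry algebra_one_closed[OF H_alg])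
  have h: "entry n x y \<in> carrier H" using xy by simp
  show "(\<Oplus>\<^bsub>H\<^esub>z\<in>row x. if even n then entry (Suc n) x z \<otimes>\<^bsub>H\<^esub> entry n z y else entry (Suc n) z y \<otimes>\<^bsub>H\<^esub> entry n x z)
      = (if x = y then \<one>\<^bsub>H\<^esub> else \<zero>\<^bsub>H\<^esub>)"
    using sweedler_antipode(1)[OF H h] entry_comult[OF H_vs b1 xy] by (simp only: * entry_Suc)
  show "(\<Oplus>\<^bsub>H\<^esub>z\<in>row x. if even n then entry n x z \<otimes>\<^bsub>H\<^esub> entry (Suc n) z y else entry n z y \<otimes>\<^bsub>H\<^esub> entry (Suc n) x z)
      = (if x = y then \<one>\<^bsub>H\<^esub> else \<zero>\<^bsub>H\<^esub>)"
    using sweedler_antipode(2)[OF H h] entry_comult[OF H_vs b2 xy] by (simp only: * entry_Suc)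
qed

subsection \<open>The action of the coefficients\<close>

text \<open>
  The categorical braiding sends \<open>v\<^sub>x \<otimes> v\<^sub>w\<close> to \<open>\<Sum>y. e x y v\<^sub>w \<otimes> v\<^sub>y\<close>, whereas the braiding of the rack
  has only a term with second factor \<open>v\<^sub>x\<close>; compare the coefficients at \<open>v\<^sub>y\<close>.
\<close>

lemma act_e:
  assumes xy: "x \<in> X" "y \<in> X" and w: "w \<in> X"
  shows "act (e x y) (basis_vec w) = (if x = y then q x w \<odot>\<^bsub>V\<^esub> basis_vec (op x w) else 0)"
proof -
  let ?VV = "tensor_space V V"
  have bw: "basis_vec w \<in> carrier V" and bx: "basis_vec x \<in> carrier V" using w xy by simp_all
  have lb: "bilinear_map V V V (\<lambda>u w. Poly_Mapping.lookup w y \<odot>\<^bsub>V\<^esub> u)"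
    by (intro bilinear_mapI linear_map_smult linear_map_smult_left linear_map_lookup linear_map_id) simp_all
  let ?l = "tensor_lift V (\<lambda>u w. Poly_Mapping.lookup w y \<odot>\<^bsub>V\<^esub> u)"
  have l: "linear_map ?VV V ?l" by (intro tensor_lift_linear lb) simp_all
  have lp: "?l (pure_tensor V V u v) = Poly_Mapping.lookup v y \<odot>\<^bsub>V\<^esub> u"
    if "u \<in> carrier V" "v \<in> carrier V" for u v
    by (intro tensor_lift_pure lb that) simp_all
  note ib = yd_braiding_inner[OF yd bw]
  have cl: "act (e x z) (basis_vec w) \<in> carrier V" if "z \<in> X" for z
    using yd_act_closed[OF yd _ bw] that xy e_closed by blast
  have "yd_braiding V act coact (pure_tensor V V (basis_vec x) (basis_vec w))
    = (\<Oplus>\<^bsub>?VV\<^esub>z\<in>row x. pure_tensor V V (act (e x z) (basis_vec w)) (basis_vec z))"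
    using yd_braiding_pure[OF yd bx bw] coact_lift[OF _ ib xy(1)] by simp
  then have "?l (rack_braiding X op q (pure_tensor V V (basis_vec x) (basis_vec w)))
    = ?l (\<Oplus>\<^bsub>?VV\<^esub>z\<in>row x. pure_tensor V V (act (e x z) (basis_vec w)) (basis_vec z))"
    using braiding[of "pure_tensor V V (basis_vec x) (basis_vec w)"] bx bw by simp
  also have "\<dots> = (\<Oplus>\<^bsub>V\<^esub>z\<in>row x. ?l (pure_tensor V V (act (e x z) (basis_vec w)) (basis_vec z)))"
    using xy cl row_subset by (intro linear_map_finsum[OF _ _ l]) simp_all
  also have "\<dots> = (\<Oplus>\<^bsub>V\<^esub>z\<in>row x. Poly_Mapping.lookup (basis_vec z) y \<odot>\<^bsub>V\<^esub> act (e x z) (basis_vec w))"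
  proof (rule vs_finsum_cong[OF vs_free_space])
    fix z assume "z \<in> row x"
    then have z: "z \<in> X" by (rule row_subset)
    show "Poly_Mapping.lookup (basis_vec z) y \<odot>\<^bsub>V\<^esub> act (e x z) (basis_vec w) \<in> carrier V"
      by (rule vs_closed(3)[OF vs_free_space cl[OF z]])
    show "?l (pure_tensor V V (act (e x z) (basis_vec w)) (basis_vec z))
      = Poly_Mapping.lookup (basis_vec z) y \<odot>\<^bsub>V\<^esub> act (e x z) (basis_vec w)"
      using z by (intro lp cl) simp_all
  qed
  also have "\<dots> = act (e x y) (basis_vec w)"
    using cl xy linear_map_zero[OF _ _ yd_act(2)[OF yd bw]] by (intro row_sum_coeff) (simp_all add: row_def)
  finally have "act (e x y) (basis_vec w) = ?l (rack_braiding X op q (pure_tensor V V (basis_vec x) (basis_vec w)))" ..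
  also have "\<dots> = q x w \<odot>\<^bsub>V\<^esub> (Poly_Mapping.lookup (basis_vec x) y \<odot>\<^bsub>V\<^esub> basis_vec (op x w))"
    unfolding rack_braiding_basis[OF rack xy(1) w]
    using xy w by (subst linear_mapD(3)[OF l]) (simp_all add: lp del: free_space_simps(4))
  also have "\<dots> = (if x = y then q x w \<odot>\<^bsub>V\<^esub> basis_vec (op x w) else 0)"
    using xy w by (auto intro!: poly_mapping_eqI simp: lookup_single when_def)
  finally show ?thesis .
qed

text \<open>
  Translations of the rack are bijective and the cocycle has no zeros.
\<close>

lemma act_e_surj:
  assumes x: "x \<in> X" and u: "u \<in> carrier V"
  shows "\<exists>v\<in>carrier V. act (e x x) v = u"
proof -
  have bij: "bij_betw (op x) X X" using rack x by (simp add: rack_def)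
  define \<psi> where "\<psi> = inv_into X (op x)"
  have \<psi>: "\<psi> z \<in> X" "op x (\<psi> z) = z" if "z \<in> X" for z
    using bij that by (auto simp: \<psi>_def bij_betw_def inv_into_into f_inv_into_f)
  let ?b = "\<lambda>z. (1 / q x (\<psi> z)) \<odot>\<^bsub>V\<^esub> basis_vec (\<psi> z)"
  have b: "?b z \<in> carrier V" if "z \<in> X" for z
    using \<psi>[OF that] by (intro vs_closed(3)[OF vs_free_space]) simp
  have exx: "e x x \<in> carrier H" using x by (simp add: e_closed)
  have act: "linear_map V V (act (e x x))" by (rule yd_act(1)[OF yd exx])
  have "act (e x x) (lin_extend V ?b u) = lin_extend V (\<lambda>z. act (e x x) (?b z)) u"
    by (rule linear_lin_extend[OF vs_free_space vs_free_space act b u])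
  also have "\<dots> = lin_extend V basis_vec u"
  proof (rule lin_extend_cong[OF vs_free_space u])
    fix z assume z: "z \<in> X"
    have "act (e x x) (?b z) = (1 / q x (\<psi> z)) \<odot>\<^bsub>V\<^esub> (q x (\<psi> z) \<odot>\<^bsub>V\<^esub> basis_vec z)"
      using linear_mapD(3)[OF act, of "basis_vec (\<psi> z)"] act_e[OF x x \<psi>(1)[OF z]] \<psi>[OF z] by simp
    then show "act (e x x) (?b z) = basis_vec z"
      using q_nonzero[OF x \<psi>(1)[OF z]] by (auto intro!: poly_mapping_eqI)
  qed simp
  also have "\<dots> = u" by (rule lin_extend_basis_vec[OF u])
  finally show ?thesis
    using linear_mapD(1)[OF lin_extend_linear[where X = X and f = ?b, OF vs_free_space b] u] by blast
qed

text \<open>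
  The relation between consecutive powers, read through the action: if off-diagonal entries of the
  lower power act by zero, a single summand is left.  Its index is \<open>y\<close> or \<open>x\<close> according to the order of
  the tensor factors in \<open>entry_comult\<close>.
\<close>

lemma act_entry_step:
  assumes off: "\<And>x y v. x \<in> X \<Longrightarrow> y \<in> X \<Longrightarrow> x \<noteq> y \<Longrightarrow> v \<in> carrier V \<Longrightarrow> act (entry n x y) v = 0"
    and xy: "x \<in> X" "y \<in> X" and v: "v \<in> carrier V"
  shows "act (entry (Suc n) x y) (act (entry n (if even n then y else x) (if even n then y else x)) v)
    = (if x = y then v else 0)"
proof -
  let ?w = "if even n then y else x"
  let ?r = "\<lambda>z. if even n then entry (Suc n) x z \<otimes>\<^bsub>H\<^esub> entry n z y else entry (Suc n) z y \<otimes>\<^bsub>H\<^esub> entry n x z"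
  have lin: "linear_map H V (\<lambda>h. act h v)" by (rule yd_act(2)[OF yd v])
  have r: "?r z \<in> carrier H" if "z \<in> X" for z using that xy by (simp add: algebra_mult_closed[OF H_alg])
  have a0: "act (entry m x' y') 0 = 0" if "x' \<in> X" "y' \<in> X" for m x' y'
    using linear_map_zero[OF _ _ yd_act(1)[OF yd entry_closed[OF that]]] by simp
  have z0: "act (?r z) v = 0" if "z \<in> X" "z \<noteq> ?w" for z
    using that xy v off by (cases "even n") (auto simp: yd_act_mult[OF yd] a0)
  have "(\<Oplus>\<^bsub>V\<^esub>z\<in>row x. act (?r z) v) = act (?r ?w) v"
  proof (cases "?w \<in> row x")
    case True
    then show ?thesis
      using xy r z0 row_subset linear_mapD(1)[OF lin] by (intro vs_finsum_single) simp_all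
  next
    case False
    then have "even n" "y \<notin> row x" using row_self[OF xy(1)] by (auto split: if_splits)
    then have "?r ?w = \<zero>\<^bsub>H\<^esub>" using xy entry_zero by (simp add: algebra_null[OF H_alg])
    then have "act (?r ?w) v = 0" using linear_map_zero[OF _ _ lin] by simp
    moreover have "(\<Oplus>\<^bsub>V\<^esub>z\<in>row x. act (?r z) v) = \<zero>\<^bsub>V\<^esub>"
    proof (rule vs_finsum_zero[OF vs_free_space])
      fix z assume z: "z \<in> row x"
      then have "z \<noteq> ?w" using False by blast
      then show "act (?r z) v = \<zero>\<^bsub>V\<^esub>" using z0[OF row_subset[OF z]] by simp
    qed
    ultimately show ?thesis by simp
  qed
  moreover have "(\<Oplus>\<^bsub>V\<^esub>z\<in>row x. act (?r z) v) = act (if x = y then \<one>\<^bsub>H\<^esub> else \<zero>\<^bsub>H\<^esub>) v"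
    unfolding entry_inverse(1)[OF xy, of n, symmetric]
    using xy r row_subset by (intro linear_map_finsum[OF _ _ lin, symmetric]) simp_all
  moreover have "act (if x = y then \<one>\<^bsub>H\<^esub> else \<zero>\<^bsub>H\<^esub>) v = (if x = y then v else 0)"
    using linear_map_zero[OF _ _ lin] v yd_act_one[OF yd v] by simp
  moreover have "act (?r ?w) v = act (entry (Suc n) x y) (act (entry n ?w ?w) v)"
    using xy v by (simp add: yd_act_mult[OF yd])
  ultimately show ?thesis by simp
qed

text \<open>
  Surjectivity of the diagonal entries is part of the induction, because it allows to cancel them in
  \<open>act_entry_step\<close>.
\<close>

lemma act_entry:
  "(\<forall>x\<in>X. \<forall>y\<in>X. x \<noteq> y \<longrightarrow> (\<forall>v\<in>carrier V. act (entry n x y) v = 0)) \<and>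
   (\<forall>x\<in>X. \<forall>u\<in>carrier V. \<exists>v\<in>carrier V. act (entry n x x) v = u)"
proof (induction n)
  case 0
  have "act (e x y) v = 0" if xy: "x \<in> X" "y \<in> X" "x \<noteq> y" and v: "v \<in> carrier V" for x y v
  proof (rule linear_map_free_eq[OF vs_free_space yd_act(1)[OF yd e_closed[OF xy(1,2)]] _ _ v])
    show "linear_map V V (\<lambda>v. 0)" by (rule linear_mapI) (auto intro!: poly_mapping_eqI)
  qed (simp add: act_e xy)
  then show ?case using act_e_surj by (simp add: entry_0 del: free_space_simps(1))
next
  case (Suc n)
  then have off: "\<And>x y v. x \<in> X \<Longrightarrow> y \<in> X \<Longrightarrow> x \<noteq> y \<Longrightarrow> v \<in> carrier V \<Longrightarrow> act (entry n x y) v = 0"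
    and surj: "\<And>x u. x \<in> X \<Longrightarrow> u \<in> carrier V \<Longrightarrow> \<exists>v\<in>carrier V. act (entry n x x) v = u" by blast+
  have step: "act (entry (Suc n) x y) (act (entry n (if even n then y else x) (if even n then y else x)) v)
    = (if x = y then v else 0)" if "x \<in> X" "y \<in> X" "v \<in> carrier V" for x y v
    using act_entry_step[OF off _ _ _] that by blast
  show ?case
  proof (intro conjI ballI impI)
    fix x y v assume xy: "x \<in> X" "y \<in> X" "x \<noteq> y" and v: "v \<in> carrier V"
    have "(if even n then y else x) \<in> X" using xy by simp
    then obtain u where u: "u \<in> carrier V"
      "act (entry n (if even n then y else x) (if even n then y else x)) u = v"
      using surj[OF _ v] by blast
    then show "act (entry (Suc n) x y) v = 0" using step[OF xy(1,2) u(1)] xy(3) by simp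
  next
    fix x u assume x: "x \<in> X" and u: "u \<in> carrier V"
    show "\<exists>v\<in>carrier V. act (entry (Suc n) x x) v = u"
      using step[OF x x u] yd_act_closed[OF yd entry_closed[OF x x] u] by auto
  qed
qed

end

context rack_realization
begin

section \<open>The Hopf algebra generated by the coefficients and its quotient\<close>

definition coeffs :: "'h set" where "coeffs = {entry n x y | n x y. x \<in> X \<and> y \<in> X}"

definition coeff_alg :: "'h set" where "coeff_alg = gen_subalgebra H coeffs"

lemma coeffs_subset: "coeffs \<subseteq> carrier H"
  by (auto simp: coeffs_def)

lemma entry_coeff_alg [simp]: "x \<in> X \<Longrightarrow> y \<in> X \<Longrightarrow> entry n x y \<in> coeff_alg"
  by (auto simp: coeff_alg_def coeffs_def intro!: gen_incl)

lemma coeff_alg_hopf: "hopf_subalgebra H coeff_alg"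
  unfolding coeff_alg_def
proof (rule gen_hopf_subalgebra[OF H coeffs_subset])
  fix s assume "s \<in> coeffs"
  then obtain n x y where s: "s = entry n x y" and xy: "x \<in> X" "y \<in> X" by (auto simp: coeffs_def)
  have "antipode H s = entry (Suc n) x y" by (simp add: s entry_Suc)
  then show "antipode H s \<in> coeffs" using xy by (auto simp: coeffs_def)
  let ?HH = "tensor_space H H" and ?B = "incl_tensor H ` carrier (tensor_sub H (gen_subalgebra H coeffs))"
  have HH: "vector_space_rec ?HH" by simp
  have "comult H s = tensor_lift ?HH (pure_tensor H H) (comult H s)"
    using xy s by (simp add: tensor_lift_id hopf_closed[OF H])
  also have "\<dots> = (\<Oplus>\<^bsub>?HH\<^esub>z\<in>row x. if even n then pure_tensor H H (entry n x z) (entry n z y)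
      else pure_tensor H H (entry n z y) (entry n x z))"
    unfolding s by (rule entry_comult[OF HH pure_tensor_bilinear[OF H_vs H_vs] xy])
  also have "\<dots> \<in> ?B"
    using xy by (intro subspace_finsum[OF HH gen_tensor_image(1)[OF H coeffs_subset]])
      (auto intro!: gen_tensor_image(2)[OF H coeffs_subset, folded coeff_alg_def]
        simp: coeff_alg_def[symmetric] row_subset)
  finally show "comult H s \<in> ?B" .
qed

text \<open>
  A Hopf subalgebra that contains the \<open>e x y\<close> is stable under the antipode and so contains all powers;
  conversely the algebra generated by the powers is a Hopf subalgebra.
\<close>

lemma hull_coeff_alg: "hopf_subalgebra H hull {e x y | x y. x \<in> X \<and> y \<in> X} = coeff_alg"
proof (rule hull_unique)
  show "{e x y | x y. x \<in> X \<and> y \<in> X} \<subseteq> coeff_alg"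
    using entry_coeff_alg[of _ _ 0] by (auto simp: entry_0)
  show "hopf_subalgebra H coeff_alg" by (rule coeff_alg_hopf)
  fix B assume B: "{e x y | x y. x \<in> X \<and> y \<in> X} \<subseteq> B" "hopf_subalgebra H B"
  have "entry n x y \<in> B" if "x \<in> X" "y \<in> X" for n x y
    using that B(1) by (induction n) (auto simp: entry_0 entry_Suc intro: hopf_subalgebra_closed(7)[OF H B(2)])
  then show "coeff_alg \<subseteq> B"
    unfolding coeff_alg_def by (intro gen_subalgebra_least[OF H coeffs_subset B(2)]) (auto simp: coeffs_def)
qed

definition K :: "('k, 'h) hopf" where "K = sub_hopf H coeff_alg"

lemma K_hopf: "hopf_algebra K"
  unfolding K_def by (rule sub_hopf_hopf_algebra[OF H coeff_alg_hopf])

lemma K_alg [simp]: "assoc_algebra K" and K_vs [simp]: "vector_space_rec K"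
  using hopf_assoc_algebra(1)[OF K_hopf] by simp_all

lemma K_simps [simp]:
  "carrier K = coeff_alg" "x \<oplus>\<^bsub>K\<^esub> y = x \<oplus>\<^bsub>H\<^esub> y" "c \<odot>\<^bsub>K\<^esub> x = c \<odot>\<^bsub>H\<^esub> x"
  "\<zero>\<^bsub>K\<^esub> = \<zero>\<^bsub>H\<^esub>" "\<one>\<^bsub>K\<^esub> = \<one>\<^bsub>H\<^esub>" "x \<otimes>\<^bsub>K\<^esub> y = x \<otimes>\<^bsub>H\<^esub> y"
  "counit K = counit H" "antipode K = antipode H"
  unfolding K_def by (simp_all add: sub_hopf_simps[OF H coeff_alg_hopf])

lemmas coeff_alg_closed = hopf_subalgebra_closed[OF H coeff_alg_hopf]

definition off :: "'h set" where "off = {(antipode H ^^ n) (e x y) | n x y. x \<in> X \<and> y \<in> X \<and> x \<noteq> y}"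

definition I :: "'h set" where "I = Idl\<^bsub>K\<^esub> off"

lemma off_entry: "off = {entry n x y | n x y. x \<in> X \<and> y \<in> X \<and> x \<noteq> y}"
  by (simp add: off_def entry_def)

lemma off_subset: "off \<subseteq> carrier K"
  by (auto simp: off_entry)

lemma I_ideal: "ideal I K"
  unfolding I_def by (rule ring.genideal_ideal[OF algebra_ring[OF K_alg] off_subset])

lemma off_I: "x \<in> X \<Longrightarrow> y \<in> X \<Longrightarrow> x \<noteq> y \<Longrightarrow> entry n x y \<in> I"
  using ring.genideal_self[OF algebra_ring[OF K_alg] off_subset] by (auto simp: I_def off_entry)

lemma I_least: "ideal J K \<Longrightarrow> (\<And>n x y. x \<in> X \<Longrightarrow> y \<in> X \<Longrightarrow> x \<noteq> y \<Longrightarrow> entry n x y \<in> J) \<Longrightarrow> I \<subseteq> J"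
  unfolding I_def by (rule ring.genideal_minimal[OF algebra_ring[OF K_alg]]) (auto simp: off_entry)

lemma I_subspace: "subspace_rec K I"
  by (rule ideal_subspace[OF K_alg I_ideal])

text \<open>The annihilator of \<open>V\<close> is an ideal that contains the off-diagonal coefficients.\<close>

lemma act_I:
  assumes "h \<in> I" "v \<in> carrier V"
  shows "act h v = 0"
proof -
  let ?J = "{h \<in> coeff_alg. \<forall>v\<in>carrier V. act h v = 0}"
  have lin: "linear_map H V (\<lambda>h. act h v)" if "v \<in> carrier V" for v by (rule yd_act(2)[OF yd that])
  note L = linear_mapD[OF lin]
  have "ideal ?J K"
  proof (rule ideal_of_subspace[OF K_alg subspace_recI[OF K_vs]])
    show "\<zero>\<^bsub>K\<^esub> \<in> ?J" using linear_map_zero[OF H_vs vs_free_space lin] coeff_alg_closed(2) by (simp del: free_space_simps(1))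
    show "x \<oplus>\<^bsub>K\<^esub> y \<in> ?J" if "x \<in> ?J" "y \<in> ?J" for x y
      using that L(2) coeff_alg_closed by (simp del: free_space_simps(1))
    show "c \<odot>\<^bsub>K\<^esub> x \<in> ?J" if "x \<in> ?J" for c x
      using that L(3) coeff_alg_closed by (auto simp del: free_space_simps(1) intro!: poly_mapping_eqI)
    show "x \<otimes>\<^bsub>K\<^esub> a \<in> ?J" if "a \<in> ?J" "x \<in> carrier K" for a x
    proof -
      have "act x 0 = 0"
        using linear_map_zero[OF vs_free_space vs_free_space yd_act(1)[OF yd]] that(2) coeff_alg_closed(1) by simp
      then show ?thesis using that coeff_alg_closed by (simp add: yd_act_mult[OF yd] del: free_space_simps(1))
    qed
    show "a \<otimes>\<^bsub>K\<^esub> x \<in> ?J" if "a \<in> ?J" "x \<in> carrier K" for a x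
      using that coeff_alg_closed yd_act_closed[OF yd] by (simp add: yd_act_mult[OF yd] del: free_space_simps(1))
  qed auto
  moreover have "entry n x y \<in> ?J" if "x \<in> X" "y \<in> X" "x \<noteq> y" for n x y
    using act_entry[of n] that by (simp del: free_space_simps(1))
  ultimately have "I \<subseteq> ?J" by (rule I_least)
  then show ?thesis using assms by blast
qed

lemma counit_I: "h \<in> I \<Longrightarrow> counit H h = 0"
proof -
  have "ideal {h \<in> carrier K. counit K h = \<zero>\<^bsub>scalars\<^esub>} K"
  proof (rule kernel_ideal[OF K_alg _ counit_linear[OF K_hopf]])
    show "assoc_algebra (scalars :: ('k, 'k) module)"
      by (rule assoc_algebraI) (auto intro!: bilinear_mapI linear_mapI simp: algebra_simps)
    show "counit K (x \<otimes>\<^bsub>K\<^esub> y) = counit K x \<otimes>\<^bsub>scalars\<^esub> counit K y" if "x \<in> carrier K" "y \<in> carrier K" for x y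
      using counit_mult[OF K_hopf that] by simp
  qed
  then have "I \<subseteq> {h \<in> carrier K. counit K h = \<zero>\<^bsub>scalars\<^esub>}"
    by (rule I_least) (simp add: counit_entry)
  then show "h \<in> I \<Longrightarrow> counit H h = 0" by auto
qed

text \<open>
  The antipode reverses products, so the preimage of an ideal is an ideal; and it maps off-diagonal
  entries to off-diagonal entries.
\<close>

lemma antipode_I: "h \<in> I \<Longrightarrow> antipode H h \<in> I"
proof -
  let ?J = "{h \<in> coeff_alg. antipode H h \<in> I}"
  interpret I: ideal I K by (rule I_ideal)
  note ID = subspace_recD[OF K_vs I_subspace]
  note Sl = linear_mapD[OF antipode_linear[OF H]]
  have S0: "antipode H \<zero>\<^bsub>H\<^esub> = \<zero>\<^bsub>H\<^esub>" by (rule linear_map_zero[OF H_vs H_vs antipode_linear[OF H]])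
  have "ideal ?J K"
  proof (rule ideal_of_subspace[OF K_alg subspace_recI[OF K_vs]])
    show "\<zero>\<^bsub>K\<^esub> \<in> ?J" using ID(2) coeff_alg_closed(2) by (simp add: S0)
    show "x \<oplus>\<^bsub>K\<^esub> y \<in> ?J" if "x \<in> ?J" "y \<in> ?J" for x y
      using that ID(3) coeff_alg_closed by (simp add: Sl)
    show "c \<odot>\<^bsub>K\<^esub> x \<in> ?J" if "x \<in> ?J" for c x
      using that ID(4) coeff_alg_closed by (simp add: Sl)
    show "x \<otimes>\<^bsub>K\<^esub> a \<in> ?J" "a \<otimes>\<^bsub>K\<^esub> x \<in> ?J" if "a \<in> ?J" "x \<in> carrier K" for a x
      using that coeff_alg_closed I.I_l_closed[of "antipode H a" "antipode H x"] I.I_r_closed[of "antipode H a" "antipode H x"]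
      by (simp_all add: antipode_mult[OF H])
  qed auto
  moreover have "entry n x y \<in> ?J" if "x \<in> X" "y \<in> X" "x \<noteq> y" for n x y
    using off_I[OF that, of "Suc n"] that by (simp add: entry_Suc)
  ultimately have "I \<subseteq> ?J" by (rule I_least)
  then show "h \<in> I \<Longrightarrow> antipode H h \<in> I" by blast
qed

text \<open>
  Needed for bilinear maps built from the projection to a quotient of \<open>K\<close>, which live on \<open>K\<close> only.
\<close>

lemma entry_comult_K:
  assumes W: "vector_space_rec W" and \<beta>: "bilinear_map K K W \<beta>" and xy: "x \<in> X" "y \<in> X"
  shows "tensor_lift W \<beta> (comult K (entry n x y)) = (\<Oplus>\<^bsub>W\<^esub>z\<in>row x.
    if even n then \<beta> (entry n x z) (entry n z y) else \<beta> (entry n z y) (entry n x z))"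
proof -
  obtain r where r: "linear_map H K r" "\<forall>n\<in>coeff_alg. r n = n"
    using sub_hopf_retraction[OF H coeff_alg_hopf] unfolding K_def by blast
  have b: "bilinear_map H H W (\<lambda>a b. \<beta> (r a) (r b))"
    by (intro bilinear_mapI linear_map_bilinear[OF \<beta>] r linear_mapD(1)[OF r(1)])
  have "tensor_lift W \<beta> (comult K (entry n x y)) = tensor_lift W (\<lambda>a b. \<beta> (r a) (r b)) (comult H (entry n x y))"
    using sub_sweedler_retract[OF H coeff_alg_hopf entry_coeff_alg[OF xy] W \<beta>[unfolded K_def] r[unfolded K_def]]
    unfolding K_def .
  also have "\<dots> = (\<Oplus>\<^bsub>W\<^esub>z\<in>row x. if even n then \<beta> (r (entry n x z)) (r (entry n z y)) else \<beta> (r (entry n z y)) (r (entry n x z)))"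
    by (rule entry_comult[OF W b xy])
  also have "\<dots> = (\<Oplus>\<^bsub>W\<^esub>z\<in>row x. if even n then \<beta> (entry n x z) (entry n z y) else \<beta> (entry n z y) (entry n x z))"
    using xy r(2) row_subset bilinear_mapD(3)[OF \<beta>] by (intro vs_finsum_cong[OF W]) simp_all
  finally show ?thesis .
qed

lemma coset_off:
  assumes "x \<in> X" "y \<in> X" "x \<noteq> y"
  shows "I +>\<^bsub>K\<^esub> entry n x y = I"
  using coset_in_null_iff[OF K_vs I_subspace, of "entry n x y"] off_I[OF assms] assms by simp

text \<open>
  In the coproduct of \<open>entry n x y\<close> the intermediate index \<open>z\<close> differs from \<open>x\<close> or from \<open>y\<close> when
  \<open>x \<noteq> y\<close>, so each summand has a factor in \<open>I\<close>.
\<close>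

lemma I_hopf_ideal: "hopf_ideal K I"
proof -
  let ?Q = "quotient_module K I" and ?p = "\<lambda>h. I +>\<^bsub>K\<^esub> h"
  have Q: "assoc_algebra ?Q" by (rule quotient_assoc_algebra(1)[OF K_alg I_ideal])
  then have vs[simp]: "vector_space_rec ?Q" by simp
  have QQ: "assoc_algebra (tensor_algebra ?Q ?Q)" by (rule tensor_algebra_assoc[OF Q Q])
  have p: "linear_map K ?Q ?p" by (rule quotient_map_linear[OF K_vs I_subspace])
  note pm = quotient_assoc_algebra(2)[OF K_alg I_ideal, symmetric]
  let ?f = "\<lambda>h. tensor_map ?Q ?Q ?p ?p (comult K h)"
  have f: "linear_map K (tensor_algebra ?Q ?Q) ?f"
    unfolding linear_map_tensor_algebra
    by (rule linear_map_comp[OF tensor_map_linear[OF K_vs K_vs vs vs p p] comult_linear[OF K_hopf]])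
  have "ideal {h \<in> carrier K. ?f h = \<zero>\<^bsub>tensor_algebra ?Q ?Q\<^esub>} K"
  proof (rule kernel_ideal[OF K_alg QQ f])
    fix x y assume "x \<in> carrier K" "y \<in> carrier K"
    then show "?f (x \<otimes>\<^bsub>K\<^esub> y) = ?f x \<otimes>\<^bsub>tensor_algebra ?Q ?Q\<^esub> ?f y"
      unfolding comult_mult[OF K_hopf \<open>x \<in> carrier K\<close> \<open>y \<in> carrier K\<close>]
      by (intro tensor_map_mult K_alg Q p pm hopf_closed[OF K_hopf])
  qed
  moreover have "entry n x y \<in> {h \<in> carrier K. ?f h = \<zero>\<^bsub>tensor_algebra ?Q ?Q\<^esub>}"
    if xy: "x \<in> X" "y \<in> X" "x \<noteq> y" for n x y
  proof -
    have z0: "?p (entry n x' y') = \<zero>\<^bsub>?Q\<^esub>" if "x' \<in> X" "y' \<in> X" "x' \<noteq> y'" for x' y'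
      using coset_off[OF that] by (simp add: quotient_module_simps)
    have pc: "?p (entry n x' y') \<in> carrier ?Q" if "x' \<in> X" "y' \<in> X" for x' y'
      using linear_mapD(1)[OF p] that by simp
    have "?f (entry n x y) = (\<Oplus>\<^bsub>tensor_space ?Q ?Q\<^esub>z\<in>row x.
      if even n then pure_tensor ?Q ?Q (?p (entry n x z)) (?p (entry n z y))
      else pure_tensor ?Q ?Q (?p (entry n z y)) (?p (entry n x z)))"
      unfolding tensor_map_def using xy
      by (intro entry_comult_K tensor_map_bilinear[OF K_vs K_vs vs vs p p]) simp_all
    also have "\<dots> = \<zero>\<^bsub>tensor_space ?Q ?Q\<^esub>"
    proof (rule vs_finsum_zero)
      fix z assume "z \<in> row x"
      then have z: "z \<in> X" by (rule row_subset)
      show "(if even n then pure_tensor ?Q ?Q (?p (entry n x z)) (?p (entry n z y))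
        else pure_tensor ?Q ?Q (?p (entry n z y)) (?p (entry n x z))) = \<zero>\<^bsub>tensor_space ?Q ?Q\<^esub>"
        using z0[OF xy(1) z] z0[OF z xy(2)] pc[OF xy(1) z] pc[OF z xy(2)] xy(3)
        by (cases "x = z") (simp_all add: pure_tensor_simps(5,6)[OF vs vs])
    qed simp
    finally show ?thesis using xy by simp
  qed
  ultimately have "I \<subseteq> {h \<in> carrier K. ?f h = \<zero>\<^bsub>tensor_algebra ?Q ?Q\<^esub>}" by (rule I_least)
  then show ?thesis
    using I_ideal counit_I antipode_I by (auto simp: hopf_ideal_def)
qed

definition Kbar :: "('k, 'h set) hopf" where "Kbar = quotient_hopf K I"

definition cls :: "'h \<Rightarrow> 'h set" where "cls h = I +>\<^bsub>K\<^esub> h"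

lemma cls_fun: "cls = (\<lambda>h. I +>\<^bsub>K\<^esub> h)"
  by (simp add: cls_def fun_eq_iff)

lemma Kbar_hopf: "hopf_algebra Kbar"
  and cls_hom: "hopf_hom K Kbar cls"
  and cls_linear: "linear_map K Kbar cls"
  and cls_mult: "x \<in> coeff_alg \<Longrightarrow> y \<in> coeff_alg \<Longrightarrow> cls (x \<otimes>\<^bsub>H\<^esub> y) = cls x \<otimes>\<^bsub>Kbar\<^esub> cls y"
  and cls_one: "cls \<one>\<^bsub>H\<^esub> = \<one>\<^bsub>Kbar\<^esub>"
  and Kbar_carrier: "carrier Kbar = cls ` coeff_alg"
  and cls_antipode: "x \<in> coeff_alg \<Longrightarrow> antipode Kbar (cls x) = cls (antipode H x)"
  and cls_counit: "x \<in> coeff_alg \<Longrightarrow> counit Kbar (cls x) = counit H x"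
  and cls_comult: "x \<in> coeff_alg \<Longrightarrow> comult Kbar (cls x) = tensor_map Kbar Kbar cls cls (comult K x)"
  unfolding Kbar_def cls_fun
  using quotient_hopf_hopf_algebra[OF K_hopf I_hopf_ideal] quotient_hopf_hom[OF K_hopf I_hopf_ideal]
    quotient_hopf_proj[OF K_hopf I_hopf_ideal] quotient_hopf_mult[OF K_hopf I_hopf_ideal]
    quotient_hopf_one[OF K_hopf I_hopf_ideal] quotient_hopf_carrier[OF K_hopf I_hopf_ideal]
    quotient_hopf_ops[OF K_hopf I_hopf_ideal] by simp_all

lemma Kbar_alg [simp]: "assoc_algebra Kbar" and Kbar_vs [simp]: "vector_space_rec Kbar"
  using hopf_assoc_algebra(1)[OF Kbar_hopf] by simp_all

lemma cls_closed [simp]: "h \<in> coeff_alg \<Longrightarrow> cls h \<in> carrier Kbar"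
  by (simp add: Kbar_carrier)

lemma cls_off: "x \<in> X \<Longrightarrow> y \<in> X \<Longrightarrow> x \<noteq> y \<Longrightarrow> cls (entry n x y) = \<zero>\<^bsub>Kbar\<^esub>"
  unfolding cls_def coset_off Kbar_def quotient_hopf_space[OF K_hopf I_hopf_ideal] quotient_module_simps ..

lemma cls_eq_act:
  assumes "g \<in> coeff_alg" "h \<in> coeff_alg" "cls g = cls h" "v \<in> carrier V"
  shows "act g v = act h v"
proof -
  have gh: "g \<in> carrier H" "h \<in> carrier H" using assms coeff_alg_closed(1) by simp_all
  have d: "g \<oplus>\<^bsub>H\<^esub> (- 1) \<odot>\<^bsub>H\<^esub> h \<in> I"
    using coset_eqD[OF K_vs I_subspace, of g h] assms by (simp add: cls_def)
  note L = linear_mapD[OF yd_act(2)[OF yd assms(4)]]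
  have "act g v \<oplus>\<^bsub>V\<^esub> (- 1) \<odot>\<^bsub>V\<^esub> act h v = act (g \<oplus>\<^bsub>H\<^esub> (- 1) \<odot>\<^bsub>H\<^esub> h) v"
    using gh by (simp only: L vs_closed(3)[OF H_vs])
  also have "\<dots> = \<zero>\<^bsub>V\<^esub>" using act_I[OF d assms(4)] by simp
  finally show ?thesis
    using vs_diff_eq_zero[OF vs_free_space] yd_act_closed[OF yd _ assms(4)] gh by blast
qed

text \<open>
  The counit descends to the quotient and maps \<open>1\<close> to \<open>1\<close>.
\<close>

lemma Kbar_nonzero: "carrier Kbar \<noteq> {\<zero>\<^bsub>Kbar\<^esub>}"
proof
  assume "carrier Kbar = {\<zero>\<^bsub>Kbar\<^esub>}"
  then have "\<one>\<^bsub>Kbar\<^esub> = \<zero>\<^bsub>Kbar\<^esub>" using algebra_one_closed[OF Kbar_alg] by blast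
  then have "counit Kbar \<one>\<^bsub>Kbar\<^esub> = 0"
    using linear_map_zero[OF Kbar_vs vs_scalars counit_linear[OF Kbar_hopf]] by simp
  then show False by (simp add: counit_one[OF Kbar_hopf])
qed

subsection \<open>The group of diagonal classes\<close>

text \<open>
  Modulo \<open>I\<close> only the summand with intermediate index \<open>x\<close> survives in the coproduct.
\<close>

lemma diag_grouplike:
  assumes x: "x \<in> X"
  shows "grouplike Kbar (cls (entry n x x))"
proof -
  let ?QQ = "tensor_space Kbar Kbar"
  have pc: "cls (entry n x y) \<in> carrier Kbar" "cls (entry n y x) \<in> carrier Kbar" if "y \<in> X" for y using that x by simp_all
  have "comult Kbar (cls (entry n x x)) = (\<Oplus>\<^bsub>?QQ\<^esub>z\<in>row x.
      if even n then pure_tensor Kbar Kbar (cls (entry n x z)) (cls (entry n z x))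
      else pure_tensor Kbar Kbar (cls (entry n z x)) (cls (entry n x z)))"
    unfolding cls_comult[OF entry_coeff_alg[OF x x]] tensor_map_def using x
    by (intro entry_comult_K tensor_map_bilinear[OF K_vs K_vs Kbar_vs Kbar_vs cls_linear cls_linear]) simp_all
  also have "\<dots> = (if even n then pure_tensor Kbar Kbar (cls (entry n x x)) (cls (entry n x x))
      else pure_tensor Kbar Kbar (cls (entry n x x)) (cls (entry n x x)))"
  proof (rule vs_finsum_single[OF _ row_finite[OF x] row_self[OF x]])
    fix z assume "z \<in> row x"
    then have z: "z \<in> X" by (rule row_subset)
    show "(if even n then pure_tensor Kbar Kbar (cls (entry n x z)) (cls (entry n z x))
      else pure_tensor Kbar Kbar (cls (entry n z x)) (cls (entry n x z))) \<in> carrier ?QQ" using z x by simp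
    assume "z \<noteq> x"
    then show "(if even n then pure_tensor Kbar Kbar (cls (entry n x z)) (cls (entry n z x))
      else pure_tensor Kbar Kbar (cls (entry n z x)) (cls (entry n x z))) = \<zero>\<^bsub>?QQ\<^esub>"
      using cls_off[OF x z] pc[OF z] by (simp add: pure_tensor_simps(5,6)[OF Kbar_vs Kbar_vs])
  qed simp
  finally show ?thesis using x by (simp add: grouplike_def cls_counit counit_entry)
qed

lemma diag_Suc: "x \<in> X \<Longrightarrow> cls (entry (Suc n) x x) = antipode Kbar (cls (entry n x x))"
  by (simp add: cls_antipode entry_Suc)

definition Gbar :: "'h set monoid" where
  "Gbar = (units_of Kbar) \<lparr>carrier := generate (units_of Kbar) {cls (e x x) | x. x \<in> X}\<rparr>"

lemma gens_grouplike: "{cls (e x x) | x. x \<in> X} \<subseteq> {g. grouplike Kbar g}"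
  using diag_grouplike[of _ 0] by (auto simp: entry_0)

lemma gens_units: "{cls (e x x) | x. x \<in> X} \<subseteq> carrier (units_of Kbar)"
  using gens_grouplike grouplike_unit[OF Kbar_hopf] by (auto simp: units_of_def)

lemma Gbar_subgroup: "subgroup (carrier Gbar) (units_of Kbar)"
  unfolding Gbar_def using group.generate_is_subgroup[OF group_units_hopf[OF Kbar_hopf] gens_units] by simp

lemma Gbar_group: "Group.group Gbar"
  using subgroup.subgroup_is_group[OF Gbar_subgroup group_units_hopf[OF Kbar_hopf]] by (simp add: Gbar_def)

lemma Gbar_simps [simp]: "g \<otimes>\<^bsub>Gbar\<^esub> h = g \<otimes>\<^bsub>Kbar\<^esub> h" "\<one>\<^bsub>Gbar\<^esub> = \<one>\<^bsub>Kbar\<^esub>"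
  by (simp_all add: Gbar_def units_of_def)

lemma Gbar_grouplike: "g \<in> carrier Gbar \<Longrightarrow> grouplike Kbar g"
  using group.generate_subgroup_incl[OF group_units_hopf[OF Kbar_hopf] gens_grouplike grouplikes_subgroup[OF Kbar_hopf]]
  by (auto simp: Gbar_def)

lemma Gbar_closed: "g \<in> carrier Gbar \<Longrightarrow> g \<in> carrier Kbar"
  using Gbar_grouplike grouplikeD(1)[OF Kbar_hopf] by blast

lemma Gbar_inv: "g \<in> carrier Gbar \<Longrightarrow> inv\<^bsub>Gbar\<^esub> g = antipode Kbar g"
  using group.m_inv_consistent[OF group_units_hopf[OF Kbar_hopf] Gbar_subgroup] grouplike_inv[OF Kbar_hopf Gbar_grouplike]
  by (simp add: Gbar_def)

lemma diag_Gbar: "x \<in> X \<Longrightarrow> cls (entry n x x) \<in> carrier Gbar"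
proof (induction n)
  case 0 then show ?case by (auto simp: Gbar_def entry_0 intro: generate.incl)
next
  case (Suc n)
  then show ?case using group.inv_closed[OF Gbar_group, of "cls (entry n x x)"] by (simp add: diag_Suc Gbar_inv)
qed

subsection \<open>The quotient as a group algebra\<close>

text \<open>
  The canonical map from the group algebra to the quotient; below it identifies the two.
\<close>

definition \<psi> :: "('h set \<Rightarrow>\<^sub>0 'k) \<Rightarrow> 'h set" where "\<psi> = lin_extend Kbar (\<lambda>g. g)"

abbreviation kG :: "('k, 'h set \<Rightarrow>\<^sub>0 'k) hopf" where "kG \<equiv> group_algebra Gbar"

lemma \<psi>_hom: "hopf_hom kG Kbar \<psi>"
  unfolding \<psi>_def
  by (rule group_algebra_hom[OF Gbar_group Kbar_hopf]) (simp_all add: Gbar_grouplike)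

lemma \<psi>_linear: "linear_map kG Kbar \<psi>"
  and \<psi>_mult: "a \<in> carrier kG \<Longrightarrow> b \<in> carrier kG \<Longrightarrow> \<psi> (a \<otimes>\<^bsub>kG\<^esub> b) = \<psi> a \<otimes>\<^bsub>Kbar\<^esub> \<psi> b"
  and \<psi>_one: "\<psi> \<one>\<^bsub>kG\<^esub> = \<one>\<^bsub>Kbar\<^esub>"
  using \<psi>_hom unfolding hopf_hom_def alg_hom_def by (blast dest: ring_hom_mult ring_hom_one)+

lemma \<psi>_basis: "g \<in> carrier Gbar \<Longrightarrow> \<psi> (basis_vec g) = g"
  unfolding \<psi>_def by (rule lin_extend_basis[OF Kbar_vs Gbar_closed])

text \<open>
  Injective because grouplike elements are independent; surjective because each generator of \<open>K\<close> is
  sent to zero or into the group.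
\<close>

lemma \<psi>_bij: "bij_betw \<psi> (carrier kG) (carrier Kbar)"
proof (rule bij_betw_imageI)
  have "lin_indep_family Kbar (carrier Gbar) (\<lambda>g. g)"
    by (rule grouplikes_independent[OF Kbar_hopf Gbar_grouplike]) auto
  then show "inj_on \<psi> (carrier kG)"
    unfolding \<psi>_def group_algebra_simps(1) by (intro lin_indep_family_inj Gbar_closed) simp_all
  have ga: "assoc_algebra kG" by (rule group_algebra_assoc[OF Gbar_group])
  have gv: "vector_space_rec kG" using ga by simp
  have "cls h \<in> \<psi> ` carrier kG" if "h \<in> coeff_alg" for h
    using that unfolding coeff_alg_def
  proof (induction rule: gen_subalgebra.induct)
    case gen_one
    show ?case unfolding cls_one \<psi>_one[symmetric] by (rule imageI[OF algebra_one_closed[OF ga]])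
  next
    case (gen_incl s)
    then obtain n x y where s: "s = entry n x y" "x \<in> X" "y \<in> X" by (auto simp: coeffs_def)
    show ?case
    proof (cases "x = y")
      case True
      then show ?thesis
        using s \<psi>_basis[OF diag_Gbar[OF s(2), of n]] diag_Gbar[OF s(2), of n]
        by (intro image_eqI[where x = "basis_vec (cls (entry n x x))"]) simp_all
    next
      case False
      then have "cls s = \<psi> \<zero>\<^bsub>kG\<^esub>" using s cls_off linear_map_zero[OF gv Kbar_vs \<psi>_linear] by simp
      then show ?thesis using vs_closed(2)[OF gv] by blast
    qed
  next
    case (gen_add x y)
    then obtain a b where ab: "a \<in> carrier kG" "b \<in> carrier kG" "cls x = \<psi> a" "cls y = \<psi> b" by blast
    have "cls (x \<oplus>\<^bsub>H\<^esub> y) = \<psi> (a \<oplus>\<^bsub>kG\<^esub> b)"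
      using linear_mapD(2)[OF cls_linear, of x y] gen_add(1,2) linear_mapD(2)[OF \<psi>_linear ab(1,2)] ab(3,4)
      by (simp only: K_simps coeff_alg_def)
    then show ?case using vs_closed(1)[OF gv ab(1,2)] by blast
  next
    case (gen_smult x c)
    then obtain a where a: "a \<in> carrier kG" "cls x = \<psi> a" by blast
    have "cls (c \<odot>\<^bsub>H\<^esub> x) = \<psi> (c \<odot>\<^bsub>kG\<^esub> a)"
      using linear_mapD(3)[OF cls_linear, of x c] gen_smult(1) linear_mapD(3)[OF \<psi>_linear a(1)] a(2)
      by (simp only: K_simps coeff_alg_def)
    then show ?case using vs_closed(3)[OF gv a(1)] by blast
  next
    case (gen_mult x y)
    then obtain a b where ab: "a \<in> carrier kG" "b \<in> carrier kG" "cls x = \<psi> a" "cls y = \<psi> b" by blast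
    have "cls (x \<otimes>\<^bsub>H\<^esub> y) = \<psi> (a \<otimes>\<^bsub>kG\<^esub> b)"
      using cls_mult[of x y] gen_mult(1,2) \<psi>_mult[OF ab(1,2)] ab(3,4) by (simp only: coeff_alg_def)
    then show ?case using algebra_mult_closed[OF ga ab(1,2)] by blast
  qed
  then show "\<psi> ` carrier kG = carrier Kbar"
    using linear_mapD(1)[OF \<psi>_linear] unfolding Kbar_carrier by blast
qed

end

context rack_realization
begin

section \<open>The relations of the enveloping group\<close>

text \<open>
  Take the compatibility condition for \<open>e x x\<close> and the basis vector of \<open>w\<close>, project the first tensor
  factor to the quotient and read off the coefficient at \<open>op x w\<close> in the second.  Off-diagonal classes
  vanish, so one summand is left on each side, and the common factor \<open>q x w\<close> is cancelled.
\<close>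

lemma diag_conjugate:
  assumes x: "x \<in> X" and w: "w \<in> X"
  shows "cls (e (op x w) (op x w)) = cls (e x x) \<otimes>\<^bsub>Kbar\<^esub> cls (e w w) \<otimes>\<^bsub>Kbar\<^esub> cls (entry 1 x x)"
proof -
  let ?u = "op x w" and ?HV = "tensor_space H V"
  have u: "?u \<in> X" using x w by simp
  have exx: "e x x \<in> carrier H" and bw: "basis_vec w \<in> carrier V" and bu: "basis_vec ?u \<in> carrier V"
    using x w by (simp_all add: e_closed)
  obtain r where r: "linear_map H K r" "\<forall>n\<in>coeff_alg. r n = n"
    using sub_hopf_retraction[OF H coeff_alg_hopf] unfolding K_def by blast
  \<comment> \<open>\<open>cls\<close> is a projection on \<open>K\<close> only; a retraction extends it to a linear map on \<open>H\<close>.\<close>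
  let ?\<pi> = "\<lambda>h. cls (r h)"
  have \<pi>: "linear_map H Kbar ?\<pi>" by (rule linear_map_comp[OF cls_linear r(1)])
  note \<pi>c = linear_mapD(1)[OF \<pi>]
  have \<pi>e: "?\<pi> h = cls h" if "h \<in> coeff_alg" for h using r(2) that by simp
  have HVv: "vector_space_rec ?HV" by simp
  have mb: "bilinear_map H V Kbar (\<lambda>h v. Poly_Mapping.lookup v ?u \<odot>\<^bsub>Kbar\<^esub> ?\<pi> h)"
    by (intro bilinear_mapI linear_map_smult linear_map_smult_left linear_map_lookup \<pi> \<pi>c Kbar_vs)
  let ?M = "tensor_lift Kbar (\<lambda>h v. Poly_Mapping.lookup v ?u \<odot>\<^bsub>Kbar\<^esub> ?\<pi> h)"
  have M: "linear_map ?HV Kbar ?M" by (intro tensor_lift_linear mb) simp_all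
  have Mp: "?M (pure_tensor H V h v) = Poly_Mapping.lookup v ?u \<odot>\<^bsub>Kbar\<^esub> ?\<pi> h"
    if "h \<in> carrier H" "v \<in> carrier V" for h v
    by (intro tensor_lift_pure mb that) simp_all
  have entry_e: "e y z = entry 0 y z" for y z by (simp add: entry_0)
  have e_alg: "e y z \<in> coeff_alg" if "y \<in> X" "z \<in> X" for y z using that by (simp add: entry_e)
  have Mcoact: "?M (coact (basis_vec y)) = cls (e y ?u)" if y: "y \<in> X" for y
  proof -
    have "?M (coact (basis_vec y)) = (\<Oplus>\<^bsub>Kbar\<^esub>z\<in>row y. Poly_Mapping.lookup (basis_vec z) ?u \<odot>\<^bsub>Kbar\<^esub> ?\<pi> (e y z))"
      by (rule coact_lift[OF Kbar_vs mb y])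
    also have "\<dots> = ?\<pi> (e y ?u)"
      using y u linear_map_zero[OF H_vs Kbar_vs \<pi>]
      by (intro row_sum_coeff) (simp_all add: e_closed \<pi>c row_def)
    finally show ?thesis using e_alg[OF y u] \<pi>e by simp
  qed
  have act: "bilinear_map H V V act" using yd_act[OF yd] by (auto simp: bilinear_map_def)
  note bil = compat_bilinear1[OF H vs_free_space act yd_coact[OF yd]]
    compat_bilinear2[OF H vs_free_space act yd_coact[OF yd]]
    compat_bilinear3[OF H vs_free_space act yd_coact[OF yd]]
  let ?T3 = "\<lambda>h1 h2 h3 a v. pure_tensor H V (h1 \<otimes>\<^bsub>H\<^esub> a \<otimes>\<^bsub>H\<^esub> antipode H h3) (act h2 v)"
  let ?T2 = "\<lambda>h1 h2 h3. tensor_lift ?HV (?T3 h1 h2 h3) (coact (basis_vec w))"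
  let ?T1 = "\<lambda>h1 h'. tensor_lift ?HV (?T2 h1) (comult H h')"
  have prod: "?\<pi> (e x a \<otimes>\<^bsub>H\<^esub> e w c \<otimes>\<^bsub>H\<^esub> antipode H (e b x)) = cls (e x a) \<otimes>\<^bsub>Kbar\<^esub> cls (e w c) \<otimes>\<^bsub>Kbar\<^esub> cls (entry 1 b x)"
    if "a \<in> X" "b \<in> X" "c \<in> X" for a b c
  proof -
    have s: "antipode H (e b x) = entry 1 b x" by (simp add: entry_def)
    have alg: "e x a \<in> coeff_alg" "e w c \<in> coeff_alg" "entry 1 b x \<in> coeff_alg" using that x w e_alg by simp_all
    then show ?thesis unfolding s by (simp add: \<pi>e cls_mult coeff_alg_closed)
  qed
  \<comment> \<open>The summand with intermediate indices \<open>a\<close>, \<open>b\<close> from the coproduct and \<open>c\<close> from the coaction.\<close>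
  define Z where "Z a b c = Poly_Mapping.lookup (act (e a b) (basis_vec c)) ?u \<odot>\<^bsub>Kbar\<^esub>
    (cls (e x a) \<otimes>\<^bsub>Kbar\<^esub> cls (e w c) \<otimes>\<^bsub>Kbar\<^esub> cls (entry 1 b x))" for a b c
  have clsc: "cls (e y z) \<in> carrier Kbar" "cls (entry 1 y z) \<in> carrier Kbar" if "y \<in> X" "z \<in> X" for y z
    using that e_alg by simp_all
  have Zc: "Z a b c \<in> carrier Kbar" if "a \<in> X" "b \<in> X" "c \<in> X" for a b c
    using that x w clsc by (simp add: Z_def vs_closed(3)[OF Kbar_vs] algebra_mult_closed[OF Kbar_alg])
  have off0: "cls (e y z) = \<zero>\<^bsub>Kbar\<^esub>" "cls (entry 1 y z) = \<zero>\<^bsub>Kbar\<^esub>" if "y \<in> X" "z \<in> X" "y \<noteq> z" for y z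
    using cls_off[OF that] by (simp_all add: entry_e)
  have Z0: "Z a b c = \<zero>\<^bsub>Kbar\<^esub>" if "a \<in> X" "b \<in> X" "c \<in> X" "a \<noteq> x \<or> b \<noteq> x \<or> c \<noteq> w" for a b c
    using that x w clsc off0
    by (auto simp: Z_def vs_zero[OF Kbar_vs] algebra_null[OF Kbar_alg] algebra_mult_closed[OF Kbar_alg])
  have T2: "?M (?T2 (e x a) (e a b) (e b x)) = (\<Oplus>\<^bsub>Kbar\<^esub>c\<in>row w. Z a b c)" if ab: "a \<in> X" "b \<in> X" for a b
  proof -
    have eh: "e x a \<in> carrier H" "e a b \<in> carrier H" "e b x \<in> carrier H" using ab x by (simp_all add: e_closed)
    have "?M (?T2 (e x a) (e a b) (e b x)) = ?M (\<Oplus>\<^bsub>?HV\<^esub>c\<in>row w. ?T3 (e x a) (e a b) (e b x) (e w c) (basis_vec c))"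
      unfolding coact_lift[OF HVv bil(3)[OF eh] w] ..
    also have "\<dots> = (\<Oplus>\<^bsub>Kbar\<^esub>c\<in>row w. ?M (?T3 (e x a) (e a b) (e b x) (e w c) (basis_vec c)))"
      using w row_subset by (intro linear_map_finsum[OF HVv Kbar_vs M] bilinear_mapD(3)[OF bil(3)[OF eh]]) (simp_all add: e_closed)
    also have "\<dots> = (\<Oplus>\<^bsub>Kbar\<^esub>c\<in>row w. Z a b c)"
    proof (rule vs_finsum_cong[OF Kbar_vs])
      fix c assume "c \<in> row w"
      then have c: "c \<in> X" by (rule row_subset)
      then show "Z a b c \<in> carrier Kbar" using ab by (rule Zc[rotated 2])
      have "act (e a b) (basis_vec c) \<in> carrier V" using yd_act_closed[OF yd eh(2)] c by simp
      then show "?M (?T3 (e x a) (e a b) (e b x) (e w c) (basis_vec c)) = Z a b c"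
        unfolding Z_def using eh w c
        by (subst Mp) (simp_all add: e_closed algebra_mult_closed[OF H_alg] hopf_closed[OF H] prod[OF ab c] del: free_space_simps(1))
    qed
    finally show ?thesis .
  qed
  have T2_eq: "?M (?T2 (e x a) (e a b) (e b x)) = (if a = x \<and> b = x then Z x x w else \<zero>\<^bsub>Kbar\<^esub>)" if ab: "a \<in> X" "b \<in> X" for a b
  proof (cases "a = x \<and> b = x")
    case True
    then show ?thesis
      unfolding T2[OF ab] using x w row_subset Zc Z0 by (subst vs_finsum_single[OF Kbar_vs _ row_self[OF w]]) auto
  next
    case False
    then show ?thesis
      unfolding T2[OF ab] using ab row_subset Z0 by (subst vs_finsum_zero[OF Kbar_vs]) auto
  qed
  have T1_eq: "?M (?T1 (e x a) (e a x)) = (if a = x then Z x x w else \<zero>\<^bsub>Kbar\<^esub>)" if a: "a \<in> X" for a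
  proof -
    have eh: "e x a \<in> carrier H" using a x by (simp add: e_closed)
    have "?M (?T1 (e x a) (e a x)) = ?M (\<Oplus>\<^bsub>?HV\<^esub>b\<in>row a. ?T2 (e x a) (e a b) (e b x))"
      using entry_comult[OF HVv bil(2)[OF eh bw] a x, of 0] by (simp add: entry_0)
    also have "\<dots> = (\<Oplus>\<^bsub>Kbar\<^esub>b\<in>row a. ?M (?T2 (e x a) (e a b) (e b x)))"
      using a x row_subset by (intro linear_map_finsum[OF HVv Kbar_vs M] bilinear_mapD(3)[OF bil(2)[OF eh bw]]) (simp_all add: e_closed)
    also have "\<dots> = (\<Oplus>\<^bsub>Kbar\<^esub>b\<in>row a. if a = x \<and> b = x then Z x x w else \<zero>\<^bsub>Kbar\<^esub>)"
      using a x w row_subset Zc by (intro vs_finsum_cong[OF Kbar_vs] T2_eq) auto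
    also have "\<dots> = (if a = x then Z x x w else \<zero>\<^bsub>Kbar\<^esub>)"
    proof (cases "a = x")
      case True
      then show ?thesis
        using x w Zc by (subst vs_finsum_single[OF Kbar_vs row_finite[OF a] row_self[OF a]]) auto
    next
      case False
      then show ?thesis by (subst vs_finsum_zero[OF Kbar_vs]) auto
    qed
    finally show ?thesis .
  qed
  have "?M (coact (act (e x x) (basis_vec w))) = ?M (tensor_lift ?HV ?T1 (comult H (e x x)))"
    unfolding yd_compat[OF yd exx bw] ..
  also have "\<dots> = ?M (\<Oplus>\<^bsub>?HV\<^esub>a\<in>row x. ?T1 (e x a) (e a x))"
    using entry_comult[OF HVv bil(1)[OF bw] x x, of 0] by (simp add: entry_0)
  also have "\<dots> = (\<Oplus>\<^bsub>Kbar\<^esub>a\<in>row x. ?M (?T1 (e x a) (e a x)))"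
    using x row_subset by (intro linear_map_finsum[OF HVv Kbar_vs M] bilinear_mapD(3)[OF bil(1)[OF bw]]) (simp_all add: e_closed)
  also have "\<dots> = (\<Oplus>\<^bsub>Kbar\<^esub>a\<in>row x. if a = x then Z x x w else \<zero>\<^bsub>Kbar\<^esub>)"
    using x w row_subset Zc by (intro vs_finsum_cong[OF Kbar_vs] T1_eq) auto
  also have "\<dots> = Z x x w"
    using x w Zc by (subst vs_finsum_single[OF Kbar_vs row_finite[OF x] row_self[OF x]]) auto
  also have "\<dots> = q x w \<odot>\<^bsub>Kbar\<^esub> (cls (e x x) \<otimes>\<^bsub>Kbar\<^esub> cls (e w w) \<otimes>\<^bsub>Kbar\<^esub> cls (entry 1 x x))"
    using act_e[OF x x w] by (simp add: Z_def)
  finally have rhs: "?M (coact (act (e x x) (basis_vec w)))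
    = q x w \<odot>\<^bsub>Kbar\<^esub> (cls (e x x) \<otimes>\<^bsub>Kbar\<^esub> cls (e w w) \<otimes>\<^bsub>Kbar\<^esub> cls (entry 1 x x))" .
  have "?M (coact (act (e x x) (basis_vec w))) = ?M (coact (q x w \<odot>\<^bsub>V\<^esub> basis_vec ?u))"
    using act_e[OF x x w] by simp
  also have "\<dots> = q x w \<odot>\<^bsub>Kbar\<^esub> cls (e ?u ?u)"
    using Mcoact[OF u] yd_coact_closed[OF yd bu]
    by (simp only: linear_mapD(3)[OF yd_coact[OF yd] bu] linear_mapD(3)[OF M])
  finally have eq: "q x w \<odot>\<^bsub>Kbar\<^esub> cls (e ?u ?u)
    = q x w \<odot>\<^bsub>Kbar\<^esub> (cls (e x x) \<otimes>\<^bsub>Kbar\<^esub> cls (e w w) \<otimes>\<^bsub>Kbar\<^esub> cls (entry 1 x x))" using rhs by simp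
  have cancel: "(1 / q x w) \<odot>\<^bsub>Kbar\<^esub> (q x w \<odot>\<^bsub>Kbar\<^esub> y) = y" if "y \<in> carrier Kbar" for y
    using that q_nonzero[OF x w] by (simp add: vs_smult(3)[OF Kbar_vs] vs_zero(5)[OF Kbar_vs])
  have "cls (e x x) \<otimes>\<^bsub>Kbar\<^esub> cls (e w w) \<otimes>\<^bsub>Kbar\<^esub> cls (entry 1 x x) \<in> carrier Kbar"
    using x w clsc by (simp add: algebra_mult_closed[OF Kbar_alg])
  then show ?thesis using cancel[OF clsc(1)[OF u u]] cancel eq by metis
qed

abbreviation g :: "'x \<Rightarrow> 'h set" where "g x \<equiv> cls (e x x)"

lemma g_entry: "g x = cls (entry 0 x x)" by (simp add: entry_0)

lemma g_Gbar [simp]: "x \<in> X \<Longrightarrow> g x \<in> carrier Gbar"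
  unfolding g_entry by (rule diag_Gbar)

lemma g_inv: "x \<in> X \<Longrightarrow> cls (entry 1 x x) = inv\<^bsub>Gbar\<^esub> g x"
  using diag_Suc[of x 0] Gbar_inv[of "g x"] by (simp add: entry_0)

lemma diag_conj_Gbar:
  assumes "x \<in> X" "w \<in> X"
  shows "g (op x w) = g x \<otimes>\<^bsub>Gbar\<^esub> g w \<otimes>\<^bsub>Gbar\<^esub> inv\<^bsub>Gbar\<^esub> g x"
  using diag_conjugate[OF assms] assms by (simp add: g_inv del: One_nat_def)

lemma diag_relation:
  assumes "x \<in> X" "w \<in> X"
  shows "g x \<otimes>\<^bsub>Gbar\<^esub> g w = g (op x w) \<otimes>\<^bsub>Gbar\<^esub> g x"
proof -
  interpret G: Group.group Gbar by (rule Gbar_group)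
  show ?thesis unfolding diag_conj_Gbar[OF assms] using assms
    by (metis G.inv_closed G.l_inv G.m_assoc G.m_closed G.r_one g_Gbar)
qed

text \<open>
  The conjugation relations extend \<open>x \<mapsto> g x\<close> to a homomorphism onto the group; linear combinations are
  lifted basis vector by basis vector.
\<close>

lemma env_surjection:
  "\<exists>\<Phi>. hopf_hom (group_algebra (enveloping_group X op)) Kbar \<Phi> \<and>
     \<Phi> ` carrier (group_algebra (enveloping_group X op) :: ('k, ('x \<times> bool) list set \<Rightarrow>\<^sub>0 'k) hopf) = carrier Kbar \<and>
     (\<forall>x\<in>X. \<Phi> (basis_vec (env_gen X op x)) = g x)"
proof -
  let ?E = "enveloping_group X op"
  let ?kE = "group_algebra ?E :: ('k, ('x \<times> bool) list set \<Rightarrow>\<^sub>0 'k) hopf"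
  have E: "Group.group ?E" by (rule group_env[OF rack])
  obtain \<phi> where \<phi>: "\<phi> \<in> hom ?E Gbar" "\<And>x. x \<in> X \<Longrightarrow> \<phi> (env_gen X op x) = g x"
    using env_group_hom[OF rack Gbar_group, of g, OF g_Gbar diag_relation] by blast
  interpret h: group_hom ?E Gbar \<phi>
    using E Gbar_group \<phi>(1) by (simp add: group_hom_def group_hom_axioms_def)
  have \<phi>c: "\<phi> c \<in> carrier Gbar" if "c \<in> carrier ?E" for c using that by simp
  have \<phi>K: "\<phi> c \<in> carrier Kbar" if "c \<in> carrier ?E" for c using Gbar_closed[OF \<phi>c[OF that]] .
  define \<Phi> where "\<Phi> = lin_extend Kbar \<phi>"
  have hom: "hopf_hom ?kE Kbar \<Phi>"
    unfolding \<Phi>_def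
    by (rule group_algebra_hom[OF E Kbar_hopf Gbar_grouplike[OF \<phi>c]]) (use h.hom_mult h.hom_one in simp_all)
  have \<Phi>lin: "linear_map (free_space (carrier ?E)) Kbar \<Phi>"
    unfolding \<Phi>_def by (intro lin_extend_linear Kbar_vs \<phi>K)
  have \<Phi>b: "\<Phi> (basis_vec c) = \<phi> c" if "c \<in> carrier ?E" for c
    unfolding \<Phi>_def by (rule lin_extend_basis[where f = \<phi> and x = c, OF Kbar_vs \<phi>K[OF that]])
  have surj: "\<phi> ` carrier ?E = carrier Gbar"
  proof
    show "\<phi> ` carrier ?E \<subseteq> carrier Gbar" using \<phi>c by blast
    have "subgroup (\<phi> ` carrier ?E) Gbar" by (rule h.img_is_subgroup)
    then have "subgroup (\<phi> ` carrier ?E) (units_of Kbar)"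
      using group.incl_subgroup[OF group_units_hopf[OF Kbar_hopf] Gbar_subgroup] by (simp add: Gbar_def)
    moreover have "{cls (e x x) | x. x \<in> X} \<subseteq> \<phi> ` carrier ?E"
      using \<phi>(2) env_gen_closed[OF rack] by force
    ultimately show "carrier Gbar \<subseteq> \<phi> ` carrier ?E"
      using group.generate_subgroup_incl[OF group_units_hopf[OF Kbar_hopf]] by (simp add: Gbar_def)
  qed
  define s where "s = inv_into (carrier ?E) \<phi>"
  have s: "s c \<in> carrier ?E" "\<phi> (s c) = c" if "c \<in> carrier Gbar" for c
    using that surj by (auto simp: s_def inv_into_into f_inv_into_f)
  have "carrier Kbar \<subseteq> \<Phi> ` carrier ?kE"
  proof
    fix y assume "y \<in> carrier Kbar"
    then obtain v where v: "v \<in> carrier (free_space (carrier Gbar))" "y = \<psi> v"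
      using \<psi>_bij unfolding bij_betw_def group_algebra_simps(1) by blast
    let ?F = "free_space (carrier ?E) :: ('k, ('x \<times> bool) list set \<Rightarrow>\<^sub>0 'k) module"
    have sb: "basis_vec (s c) \<in> carrier ?F" if "c \<in> carrier Gbar" for c using s(1)[OF that] by simp
    have "\<Phi> (lin_extend ?F (\<lambda>c. basis_vec (s c)) v) = lin_extend Kbar (\<lambda>c. \<Phi> (basis_vec (s c))) v"
      by (rule linear_lin_extend[OF vs_free_space Kbar_vs \<Phi>lin sb v(1)])
    also have "\<dots> = lin_extend Kbar (\<lambda>c. c) v"
      by (rule lin_extend_cong[OF Kbar_vs v(1)]) (simp_all add: \<Phi>b s Gbar_closed)
    finally have "y = \<Phi> (lin_extend ?F (\<lambda>c. basis_vec (s c)) v)" using v by (simp add: \<psi>_def)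
    moreover have "lin_extend ?F (\<lambda>c. basis_vec (s c)) v \<in> carrier ?kE"
      unfolding group_algebra_simps(1)
      by (rule linear_mapD(1)[OF lin_extend_linear[OF vs_free_space sb] v(1)])
    ultimately show "y \<in> \<Phi> ` carrier ?kE" by blast
  qed
  moreover have "\<Phi> ` carrier ?kE \<subseteq> carrier Kbar"
    using linear_mapD(1)[OF \<Phi>lin] unfolding group_algebra_simps(1) by blast
  ultimately show ?thesis using hom \<Phi>b \<phi>(2) env_gen_closed[OF rack] by auto
qed

section \<open>The realization over the group algebra\<close>

text \<open>
  An element of the group algebra acts through any representative in \<open>K\<close>; the choice is immaterial
  because \<open>I\<close> annihilates \<open>V\<close>.
\<close>

definition gact :: "('h set \<Rightarrow>\<^sub>0 'k) \<Rightarrow> ('x \<Rightarrow>\<^sub>0 'k) \<Rightarrow> ('x \<Rightarrow>\<^sub>0 'k)" where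
  "gact a v = act (SOME h. h \<in> coeff_alg \<and> cls h = \<psi> a) v"

definition gcoact :: "('x \<Rightarrow>\<^sub>0 'k) \<Rightarrow> ('k, 'h set \<Rightarrow>\<^sub>0 'k, 'x \<Rightarrow>\<^sub>0 'k) tensor" where
  "gcoact = lin_extend (tensor_space kG V) (\<lambda>x. pure_tensor kG V (basis_vec (g x)) (basis_vec x))"

lemma gact_eq:
  assumes "h \<in> coeff_alg" "\<psi> a = cls h" "v \<in> carrier V"
  shows "gact a v = act h v"
proof -
  define k where "k = (SOME h. h \<in> coeff_alg \<and> cls h = \<psi> a)"
  have "\<exists>h. h \<in> coeff_alg \<and> cls h = \<psi> a" using assms(1,2) by metis
  then have "k \<in> coeff_alg \<and> cls k = \<psi> a" unfolding k_def by (rule someI_ex)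
  then have "act k v = act h v" using assms by (intro cls_eq_act) simp_all
  then show ?thesis by (simp only: gact_def k_def)
qed

lemma \<psi>_lift:
  assumes "a \<in> carrier kG"
  obtains h where "h \<in> coeff_alg" "\<psi> a = cls h"
proof -
  have "\<psi> a \<in> cls ` coeff_alg" using linear_mapD(1)[OF \<psi>_linear assms] by (simp add: Kbar_carrier)
  then show ?thesis using that by blast
qed

lemma kG_hopf: "hopf_algebra kG"
  by (rule group_algebra_hopf[OF Gbar_group])

lemma kG_alg [simp]: "assoc_algebra kG"
  by (rule group_algebra_assoc[OF Gbar_group])

lemma kG_vs [simp]: "vector_space_rec kG"
  by (rule algebra_vs[OF kG_alg])

lemma gact_bilinear: "bilinear_map kG V V gact"
proof (intro bilinear_mapI linear_mapI)
  fix a assume a: "a \<in> carrier kG"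
  obtain h where h: "h \<in> coeff_alg" "\<psi> a = cls h" using \<psi>_lift[OF a] .
  have hH: "h \<in> carrier H" using h coeff_alg_closed by simp
  note L = linear_mapD[OF yd_act(1)[OF yd hH]]
  fix v w c assume v: "v \<in> carrier V"
  show "gact a v \<in> carrier V" using L(1)[OF v] gact_eq[OF h v] by simp
  show "gact a (c \<odot>\<^bsub>V\<^esub> v) = c \<odot>\<^bsub>V\<^esub> gact a v"
    using L(3)[OF v] gact_eq[OF h v] gact_eq[OF h vs_closed(3)[OF vs_free_space v]] by simp
  assume w: "w \<in> carrier V"
  show "gact a (v \<oplus>\<^bsub>V\<^esub> w) = gact a v \<oplus>\<^bsub>V\<^esub> gact a w"
    using L(2)[OF v w] gact_eq[OF h v] gact_eq[OF h w] gact_eq[OF h vs_closed(1)[OF vs_free_space v w]] by simp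
next
  fix v a b c assume v: "v \<in> carrier V" and a: "a \<in> carrier kG"
  note L = linear_mapD[OF yd_act(2)[OF yd v]]
  obtain h where h: "h \<in> coeff_alg" "\<psi> a = cls h" using \<psi>_lift[OF a] .
  have hH: "h \<in> carrier H" using h coeff_alg_closed by simp
  show "gact a v \<in> carrier V" using L(1)[OF hH] gact_eq[OF h v] by simp
  have "\<psi> (c \<odot>\<^bsub>kG\<^esub> a) = cls (c \<odot>\<^bsub>H\<^esub> h)"
    using linear_mapD(3)[OF \<psi>_linear a] linear_mapD(3)[OF cls_linear, of h c] h by (simp only: K_simps)
  from gact_eq[OF coeff_alg_closed(6)[OF h(1)] this v]
  show "gact (c \<odot>\<^bsub>kG\<^esub> a) v = c \<odot>\<^bsub>V\<^esub> gact a v" using L(3)[OF hH] gact_eq[OF h v] by simp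
  assume b: "b \<in> carrier kG"
  obtain k where k: "k \<in> coeff_alg" "\<psi> b = cls k" using \<psi>_lift[OF b] .
  have kH: "k \<in> carrier H" using k coeff_alg_closed by simp
  have "\<psi> (a \<oplus>\<^bsub>kG\<^esub> b) = cls (h \<oplus>\<^bsub>H\<^esub> k)"
    using linear_mapD(2)[OF \<psi>_linear a b] linear_mapD(2)[OF cls_linear, of h k] h k by (simp only: K_simps)
  from gact_eq[OF coeff_alg_closed(4)[OF h(1) k(1)] this v]
  show "gact (a \<oplus>\<^bsub>kG\<^esub> b) v = gact a v \<oplus>\<^bsub>V\<^esub> gact b v"
    using L(2)[OF hH kH] gact_eq[OF h v] gact_eq[OF k v] by simp
qed

lemma gact_one: "v \<in> carrier V \<Longrightarrow> gact \<one>\<^bsub>kG\<^esub> v = v"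
  using gact_eq[of "\<one>\<^bsub>H\<^esub>" "\<one>\<^bsub>kG\<^esub>" v] yd_act_one[OF yd] coeff_alg_closed(3) cls_one \<psi>_one by simp

lemma gact_mult:
  assumes a: "a \<in> carrier kG" and b: "b \<in> carrier kG" and v: "v \<in> carrier V"
  shows "gact (a \<otimes>\<^bsub>kG\<^esub> b) v = gact a (gact b v)"
proof -
  obtain h where h: "h \<in> coeff_alg" "\<psi> a = cls h" using \<psi>_lift[OF a] .
  obtain k where k: "k \<in> coeff_alg" "\<psi> b = cls k" using \<psi>_lift[OF b] .
  have hk: "h \<in> carrier H" "k \<in> carrier H" using h k coeff_alg_closed by simp_all
  have "\<psi> (a \<otimes>\<^bsub>kG\<^esub> b) = cls (h \<otimes>\<^bsub>H\<^esub> k)" using \<psi>_mult[OF a b] cls_mult h k by simp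
  then have "gact (a \<otimes>\<^bsub>kG\<^esub> b) v = act (h \<otimes>\<^bsub>H\<^esub> k) v" by (rule gact_eq[OF coeff_alg_closed(5)[OF h(1) k(1)] _ v])
  also have "\<dots> = act h (act k v)" by (rule yd_act_mult[OF yd hk v])
  also have "\<dots> = gact a (gact b v)"
    using gact_eq[OF k v] gact_eq[OF h yd_act_closed[OF yd hk(2) v]] by simp
  finally show ?thesis .
qed

lemma gact_entry:
  assumes "x \<in> X" "v \<in> carrier V"
  shows "gact (basis_vec (cls (entry n x x))) v = act (entry n x x) v"
  using assms by (intro gact_eq) (simp_all add: \<psi>_basis diag_Gbar)

lemma basis_kG: "\<gamma> \<in> carrier Gbar \<Longrightarrow> basis_vec \<gamma> \<in> carrier kG"
  by simp

text \<open>
  The group acts on \<open>V\<close> by monomial transformations whose permutation part is conjugation on the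
  degrees; it is enough to check this on the generators and their inverses.
\<close>

lemma gact_monomial:
  assumes "\<gamma> \<in> carrier Gbar"
  shows "\<forall>x\<in>X. \<exists>c. \<exists>y\<in>X. gact (basis_vec \<gamma>) (basis_vec x) = c \<odot>\<^bsub>V\<^esub> basis_vec y \<and>
    g y = \<gamma> \<otimes>\<^bsub>Gbar\<^esub> g x \<otimes>\<^bsub>Gbar\<^esub> inv\<^bsub>Gbar\<^esub> \<gamma>"
proof -
  interpret G: Group.group Gbar by (rule Gbar_group)
  have inv_units: "inv\<^bsub>units_of Kbar\<^esub> \<gamma> = inv\<^bsub>Gbar\<^esub> \<gamma>" if "\<gamma> \<in> carrier Gbar" for \<gamma>
    using Gbar_inv[OF that] grouplike_inv[OF Kbar_hopf Gbar_grouplike[OF that]] by simp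
  have "\<gamma> \<in> generate (units_of Kbar) {cls (e x x) | x. x \<in> X}" using assms by (simp add: Gbar_def)
  then show ?thesis
  proof (induction rule: generate.induct)
    case one
    have o: "\<one>\<^bsub>units_of Kbar\<^esub> = \<one>\<^bsub>Gbar\<^esub>" by (simp add: units_of_def)
    show ?case
    proof
      fix x assume x: "x \<in> X"
      have "gact (basis_vec \<one>\<^bsub>Gbar\<^esub>) (basis_vec x) = 1 \<odot>\<^bsub>V\<^esub> basis_vec x"
        using gact_one[of "basis_vec x"] x by (simp add: map_single)
      moreover have "g x = \<one>\<^bsub>Gbar\<^esub> \<otimes>\<^bsub>Gbar\<^esub> g x \<otimes>\<^bsub>Gbar\<^esub> inv\<^bsub>Gbar\<^esub> \<one>\<^bsub>Gbar\<^esub>"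
        using G.l_one[OF g_Gbar[OF x]] G.r_one[OF g_Gbar[OF x]] by (simp only: G.inv_one)
      ultimately show "\<exists>c. \<exists>y\<in>X. gact (basis_vec \<one>\<^bsub>units_of Kbar\<^esub>) (basis_vec x) = c \<odot>\<^bsub>V\<^esub> basis_vec y \<and>
        g y = \<one>\<^bsub>units_of Kbar\<^esub> \<otimes>\<^bsub>Gbar\<^esub> g x \<otimes>\<^bsub>Gbar\<^esub> inv\<^bsub>Gbar\<^esub> \<one>\<^bsub>units_of Kbar\<^esub>"
        unfolding o using x by blast
    qed
  next
    case (incl \<gamma>)
    then obtain w where w: "w \<in> X" "\<gamma> = g w" by blast
    show ?case
    proof
      fix x assume x: "x \<in> X"
      have bx: "basis_vec x \<in> carrier V" using x by simp
      have "gact (basis_vec \<gamma>) (basis_vec x) = q w x \<odot>\<^bsub>V\<^esub> basis_vec (op w x)"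
        using gact_entry[OF w(1) bx, of 0] act_e[OF w(1,1) x] w(2) by (simp add: entry_0)
      moreover have "g (op w x) = \<gamma> \<otimes>\<^bsub>Gbar\<^esub> g x \<otimes>\<^bsub>Gbar\<^esub> inv\<^bsub>Gbar\<^esub> \<gamma>"
        unfolding w(2) by (rule diag_conj_Gbar[OF w(1) x])
      ultimately show "\<exists>c. \<exists>y\<in>X. gact (basis_vec \<gamma>) (basis_vec x) = c \<odot>\<^bsub>V\<^esub> basis_vec y \<and>
        g y = \<gamma> \<otimes>\<^bsub>Gbar\<^esub> g x \<otimes>\<^bsub>Gbar\<^esub> inv\<^bsub>Gbar\<^esub> \<gamma>" using op_closed[OF w(1) x] by blast
    qed
  next
    case (inv \<gamma>)
    then obtain w where w: "w \<in> X" "\<gamma> = g w" by blast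
    have \<gamma>: "\<gamma> \<in> carrier Gbar" using w by simp
    have i: "inv\<^bsub>units_of Kbar\<^esub> \<gamma> = inv\<^bsub>Gbar\<^esub> g w" using inv_units[OF \<gamma>] w by simp
    show ?case
      unfolding i
    proof
      fix x assume x: "x \<in> X"
      have "bij_betw (op w) X X" using rack w(1) by (simp add: rack_def)
      then have "x \<in> op w ` X" using x by (simp add: bij_betw_def)
      then obtain u where u: "u \<in> X" "op w u = x" by blast
      have bx: "basis_vec x \<in> carrier V" and bu: "basis_vec u \<in> carrier V" using x u by simp_all
      have e1: "entry 1 w w \<in> carrier H" using w by simp
      note A = linear_mapD[OF yd_act(1)[OF yd e1]]
      have off: "act (entry 0 x' y') v = 0" if "x' \<in> X" "y' \<in> X" "x' \<noteq> y'" "v \<in> carrier V" for x' y' v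
        using act_entry[of 0] that by blast
      \<comment> \<open>The inverse of \<open>g w\<close> is the class of \<open>S (e w w)\<close>, which undoes the action of \<open>e w w\<close>.\<close>
      have "act (entry 1 w w) (act (e w w) (basis_vec u)) = basis_vec u"
        using act_entry_step[OF off w(1,1) bu] by (simp add: entry_0)
      then have "q w u \<odot>\<^bsub>V\<^esub> act (entry 1 w w) (basis_vec x) = basis_vec u"
        using act_e[OF w(1,1) u(1)] A(3)[OF bx, of "q w u"] u(2) by simp
      moreover have "(1 / q w u) \<odot>\<^bsub>V\<^esub> (q w u \<odot>\<^bsub>V\<^esub> v) = v" for v
        using q_nonzero[OF w(1) u(1)] by (auto intro!: poly_mapping_eqI)
      ultimately have "act (entry 1 w w) (basis_vec x) = (1 / q w u) \<odot>\<^bsub>V\<^esub> basis_vec u" by metis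
      then have 1: "gact (basis_vec (inv\<^bsub>Gbar\<^esub> g w)) (basis_vec x) = (1 / q w u) \<odot>\<^bsub>V\<^esub> basis_vec u"
        using gact_entry[OF w(1) bx, of 1] by (simp only: g_inv[OF w(1)])
      have gw: "g w \<in> carrier Gbar" "g u \<in> carrier Gbar" using w u by simp_all
      have "g x = g w \<otimes>\<^bsub>Gbar\<^esub> g u \<otimes>\<^bsub>Gbar\<^esub> inv\<^bsub>Gbar\<^esub> g w" using diag_conj_Gbar[OF w(1) u(1)] u(2) by simp
      then have "inv\<^bsub>Gbar\<^esub> g w \<otimes>\<^bsub>Gbar\<^esub> g x \<otimes>\<^bsub>Gbar\<^esub> g w
        = (inv\<^bsub>Gbar\<^esub> g w \<otimes>\<^bsub>Gbar\<^esub> g w) \<otimes>\<^bsub>Gbar\<^esub> g u \<otimes>\<^bsub>Gbar\<^esub> (inv\<^bsub>Gbar\<^esub> g w \<otimes>\<^bsub>Gbar\<^esub> g w)"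
        using gw by (simp only: G.m_assoc G.m_closed G.inv_closed)
      also have "\<dots> = g u" using gw by (simp only: G.l_inv G.l_one G.r_one)
      finally have "inv\<^bsub>Gbar\<^esub> g w \<otimes>\<^bsub>Gbar\<^esub> g x \<otimes>\<^bsub>Gbar\<^esub> g w = g u" .
      then have 2: "g u = inv\<^bsub>Gbar\<^esub> g w \<otimes>\<^bsub>Gbar\<^esub> g x \<otimes>\<^bsub>Gbar\<^esub> inv\<^bsub>Gbar\<^esub> (inv\<^bsub>Gbar\<^esub> g w)"
        using G.inv_inv[OF gw(1)] by simp
      show "\<exists>c. \<exists>y\<in>X. gact (basis_vec (inv\<^bsub>Gbar\<^esub> g w)) (basis_vec x) = c \<odot>\<^bsub>V\<^esub> basis_vec y \<and>
        g y = inv\<^bsub>Gbar\<^esub> g w \<otimes>\<^bsub>Gbar\<^esub> g x \<otimes>\<^bsub>Gbar\<^esub> inv\<^bsub>Gbar\<^esub> (inv\<^bsub>Gbar\<^esub> g w)"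
        using 1 2 u(1) by blast
    qed
  next
    case (eng \<gamma> \<delta>)
    have \<gamma>\<delta>: "\<gamma> \<in> carrier Gbar" "\<delta> \<in> carrier Gbar" using eng.hyps by (simp_all add: Gbar_def)
    have m: "\<gamma> \<otimes>\<^bsub>units_of Kbar\<^esub> \<delta> = \<gamma> \<otimes>\<^bsub>Gbar\<^esub> \<delta>" by (simp add: units_of_def)
    show ?case
      unfolding m
    proof
      fix x assume x: "x \<in> X"
      obtain c y where y: "y \<in> X" "gact (basis_vec \<delta>) (basis_vec x) = c \<odot>\<^bsub>V\<^esub> basis_vec y"
        "g y = \<delta> \<otimes>\<^bsub>Gbar\<^esub> g x \<otimes>\<^bsub>Gbar\<^esub> inv\<^bsub>Gbar\<^esub> \<delta>" using eng.IH(2) x by blast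
      obtain d z where z: "z \<in> X" "gact (basis_vec \<gamma>) (basis_vec y) = d \<odot>\<^bsub>V\<^esub> basis_vec z"
        "g z = \<gamma> \<otimes>\<^bsub>Gbar\<^esub> g y \<otimes>\<^bsub>Gbar\<^esub> inv\<^bsub>Gbar\<^esub> \<gamma>" using eng.IH(1) y(1) by blast
      have b: "basis_vec x \<in> carrier V" "basis_vec y \<in> carrier V" "basis_vec z \<in> carrier V" using x y z by simp_all
      have "gact (basis_vec (\<gamma> \<otimes>\<^bsub>Gbar\<^esub> \<delta>)) (basis_vec x) = gact (basis_vec \<gamma>) (gact (basis_vec \<delta>) (basis_vec x))"
        unfolding group_algebra_mult_basis[OF Gbar_group \<gamma>\<delta>, where 'k = 'k, symmetric]
        by (rule gact_mult[OF basis_kG[OF \<gamma>\<delta>(1)] basis_kG[OF \<gamma>\<delta>(2)] b(1)])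
      also have "\<dots> = c \<odot>\<^bsub>V\<^esub> (d \<odot>\<^bsub>V\<^esub> basis_vec z)"
        unfolding y(2) linear_mapD(3)[OF bilinear_mapD(1)[OF gact_bilinear basis_kG[OF \<gamma>\<delta>(1)]] b(2)] z(2) ..
      also have "\<dots> = (c * d) \<odot>\<^bsub>V\<^esub> basis_vec z" by (rule vs_smult(3)[OF vs_free_space b(3)])
      finally have 1: "gact (basis_vec (\<gamma> \<otimes>\<^bsub>Gbar\<^esub> \<delta>)) (basis_vec x) = (c * d) \<odot>\<^bsub>V\<^esub> basis_vec z" .
      have 2: "g z = \<gamma> \<otimes>\<^bsub>Gbar\<^esub> \<delta> \<otimes>\<^bsub>Gbar\<^esub> g x \<otimes>\<^bsub>Gbar\<^esub> inv\<^bsub>Gbar\<^esub> (\<gamma> \<otimes>\<^bsub>Gbar\<^esub> \<delta>)"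
        unfolding z(3) y(3) using \<gamma>\<delta> g_Gbar[OF x]
        by (simp only: G.inv_mult_group G.m_assoc G.m_closed G.inv_closed)
      show "\<exists>c. \<exists>y\<in>X. gact (basis_vec (\<gamma> \<otimes>\<^bsub>Gbar\<^esub> \<delta>)) (basis_vec x) = c \<odot>\<^bsub>V\<^esub> basis_vec y \<and>
        g y = \<gamma> \<otimes>\<^bsub>Gbar\<^esub> \<delta> \<otimes>\<^bsub>Gbar\<^esub> g x \<otimes>\<^bsub>Gbar\<^esub> inv\<^bsub>Gbar\<^esub> (\<gamma> \<otimes>\<^bsub>Gbar\<^esub> \<delta>)"
        using 1 2 z(1) by blast
    qed
  qed
qed

end

context rack_realization
begin

lemma gcoact_linear: "linear_map V (tensor_space kG V) gcoact"
  unfolding gcoact_def by (intro lin_extend_linear) (simp_all add: pure_tensor_closed[OF kG_vs vs_free_space])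

lemma gcoact_basis: "x \<in> X \<Longrightarrow> gcoact (basis_vec x) = pure_tensor kG V (basis_vec (g x)) (basis_vec x)"
  unfolding gcoact_def
  by (intro lin_extend_basis[where f = "\<lambda>x. pure_tensor kG V (basis_vec (g x)) (basis_vec x)"])
     (simp_all add: pure_tensor_closed[OF kG_vs vs_free_space])

lemma kG_grouplike:
  assumes "\<gamma> \<in> carrier Gbar"
  shows "comult kG (basis_vec \<gamma>) = pure_tensor kG kG (basis_vec \<gamma>) (basis_vec \<gamma>)"
    and "counit kG (basis_vec \<gamma>) = 1"
    and "antipode kG (basis_vec \<gamma>) = basis_vec (inv\<^bsub>Gbar\<^esub> \<gamma>)"
proof -
  show "comult kG (basis_vec \<gamma>) = pure_tensor kG kG (basis_vec \<gamma>) (basis_vec \<gamma>)"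
    "counit kG (basis_vec \<gamma>) = 1"
    using group_algebra_grouplike[OF Gbar_group assms, where 'k = 'k] unfolding grouplike_def by blast+
  show "antipode kG (basis_vec \<gamma>) = basis_vec (inv\<^bsub>Gbar\<^esub> \<gamma>)"
    using group.inv_closed[OF Gbar_group assms] by simp
qed

lemma gcoact_counit:
  assumes v: "v \<in> carrier V"
  shows "tensor_lift V (\<lambda>h w. counit kG h \<odot>\<^bsub>V\<^esub> w) (gcoact v) = v"
proof (rule linear_map_free_eq[OF vs_free_space _ linear_map_id _ v])
  have b: "bilinear_map kG V V (\<lambda>h w. counit kG h \<odot>\<^bsub>V\<^esub> w)"
    by (intro bilinear_mapI linear_map_smult linear_map_smult_left counit_linear[OF kG_hopf] linear_map_id vs_free_space)
  show "linear_map V V (\<lambda>v. tensor_lift V (\<lambda>h w. counit kG h \<odot>\<^bsub>V\<^esub> w) (gcoact v))"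
    by (rule linear_map_comp[OF tensor_lift_linear[OF kG_vs vs_free_space vs_free_space b] gcoact_linear])
  fix x assume x: "x \<in> X"
  have "tensor_lift V (\<lambda>h w. counit kG h \<odot>\<^bsub>V\<^esub> w) (gcoact (basis_vec x)) = counit kG (basis_vec (g x)) \<odot>\<^bsub>V\<^esub> basis_vec x"
    unfolding gcoact_basis[OF x] using x
    by (intro tensor_lift_pure[OF kG_vs vs_free_space vs_free_space b] basis_kG) simp_all
  then show "tensor_lift V (\<lambda>h w. counit kG h \<odot>\<^bsub>V\<^esub> w) (gcoact (basis_vec x)) = basis_vec x"
    unfolding kG_grouplike(2)[OF g_Gbar[OF x]] using x by (simp add: map_single)
qed

lemma gcoact_coassoc:
  assumes v: "v \<in> carrier V"
  shows "tensor_lift (tensor_space kG (tensor_space kG V)) (\<lambda>h w. tensor_lift (tensor_space kG (tensor_space kG V)) (\<lambda>a b.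
        pure_tensor kG (tensor_space kG V) a (pure_tensor kG V b w)) (comult kG h)) (gcoact v)
    = tensor_lift (tensor_space kG (tensor_space kG V)) (\<lambda>h w. pure_tensor kG (tensor_space kG V) h (gcoact w)) (gcoact v)"
    (is "tensor_lift ?W ?\<alpha> _ = tensor_lift ?W ?\<beta> _")
proof (rule linear_map_free_eq[OF _ _ _ _ v, where W = ?W])
  note co = coassoc_linear[OF kG_hopf vs_free_space gact_bilinear gcoact_linear]
  have kV: "vector_space_rec (tensor_space kG V)" by (rule vs_tensor_space[OF kG_vs vs_free_space])
  show W: "vector_space_rec ?W" by (rule vs_tensor_space[OF kG_vs kV])
  show "linear_map V ?W (\<lambda>v. tensor_lift ?W ?\<alpha> (gcoact v))" "linear_map V ?W (\<lambda>v. tensor_lift ?W ?\<beta> (gcoact v))"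
    by (rule linear_map_comp[OF tensor_lift_linear[OF kG_vs vs_free_space W] gcoact_linear], rule co)+
  fix x assume x: "x \<in> X"
  have gk: "basis_vec (g x) \<in> carrier kG" and bx: "basis_vec x \<in> carrier V" using basis_kG[OF g_Gbar[OF x]] x by simp_all
  have "tensor_lift ?W ?\<alpha> (gcoact (basis_vec x)) = ?\<alpha> (basis_vec (g x)) (basis_vec x)"
    unfolding gcoact_basis[OF x] by (rule tensor_lift_pure[OF kG_vs vs_free_space W co(1) gk bx])
  also have "\<dots> = pure_tensor kG (tensor_space kG V) (basis_vec (g x)) (pure_tensor kG V (basis_vec (g x)) (basis_vec x))"
    unfolding kG_grouplike(1)[OF g_Gbar[OF x]] by (rule tensor_lift_pure[OF kG_vs kG_vs W co(2)[OF bx] gk gk])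
  also have "\<dots> = ?\<beta> (basis_vec (g x)) (basis_vec x)" unfolding gcoact_basis[OF x] ..
  also have "\<dots> = tensor_lift ?W ?\<beta> (pure_tensor kG V (basis_vec (g x)) (basis_vec x))"
    by (rule tensor_lift_pure[OF kG_vs vs_free_space W co(3) gk bx, symmetric])
  also have "\<dots> = tensor_lift ?W ?\<beta> (gcoact (basis_vec x))" unfolding gcoact_basis[OF x] ..
  finally show "tensor_lift ?W ?\<alpha> (gcoact (basis_vec x)) = tensor_lift ?W ?\<beta> (gcoact (basis_vec x))" .
qed

text \<open>Both sides are linear in \<open>h\<close> and \<open>v\<close>, which may therefore be taken from the bases.\<close>

lemma gcoact_compat:
  assumes h: "h \<in> carrier kG" and v: "v \<in> carrier V"
  shows "gcoact (gact h v) = tensor_lift (tensor_space kG V) (\<lambda>h1 h'. tensor_lift (tensor_space kG V) (\<lambda>h2 h3.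
    tensor_lift (tensor_space kG V) (\<lambda>a w. pure_tensor kG V (h1 \<otimes>\<^bsub>kG\<^esub> a \<otimes>\<^bsub>kG\<^esub> antipode kG h3) (gact h2 w)) (gcoact v))
      (comult kG h')) (comult kG h)"
    (is "_ = ?R h v")
proof -
  let ?kV = "tensor_space kG V"
  have kV: "vector_space_rec ?kV" by (rule vs_tensor_space[OF kG_vs vs_free_space])
  note A = bilinear_mapD[OF gact_bilinear]
  note data = kG_hopf vs_free_space gact_bilinear gcoact_linear
  note R = compat_linear[OF data]
  show ?thesis
  proof (rule linear_map_span_eq[where f = "\<lambda>h. gcoact (gact h v)" and g = "\<lambda>h. ?R h v", OF kG_vs kV
        group_algebra_spanned[OF Gbar_group] linear_map_comp[OF gcoact_linear A(2)[OF v]] R(1)[OF v] _ h])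
    fix \<gamma> assume \<gamma>: "\<gamma> \<in> carrier Gbar"
    have \<gamma>k: "basis_vec \<gamma> \<in> carrier kG" by (rule basis_kG[OF \<gamma>])
    show "gcoact (gact (basis_vec \<gamma>) v) = ?R (basis_vec \<gamma>) v"
    proof (rule linear_map_free_eq[where f = "\<lambda>v. gcoact (gact (basis_vec \<gamma>) v)" and g = "\<lambda>v. ?R (basis_vec \<gamma>) v",
          OF kV linear_map_comp[OF gcoact_linear A(1)[OF \<gamma>k]] R(2)[OF \<gamma>k] _ v])
      fix x assume x: "x \<in> X"
      have gk: "basis_vec (g x) \<in> carrier kG" and bx: "basis_vec x \<in> carrier V" using basis_kG[OF g_Gbar[OF x]] x by simp_all
      obtain c y where y: "y \<in> X" "gact (basis_vec \<gamma>) (basis_vec x) = c \<odot>\<^bsub>V\<^esub> basis_vec y"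
        "g y = \<gamma> \<otimes>\<^bsub>Gbar\<^esub> g x \<otimes>\<^bsub>Gbar\<^esub> inv\<^bsub>Gbar\<^esub> \<gamma>" using gact_monomial[OF \<gamma>] x by blast
      have by': "basis_vec y \<in> carrier V" using y by simp
      have G: "\<gamma> \<otimes>\<^bsub>Gbar\<^esub> g x \<in> carrier Gbar" "inv\<^bsub>Gbar\<^esub> \<gamma> \<in> carrier Gbar"
        using group.inv_closed[OF Gbar_group \<gamma>] monoid.m_closed[OF group.is_monoid[OF Gbar_group] \<gamma> g_Gbar[OF x]] by simp_all
      have m: "basis_vec \<gamma> \<otimes>\<^bsub>kG\<^esub> basis_vec (g x) \<otimes>\<^bsub>kG\<^esub> antipode kG (basis_vec \<gamma>) = basis_vec (g y)"
        unfolding kG_grouplike(3)[OF \<gamma>] y(3)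
        by (simp only: group_algebra_mult_basis[OF Gbar_group] G \<gamma> g_Gbar[OF x])
      have "?R (basis_vec \<gamma>) (basis_vec x)
        = pure_tensor kG V (basis_vec \<gamma> \<otimes>\<^bsub>kG\<^esub> basis_vec (g x) \<otimes>\<^bsub>kG\<^esub> antipode kG (basis_vec \<gamma>)) (gact (basis_vec \<gamma>) (basis_vec x))"
        by (simp only: kG_grouplike(1)[OF \<gamma>] gcoact_basis[OF x]
            tensor_lift_pure[OF kG_vs kG_vs kV compat_bilinear1[OF data bx, unfolded gcoact_basis[OF x]] \<gamma>k \<gamma>k]
            tensor_lift_pure[OF kG_vs kG_vs kV compat_bilinear2[OF data \<gamma>k bx, unfolded gcoact_basis[OF x]] \<gamma>k \<gamma>k]
            tensor_lift_pure[OF kG_vs vs_free_space kV compat_bilinear3[OF data \<gamma>k \<gamma>k \<gamma>k] gk bx])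
      also have "\<dots> = pure_tensor kG V (basis_vec (g y)) (c \<odot>\<^bsub>V\<^esub> basis_vec y)" by (simp only: m y(2))
      also have "\<dots> = c \<odot>\<^bsub>?kV\<^esub> gcoact (basis_vec y)"
        unfolding gcoact_basis[OF y(1)]
        by (rule pure_tensor_simps(4)[OF kG_vs vs_free_space basis_kG[OF g_Gbar[OF y(1)]] by'])
      also have "\<dots> = gcoact (gact (basis_vec \<gamma>) (basis_vec x))"
        unfolding y(2) by (rule linear_mapD(3)[OF gcoact_linear by', symmetric])
      finally show "gcoact (gact (basis_vec \<gamma>) (basis_vec x)) = ?R (basis_vec \<gamma>) (basis_vec x)" ..
    qed
  qed
qed

lemma gbar_yetter_drinfeld: "yetter_drinfeld kG V gact gcoact"
  unfolding yetter_drinfeld_def Let_def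
  using kG_hopf vs_free_space bilinear_mapD(1,2)[OF gact_bilinear] gact_one gact_mult gcoact_linear
    gcoact_counit gcoact_coassoc gcoact_compat
  by (intro conjI ballI)

text \<open>
  The braiding over the group is \<open>v\<^sub>x \<otimes> v\<^sub>y \<mapsto> g x v\<^sub>y \<otimes> v\<^sub>x\<close>, and \<open>g x\<close> acts as \<open>e x x\<close>.
\<close>

lemma gbar_realization: "realization kG X op q gact gcoact"
  unfolding realization_def
proof (intro conjI ballI gbar_yetter_drinfeld)
  let ?VV = "tensor_space V V"
  note ydG = gbar_yetter_drinfeld
  have VV: "vector_space_rec ?VV" by simp
  fix T assume T: "T \<in> carrier ?VV"
  show "yd_braiding V gact gcoact T = rack_braiding X op q T"
  proof (rule linear_map_tensor_free_eq[OF VV yd_braiding_linear[OF ydG] rack_braiding_linear[OF rack] _ T])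
    fix x y assume x: "x \<in> X" and y: "y \<in> X"
    have b: "basis_vec x \<in> carrier V" "basis_vec y \<in> carrier V" "basis_vec (op x y) \<in> carrier V" using x y by simp_all
    have "yd_braiding V gact gcoact (pure_tensor V V (basis_vec x) (basis_vec y))
      = pure_tensor V V (gact (basis_vec (g x)) (basis_vec y)) (basis_vec x)"
      unfolding yd_braiding_pure[OF ydG b(1,2)] gcoact_basis[OF x]
      by (rule tensor_lift_pure[OF kG_vs vs_free_space VV yd_braiding_inner[OF ydG b(2)] basis_kG[OF g_Gbar[OF x]] b(1)])
    also have "gact (basis_vec (g x)) (basis_vec y) = q x y \<odot>\<^bsub>V\<^esub> basis_vec (op x y)"
      using gact_entry[OF x b(2), of 0] act_e[OF x x y] by (simp add: entry_0)
    also have "pure_tensor V V (q x y \<odot>\<^bsub>V\<^esub> basis_vec (op x y)) (basis_vec x)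
      = q x y \<odot>\<^bsub>?VV\<^esub> pure_tensor V V (basis_vec (op x y)) (basis_vec x)"
      by (rule pure_tensor_simps(3)[OF vs_free_space vs_free_space b(3,1)])
    finally show "yd_braiding V gact gcoact (pure_tensor V V (basis_vec x) (basis_vec y))
      = rack_braiding X op q (pure_tensor V V (basis_vec x) (basis_vec y))"
      unfolding rack_braiding_basis[OF rack x y] .
  qed
qed

text \<open>
  The class \<open>g x\<close> determines the action of \<open>e x x\<close> and with it the translation by \<open>x\<close>.
\<close>

lemma diag_inj:
  assumes "faithful_rack X op"
  shows "inj_on g X"
proof (rule inj_onI)
  fix x y assume x: "x \<in> X" and y: "y \<in> X" and eq: "g x = g y"
  have "op x z = op y z" if z: "z \<in> X" for z
  proof -
    have "q x z \<odot>\<^bsub>V\<^esub> basis_vec (op x z) = q y z \<odot>\<^bsub>V\<^esub> basis_vec (op y z)"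
      using cls_eq_act[of "e x x" "e y y" "basis_vec z"] eq x y z entry_coeff_alg[of _ _ 0]
        act_e[OF x x z] act_e[OF y y z] by (simp add: entry_0)
    then have "Poly_Mapping.single (op x z) (q x z) = Poly_Mapping.single (op y z) (q y z)" by (simp add: map_single)
    then have "Poly_Mapping.keys (Poly_Mapping.single (op x z) (q x z)) = Poly_Mapping.keys (Poly_Mapping.single (op y z) (q y z))"
      by simp
    then show ?thesis using q_nonzero[OF x z] q_nonzero[OF y z] by simp
  qed
  then show "x = y" using assms x y by (simp add: faithful_rack_def)
qed

lemma diag_independent: "faithful_rack X op \<Longrightarrow> lin_indep_family Kbar X g"
  using diag_grouplike[of _ 0] by (intro grouplikes_independent[OF Kbar_hopf] diag_inj) (simp_all add: entry_0)

end

theorem proposition4p6: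
  fixes X :: "'x set" and op :: "'x \<Rightarrow> 'x \<Rightarrow> 'x"
    and q :: "'x \<Rightarrow> 'x \<Rightarrow> 'k::{alg_closed_field, field_char_0}"
    and H :: "('k, 'h) hopf"
    and act :: "'h \<Rightarrow> ('x \<Rightarrow>\<^sub>0 'k) \<Rightarrow> ('x \<Rightarrow>\<^sub>0 'k)"
    and coact :: "('x \<Rightarrow>\<^sub>0 'k) \<Rightarrow> ('k, 'h, 'x \<Rightarrow>\<^sub>0 'k) tensor"
    and e :: "'x \<Rightarrow> 'x \<Rightarrow> 'h"
    and V :: "('k, 'x \<Rightarrow>\<^sub>0 'k) module"
    and K :: "('k, 'h) hopf" and I :: "'h set"
    and Kbar :: "('k, 'h set) hopf" and cls :: "'h \<Rightarrow> 'h set"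
    and Gbar :: "'h set monoid"
  assumes "rack X op" and "rack_cocycle X op q"
    and "hopf_algebra H" and "realization H X op q act coact"
    and V_def: "V = free_space X"
    and "\<forall>x\<in>X. \<forall>y\<in>X. e x y \<in> carrier H"
    and "\<forall>x\<in>X. finite {y\<in>X. e x y \<noteq> \<zero>\<^bsub>H\<^esub>}"
    and "\<forall>x\<in>X. coact (basis_vec x) =
           (\<Oplus>\<^bsub>tensor_space H V\<^esub>y\<in>{y\<in>X. e x y \<noteq> \<zero>\<^bsub>H\<^esub>}. pure_tensor H V (e x y) (basis_vec y))"
    and K_def: "K = sub_hopf H (hopf_subalgebra H hull {e x y | x y. x \<in> X \<and> y \<in> X})"
    and I_def: "I = Idl\<^bsub>K\<^esub> {(antipode H ^^ n) (e x y) | n x y. x \<in> X \<and> y \<in> X \<and> x \<noteq> y}"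
    and Kbar_def: "Kbar = quotient_hopf K I"
    and cls_def: "cls = (\<lambda>h. I +>\<^bsub>K\<^esub> h)"
    and Gbar_def: "Gbar = (units_of Kbar)
           \<lparr>carrier := generate (units_of Kbar) {cls (e x x) | x. x \<in> X}\<rparr>"
  shows
    "hopf_hom K Kbar cls \<and>
     carrier Kbar \<noteq> {\<zero>\<^bsub>Kbar\<^esub>} \<and>
     (\<exists>\<Phi>. hopf_hom (group_algebra (enveloping_group X op)) Kbar \<Phi> \<and>
          \<Phi> ` carrier (group_algebra (enveloping_group X op)) = carrier Kbar \<and>
          (\<forall>x\<in>X. \<Phi> (basis_vec (env_gen X op x)) = cls (e x x))) \<and>
     subgroup (carrier Gbar) (units_of Kbar) \<and>
     hopf_hom (group_algebra Gbar) Kbar (lin_extend Kbar (\<lambda>g. g)) \<and>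
     bij_betw (lin_extend Kbar (\<lambda>g. g)) (carrier (group_algebra Gbar)) (carrier Kbar) \<and>
     (\<exists>act' coact'.
          realization (group_algebra Gbar) X op q act' coact' \<and>
          (\<forall>a\<in>carrier (group_algebra Gbar). \<forall>h\<in>carrier K. lin_extend Kbar (\<lambda>g. g) a = cls h \<longrightarrow>
             (\<forall>v\<in>carrier V. act' a v = act h v)) \<and>
          (\<forall>x\<in>X. coact' (basis_vec x) =
             pure_tensor (group_algebra Gbar) V (basis_vec (cls (e x x))) (basis_vec x))) \<and>
     (faithful_rack X op \<longrightarrow> lin_indep_family Kbar X (\<lambda>x. cls (e x x)))"
proof -
  interpret R: rack_realization X op q H act coact e
    using assms(1,2,4,6,7,8) unfolding V_def by unfold_locales blast+
  have K: "K = R.K" unfolding K_def R.K_def R.hull_coeff_alg ..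
  have I: "I = R.I" unfolding I_def K R.I_def R.off_def ..
  have Kbar: "Kbar = R.Kbar" unfolding Kbar_def R.Kbar_def K I ..
  have cls: "cls = R.cls" unfolding cls_def R.cls_fun K I ..
  have Gbar: "Gbar = R.Gbar" unfolding Gbar_def R.Gbar_def Kbar cls ..
  have \<psi>: "lin_extend R.Kbar (\<lambda>g. g) = R.\<psi>" unfolding R.\<psi>_def ..
  show ?thesis
    unfolding K Kbar cls Gbar \<psi> V_def
  proof (intro conjI impI R.cls_hom R.Kbar_nonzero R.env_surjection R.Gbar_subgroup R.\<psi>_hom R.\<psi>_bij
      R.diag_independent)
    show "\<exists>act' coact'. realization (group_algebra R.Gbar) X op q act' coact' \<and>
      (\<forall>a\<in>carrier (group_algebra R.Gbar). \<forall>h\<in>carrier R.K. R.\<psi> a = R.cls h \<longrightarrow>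
         (\<forall>v\<in>carrier (free_space X). act' a v = act h v)) \<and>
      (\<forall>x\<in>X. coact' (basis_vec x) =
         pure_tensor (group_algebra R.Gbar) (free_space X) (basis_vec (R.cls (e x x))) (basis_vec x))"
      using R.gact_eq R.gcoact_basis R.K_simps(1)
      by (intro exI[of _ R.gact] exI[of _ R.gcoact] conjI R.gbar_realization ballI impI) simp_all
  qed
qed

end
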